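(* Let $k$ be a field, $G$ a finite group, $\mathcal S$ a collection of non-trivial pairs $(\mathcal C,\pi)$ and $\mathcal L=\bigoplus_{(\mathcal C,\pi)\in\mathcal S}\mathcal L_{\mathcal C,\pi}$. There is a map of braided bialgebras $U(\mathcal L)\to BD(G)$ in the category of $G$-crossed modules given on the generators by $$E_{ai}{}^{bj}\mapsto r_{ai}{}^{bj}=\sum_{n\in C_G}\pi(n)^j{}_i\,\delta_{q_an^{-1}q_b^{-1}}\otimes b^{-1},$$ which commutes with the inclusion of $\mathcal L$ (in $U(\mathcal L)$, and in $BD(G)$ via $E_{ai}{}^{bj}\mapsto r_{ai}{}^{bj}$). Moreover, this map is the transmutation of the map of coquasitriangular bialgebras $A(\mathcal R)\to D^\vee(G)$ given on the generators by $t_{ai}{}^{bj}\mapsto r_{ai}{}^{bj}$.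
   Context: A pair $(\mathcal C,\pi)$ is a conjugacy class $\mathcal C$ of $G$ with fixed base point $r\in\mathcal C$ with centraliser $C_G$, and an irreducible representation $\pi$ of $C_G$ on a finite-dimensional space $V_\pi$ over $k$; it is non-trivial if it is not $(\{e\},1)$. For each class fix $q:\mathcal C\to G$ with $q_crq_c^{-1}=c$, $q_r=e$, and $\zeta_c(g)=q_{gcg^{-1}}^{-1}gq_c\in C_G$. Repeated $V_\pi$-indices are summed; primes refer to a second pair $(\mathcal C',\pi')\in\mathcal S$. A $G$-crossed module is a $G$-graded vector space with left $G$-action such that $|h\triangleright v|=h|v|h^{-1}$, with braiding $\Psi(v\otimes w)=|v|\triangleright w\otimes v$; equivalently, it is a right $D^\vee(G)$-comodule by $\Delta_Rv=\sum_gg\triangleright v\otimes\delta_g\otimes|v|$. $\mathcal L_{\mathcal C,\pi}=\mathrm{End}(V_{\mathcal C,\pi})$, $V_{\mathcal C,\pi}=k\mathcal C\otimes V_\pi$, has basis $E_{ai}{}^{bj}=E_{ai}\otimes E^{bj}$ with $h\triangleright E_{ci}=\pi(\zeta_c(h))^m{}_iE_{(hch^{-1})m}$, $h\triangleright E^{ci}=\pi(\zeta_c(h)^{-1})^i{}_mE^{(hch^{-1})m}$, $|E_{ai}{}^{bj}|=ab^{-1}$, and matrix coalgebra $\Delta E_{ai}{}^{bj}=\sum_{c\in\mathcal C}E_{ai}{}^{cm}\otimes E_{cm}{}^{bj}$, $\epsilon(E_{ai}{}^{bj})=\delta_{a,b}\delta_i^j$. The fundamental braiding on $\mathcal L$ is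 $\widetilde\Psi(E_{ai}{}^{bj}\otimes E_{c'm'}{}^{d'l'})=b^{-1}\triangleright E_{c'm'}{}^{d'l'}\otimes(|b^{-1}\triangleright E_{c'm'}{}^{d'l'}|^{-1}\triangleright E_{ai})\otimes E^{bj}$. $U(\mathcal L)$ is the tensor algebra of $\mathcal L$ modulo $xy=\cdot\widetilde\Psi(x\otimes y)$, a bialgebra in the braided category with coproduct extending that of $\mathcal L$. $D^\vee(G)$ is the Hopf algebra on $k(G)\otimes kG$ with tensor product algebra and counit, $\Delta(\delta_g\otimes h)=\sum_f\delta_f\otimes f^{-1}ghg^{-1}f\otimes\delta_{f^{-1}g}\otimes h$, $S(\delta_g\otimes h)=\delta_{g^{-1}}\otimes gh^{-1}g^{-1}$, and coquasitriangular structure $\mathcal R(\delta_g\otimes h\otimes\delta_u\otimes v)=\delta_{g,e}\delta_{h,u}$. $BD(G)$ is the braided Hopf algebra on $k(G)\otimes kG$ with the coalgebra of $D^\vee(G)$, product $(\delta_g\otimes h)(\delta_u\otimes v)=\delta_{g,huh^{-1}}\delta_g\otimes hv$, and $f\triangleright(\delta_g\otimes h)=\delta_{fgf^{-1}}\otimes fhf^{-1}$, $|\delta_g\otimes h|=gh^{-1}g^{-1}h$. $A(\mathcal R)$ is the bialgebra generated by $1$ and $t_{ai}{}^{bj}$ for each pair in $\mathcal S$, with matrix coalgebra on each block and relations $\sum\mathcal R^{fp}{}_{ai}{}^{g's'}{}_{c'm'}\,t_{fp}{}^{bj}t_{g's'}{}^{d'l'}=\sum t_{c'm'}{}^{g's'}t_{ai}{}^{fp}\,\mathcal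 R^{bj}{}_{fp}{}^{d'l'}{}_{g's'}$, where $\mathcal R^{ai}{}_{bj}{}^{c'm'}{}_{d'l'}=\delta_{a,b}\,\delta^i_j\,\delta_{c',ad'a^{-1}}\,\pi'(\zeta_{d'}(a))^{m'}{}_{l'}$; it is coquasitriangular with $\mathcal R^A(t_{ai}{}^{bj}\otimes t_{c'm'}{}^{d'l'})=\mathcal R^{bj}{}_{ai}{}^{d'l'}{}_{c'm'}$ extended as a bicharacter. Transmutation: for a coquasitriangular bialgebra $A$ with a map $\Upsilon:A\to H$ to a coquasitriangular Hopf algebra $H$, the transmuted bialgebra has the same coalgebra as $A$, right $H$-coaction $a\mapsto a_2\otimes S\Upsilon(a_1)\,\Upsilon(a_3)$ and product $a\bullet b=a_2b_2\,\mathcal R(S\Upsilon(a_1)\,\Upsilon(a_3)\otimes S\Upsilon(b_1))$, and transmuted maps have the same underlying linear map. For $A=H=D^\vee(G)$ this gives $BD(G)$, and for $A(\mathcal R)\to D^\vee(G)$ this gives $U(\mathcal L)$ with $t_{ai}{}^{bj}$ corresponding to $E_{ai}{}^{bj}$. *)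

theory Defs
  imports "HOL-Algebra.Group" "HOL-Library.Poly_Mapping" "Jordan_Normal_Form.Matrix"
begin

section \<open>Vector spaces given by a basis and a space of relations\<close>

text \<open>
  The free vector space on a set \<open>B\<close> consists of the finitely supported functions
  \<open>'b \<Rightarrow>\<^sub>0 'k\<close> with support in \<open>B\<close>. A function \<open>f :: 'b \<Rightarrow> ('c \<Rightarrow>\<^sub>0 'k)\<close> on basis elements stands for
  the linear map \<open>lin f\<close> that extends it.
\<close>

definition scale :: "'k::field \<Rightarrow> ('b \<Rightarrow>\<^sub>0 'k) \<Rightarrow> ('b \<Rightarrow>\<^sub>0 'k)" where
  "scale c x = Poly_Mapping.map ((*) c) x"

lemma lookup_scale: "Poly_Mapping.lookup (scale c x) b = c * Poly_Mapping.lookup x b"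
  by (simp add: scale_def Poly_Mapping.map.rep_eq when_def)

interpretation fv: vector_space "scale :: 'k::field \<Rightarrow> ('b \<Rightarrow>\<^sub>0 'k) \<Rightarrow> ('b \<Rightarrow>\<^sub>0 'k)"
  by unfold_locales
    (auto intro!: poly_mapping_eqI simp: lookup_scale lookup_add algebra_simps)

definition bvec :: "'b \<Rightarrow> ('b \<Rightarrow>\<^sub>0 'k::field)" where
  "bvec b = Poly_Mapping.single b 1"

definition fspan :: "'b set \<Rightarrow> ('b \<Rightarrow>\<^sub>0 'k::field) set" where
  "fspan B = {x. Poly_Mapping.keys x \<subseteq> B}"

definition lin :: "('b \<Rightarrow> ('c \<Rightarrow>\<^sub>0 'k::field)) \<Rightarrow> ('b \<Rightarrow>\<^sub>0 'k) \<Rightarrow> ('c \<Rightarrow>\<^sub>0 'k)" where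
  "lin f x = (\<Sum>b\<in>Poly_Mapping.keys x. scale (Poly_Mapping.lookup x b) (f b))"

definition linf :: "('b \<Rightarrow> 'k::field) \<Rightarrow> ('b \<Rightarrow>\<^sub>0 'k) \<Rightarrow> 'k" where
  "linf f x = (\<Sum>b\<in>Poly_Mapping.keys x. Poly_Mapping.lookup x b * f b)"

definition tensor :: "('b \<Rightarrow>\<^sub>0 'k::field) \<Rightarrow> ('c \<Rightarrow>\<^sub>0 'k) \<Rightarrow> ('b \<times> 'c \<Rightarrow>\<^sub>0 'k)" where
  "tensor x y = lin (\<lambda>b. lin (\<lambda>c. bvec (b, c)) y) x"

definition tmap :: "('b \<Rightarrow> ('d \<Rightarrow>\<^sub>0 'k::field)) \<Rightarrow> ('c \<Rightarrow> ('e \<Rightarrow>\<^sub>0 'k)) \<Rightarrow> 'b \<times> 'c \<Rightarrow> ('d \<times> 'e \<Rightarrow>\<^sub>0 'k)" where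
  "tmap f g = (\<lambda>(b, c). tensor (f b) (g c))"

text \<open>
  A record \<open>V\<close> stands for the quotient space \<open>fspan (basis V) / null V\<close>. Its elements are handled
  through representatives, and equality in the quotient is \<open>eqv V\<close>. A linear map between quotients
  is handled through a lift to the free spaces, which always exists; \<open>lmap\<close> says that the lift
  descends to the quotients.
\<close>

record (overloaded) ('b, 'k) pspace =
  basis :: "'b set"
  null :: "('b \<Rightarrow>\<^sub>0 'k) set"

definition pspace_ok :: "('b, 'k::field, 'z) pspace_scheme \<Rightarrow> bool" where
  "pspace_ok V \<longleftrightarrow> fv.subspace (null V) \<and> null V \<subseteq> fspan (basis V)"

definition eqv :: "('b, 'k::field, 'z) pspace_scheme \<Rightarrow> ('b \<Rightarrow>\<^sub>0 'k) \<Rightarrow> ('b \<Rightarrow>\<^sub>0 'k) \<Rightarrow> bool" where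
  "eqv V x y \<longleftrightarrow> x - y \<in> null V"

definition lmap :: "('b, 'k::field, 'y) pspace_scheme \<Rightarrow> ('c, 'k, 'z) pspace_scheme \<Rightarrow>
    ('b \<Rightarrow> ('c \<Rightarrow>\<^sub>0 'k)) \<Rightarrow> bool" where
  "lmap V W f \<longleftrightarrow> (\<forall>b\<in>basis V. f b \<in> fspan (basis W)) \<and> (\<forall>x\<in>null V. lin f x \<in> null W)"

text \<open>Bijectivity of the induced map of quotients.\<close>

definition quot_bij :: "('b, 'k::field, 'y) pspace_scheme \<Rightarrow> ('c, 'k, 'z) pspace_scheme \<Rightarrow>
    ('b \<Rightarrow> ('c \<Rightarrow>\<^sub>0 'k)) \<Rightarrow> bool" where
  "quot_bij V W f \<longleftrightarrow>
     (\<forall>x\<in>fspan (basis V). lin f x \<in> null W \<longrightarrow> x \<in> null V) \<and>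
     (\<forall>y\<in>fspan (basis W). \<exists>x\<in>fspan (basis V). eqv W (lin f x) y)"

text \<open>\<open>(k[B]/M) \<otimes> (k[C]/N) = k[B \<times> C] / (M \<otimes> k[C] + k[B] \<otimes> N)\<close>.\<close>

definition tens :: "('b, 'k::field, 'y) pspace_scheme \<Rightarrow> ('c, 'k, 'z) pspace_scheme \<Rightarrow>
    ('b \<times> 'c, 'k) pspace" where
  "tens V W = \<lparr>basis = basis V \<times> basis W,
     null = fv.span ({tensor x y | x y. x \<in> null V \<and> y \<in> fspan (basis W)} \<union>
                     {tensor x y | x y. x \<in> fspan (basis V) \<and> y \<in> null W})\<rparr>"

definition kspace :: "(unit, 'k::field) pspace" where
  "kspace = \<lparr>basis = UNIV, null = {0}\<rparr>"


section \<open>Algebras, coalgebras and bialgebras\<close>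

record (overloaded) ('b, 'k) bialg =
  bone :: "'b \<Rightarrow>\<^sub>0 'k"
  bmul :: "'b \<times> 'b \<Rightarrow> ('b \<Rightarrow>\<^sub>0 'k)"
  bcop :: "'b \<Rightarrow> ('b \<times> 'b \<Rightarrow>\<^sub>0 'k)"
  beps :: "'b \<Rightarrow> 'k"

definition algebra_on :: "('b, 'k::field, 'z) pspace_scheme \<Rightarrow> ('b, 'k) bialg \<Rightarrow> bool" where
  "algebra_on V H \<longleftrightarrow>
     bone H \<in> fspan (basis V) \<and> lmap (tens V V) V (bmul H) \<and>
     (\<forall>a\<in>basis V. \<forall>b\<in>basis V. \<forall>c\<in>basis V.
        eqv V (lin (bmul H) (tensor (bmul H (a, b)) (bvec c)))
              (lin (bmul H) (tensor (bvec a) (bmul H (b, c))))) \<and>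
     (\<forall>a\<in>basis V. eqv V (lin (bmul H) (tensor (bone H) (bvec a))) (bvec a) \<and>
                   eqv V (lin (bmul H) (tensor (bvec a) (bone H))) (bvec a))"

definition coalgebra_on :: "('b, 'k::field, 'z) pspace_scheme \<Rightarrow> ('b, 'k) bialg \<Rightarrow> bool" where
  "coalgebra_on V H \<longleftrightarrow>
     lmap V (tens V V) (bcop H) \<and> lmap V kspace (\<lambda>b. Poly_Mapping.single () (beps H b)) \<and>
     (\<forall>a\<in>basis V. eqv (tens (tens V V) V)
        (lin (tmap (bcop H) bvec) (bcop H a))
        (lin (\<lambda>(x, (y, z)). bvec ((x, y), z)) (lin (tmap bvec (bcop H)) (bcop H a)))) \<and>
     (\<forall>a\<in>basis V. eqv V (lin (\<lambda>(x, y). scale (beps H x) (bvec y)) (bcop H a)) (bvec a) \<and>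
                   eqv V (lin (\<lambda>(x, y). scale (beps H y) (bvec x)) (bcop H a)) (bvec a))"

text \<open>
  The product of the tensor product algebra for a braiding \<open>Psi\<close>:
  \<open>(a \<otimes> b) (c \<otimes> d) = a Psi(b \<otimes> c) d\<close>.
\<close>

definition tens_mul :: "('b \<times> 'b \<Rightarrow> ('b \<times> 'b \<Rightarrow>\<^sub>0 'k::field)) \<Rightarrow> ('b \<times> 'b \<Rightarrow> ('b \<Rightarrow>\<^sub>0 'k)) \<Rightarrow>
    ('b \<times> 'b) \<times> ('b \<times> 'b) \<Rightarrow> ('b \<times> 'b \<Rightarrow>\<^sub>0 'k)" where
  "tens_mul Psi m = (\<lambda>((a, b), (c, d)).
     lin (\<lambda>(c', b'). tensor (m (a, c')) (m (b', d))) (Psi (b, c)))"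

definition flip :: "'b \<times> 'c \<Rightarrow> ('c \<times> 'b \<Rightarrow>\<^sub>0 'k::field)" where
  "flip = (\<lambda>(b, c). bvec (c, b))"

definition bialgebra_wrt :: "('b \<times> 'b \<Rightarrow> ('b \<times> 'b \<Rightarrow>\<^sub>0 'k::field)) \<Rightarrow> ('b, 'k, 'z) pspace_scheme \<Rightarrow>
    ('b, 'k) bialg \<Rightarrow> bool" where
  "bialgebra_wrt Psi V H \<longleftrightarrow> pspace_ok V \<and> algebra_on V H \<and> coalgebra_on V H \<and>
     eqv (tens V V) (lin (bcop H) (bone H)) (tensor (bone H) (bone H)) \<and>
     linf (beps H) (bone H) = 1 \<and>
     (\<forall>a\<in>basis V. \<forall>b\<in>basis V.
        eqv (tens V V) (lin (bcop H) (bmul H (a, b)))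
          (lin (tens_mul Psi (bmul H)) (tensor (bcop H a) (bcop H b))) \<and>
        linf (beps H) (bmul H (a, b)) = beps H a * beps H b)"

definition bialgebra_hom :: "('b, 'k::field, 'y) pspace_scheme \<Rightarrow> ('b, 'k) bialg \<Rightarrow>
    ('c, 'k, 'z) pspace_scheme \<Rightarrow> ('c, 'k) bialg \<Rightarrow> ('b \<Rightarrow> ('c \<Rightarrow>\<^sub>0 'k)) \<Rightarrow> bool" where
  "bialgebra_hom V H W K f \<longleftrightarrow> lmap V W f \<and>
     eqv W (lin f (bone H)) (bone K) \<and>
     (\<forall>a\<in>basis V. \<forall>b\<in>basis V.
        eqv W (lin f (bmul H (a, b))) (lin (bmul K) (tensor (f a) (f b)))) \<and>
     (\<forall>a\<in>basis V. eqv (tens W W) (lin (tmap f f) (bcop H a)) (lin (bcop K) (f a))) \<and>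
     (\<forall>a\<in>basis V. linf (beps K) (f a) = beps H a)"


section \<open>Crossed modules and braided bialgebras\<close>

text \<open>The basis is homogeneous, and the grading descends to the quotient by \<open>null\<close>.\<close>

record (overloaded) ('g, 'b, 'k) xmod = "('b, 'k) pspace" +
  act :: "'g \<Rightarrow> 'b \<Rightarrow> ('b \<Rightarrow>\<^sub>0 'k)"
  deg :: "'b \<Rightarrow> 'g"

definition homog :: "('g, 'b, 'k::field) xmod \<Rightarrow> 'g \<Rightarrow> ('b \<Rightarrow>\<^sub>0 'k) set" where
  "homog X g = {x. \<exists>y\<in>fspan {b \<in> basis X. deg X b = g}. eqv X x y}"

definition crossed_module :: "('g, 'm) monoid_scheme \<Rightarrow> ('g, 'b, 'k::field) xmod \<Rightarrow> bool" where
  "crossed_module G X \<longleftrightarrow> pspace_ok X \<and>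
     (\<forall>b\<in>basis X. deg X b \<in> carrier G) \<and>
     (\<forall>x\<in>null X. \<forall>g\<in>carrier G. lin (\<lambda>b. if deg X b = g then bvec b else 0) x \<in> null X) \<and>
     (\<forall>h\<in>carrier G. lmap X X (act X h)) \<and>
     (\<forall>b\<in>basis X. eqv X (act X \<one>\<^bsub>G\<^esub> b) (bvec b)) \<and>
     (\<forall>g\<in>carrier G. \<forall>h\<in>carrier G. \<forall>b\<in>basis X.
        eqv X (act X (g \<otimes>\<^bsub>G\<^esub> h) b) (lin (act X g) (act X h b))) \<and>
     (\<forall>h\<in>carrier G. \<forall>b\<in>basis X. act X h b \<in> homog X (h \<otimes>\<^bsub>G\<^esub> deg X b \<otimes>\<^bsub>G\<^esub> inv\<^bsub>G\<^esub> h))"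

definition crossed_hom :: "('g, 'm) monoid_scheme \<Rightarrow> ('g, 'b, 'k::field) xmod \<Rightarrow>
    ('g, 'c, 'k) xmod \<Rightarrow> ('b \<Rightarrow> ('c \<Rightarrow>\<^sub>0 'k)) \<Rightarrow> bool" where
  "crossed_hom G X Y f \<longleftrightarrow> lmap X Y f \<and>
     (\<forall>h\<in>carrier G. \<forall>b\<in>basis X. eqv Y (lin f (act X h b)) (lin (act Y h) (f b))) \<and>
     (\<forall>b\<in>basis X. f b \<in> homog Y (deg X b))"

definition xtens :: "('g, 'm) monoid_scheme \<Rightarrow> ('g, 'b, 'k::field) xmod \<Rightarrow> ('g, 'c, 'k) xmod \<Rightarrow>
    ('g, 'b \<times> 'c, 'k) xmod" where
  "xtens G X Y = \<lparr>basis = basis (tens X Y), null = null (tens X Y),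
     act = (\<lambda>h. tmap (act X h) (act Y h)),
     deg = (\<lambda>(b, c). deg X b \<otimes>\<^bsub>G\<^esub> deg Y c)\<rparr>"

definition xtriv :: "('g, 'm) monoid_scheme \<Rightarrow> ('g, unit, 'k::field) xmod" where
  "xtriv G = \<lparr>basis = UNIV, null = {0}, act = (\<lambda>h b. bvec b), deg = (\<lambda>b. \<one>\<^bsub>G\<^esub>)\<rparr>"

definition xbraid :: "('g, 'b, 'k::field) xmod \<Rightarrow> 'b \<times> 'b \<Rightarrow> ('b \<times> 'b \<Rightarrow>\<^sub>0 'k)" where
  "xbraid X = (\<lambda>(v, w). tensor (act X (deg X v) w) (bvec v))"

definition braided_bialgebra :: "('g, 'm) monoid_scheme \<Rightarrow> ('g, 'b, 'k::field) xmod \<Rightarrow>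
    ('b, 'k) bialg \<Rightarrow> bool" where
  "braided_bialgebra G X H \<longleftrightarrow> crossed_module G X \<and> bialgebra_wrt (xbraid X) X H \<and>
     crossed_hom G (xtriv G) X (\<lambda>_. bone H) \<and>
     crossed_hom G (xtens G X X) X (bmul H) \<and>
     crossed_hom G X (xtens G X X) (bcop H) \<and>
     crossed_hom G X (xtriv G) (\<lambda>b. Poly_Mapping.single () (beps H b))"

definition braided_bialgebra_hom :: "('g, 'm) monoid_scheme \<Rightarrow> ('g, 'b, 'k::field) xmod \<Rightarrow>
    ('b, 'k) bialg \<Rightarrow> ('g, 'c, 'k) xmod \<Rightarrow> ('c, 'k) bialg \<Rightarrow> ('b \<Rightarrow> ('c \<Rightarrow>\<^sub>0 'k)) \<Rightarrow> bool" where
  "braided_bialgebra_hom G X H Y K f \<longleftrightarrow>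
     braided_bialgebra G X H \<and> braided_bialgebra G Y K \<and>
     crossed_hom G X Y f \<and> bialgebra_hom X H Y K f"


section \<open>Coquasitriangular bialgebras\<close>

definition coquasitriangular_bialgebra :: "('b, 'k::field, 'z) pspace_scheme \<Rightarrow> ('b, 'k) bialg \<Rightarrow>
    ('b \<times> 'b \<Rightarrow> 'k) \<Rightarrow> bool" where
  "coquasitriangular_bialgebra V H R \<longleftrightarrow> bialgebra_wrt flip V H \<and>
     (\<forall>x\<in>null (tens V V). linf R x = 0) \<and>
     (\<exists>R'. (\<forall>x\<in>null (tens V V). linf R' x = 0) \<and>
        (\<forall>a\<in>basis V. \<forall>b\<in>basis V.
           linf (\<lambda>((a1, a2), (b1, b2)). R (a1, b1) * R' (a2, b2)) (tensor (bcop H a) (bcop H b))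
             = beps H a * beps H b \<and>
           linf (\<lambda>((a1, a2), (b1, b2)). R' (a1, b1) * R (a2, b2)) (tensor (bcop H a) (bcop H b))
             = beps H a * beps H b)) \<and>
     (\<forall>a\<in>basis V. \<forall>b\<in>basis V. \<forall>c\<in>basis V.
        linf R (tensor (bmul H (a, b)) (bvec c)) =
          linf (\<lambda>(c1, c2). R (a, c1) * R (b, c2)) (bcop H c) \<and>
        linf R (tensor (bvec a) (bmul H (b, c))) =
          linf (\<lambda>(a1, a2). R (a1, c) * R (a2, b)) (bcop H a)) \<and>
     (\<forall>a\<in>basis V. \<forall>b\<in>basis V. eqv V
        (lin (\<lambda>((a1, a2), (b1, b2)). scale (R (a2, b2)) (bmul H (b1, a1)))
             (tensor (bcop H a) (bcop H b)))
        (lin (\<lambda>((a1, a2), (b1, b2)). scale (R (a1, b1)) (bmul H (a2, b2)))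
             (tensor (bcop H a) (bcop H b))))"

definition coquasitriangular_hom :: "('b, 'k::field, 'y) pspace_scheme \<Rightarrow> ('b, 'k) bialg \<Rightarrow>
    ('b \<times> 'b \<Rightarrow> 'k) \<Rightarrow> ('c, 'k, 'z) pspace_scheme \<Rightarrow> ('c, 'k) bialg \<Rightarrow> ('c \<times> 'c \<Rightarrow> 'k) \<Rightarrow>
    ('b \<Rightarrow> ('c \<Rightarrow>\<^sub>0 'k)) \<Rightarrow> bool" where
  "coquasitriangular_hom V H R W K Q f \<longleftrightarrow>
     coquasitriangular_bialgebra V H R \<and> coquasitriangular_bialgebra W K Q \<and>
     bialgebra_hom V H W K f \<and>
     (\<forall>a\<in>basis V. \<forall>b\<in>basis V. linf Q (tensor (f a) (f b)) = R (a, b))"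


section \<open>The quantum double \<open>D\<^sup>\<or>(G)\<close> and its braided version\<close>

text \<open>The basis element \<open>(g, h)\<close> is \<open>\<delta>\<^sub>g \<otimes> h\<close>.\<close>

definition D_space :: "('g, 'm) monoid_scheme \<Rightarrow> ('g \<times> 'g, 'k::field) pspace" where
  "D_space G = \<lparr>basis = carrier G \<times> carrier G, null = {0}\<rparr>"

definition D_bialg :: "('g, 'm) monoid_scheme \<Rightarrow> ('g \<times> 'g, 'k::field) bialg" where
  "D_bialg G = \<lparr>
     bone = (\<Sum>g\<in>carrier G. bvec (g, \<one>\<^bsub>G\<^esub>)),
     bmul = (\<lambda>((g, h), (u, v)). if g = u then bvec (g, h \<otimes>\<^bsub>G\<^esub> v) else 0),
     bcop = (\<lambda>(g, h). \<Sum>f\<in>carrier G.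
       bvec ((f, inv\<^bsub>G\<^esub> f \<otimes>\<^bsub>G\<^esub> g \<otimes>\<^bsub>G\<^esub> h \<otimes>\<^bsub>G\<^esub> inv\<^bsub>G\<^esub> g \<otimes>\<^bsub>G\<^esub> f), (inv\<^bsub>G\<^esub> f \<otimes>\<^bsub>G\<^esub> g, h))),
     beps = (\<lambda>(g, h). if g = \<one>\<^bsub>G\<^esub> then 1 else 0)\<rparr>"

definition D_antipode :: "('g, 'm) monoid_scheme \<Rightarrow> 'g \<times> 'g \<Rightarrow> ('g \<times> 'g \<Rightarrow>\<^sub>0 'k::field)" where
  "D_antipode G = (\<lambda>(g, h). bvec (inv\<^bsub>G\<^esub> g, g \<otimes>\<^bsub>G\<^esub> inv\<^bsub>G\<^esub> h \<otimes>\<^bsub>G\<^esub> inv\<^bsub>G\<^esub> g))"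

definition D_R :: "('g, 'm) monoid_scheme \<Rightarrow> ('g \<times> 'g) \<times> ('g \<times> 'g) \<Rightarrow> 'k::field" where
  "D_R G = (\<lambda>((g, h), (u, v)). if g = \<one>\<^bsub>G\<^esub> \<and> h = u then 1 else 0)"

definition BD_xmod :: "('g, 'm) monoid_scheme \<Rightarrow> ('g, 'g \<times> 'g, 'k::field) xmod" where
  "BD_xmod G = \<lparr>basis = carrier G \<times> carrier G, null = {0},
     act = (\<lambda>f (g, h). bvec (f \<otimes>\<^bsub>G\<^esub> g \<otimes>\<^bsub>G\<^esub> inv\<^bsub>G\<^esub> f, f \<otimes>\<^bsub>G\<^esub> h \<otimes>\<^bsub>G\<^esub> inv\<^bsub>G\<^esub> f)),
     deg = (\<lambda>(g, h). g \<otimes>\<^bsub>G\<^esub> inv\<^bsub>G\<^esub> h \<otimes>\<^bsub>G\<^esub> inv\<^bsub>G\<^esub> g \<otimes>\<^bsub>G\<^esub> h)\<rparr>"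

definition BD_bialg :: "('g, 'm) monoid_scheme \<Rightarrow> ('g \<times> 'g, 'k::field) bialg" where
  "BD_bialg G = (D_bialg G)\<lparr>
     bmul := (\<lambda>((g, h), (u, v)).
       if g = h \<otimes>\<^bsub>G\<^esub> u \<otimes>\<^bsub>G\<^esub> inv\<^bsub>G\<^esub> h then bvec (g, h \<otimes>\<^bsub>G\<^esub> v) else 0)\<rparr>"


section \<open>Transmutation\<close>

definition cop3 :: "('b, 'k::field) bialg \<Rightarrow> 'b \<Rightarrow> (('b \<times> 'b) \<times> 'b \<Rightarrow>\<^sub>0 'k)" where
  "cop3 A a = lin (tmap (bcop A) bvec) (bcop A a)"

text \<open>\<open>S(U(a\<^sub>1)) U(a\<^sub>3)\<close> in \<open>D\<^sup>\<or>(G)\<close>, for a map \<open>U\<close> into \<open>D\<^sup>\<or>(G)\<close>.\<close>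

definition adj_part :: "('g, 'm) monoid_scheme \<Rightarrow> ('b \<Rightarrow> ('g \<times> 'g \<Rightarrow>\<^sub>0 'k::field)) \<Rightarrow> 'b \<Rightarrow> 'b \<Rightarrow>
    ('g \<times> 'g \<Rightarrow>\<^sub>0 'k)" where
  "adj_part G U a1 a3 = lin (bmul (D_bialg G)) (tensor (lin (D_antipode G) (U a1)) (U a3))"

definition transmuted_coaction :: "('g, 'm) monoid_scheme \<Rightarrow> ('b, 'k::field) bialg \<Rightarrow>
    ('b \<Rightarrow> ('g \<times> 'g \<Rightarrow>\<^sub>0 'k)) \<Rightarrow> 'b \<Rightarrow> ('b \<times> ('g \<times> 'g) \<Rightarrow>\<^sub>0 'k)" where
  "transmuted_coaction G A U a =
     lin (\<lambda>((a1, a2), a3). tensor (bvec a2) (adj_part G U a1 a3)) (cop3 A a)"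

definition transmuted_bialg :: "('g, 'm) monoid_scheme \<Rightarrow> ('b, 'k::field) bialg \<Rightarrow>
    ('b \<Rightarrow> ('g \<times> 'g \<Rightarrow>\<^sub>0 'k)) \<Rightarrow> ('b, 'k) bialg" where
  "transmuted_bialg G A U = A\<lparr>
     bmul := (\<lambda>(a, b).
       lin (\<lambda>(((a1, a2), a3), (b1, b2)).
              scale (linf (D_R G) (tensor (adj_part G U a1 a3) (lin (D_antipode G) (U b1))))
                    (bmul A (a2, b2)))
           (tensor (cop3 A a) (bcop A b)))\<rparr>"

definition crossed_coaction :: "('g, 'm) monoid_scheme \<Rightarrow> ('g, 'b, 'k::field) xmod \<Rightarrow> 'b \<Rightarrow>
    ('b \<times> ('g \<times> 'g) \<Rightarrow>\<^sub>0 'k)" where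
  "crossed_coaction G X v = (\<Sum>g\<in>carrier G. tensor (act X g v) (bvec (g, deg X v)))"

text \<open>
  \<open>th\<close> identifies the bialgebra \<open>H\<close> on the crossed module \<open>X\<close> with the transmutation of the
  bialgebra \<open>A\<close> on \<open>V\<close> along \<open>U\<close>. The transmuted object is given as a \<open>D\<^sup>\<or>(G)\<close>-comodule.
\<close>

definition transmutation_iso :: "('g, 'm) monoid_scheme \<Rightarrow> ('g, 'b, 'k::field) xmod \<Rightarrow>
    ('b, 'k) bialg \<Rightarrow> ('c, 'k, 'z) pspace_scheme \<Rightarrow> ('c, 'k) bialg \<Rightarrow>
    ('c \<Rightarrow> ('g \<times> 'g \<Rightarrow>\<^sub>0 'k)) \<Rightarrow> ('b \<Rightarrow> ('c \<Rightarrow>\<^sub>0 'k)) \<Rightarrow> bool" where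
  "transmutation_iso G X H V A U th \<longleftrightarrow>
     bialgebra_hom X H V (transmuted_bialg G A U) th \<and> quot_bij X V th \<and>
     (\<forall>b\<in>basis X. eqv (tens V (D_space G))
        (lin (tmap th bvec) (crossed_coaction G X b))
        (lin (transmuted_coaction G A U) (th b)))"


section \<open>Pairs of a conjugacy class and an irreducible representation\<close>

definition conj_classes :: "('g, 'm) monoid_scheme \<Rightarrow> 'g set set" where
  "conj_classes G = {{g \<otimes>\<^bsub>G\<^esub> x \<otimes>\<^bsub>G\<^esub> inv\<^bsub>G\<^esub> g | g. g \<in> carrier G} | x. x \<in> carrier G}"

definition centralizer :: "('g, 'm) monoid_scheme \<Rightarrow> 'g \<Rightarrow> 'g set" where
  "centralizer G x = {g \<in> carrier G. g \<otimes>\<^bsub>G\<^esub> x = x \<otimes>\<^bsub>G\<^esub> g}"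

text \<open>The base point \<open>r\<close> and the section \<open>q\<close> depend on the class only.\<close>

definition class_choice :: "('g, 'm) monoid_scheme \<Rightarrow> ('g set \<Rightarrow> 'g) \<Rightarrow> ('g set \<Rightarrow> 'g \<Rightarrow> 'g) \<Rightarrow> bool"
  where
  "class_choice G r q \<longleftrightarrow> (\<forall>C\<in>conj_classes G. r C \<in> C \<and> q C (r C) = \<one>\<^bsub>G\<^esub> \<and>
     (\<forall>c\<in>C. q C c \<in> carrier G \<and> q C c \<otimes>\<^bsub>G\<^esub> r C \<otimes>\<^bsub>G\<^esub> inv\<^bsub>G\<^esub> (q C c) = c))"

text \<open>
  A finite-dimensional representation with a chosen basis is a matrix representation on \<open>k\<^sup>d\<close>;
  the entry \<open>\<pi>(n)\<^sup>j\<^sub>i\<close> is the one in row \<open>j\<close> and column \<open>i\<close>.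
\<close>

definition matrix_rep :: "('g, 'm) monoid_scheme \<Rightarrow> 'g set \<Rightarrow> nat \<Rightarrow> ('g \<Rightarrow> 'k::field mat) \<Rightarrow> bool"
  where
  "matrix_rep G K d \<pi> \<longleftrightarrow> (\<forall>n\<in>K. \<pi> n \<in> carrier_mat d d) \<and> \<pi> \<one>\<^bsub>G\<^esub> = 1\<^sub>m d \<and>
     (\<forall>m\<in>K. \<forall>n\<in>K. \<pi> (m \<otimes>\<^bsub>G\<^esub> n) = \<pi> m * \<pi> n)"

definition irreducible_rep :: "('g, 'm) monoid_scheme \<Rightarrow> 'g set \<Rightarrow> nat \<Rightarrow> ('g \<Rightarrow> 'k::field mat) \<Rightarrow>
    bool" where
  "irreducible_rep G K d \<pi> \<longleftrightarrow> matrix_rep G K d \<pi> \<and> d > 0 \<and>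
     (\<forall>W \<subseteq> carrier_vec d.
        0\<^sub>v d \<in> W \<and> (\<forall>v\<in>W. \<forall>w\<in>W. v + w \<in> W) \<and> (\<forall>c. \<forall>v\<in>W. c \<cdot>\<^sub>v v \<in> W) \<and>
        (\<forall>n\<in>K. \<forall>v\<in>W. \<pi> n *\<^sub>v v \<in> W) \<longrightarrow> W = {0\<^sub>v d} \<or> W = carrier_vec d)"

type_synonym ('g, 'k) cpair = "'g set \<times> ('g \<Rightarrow> 'k mat)"

definition pdim :: "('g, 'm) monoid_scheme \<Rightarrow> ('g, 'k::field) cpair \<Rightarrow> nat" where
  "pdim G P = dim_row (snd P \<one>\<^bsub>G\<^esub>)"

definition nontrivial_pair :: "('g, 'm) monoid_scheme \<Rightarrow> ('g set \<Rightarrow> 'g) \<Rightarrow> ('g, 'k::field) cpair \<Rightarrow>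
    bool" where
  "nontrivial_pair G r P \<longleftrightarrow> fst P \<in> conj_classes G \<and>
     irreducible_rep G (centralizer G (r (fst P))) (pdim G P) (snd P) \<and>
     \<not> (fst P = {\<one>\<^bsub>G\<^esub>} \<and> (\<forall>n\<in>carrier G. snd P n = 1\<^sub>m 1))"

definition zeta :: "('g, 'm) monoid_scheme \<Rightarrow> ('g set \<Rightarrow> 'g \<Rightarrow> 'g) \<Rightarrow> 'g set \<Rightarrow> 'g \<Rightarrow> 'g \<Rightarrow> 'g" where
  "zeta G q C c g =
     inv\<^bsub>G\<^esub> (q C (g \<otimes>\<^bsub>G\<^esub> c \<otimes>\<^bsub>G\<^esub> inv\<^bsub>G\<^esub> g)) \<otimes>\<^bsub>G\<^esub> g \<otimes>\<^bsub>G\<^esub> q C c"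


section \<open>The braided-Lie algebra \<open>L\<close>\<close>

definition pidx :: "('g, 'm) monoid_scheme \<Rightarrow> ('g, 'k::field) cpair \<Rightarrow> ('g \<times> nat) set" where
  "pidx G P = fst P \<times> {..<pdim G P}"

text \<open>\<open>(P, (a, i), (b, j))\<close> indexes both \<open>E\<^sub>a\<^sub>i\<^sup>b\<^sup>j\<close> and \<open>t\<^sub>a\<^sub>i\<^sup>b\<^sup>j\<close>.\<close>

type_synonym ('g, 'k) gen = "('g, 'k) cpair \<times> ('g \<times> nat) \<times> ('g \<times> nat)"

definition gens :: "('g, 'm) monoid_scheme \<Rightarrow> ('g, 'k::field) cpair set \<Rightarrow> ('g, 'k) gen set" where
  "gens G S = {(P, x, y). P \<in> S \<and> x \<in> pidx G P \<and> y \<in> pidx G P}"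

definition L_act :: "('g, 'm) monoid_scheme \<Rightarrow> ('g set \<Rightarrow> 'g \<Rightarrow> 'g) \<Rightarrow> 'g \<Rightarrow> ('g, 'k::field) gen \<Rightarrow>
    (('g, 'k) gen \<Rightarrow>\<^sub>0 'k)" where
  "L_act G q h = (\<lambda>(P, (a, i), (b, j)). \<Sum>m<pdim G P. \<Sum>l<pdim G P.
     scale (snd P (zeta G q (fst P) a h) $$ (m, i) *
            snd P (inv\<^bsub>G\<^esub> (zeta G q (fst P) b h)) $$ (j, l))
       (bvec (P, (h \<otimes>\<^bsub>G\<^esub> a \<otimes>\<^bsub>G\<^esub> inv\<^bsub>G\<^esub> h, m), (h \<otimes>\<^bsub>G\<^esub> b \<otimes>\<^bsub>G\<^esub> inv\<^bsub>G\<^esub> h, l))))"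

definition L_deg :: "('g, 'm) monoid_scheme \<Rightarrow> ('g, 'k::field) gen \<Rightarrow> 'g" where
  "L_deg G = (\<lambda>(P, (a, i), (b, j)). a \<otimes>\<^bsub>G\<^esub> inv\<^bsub>G\<^esub> b)"

definition mat_cop :: "('g, 'm) monoid_scheme \<Rightarrow> ('g, 'k::field) gen \<Rightarrow>
    (('g, 'k) gen \<times> ('g, 'k) gen \<Rightarrow>\<^sub>0 'k)" where
  "mat_cop G = (\<lambda>(P, x, y). \<Sum>z\<in>pidx G P. bvec ((P, x, z), (P, z, y)))"

definition mat_eps :: "('g, 'k::field) gen \<Rightarrow> 'k" where
  "mat_eps = (\<lambda>(P, x, y). if x = y then 1 else 0)"

text \<open>The action on the first tensor factor \<open>E\<^sub>a\<^sub>i\<close> of \<open>E\<^sub>a\<^sub>i\<^sup>b\<^sup>j\<close> only.\<close>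

definition left_act :: "('g, 'm) monoid_scheme \<Rightarrow> ('g set \<Rightarrow> 'g \<Rightarrow> 'g) \<Rightarrow> 'g \<Rightarrow> ('g, 'k::field) gen \<Rightarrow>
    (('g, 'k) gen \<Rightarrow>\<^sub>0 'k)" where
  "left_act G q h = (\<lambda>(P, (a, i), y). \<Sum>m<pdim G P.
     scale (snd P (zeta G q (fst P) a h) $$ (m, i)) (bvec (P, (h \<otimes>\<^bsub>G\<^esub> a \<otimes>\<^bsub>G\<^esub> inv\<^bsub>G\<^esub> h, m), y)))"

definition fund_braiding :: "('g, 'm) monoid_scheme \<Rightarrow> ('g set \<Rightarrow> 'g \<Rightarrow> 'g) \<Rightarrow>
    ('g, 'k::field) gen \<times> ('g, 'k) gen \<Rightarrow> (('g, 'k) gen \<times> ('g, 'k) gen \<Rightarrow>\<^sub>0 'k)" where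
  "fund_braiding G q = (\<lambda>((P, x, (b, j)), y).
     lin (\<lambda>y'. tensor (bvec y') (left_act G q (inv\<^bsub>G\<^esub> (L_deg G y')) (P, x, (b, j))))
         (L_act G q (inv\<^bsub>G\<^esub> b) y))"


section \<open>Quotients of the tensor algebra: \<open>U(L)\<close> and \<open>A(R)\<close>\<close>

text \<open>A list of generators is a basis element of the tensor algebra.\<close>

primrec word_act :: "('x \<Rightarrow> ('x \<Rightarrow>\<^sub>0 'k::field)) \<Rightarrow> 'x list \<Rightarrow> ('x list \<Rightarrow>\<^sub>0 'k)" where
  "word_act f [] = bvec []"
| "word_act f (x # w) = lin (\<lambda>(y, v). bvec (y # v)) (tensor (f x) (word_act f w))"

primrec word_deg :: "('g, 'm) monoid_scheme \<Rightarrow> ('x \<Rightarrow> 'g) \<Rightarrow> 'x list \<Rightarrow> 'g" where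
  "word_deg G d [] = \<one>\<^bsub>G\<^esub>"
| "word_deg G d (x # w) = d x \<otimes>\<^bsub>G\<^esub> word_deg G d w"

primrec word_eps :: "('x \<Rightarrow> 'k::field) \<Rightarrow> 'x list \<Rightarrow> 'k" where
  "word_eps e [] = 1"
| "word_eps e (x # w) = e x * word_eps e w"

definition word_mul :: "'x list \<times> 'x list \<Rightarrow> ('x list \<Rightarrow>\<^sub>0 'k::field)" where
  "word_mul = (\<lambda>(u, v). bvec (u @ v))"

text \<open>The multiplicative extension of a coproduct on generators, with respect to a braiding \<open>Psi\<close>.\<close>

primrec word_cop :: "('x list \<times> 'x list \<Rightarrow> ('x list \<times> 'x list \<Rightarrow>\<^sub>0 'k::field)) \<Rightarrow>
    ('x \<Rightarrow> ('x \<times> 'x \<Rightarrow>\<^sub>0 'k)) \<Rightarrow> 'x list \<Rightarrow> ('x list \<times> 'x list \<Rightarrow>\<^sub>0 'k)" where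
  "word_cop Psi D [] = bvec ([], [])"
| "word_cop Psi D (x # w) = lin (tens_mul Psi word_mul)
     (tensor (lin (\<lambda>(y, z). bvec ([y], [z])) (D x)) (word_cop Psi D w))"

definition word_bialg :: "('x list \<times> 'x list \<Rightarrow> ('x list \<times> 'x list \<Rightarrow>\<^sub>0 'k::field)) \<Rightarrow>
    ('x \<Rightarrow> ('x \<times> 'x \<Rightarrow>\<^sub>0 'k)) \<Rightarrow> ('x \<Rightarrow> 'k) \<Rightarrow> ('x list, 'k) bialg" where
  "word_bialg Psi D e = \<lparr>bone = bvec [], bmul = word_mul, bcop = word_cop Psi D, beps = word_eps e\<rparr>"

text \<open>The two-sided ideal of the tensor algebra on \<open>B\<close> generated by \<open>Q\<close>.\<close>

definition word_ideal :: "'x set \<Rightarrow> ('x list \<Rightarrow>\<^sub>0 'k::field) set \<Rightarrow> ('x list \<Rightarrow>\<^sub>0 'k) set" where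
  "word_ideal B Q =
     fv.span {lin (\<lambda>w. bvec (u @ w @ v)) x | u v x. u \<in> lists B \<and> v \<in> lists B \<and> x \<in> Q}"

definition U_rels :: "('g, 'm) monoid_scheme \<Rightarrow> ('g set \<Rightarrow> 'g \<Rightarrow> 'g) \<Rightarrow> ('g, 'k::field) cpair set \<Rightarrow>
    (('g, 'k) gen list \<Rightarrow>\<^sub>0 'k) set" where
  "U_rels G q S = {bvec [x, y] - lin (\<lambda>(y', x'). bvec [y', x']) (fund_braiding G q (x, y)) | x y.
     x \<in> gens G S \<and> y \<in> gens G S}"

definition U_xmod :: "('g, 'm) monoid_scheme \<Rightarrow> ('g set \<Rightarrow> 'g \<Rightarrow> 'g) \<Rightarrow> ('g, 'k::field) cpair set \<Rightarrow>
    ('g, ('g, 'k) gen list, 'k) xmod" where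
  "U_xmod G q S = \<lparr>basis = lists (gens G S), null = word_ideal (gens G S) (U_rels G q S),
     act = (\<lambda>h. word_act (L_act G q h)), deg = word_deg G (L_deg G)\<rparr>"

definition U_bialg :: "('g, 'm) monoid_scheme \<Rightarrow> ('g set \<Rightarrow> 'g \<Rightarrow> 'g) \<Rightarrow> ('g, 'k::field) cpair set \<Rightarrow>
    (('g, 'k) gen list, 'k) bialg" where
  "U_bialg G q S = word_bialg (xbraid (U_xmod G q S)) (mat_cop G) mat_eps"

text \<open>\<open>R_entry G q P P' (a,i) (b,j) (c,m) (d,l)\<close> is \<open>R\<^sup>a\<^sup>i\<^sub>b\<^sub>j\<^sup>c\<^sup>m\<^sub>d\<^sub>l\<close>, with \<open>c, m, d, l\<close> referring to \<open>P'\<close>.\<close>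

definition R_entry :: "('g, 'm) monoid_scheme \<Rightarrow> ('g set \<Rightarrow> 'g \<Rightarrow> 'g) \<Rightarrow>
    ('g, 'k::field) cpair \<Rightarrow> ('g, 'k) cpair \<Rightarrow>
    'g \<times> nat \<Rightarrow> 'g \<times> nat \<Rightarrow> 'g \<times> nat \<Rightarrow> 'g \<times> nat \<Rightarrow> 'k" where
  "R_entry G q P P' = (\<lambda>(a, i) (b, j) (c, m) (d, l).
     if a = b \<and> i = j \<and> c = a \<otimes>\<^bsub>G\<^esub> d \<otimes>\<^bsub>G\<^esub> inv\<^bsub>G\<^esub> a
     then snd P' (zeta G q (fst P') d a) $$ (m, l) else 0)"

definition A_rels :: "('g, 'm) monoid_scheme \<Rightarrow> ('g set \<Rightarrow> 'g \<Rightarrow> 'g) \<Rightarrow> ('g, 'k::field) cpair set \<Rightarrow>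
    (('g, 'k) gen list \<Rightarrow>\<^sub>0 'k) set" where
  "A_rels G q S =
    {(\<Sum>z\<in>pidx G P. \<Sum>w\<in>pidx G P'. scale (R_entry G q P P' z x w x') (bvec [(P, z, y), (P', w, y')])) -
     (\<Sum>w\<in>pidx G P'. \<Sum>z\<in>pidx G P. scale (R_entry G q P P' y z y' w) (bvec [(P', x', w), (P, x, z)]))
     | P x y P' x' y'. (P, x, y) \<in> gens G S \<and> (P', x', y') \<in> gens G S}"

definition A_space :: "('g, 'm) monoid_scheme \<Rightarrow> ('g set \<Rightarrow> 'g \<Rightarrow> 'g) \<Rightarrow> ('g, 'k::field) cpair set \<Rightarrow>
    (('g, 'k) gen list, 'k) pspace" where
  "A_space G q S = \<lparr>basis = lists (gens G S), null = word_ideal (gens G S) (A_rels G q S)\<rparr>"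

definition A_bialg :: "('g, 'm) monoid_scheme \<Rightarrow> (('g, 'k::field) gen list, 'k) bialg" where
  "A_bialg G = word_bialg flip (mat_cop G) mat_eps"

text \<open>
  The extension of \<open>R\<close> from generators to words by
  \<open>R(a \<otimes> bc) = R(a\<^sub>1 \<otimes> c) R(a\<^sub>2 \<otimes> b)\<close> (with \<open>a\<close> a generator) and then by
  \<open>R(ab \<otimes> c) = R(a \<otimes> c\<^sub>1) R(b \<otimes> c\<^sub>2)\<close>.
\<close>

primrec gen_R :: "('x \<Rightarrow> ('x \<times> 'x \<Rightarrow>\<^sub>0 'k::field)) \<Rightarrow> ('x \<Rightarrow> 'k) \<Rightarrow> ('x \<times> 'x \<Rightarrow> 'k) \<Rightarrow> 'x list \<Rightarrow> 'x \<Rightarrow> 'k"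
  where
  "gen_R D e R [] x = e x"
| "gen_R D e R (y # v) x = linf (\<lambda>(x1, x2). gen_R D e R v x1 * R (x2, y)) (D x)"

primrec word_R :: "('x \<Rightarrow> ('x \<times> 'x \<Rightarrow>\<^sub>0 'k::field)) \<Rightarrow> ('x \<Rightarrow> 'k) \<Rightarrow> ('x \<times> 'x \<Rightarrow> 'k) \<Rightarrow>
    'x list \<Rightarrow> 'x list \<Rightarrow> 'k" where
  "word_R D e R [] v = word_eps e v"
| "word_R D e R (x # u) v =
     linf (\<lambda>(v1, v2). gen_R D e R v1 x * word_R D e R u v2) (word_cop flip D v)"

definition A_R :: "('g, 'm) monoid_scheme \<Rightarrow> ('g set \<Rightarrow> 'g \<Rightarrow> 'g) \<Rightarrow>
    ('g, 'k::field) gen list \<times> ('g, 'k) gen list \<Rightarrow> 'k" where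
  "A_R G q = (\<lambda>(u, v). word_R (mat_cop G) mat_eps
     (\<lambda>((P, x, y), (P', x', y')). R_entry G q P P' y x y' x') u v)"


section \<open>The map on generators\<close>

definition r_elem :: "('g, 'm) monoid_scheme \<Rightarrow> ('g set \<Rightarrow> 'g) \<Rightarrow> ('g set \<Rightarrow> 'g \<Rightarrow> 'g) \<Rightarrow>
    ('g, 'k::field) gen \<Rightarrow> ('g \<times> 'g \<Rightarrow>\<^sub>0 'k)" where
  "r_elem G r q = (\<lambda>(P, (a, i), (b, j)). \<Sum>n\<in>centralizer G (r (fst P)).
     scale (snd P n $$ (j, i))
       (bvec (q (fst P) a \<otimes>\<^bsub>G\<^esub> inv\<^bsub>G\<^esub> n \<otimes>\<^bsub>G\<^esub> inv\<^bsub>G\<^esub> (q (fst P) b), inv\<^bsub>G\<^esub> b)))"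

definition L_incl :: "('g, 'k::field) gen \<Rightarrow> (('g, 'k) gen list \<Rightarrow>\<^sub>0 'k)" where
  "L_incl x = bvec [x]"

end

theory Submission
  imports Defs
begin

text \<open>
  A bialgebra \<open>A\<close> with a bialgebra map to \<open>D\<^sup>\<or>(G)\<close> carries two commuting actions \<open>\<lambda>\<close>, \<open>\<rho>\<close> of \<open>G\<close> and two
  degrees \<open>dl\<close>, \<open>dr\<close>, and the map is recovered as \<open>a \<mapsto> \<Sum>\<^sub>g \<epsilon>(\<lambda>\<^sub>g\<^sup>-\<^sup>1 a) \<delta>\<^sub>g \<otimes> dr a\<close>. In these terms the
  pulled back coquasitriangular structure is \<open>\<epsilon>(a) \<epsilon>(\<lambda>\<^sub>h b)\<close> with \<open>h = (dl a)\<^sup>-\<^sup>1\<close>, the transmuted product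
  is \<open>a \<bullet> b = a \<lambda>\<^sub>|\<^sub>a\<^sub>|(b)\<close> with \<open>|a| = (dl a)\<^sup>-\<^sup>1 (dr a)\<close>, and \<open>h\<close> acts as \<open>\<rho>\<^sub>h \<lambda>\<^sub>h\<close>. The axioms of a braided
  bialgebra then follow from the compatibility of \<open>\<lambda>\<close> and \<open>\<rho>\<close> with the coproduct, above all from the
  invariance \<open>(\<rho>\<^sub>h \<otimes> \<lambda>\<^sub>h) \<Delta> = \<Delta>\<close>.

  \<open>D\<^sup>\<or>(G)\<close> itself is of this form, with \<open>\<lambda>\<^sub>k(\<delta>\<^sub>g \<otimes> h) = \<delta>\<^sub>k\<^sub>g \<otimes> h\<close>, and so is \<open>A(\<R>)\<close>, whose relations become
  \<open>a \<lambda>\<^sub>h(b) = \<rho>\<^sub>k(b) a\<close> with \<open>h = (dl a)\<^sup>-\<^sup>1\<close> and \<open>k = dr a\<close>. The algebra map \<open>\<theta>\<close> from words with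
  concatenation to words with the transmuted product which fixes the generators, \<open>\<theta>(x w) = x \<lambda>\<^sub>|\<^sub>x\<^sub>|(\<theta> w)\<close>,
  is bijective already on the free algebra, and it carries the relations \<open>x y = \<cdot>\<Psi>(x \<otimes> y)\<close> of \<open>U(\<L>)\<close> to
  linear combinations of those of \<open>A(\<R>)\<close>. Hence \<open>U(\<L>)\<close> is the transmutation of \<open>A(\<R>)\<close>, and the map to
  \<open>BD(G)\<close> is the composite of \<open>\<theta>\<close> with \<open>A(\<R>) \<rightarrow> D\<^sup>\<or>(G)\<close>.
\<close>


section \<open>Linear maps on free vector spaces\<close>

text \<open>The two actions are the two coactions of the quantum double in disguise. A bialgebra map
  to the double makes \<open>A\<close> a bicomodule, and a comodule over the double is a
  \<open>G\<close>-graded space with an action: the right coaction gives \<open>ra\<close> and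
  \<open>dr\<close>, the left one \<open>la\<close> and \<open>dl\<close>. Most case distinctions
  come from one rule: the counit is nonzero only where \<open>dl\<close> and \<open>dr\<close>
  agree, so the coefficient of the delta function at \<open>g\<close> vanishes unless
  \<open>g\<close> conjugates \<open>dr a\<close> into \<open>dl a\<close>. The obstacle is the
  coproduct of \<open>U(L)\<close>, defined on words by recursion through the braiding. A direct
  proof that its relations span a coideal would entangle both legs. In \<open>A(R)\<close> the
  tensor square carries the ordinary product, and the coproduct of a relation telescopes into
  relations in one leg at a time. So all axioms are proved for the transmutation of
  \<open>A(R)\<close> and pulled back along the rearrangement of words, whose inverse is exact on
  the free algebra. What remains is that each of the two maps sends one ideal into the other; this
  rests on the left action preserving the span of the relations.\<close>

lemma scale_scale [simp]: "scale a (scale b x) = scale (a * b) x"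
  by (simp add: poly_mapping_eqI lookup_scale mult.assoc)

lemma scale_add_right: "scale c (x + y) = scale c x + scale c y"
  by (simp add: poly_mapping_eqI lookup_scale lookup_add distrib_left)

lemma scale_add_left: "scale (c + d) x = scale c x + scale d x"
  by (simp add: poly_mapping_eqI lookup_scale lookup_add distrib_right)

lemma scale_sum_right: "scale c (sum f A) = (\<Sum>a\<in>A. scale c (f a))"
  by (rule fv.scale_sum_right)

lemma scale_sum_left: "scale (sum f A) x = (\<Sum>a\<in>A. scale (f a) x)"
  by (rule fv.scale_sum_left)

lemma lookup_sum': "Poly_Mapping.lookup (sum f A) b = (\<Sum>a\<in>A. Poly_Mapping.lookup (f a) b)"
  by (induction A rule: infinite_finite_induct) (auto simp: lookup_add)

lemma keys_bvec [simp]: "Poly_Mapping.keys (bvec b :: _ \<Rightarrow>\<^sub>0 'k::field) = {b}"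
  by (simp add: bvec_def)

lemma lookup_bvec: "Poly_Mapping.lookup (bvec b) c = (if b = c then 1 else 0)"
  by (simp add: bvec_def lookup_single when_def)

text \<open>The sum defining \<open>lin\<close> runs over the support of its argument, which changes
  under addition. A common finite index set, padded with zero coefficients, gives the linearity
  laws.\<close>

lemma lin_superset:
  assumes "finite A" "Poly_Mapping.keys x \<subseteq> A"
  shows "lin f x = (\<Sum>b\<in>A. scale (Poly_Mapping.lookup x b) (f b))"
  unfolding lin_def using assms
  by (intro sum.mono_neutral_left) (auto simp: in_keys_iff)

lemma lin_zero [simp]: "lin f 0 = 0"
  by (simp add: lin_def)

lemma lin_add: "lin f (x + y) = lin f x + lin f y"
proof -
  have "lin f (x + y) = (\<Sum>b\<in>Poly_Mapping.keys x \<union> Poly_Mapping.keys y. scale (Poly_Mapping.lookup (x + y) b) (f b))"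
    using keys_add[of x y] by (intro lin_superset) auto
  also have "\<dots> = (\<Sum>b\<in>Poly_Mapping.keys x \<union> Poly_Mapping.keys y. scale (Poly_Mapping.lookup x b) (f b)) + (\<Sum>b\<in>Poly_Mapping.keys x \<union> Poly_Mapping.keys y. scale (Poly_Mapping.lookup y b) (f b))"
    by (simp add: lookup_add scale_add_left sum.distrib)
  also have "\<dots> = lin f x + lin f y"
    by (subst (1 2) lin_superset[of "Poly_Mapping.keys x \<union> Poly_Mapping.keys y"]) auto
  finally show ?thesis .
qed

lemma lin_scale: "lin f (scale c x) = scale c (lin f x)"
proof -
  have "Poly_Mapping.keys (scale c x) \<subseteq> Poly_Mapping.keys x"
    by (auto simp: in_keys_iff lookup_scale)
  hence "lin f (scale c x) = (\<Sum>b\<in>Poly_Mapping.keys x. scale (Poly_Mapping.lookup (scale c x) b) (f b))"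
    by (intro lin_superset) auto
  thus ?thesis by (simp add: lookup_scale lin_def scale_sum_right)
qed

lemma lin_sum: "lin f (sum g A) = (\<Sum>a\<in>A. lin f (g a))"
  by (induction A rule: infinite_finite_induct) (auto simp: lin_add)

lemma lin_uminus: "lin f (- x) = - lin f x"
  using lin_scale[of f "-1" x] by simp

lemma lin_diff: "lin f (x - y) = lin f x - lin f y"
  using lin_add[of f x "- y"] by (simp add: lin_uminus)

lemma lin_bvec [simp]: "lin f (bvec b) = f b"
  by (simp add: lin_def lookup_bvec)

lemma lin_cong: "(\<And>b. b \<in> Poly_Mapping.keys x \<Longrightarrow> f b = g b) \<Longrightarrow> lin f x = lin g x"
  by (simp add: lin_def)

lemma lin_fun_zero [simp]: "lin (\<lambda>_. 0) x = 0"
  by (simp add: lin_def)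

lemma lin_fun_add: "lin (\<lambda>b. f b + g b) x = lin f x + lin g x"
  by (simp add: lin_def scale_add_right sum.distrib)

lemma lin_fun_scale: "lin (\<lambda>b. scale c (f b)) x = scale c (lin f x)"
  by (simp add: lin_def scale_sum_right mult.commute)

lemma lin_fun_uminus: "lin (\<lambda>b. - f b) x = - lin f x"
  using lin_fun_scale[of "-1" f x] by simp

lemma lin_fun_diff: "lin (\<lambda>b. f b - g b) x = lin f x - lin g x"
  using lin_fun_add[of f "\<lambda>b. - g b" x] by (simp add: lin_fun_uminus)

lemma lin_fun_sum: "lin (\<lambda>b. \<Sum>a\<in>A. f a b) x = (\<Sum>a\<in>A. lin (f a) x)"
  by (induction A rule: infinite_finite_induct) (auto simp: lin_fun_add)

lemma lin_lin: "lin f (lin g x) = lin (\<lambda>b. lin f (g b)) x"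
  by (simp add: lin_def[of g] lin_sum lin_scale lin_def[of "\<lambda>b. lin f (g b)"])

lemma lookup_lin: "Poly_Mapping.lookup (lin f x) c = (\<Sum>b\<in>Poly_Mapping.keys x. Poly_Mapping.lookup x b * Poly_Mapping.lookup (f b) c)"
  by (simp add: lin_def lookup_sum' lookup_scale)

lemma lin_bvec_right [simp]: "lin bvec x = x"
proof (rule poly_mapping_eqI)
  fix c
  have "Poly_Mapping.lookup (lin bvec x) c = (\<Sum>b\<in>Poly_Mapping.keys x. if b = c then Poly_Mapping.lookup x b else 0)"
    unfolding lookup_lin by (intro sum.cong) (auto simp: lookup_bvec)
  thus "Poly_Mapping.lookup (lin bvec x) c = Poly_Mapping.lookup x c"
    by (simp add: in_keys_iff)
qed

lemma lin_swap: "lin (\<lambda>b. lin (\<lambda>c. f b c) y) x = lin (\<lambda>c. lin (\<lambda>b. f b c) x) y"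
  unfolding lin_def scale_sum_right scale_scale
  by (subst sum.swap) (simp add: mult.commute)

lemma lin_if_zero: "lin (\<lambda>b. if P then f b else 0) x = (if P then lin f x else 0)"
  by simp

text \<open>A functional is read as a linear map to the one-dimensional free space on
  \<open>unit\<close>, so that the laws of \<open>linf\<close> follow from those of
  \<open>lin\<close>.\<close>

lemma linf_eq_lookup: "linf e x = Poly_Mapping.lookup (lin (\<lambda>b. Poly_Mapping.single () (e b)) x) ()"
  by (simp add: linf_def lookup_lin)

lemma single_eq_scale_bvec: "Poly_Mapping.single () c = scale c (bvec ())"
  by (rule poly_mapping_eqI) (simp add: lookup_scale lookup_bvec lookup_single)

lemma linf_zero [simp]: "linf e 0 = 0"
  by (simp add: linf_def)

lemma linf_add: "linf e (x + y) = linf e x + linf e y"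
  by (simp add: linf_eq_lookup lin_add lookup_add)

lemma linf_diff: "linf e (x - y) = linf e x - linf e y"
  by (simp add: linf_eq_lookup lin_diff lookup_minus)

lemma linf_scale: "linf e (scale c x) = c * linf e x"
  by (simp add: linf_eq_lookup lin_scale lookup_scale)

lemma linf_sum: "linf e (sum g A) = (\<Sum>a\<in>A. linf e (g a))"
  by (induction A rule: infinite_finite_induct) (auto simp: linf_add)

lemma linf_bvec [simp]: "linf e (bvec b) = e b"
  by (simp add: linf_def lookup_bvec)

lemma linf_lin: "linf e (lin f x) = linf (\<lambda>b. linf e (f b)) x"
  by (simp add: lin_def linf_sum linf_scale linf_def[of "\<lambda>b. linf e (f b)"])

lemma linf_cong: "(\<And>b. b \<in> Poly_Mapping.keys x \<Longrightarrow> f b = g b) \<Longrightarrow> linf f x = linf g x"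
  by (simp add: linf_def)

lemma linf_fun_mult_left: "linf (\<lambda>b. c * f b) x = c * linf f x"
  by (simp add: linf_def sum_distrib_left mult.left_commute)

lemma linf_fun_mult_right: "linf (\<lambda>b. f b * c) x = linf f x * c"
  by (simp add: linf_def sum_distrib_right mult.assoc)

lemma linf_fun_zero [simp]: "linf (\<lambda>_. 0) x = 0"
  by (simp add: linf_def)

lemma lin_scale_fun_const: "lin (\<lambda>b. scale (e b) y) x = scale (linf e x) y"
  by (simp add: lin_def linf_def scale_sum_left)

lemma tensor_bvec [simp]: "tensor (bvec b) (bvec c) = bvec (b, c)"
  by (simp add: tensor_def)

lemma tensor_bvec_left: "tensor (bvec b) y = lin (\<lambda>c. bvec (b, c)) y"
  by (simp add: tensor_def)

lemma tensor_bvec_right: "tensor x (bvec c) = lin (\<lambda>b. bvec (b, c)) x"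
  by (simp add: tensor_def)

lemma lin_tensor: "lin f (tensor x y) = lin (\<lambda>b. lin (\<lambda>c. f (b, c)) y) x"
  by (simp add: tensor_def lin_lin)

lemma linf_tensor: "linf f (tensor x y) = linf (\<lambda>b. linf (\<lambda>c. f (b, c)) y) x"
  by (simp add: tensor_def linf_lin)

lemma tensor_zero [simp]: "tensor 0 y = 0" "tensor x 0 = 0"
  by (simp_all add: tensor_def)

lemma tensor_lin_left: "tensor (lin f x) y = lin (\<lambda>b. tensor (f b) y) x"
  by (simp add: tensor_def lin_lin)

lemma tensor_lin_right: "tensor x (lin f y) = lin (\<lambda>b. tensor x (f b)) y"
  unfolding tensor_def lin_lin by (rule lin_swap)

lemma tensor_scale_left: "tensor (scale c x) y = scale c (tensor x y)"
  by (simp add: tensor_def lin_scale)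

lemma tensor_scale_right: "tensor x (scale c y) = scale c (tensor x y)"
  by (simp add: tensor_def lin_scale lin_fun_scale)

lemma tensor_sum_left: "tensor (sum f A) y = (\<Sum>a\<in>A. tensor (f a) y)"
  by (simp add: tensor_def lin_sum)

lemma tensor_sum_right: "tensor x (sum f A) = (\<Sum>a\<in>A. tensor x (f a))"
  by (simp add: tensor_def lin_sum lin_fun_sum)

lemma tensor_diff_left: "tensor (x - x') y = tensor x y - tensor x' y"
  by (simp add: tensor_def lin_diff)

lemma tensor_diff_right: "tensor x (y - y') = tensor x y - tensor x y'"
  by (simp add: tensor_def lin_diff lin_fun_diff)

lemma lin_tmap_tensor: "lin (tmap f g) (tensor x y) = tensor (lin f x) (lin g y)"
  by (simp add: lin_tensor tmap_def tensor_lin_left tensor_lin_right) (rule lin_swap)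

lemma tmap_apply: "tmap f g (b, c) = tensor (f b) (g c)"
  by (simp add: tmap_def)

lemma tmap_bvec [simp]: "tmap bvec bvec = bvec"
  by (auto simp: tmap_def fun_eq_iff)

lemma lin_in_subspace:
  assumes "fv.subspace W" "\<And>b. b \<in> Poly_Mapping.keys x \<Longrightarrow> f b \<in> W"
  shows "lin f x \<in> W"
  unfolding lin_def using assms by (intro fv.subspace_sum fv.subspace_scale) auto

lemma fspan_subspace [simp]: "fv.subspace (fspan B :: ('b \<Rightarrow>\<^sub>0 'k::field) set)"
proof (rule fv.subspaceI)
  fix x y :: "'b \<Rightarrow>\<^sub>0 'k" and c
  assume "x \<in> fspan B" "y \<in> fspan B"
  thus "x + y \<in> fspan B" using keys_add[of x y] by (auto simp: fspan_def)
next
  fix x :: "'b \<Rightarrow>\<^sub>0 'k" and c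
  assume "x \<in> fspan B"
  thus "scale c x \<in> fspan B" by (auto simp: fspan_def in_keys_iff lookup_scale)
qed (auto simp: fspan_def)

lemma bvec_in_fspan [simp]: "bvec b \<in> fspan B \<longleftrightarrow> b \<in> B"
  by (simp add: fspan_def)

lemma zero_in_fspan [simp]: "0 \<in> fspan B"
  by (simp add: fspan_def)

lemma fspan_mono: "A \<subseteq> B \<Longrightarrow> fspan A \<subseteq> fspan B"
  by (auto simp: fspan_def)

lemma keysD: "x \<in> fspan B \<Longrightarrow> b \<in> Poly_Mapping.keys x \<Longrightarrow> b \<in> B"
  by (auto simp: fspan_def)

lemma scale_in_fspan: "x \<in> fspan B \<Longrightarrow> scale c x \<in> fspan B"
  by (rule fv.subspace_scale) auto

lemma sum_in_fspan: "(\<And>a. a \<in> A \<Longrightarrow> f a \<in> fspan B) \<Longrightarrow> sum f A \<in> fspan B"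
  by (rule fv.subspace_sum) auto

lemma diff_in_fspan: "x \<in> fspan B \<Longrightarrow> y \<in> fspan B \<Longrightarrow> x - y \<in> fspan B"
  by (rule fv.subspace_diff) auto

lemma lin_in_fspan: "x \<in> fspan A \<Longrightarrow> (\<And>a. a \<in> A \<Longrightarrow> f a \<in> fspan B) \<Longrightarrow> lin f x \<in> fspan B"
  by (rule lin_in_subspace) (auto dest: keysD)

lemma tensor_in_fspan: "x \<in> fspan A \<Longrightarrow> y \<in> fspan B \<Longrightarrow> tensor x y \<in> fspan (A \<times> B)"
  unfolding tensor_def by (auto intro!: lin_in_fspan)

lemma fspan_lin_cong: "x \<in> fspan A \<Longrightarrow> (\<And>b. b \<in> A \<Longrightarrow> f b = g b) \<Longrightarrow> lin f x = lin g x"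
  by (auto intro!: lin_cong dest: keysD)

lemma fspan_linf_cong: "x \<in> fspan A \<Longrightarrow> (\<And>b. b \<in> A \<Longrightarrow> f b = g b) \<Longrightarrow> linf f x = linf g x"
  by (auto intro!: linf_cong dest: keysD)

section \<open>Null spaces of tensor products and the maps that respect them\<close>

lemma tens_simps [simp]: "basis (tens V W) = basis V \<times> basis W"
  by (simp add: tens_def)

lemma null_tens_subspace [simp]: "fv.subspace (null (tens V W))"
  by (simp add: tens_def)

lemma pspace_ok_tens:
  assumes "pspace_ok V" "pspace_ok W"
  shows "pspace_ok (tens V W)"
proof -
  have "null (tens V W) \<subseteq> fspan (basis V \<times> basis W)"
    unfolding tens_def pspace.simps using assms
    by (intro fv.span_minimal) (auto intro!: tensor_in_fspan simp: pspace_ok_def)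
  thus ?thesis by (simp add: pspace_ok_def)
qed

lemma tensor_null_left: "x \<in> null V \<Longrightarrow> y \<in> fspan (basis W) \<Longrightarrow> tensor x y \<in> null (tens V W)"
  unfolding tens_def by (auto intro!: fv.span_base)

lemma tensor_null_right: "x \<in> fspan (basis V) \<Longrightarrow> y \<in> null W \<Longrightarrow> tensor x y \<in> null (tens V W)"
  unfolding tens_def by (auto intro!: fv.span_base)

lemma span_lin_closed:
  assumes "x \<in> fv.span A" "fv.subspace W" "\<And>a. a \<in> A \<Longrightarrow> lin f a \<in> W"
  shows "lin f x \<in> W"
  using assms(1)
proof (induction rule: fv.span_induct)
  case base
  thus ?case using assms(2) by (auto simp: fv.subspace_def lin_add lin_scale)
qed (use assms(3) in auto)

text \<open>The null space is spanned by elementary tensors with one null factor, so a linear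
  condition is checked on these two families.\<close>

lemma null_tens_lin:
  assumes "x \<in> null (tens V W)" "fv.subspace Z"
    and "\<And>x y. x \<in> null V \<Longrightarrow> y \<in> fspan (basis W) \<Longrightarrow> lin f (tensor x y) \<in> Z"
    and "\<And>x y. x \<in> fspan (basis V) \<Longrightarrow> y \<in> null W \<Longrightarrow> lin f (tensor x y) \<in> Z"
  shows "lin f x \<in> Z"
  by (rule span_lin_closed[OF assms(1)[unfolded tens_def pspace.simps] assms(2)])
    (use assms(3,4) in auto)

lemma null_tens_linf:
  fixes V :: "('b, 'k::field, 'y) pspace_scheme" and W :: "('c, 'k, 'z) pspace_scheme"
  assumes "x \<in> null (tens V W)"
    and "\<And>x y. x \<in> null V \<Longrightarrow> y \<in> fspan (basis W) \<Longrightarrow> linf f (tensor x y) = 0"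
    and "\<And>x y. x \<in> fspan (basis V) \<Longrightarrow> y \<in> null W \<Longrightarrow> linf f (tensor x y) = 0"
  shows "linf f x = 0"
proof -
  have "lin (\<lambda>b. Poly_Mapping.single () (f b)) x \<in> {0}"
  proof (rule null_tens_lin[OF assms(1)])
    fix x and y :: "'c \<Rightarrow>\<^sub>0 'k" assume "x \<in> null V" "y \<in> fspan (basis W)"
    from assms(2)[of x y, OF this] show "lin (\<lambda>b. Poly_Mapping.single () (f b)) (tensor x y) \<in> {0}"
      by (simp add: single_eq_scale_bvec lin_scale_fun_const)
  next
    fix x :: "'b \<Rightarrow>\<^sub>0 'k" and y assume "x \<in> fspan (basis V)" "y \<in> null W"
    from assms(3)[of x y, OF this] show "lin (\<lambda>b. Poly_Mapping.single () (f b)) (tensor x y) \<in> {0}"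
      by (simp add: single_eq_scale_bvec lin_scale_fun_const)
  qed auto
  thus ?thesis by (simp add: linf_eq_lookup)
qed

lemma lmap_lin_fspan: "lmap V W f \<Longrightarrow> x \<in> fspan (basis V) \<Longrightarrow> lin f x \<in> fspan (basis W)"
  by (auto intro!: lin_in_fspan simp: lmap_def)

lemma lmap_lin_null: "lmap V W f \<Longrightarrow> x \<in> null V \<Longrightarrow> lin f x \<in> null W"
  by (simp add: lmap_def)

lemma lmap_tmap:
  fixes V :: "('b, 'k::field, 'y) pspace_scheme" and W :: "('c, 'k, 'z) pspace_scheme"
  assumes "lmap V V' f" "lmap W W' g"
  shows "lmap (tens V W) (tens V' W') (tmap f g)"
  unfolding lmap_def
proof (intro conjI ballI)
  fix b assume "b \<in> basis (tens V W)"
  thus "tmap f g b \<in> fspan (basis (tens V' W'))"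
    using assms by (auto simp: tmap_apply lmap_def intro!: tensor_in_fspan)
next
  fix z assume z: "z \<in> null (tens V W)"
  show "lin (tmap f g) z \<in> null (tens V' W')"
  proof (rule null_tens_lin[OF z null_tens_subspace])
    fix x and y :: "'c \<Rightarrow>\<^sub>0 'k" assume "x \<in> null V" "y \<in> fspan (basis W)"
    thus "lin (tmap f g) (tensor x y) \<in> null (tens V' W')"
      using assms unfolding lin_tmap_tensor
      by (intro tensor_null_left) (auto intro: lmap_lin_fspan lmap_lin_null)
  next
    fix x :: "'b \<Rightarrow>\<^sub>0 'k" and y assume "x \<in> fspan (basis V)" "y \<in> null W"
    thus "lin (tmap f g) (tensor x y) \<in> null (tens V' W')"
      using assms unfolding lin_tmap_tensor
      by (intro tensor_null_right) (auto intro: lmap_lin_fspan lmap_lin_null)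
  qed
qed

section \<open>Bialgebras with two commuting actions\<close>

text \<open>
  The model is the matrix coalgebra of a crossed module: for \<open>t\<^sub>x\<^sup>y\<close>, the action \<open>la\<close> is the one on the
  lower index and \<open>ra\<close> the dual one on the upper index, and \<open>dl\<close>, \<open>dr\<close> are the inverse degrees of
  \<open>x\<close> and \<open>y\<close>. Everything holds on the nose on basis elements; only the null space of the extension
  to bialgebras below involves a quotient.
\<close>

locale crossed_coalgebra = group G for G (structure) +
  fixes B :: "'b set"
    and la ra :: "'a \<Rightarrow> 'b \<Rightarrow> ('b \<Rightarrow>\<^sub>0 'k::field)"
    and dl dr :: "'b \<Rightarrow> 'a"
    and cop :: "'b \<Rightarrow> ('b \<times> 'b \<Rightarrow>\<^sub>0 'k)"
    and eps :: "'b \<Rightarrow> 'k"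
  assumes fin: "finite (carrier G)"
    and dl_in [simp]: "a \<in> B \<Longrightarrow> dl a \<in> carrier G"
    and dr_in [simp]: "a \<in> B \<Longrightarrow> dr a \<in> carrier G"
    and la_deg: "h \<in> carrier G \<Longrightarrow> a \<in> B \<Longrightarrow>
      la h a \<in> fspan {b \<in> B. dl b = h \<otimes> dl a \<otimes> inv h \<and> dr b = dr a}"
    and ra_deg: "h \<in> carrier G \<Longrightarrow> a \<in> B \<Longrightarrow>
      ra h a \<in> fspan {b \<in> B. dl b = dl a \<and> dr b = h \<otimes> dr a \<otimes> inv h}"
    and la_one: "a \<in> B \<Longrightarrow> la \<one> a = bvec a"
    and ra_one: "a \<in> B \<Longrightarrow> ra \<one> a = bvec a"
    and la_mult: "g \<in> carrier G \<Longrightarrow> h \<in> carrier G \<Longrightarrow> a \<in> B \<Longrightarrow> lin (la g) (la h a) = la (g \<otimes> h) a"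
    and ra_mult: "g \<in> carrier G \<Longrightarrow> h \<in> carrier G \<Longrightarrow> a \<in> B \<Longrightarrow> lin (ra g) (ra h a) = ra (g \<otimes> h) a"
    and la_ra: "g \<in> carrier G \<Longrightarrow> h \<in> carrier G \<Longrightarrow> a \<in> B \<Longrightarrow>
      lin (la g) (ra h a) = lin (ra h) (la g a)"
    and cop_deg: "a \<in> B \<Longrightarrow> cop a \<in> fspan {(b, c). b \<in> B \<and> c \<in> B \<and> dl b = dl a \<and> dr b = dl c \<and> dr c = dr a}"
    and cop_la: "h \<in> carrier G \<Longrightarrow> a \<in> B \<Longrightarrow> lin cop (la h a) = lin (tmap (la h) bvec) (cop a)"
    and cop_ra: "h \<in> carrier G \<Longrightarrow> a \<in> B \<Longrightarrow> lin cop (ra h a) = lin (tmap bvec (ra h)) (cop a)"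
    and cop_inv: "h \<in> carrier G \<Longrightarrow> a \<in> B \<Longrightarrow> lin (tmap (ra h) (la h)) (cop a) = cop a"
    and coassoc: "a \<in> B \<Longrightarrow> lin (tmap cop bvec) (cop a) =
      lin (\<lambda>(x, (y, z)). bvec ((x, y), z)) (lin (tmap bvec cop) (cop a))"
    and counit_left: "a \<in> B \<Longrightarrow> lin (\<lambda>(x, y). scale (eps x) (bvec y)) (cop a) = bvec a"
    and counit_right: "a \<in> B \<Longrightarrow> lin (\<lambda>(x, y). scale (eps y) (bvec x)) (cop a) = bvec a"
    and eps_deg: "a \<in> B \<Longrightarrow> eps a \<noteq> 0 \<Longrightarrow> dl a = dr a"
    and eps_inv: "h \<in> carrier G \<Longrightarrow> a \<in> B \<Longrightarrow> linf eps (lin (ra h) (la h a)) = eps a"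
begin

lemma la_in [simp]: "h \<in> carrier G \<Longrightarrow> a \<in> B \<Longrightarrow> la h a \<in> fspan B"
  using la_deg[of h a] by (auto simp: fspan_def)

lemma ra_in [simp]: "h \<in> carrier G \<Longrightarrow> a \<in> B \<Longrightarrow> ra h a \<in> fspan B"
  using ra_deg[of h a] by (auto simp: fspan_def)

lemma lin_la_in [simp]: "h \<in> carrier G \<Longrightarrow> x \<in> fspan B \<Longrightarrow> lin (la h) x \<in> fspan B"
  by (rule lin_in_fspan) auto

lemma lin_ra_in [simp]: "h \<in> carrier G \<Longrightarrow> x \<in> fspan B \<Longrightarrow> lin (ra h) x \<in> fspan B"
  by (rule lin_in_fspan) auto

lemma cop_in [simp]: "a \<in> B \<Longrightarrow> cop a \<in> fspan (B \<times> B)"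
  using cop_deg[of a] by (auto simp: fspan_def)

lemma la_cong:
  assumes "h \<in> carrier G" "a \<in> B"
    and "\<And>b. b \<in> B \<Longrightarrow> dl b = h \<otimes> dl a \<otimes> inv h \<Longrightarrow> dr b = dr a \<Longrightarrow> f b = g b"
  shows "lin f (la h a) = lin g (la h a)"
  by (rule fspan_lin_cong[OF la_deg[OF assms(1,2)]]) (use assms(3) in auto)

lemma ra_cong:
  assumes "h \<in> carrier G" "a \<in> B"
    and "\<And>b. b \<in> B \<Longrightarrow> dl b = dl a \<Longrightarrow> dr b = h \<otimes> dr a \<otimes> inv h \<Longrightarrow> f b = g b"
  shows "lin f (ra h a) = lin g (ra h a)"
  by (rule fspan_lin_cong[OF ra_deg[OF assms(1,2)]]) (use assms(3) in auto)

lemma cop_cong: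
  assumes "a \<in> B"
    and "\<And>b c. b \<in> B \<Longrightarrow> c \<in> B \<Longrightarrow> dl b = dl a \<Longrightarrow> dr b = dl c \<Longrightarrow> dr c = dr a \<Longrightarrow> f b c = g b c"
  shows "lin (\<lambda>(b, c). f b c) (cop a) = lin (\<lambda>(b, c). g b c) (cop a)"
  by (rule fspan_lin_cong[OF cop_deg[OF assms(1)]]) (use assms(2) in auto)

lemma cop_congf:
  assumes "a \<in> B"
    and "\<And>b c. b \<in> B \<Longrightarrow> c \<in> B \<Longrightarrow> dl b = dl a \<Longrightarrow> dr b = dl c \<Longrightarrow> dr c = dr a \<Longrightarrow> f b c = g b c"
  shows "linf (\<lambda>(b, c). f b c) (cop a) = linf (\<lambda>(b, c). g b c) (cop a)"
  by (rule fspan_linf_cong[OF cop_deg[OF assms(1)]]) (use assms(2) in auto)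

lemma ra_mult': "g \<in> carrier G \<Longrightarrow> h \<in> carrier G \<Longrightarrow> x \<in> fspan B \<Longrightarrow>
    lin (ra g) (lin (ra h) x) = lin (ra (g \<otimes> h)) x"
  unfolding lin_lin by (rule fspan_lin_cong) (auto simp: ra_mult)

lemma la_ra': "g \<in> carrier G \<Longrightarrow> h \<in> carrier G \<Longrightarrow> x \<in> fspan B \<Longrightarrow>
    lin (la g) (lin (ra h) x) = lin (ra h) (lin (la g) x)"
  unfolding lin_lin by (rule fspan_lin_cong) (auto simp: la_ra lin_lin)

text \<open>\<open>eps_inv\<close> applied to \<open>la (inv h) a\<close> cancels the left action.
  Under the counit the right action is thus expressed by the left one, which is why the coefficients
  below involve \<open>la\<close> alone.\<close>

lemma eps_ra: "h \<in> carrier G \<Longrightarrow> a \<in> B \<Longrightarrow> linf eps (ra h a) = linf eps (la (inv h) a)"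
proof -
  assume h: "h \<in> carrier G" and a: "a \<in> B"
  have "linf eps (la (inv h) a) = linf (\<lambda>b. linf eps (lin (ra h) (la h b))) (la (inv h) a)"
    by (rule fspan_linf_cong[of _ B]) (use h a in \<open>auto simp: eps_inv\<close>)
  also have "\<dots> = linf eps (lin (ra h) (lin (la h) (la (inv h) a)))"
    by (simp add: linf_lin lin_lin)
  also have "\<dots> = linf eps (ra h a)"
    using h a by (simp add: la_mult la_one)
  finally show ?thesis by simp
qed

text \<open>\<open>la h\<close> conjugates the left degree and keeps the right one, and the counit
  sees only elements whose two degrees agree.\<close>

lemma eps_la_deg:
  assumes "h \<in> carrier G" "a \<in> B" "linf eps (la h a) \<noteq> 0"
  shows "h \<otimes> dl a \<otimes> inv h = dr a"
proof (rule ccontr)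
  assume *: "h \<otimes> dl a \<otimes> inv h \<noteq> dr a"
  have "linf eps (la h a) = linf (\<lambda>_. 0) (la h a)"
    by (rule fspan_linf_cong[OF la_deg[OF assms(1,2)]]) (use * eps_deg in force)
  thus False using assms(3) by simp
qed

text \<open>In Sweedler notation: \<open>\<epsilon>(\<lambda>\<^sub>g a\<^sub>1) a\<^sub>2 = \<lambda>\<^sub>g a\<close> and \<open>a\<^sub>1 \<epsilon>(\<lambda>\<^sub>g a\<^sub>2) = \<rho>\<^sub>g\<^sup>-\<^sup>1 a\<close>.\<close>

lemma contract_left:
  assumes "g \<in> carrier G" "a \<in> B"
  shows "lin (\<lambda>(b, c). scale (linf eps (la g b)) (f c)) (cop a) = lin f (la g a)"
proof -
  have "la g a = lin (\<lambda>b. lin (\<lambda>(x, y). scale (eps x) (bvec y)) (cop b)) (la g a)"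
    using fspan_lin_cong[of "la g a" B "\<lambda>b. lin (\<lambda>(x, y). scale (eps x) (bvec y)) (cop b)" bvec] assms
    by (simp add: counit_left)
  also have "\<dots> = lin (\<lambda>(x, y). scale (eps x) (bvec y)) (lin cop (la g a))"
    by (simp add: lin_lin)
  also have "\<dots> = lin (\<lambda>(x, y). scale (linf eps (la g x)) (bvec y)) (cop a)"
    using assms
    by (simp add: cop_la lin_lin tmap_def lin_tensor lin_scale_fun_const case_prod_unfold)
  finally have "lin f (la g a) = lin f (lin (\<lambda>(x, y). scale (linf eps (la g x)) (bvec y)) (cop a))"
    by simp
  thus ?thesis by (simp add: lin_lin case_prod_unfold lin_scale)
qed

lemma contract_right:
  assumes "g \<in> carrier G" "a \<in> B"
  shows "lin (\<lambda>(b, c). scale (linf eps (la g c)) (f b)) (cop a) = lin f (ra (inv g) a)"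
proof -
  let ?g = "inv g"
  have "ra ?g a = lin (\<lambda>b. lin (\<lambda>(x, y). scale (eps y) (bvec x)) (cop b)) (ra ?g a)"
    using fspan_lin_cong[of "ra ?g a" B "\<lambda>b. lin (\<lambda>(x, y). scale (eps y) (bvec x)) (cop b)" bvec] assms
    by (simp add: counit_right)
  also have "\<dots> = lin (\<lambda>(x, y). scale (eps y) (bvec x)) (lin cop (ra ?g a))"
    by (simp add: lin_lin)
  also have "\<dots> = lin (\<lambda>(x, y). scale (linf eps (ra ?g y)) (bvec x)) (cop a)"
    using assms
    by (simp add: cop_ra lin_lin tmap_def lin_tensor lin_scale_fun_const case_prod_unfold)
  \<comment> \<open>\<open>cop_ra\<close> produced the counit of a right action;
    \<open>eps_ra\<close> trades it for \<open>la g\<close>.\<close>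
  also have "\<dots> = lin (\<lambda>(x, y). scale (linf eps (la g y)) (bvec x)) (cop a)"
    using assms by (intro cop_cong) (auto simp: eps_ra)
  finally have "lin f (ra ?g a) = lin f (lin (\<lambda>(x, y). scale (linf eps (la g y)) (bvec x)) (cop a))"
    by simp
  thus ?thesis by (simp add: lin_lin case_prod_unfold lin_scale)
qed

lemma contract_left_counit:
  assumes "a \<in> B"
  shows "lin (\<lambda>(b, c). scale (eps b) (f c)) (cop a) = f a"
proof -
  have "lin (\<lambda>(b, c). scale (eps b) (f c)) (cop a) = lin (\<lambda>(b, c). scale (linf eps (la \<one> b)) (f c)) (cop a)"
    by (rule cop_cong) (use assms in \<open>auto simp: la_one\<close>)
  thus ?thesis using assms by (simp add: contract_left la_one)
qed

lemma contract_right_counit: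
  assumes "a \<in> B"
  shows "lin (\<lambda>(b, c). scale (eps c) (f b)) (cop a) = f a"
proof -
  have "lin (\<lambda>(b, c). scale (eps c) (f b)) (cop a) = lin (\<lambda>(b, c). scale (linf eps (la \<one> c)) (f b)) (cop a)"
    by (rule cop_cong) (use assms in \<open>auto simp: la_one\<close>)
  thus ?thesis using assms by (simp add: contract_right ra_one)
qed

lemma contract_counitf:
  assumes "a \<in> B"
  shows "linf (\<lambda>(b, c). eps b * f c) (cop a) = f a"
  using arg_cong[OF contract_left_counit[OF assms, of "\<lambda>c. Poly_Mapping.single () (f c)"], of "\<lambda>x. Poly_Mapping.lookup x ()"]
  by (simp add: linf_eq_lookup case_prod_unfold single_eq_scale_bvec lookup_scale lookup_bvec)

lemma contract_leftf:
  assumes "g \<in> carrier G" "a \<in> B"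
  shows "linf (\<lambda>(b, c). linf eps (la g b) * f c) (cop a) = linf f (la g a)"
  using arg_cong[OF contract_left[OF assms, of "\<lambda>c. Poly_Mapping.single () (f c)"], of "\<lambda>x. Poly_Mapping.lookup x ()"]
  by (simp add: linf_eq_lookup case_prod_unfold single_eq_scale_bvec lookup_scale lookup_bvec)

text \<open>The first counit moves \<open>la g\<close> onto the second leg, where
  \<open>la h\<close> acts afterwards; hence the order \<open>h \<otimes> g\<close>. This
  composition rule makes \<open>toD\<close> comultiplicative and \<open>canon_R\<close>
  invertible.\<close>

lemma eps_la_la:
  assumes "g \<in> carrier G" "h \<in> carrier G" "a \<in> B"
  shows "linf (\<lambda>(b, c). linf eps (la g b) * linf eps (la h c)) (cop a) = linf eps (la (h \<otimes> g) a)"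
  using assms by (simp add: contract_leftf flip: linf_lin la_mult)

end

text \<open>The double and the words in the generators both satisfy the algebra laws strictly on
  basis elements. Relations enter only through \<open>null V\<close>, which must be stable under all
  operations and homogeneous for both degrees.\<close>

locale crossed_bialgebra =
  crossed_coalgebra G "basis V" la ra dl dr "bcop H" "beps H"
  for G (structure) and V :: "('b, 'k::field) pspace" and H :: "('b, 'k) bialg"
    and la ra :: "'a \<Rightarrow> 'b \<Rightarrow> ('b \<Rightarrow>\<^sub>0 'k)" and dl dr :: "'b \<Rightarrow> 'a" +
  assumes null_ok: "pspace_ok V"
    and null_la: "h \<in> carrier G \<Longrightarrow> x \<in> null V \<Longrightarrow> lin (la h) x \<in> null V"
    and null_ra: "h \<in> carrier G \<Longrightarrow> x \<in> null V \<Longrightarrow> lin (ra h) x \<in> null V"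
    and null_deg: "u \<in> carrier G \<Longrightarrow> v \<in> carrier G \<Longrightarrow> x \<in> null V \<Longrightarrow>
      lin (\<lambda>b. if dl b = u \<and> dr b = v then bvec b else 0) x \<in> null V"
    and null_mul_right: "x \<in> null V \<Longrightarrow> b \<in> basis V \<Longrightarrow> lin (\<lambda>a. bmul H (a, b)) x \<in> null V"
    and null_mul_left: "x \<in> null V \<Longrightarrow> b \<in> basis V \<Longrightarrow> lin (\<lambda>a. bmul H (b, a)) x \<in> null V"
    and null_cop: "x \<in> null V \<Longrightarrow> lin (bcop H) x \<in> null (tens V V)"
    and null_eps: "x \<in> null V \<Longrightarrow> linf (beps H) x = 0"
    and mul_deg: "a \<in> basis V \<Longrightarrow> b \<in> basis V \<Longrightarrow>
      bmul H (a, b) \<in> fspan {c \<in> basis V. dl c = dl a \<otimes> dl b \<and> dr c = dr a \<otimes> dr b}"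
    and one_deg: "bone H \<in> fspan {c \<in> basis V. dl c = \<one> \<and> dr c = \<one>}"
    and la_mul: "h \<in> carrier G \<Longrightarrow> a \<in> basis V \<Longrightarrow> b \<in> basis V \<Longrightarrow>
      lin (la h) (bmul H (a, b)) = lin (bmul H) (tensor (la h a) (la h b))"
    and ra_mul: "h \<in> carrier G \<Longrightarrow> a \<in> basis V \<Longrightarrow> b \<in> basis V \<Longrightarrow>
      lin (ra h) (bmul H (a, b)) = lin (bmul H) (tensor (ra h a) (ra h b))"
    and la_unit: "h \<in> carrier G \<Longrightarrow> lin (la h) (bone H) = bone H"
    and ra_unit: "h \<in> carrier G \<Longrightarrow> lin (ra h) (bone H) = bone H"
    and mul_assoc: "a \<in> basis V \<Longrightarrow> b \<in> basis V \<Longrightarrow> c \<in> basis V \<Longrightarrow>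
      lin (bmul H) (tensor (bmul H (a, b)) (bvec c)) = lin (bmul H) (tensor (bvec a) (bmul H (b, c)))"
    and mul_one_left: "a \<in> basis V \<Longrightarrow> lin (bmul H) (tensor (bone H) (bvec a)) = bvec a"
    and mul_one_right: "a \<in> basis V \<Longrightarrow> lin (bmul H) (tensor (bvec a) (bone H)) = bvec a"
    and cop_mul: "a \<in> basis V \<Longrightarrow> b \<in> basis V \<Longrightarrow> lin (bcop H) (bmul H (a, b)) =
      lin (\<lambda>(a1, a2). lin (\<lambda>(b1, b2). tensor (bmul H (a1, b1)) (bmul H (a2, b2))) (bcop H b)) (bcop H a)"
    and cop_one: "lin (bcop H) (bone H) = tensor (bone H) (bone H)"
    and eps_mul: "a \<in> basis V \<Longrightarrow> b \<in> basis V \<Longrightarrow> linf (beps H) (bmul H (a, b)) = beps H a * beps H b"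
    and eps_one: "linf (beps H) (bone H) = 1"
begin

lemma null_subspace [simp]: "fv.subspace (null V)"
  using null_ok by (simp add: pspace_ok_def)

lemma null_in: "x \<in> null V \<Longrightarrow> x \<in> fspan (basis V)"
  using null_ok by (auto simp: pspace_ok_def)

lemma zero_null [simp]: "0 \<in> null V"
  by (rule fv.subspace_0) simp

lemma eqv_refl [simp]: "eqv V x x"
  by (simp add: eqv_def)

lemma eqv_tens_refl [simp]: "eqv (tens V' W') x x"
  by (simp add: eqv_def fv.subspace_0)

lemma mul_in [simp]: "a \<in> basis V \<Longrightarrow> b \<in> basis V \<Longrightarrow> bmul H (a, b) \<in> fspan (basis V)"
  using mul_deg[of a b] by (auto simp: fspan_def)

lemma one_in [simp]: "bone H \<in> fspan (basis V)"
  using one_deg by (auto simp: fspan_def)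

lemma coalgebra_on_V: "coalgebra_on V H"
  unfolding coalgebra_on_def
proof (intro conjI ballI)
  show "lmap V (tens V V) (bcop H)"
    by (auto simp: lmap_def null_cop)
  show "lmap V kspace (\<lambda>b. Poly_Mapping.single () (beps H b))"
    by (auto simp: lmap_def kspace_def fspan_def single_eq_scale_bvec lin_scale_fun_const null_eps)
qed (auto simp: coassoc counit_left counit_right)

lemma algebra_on_V: "algebra_on V H"
  unfolding algebra_on_def
proof (intro conjI ballI)
  show "lmap (tens V V) V (bmul H)"
    unfolding lmap_def
  proof (intro conjI ballI)
    fix z assume "z \<in> null (tens V V)"
    thus "lin (bmul H) z \<in> null V"
    proof (rule null_tens_lin)
      fix x and y :: "'b \<Rightarrow>\<^sub>0 'k" assume x: "x \<in> null V" and y: "y \<in> fspan (basis V)"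
      have "lin (bmul H) (tensor x y) = lin (\<lambda>b. lin (\<lambda>a. bmul H (a, b)) x) y"
        unfolding lin_tensor by (rule lin_swap)
      thus "lin (bmul H) (tensor x y) \<in> null V"
        using x y by (auto intro!: lin_in_subspace null_mul_right dest: keysD)
    next
      fix x :: "'b \<Rightarrow>\<^sub>0 'k" and y assume x: "x \<in> fspan (basis V)" and y: "y \<in> null V"
      thus "lin (bmul H) (tensor x y) \<in> null V"
        unfolding lin_tensor
        using x y by (auto intro!: lin_in_subspace null_mul_left dest: keysD)
    qed simp
  qed auto
qed (auto simp: mul_assoc mul_one_left mul_one_right)

lemma bialgebra_wrt_flip: "bialgebra_wrt flip V H"
  unfolding bialgebra_wrt_def
proof (intro conjI ballI)
  fix a b assume ab: "a \<in> basis V" "b \<in> basis V"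
  have "lin (tens_mul flip (bmul H)) (tensor (bcop H a) (bcop H b)) = lin (bcop H) (bmul H (a, b))"
    using ab by (simp add: cop_mul tens_mul_def flip_def lin_tensor case_prod_unfold)
  thus "eqv (tens V V) (lin (bcop H) (bmul H (a, b)))
          (lin (tens_mul flip (bmul H)) (tensor (bcop H a) (bcop H b)))"
    by simp
qed (auto simp: null_ok algebra_on_V coalgebra_on_V cop_one eps_one eps_mul)

text \<open>By \<open>null_deg\<close> the components of fixed bidegree of a null vector are null,
  and there are finitely many because \<open>G\<close> is finite. It suffices to treat one
  component, on which every degree-dependent coefficient is constant.\<close>

lemma null_deg_subspace:
  assumes "fv.subspace W" "x \<in> null V"
    and "\<And>x u v. x \<in> null V \<Longrightarrow> x \<in> fspan {b \<in> basis V. dl b = u \<and> dr b = v} \<Longrightarrow>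
       u \<in> carrier G \<Longrightarrow> v \<in> carrier G \<Longrightarrow> lin f x \<in> W"
  shows "lin f x \<in> W"
proof -
  let ?p = "\<lambda>u v. lin (\<lambda>b. if dl b = u \<and> dr b = v then bvec b else 0) x"
  \<comment> \<open>Exactly one pair \<open>(u, v)\<close> contributes to each basis
    element.\<close>
  have "x = lin (\<lambda>b. \<Sum>u\<in>carrier G. \<Sum>v\<in>carrier G. if dl b = u \<and> dr b = v then bvec b else 0) x"
  proof -
    have "lin (\<lambda>b. \<Sum>u\<in>carrier G. \<Sum>v\<in>carrier G. if dl b = u \<and> dr b = v then bvec b else 0) x = lin bvec x"
    proof (rule fspan_lin_cong[OF null_in[OF assms(2)]])
      fix b assume b: "b \<in> basis V"
      have "(\<Sum>u\<in>carrier G. \<Sum>v\<in>carrier G. if dl b = u \<and> dr b = v then bvec b else 0)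
         = (\<Sum>u\<in>carrier G. if dl b = u then (\<Sum>v\<in>carrier G. if dr b = v then bvec b else 0) else (0 :: 'b \<Rightarrow>\<^sub>0 'k))"
        by (intro sum.cong) auto
      thus "(\<Sum>u\<in>carrier G. \<Sum>v\<in>carrier G. if dl b = u \<and> dr b = v then bvec b else 0) = (bvec b :: 'b \<Rightarrow>\<^sub>0 'k)"
        using b fin by (simp add: sum.delta')
    qed
    thus ?thesis by simp
  qed
  hence "x = (\<Sum>u\<in>carrier G. \<Sum>v\<in>carrier G. ?p u v)"
    unfolding lin_fun_sum .
  from arg_cong[OF this, of "lin f"]
  have "lin f x = (\<Sum>u\<in>carrier G. \<Sum>v\<in>carrier G. lin f (?p u v))"
    unfolding lin_sum .
  moreover have "lin f (?p u v) \<in> W" if "u \<in> carrier G" "v \<in> carrier G" for u v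
  proof (rule assms(3)[of _ u v])
    show "?p u v \<in> null V" using that assms(2) by (rule null_deg)
    show "?p u v \<in> fspan {b \<in> basis V. dl b = u \<and> dr b = v}"
      by (rule lin_in_fspan[OF null_in[OF assms(2)]]) auto
  qed (use that in auto)
  ultimately show ?thesis
    using assms(1) by (auto intro!: fv.subspace_sum)
qed

lemma null_deg_linf:
  assumes "x \<in> null V"
    and "\<And>x u v. x \<in> null V \<Longrightarrow> x \<in> fspan {b \<in> basis V. dl b = u \<and> dr b = v} \<Longrightarrow>
       u \<in> carrier G \<Longrightarrow> v \<in> carrier G \<Longrightarrow> linf f x = 0"
  shows "linf f x = 0"
proof -
  have "lin (\<lambda>b. scale (f b) (bvec ())) x \<in> {0}"
    by (rule null_deg_subspace[OF _ assms(1)]) (use assms(2) in \<open>auto simp: lin_scale_fun_const\<close>)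
  hence "Poly_Mapping.lookup (lin (\<lambda>b. scale (f b) (bvec ())) x) () = 0" by auto
  thus ?thesis by (simp add: linf_eq_lookup single_eq_scale_bvec)
qed

end

section \<open>Coquasitriangularity\<close>

context crossed_bialgebra
begin

definition canon_R :: "'b \<times> 'b \<Rightarrow> 'k" where
  "canon_R = (\<lambda>(a, b). beps H a * linf (beps H) (la (inv (dl a)) b))"

text \<open>The convolution inverse of \<open>canon_R\<close>: the translation by
  \<open>inv (dl a)\<close> is undone.\<close>

definition canon_R_inv :: "'b \<times> 'b \<Rightarrow> 'k" where
  "canon_R_inv = (\<lambda>(a, b). beps H a * linf (beps H) (la (dl a) b))"

text \<open>The map \<open>\<sigma>\<close> is inversion for \<open>canon_R\<close> and the identity
  for its inverse. A null first factor may be taken homogeneous, which makes the group element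
  constant; a null second factor is handled by the invariance of \<open>null V\<close> under
  \<open>la\<close>.\<close>

lemma canon_R_null_tens:
  assumes z: "z \<in> null (tens V V)"
    and S: "\<And>a b. a \<in> basis V \<Longrightarrow> b \<in> basis V \<Longrightarrow> R (a, b) = beps H a * linf (beps H) (la (\<sigma> (dl a)) b)"
    and \<sigma>: "\<And>g. g \<in> carrier G \<Longrightarrow> \<sigma> g \<in> carrier G"
  shows "linf R z = 0"
  using z
proof (rule null_tens_linf)
  fix x and y :: "'b \<Rightarrow>\<^sub>0 'k" assume x: "x \<in> null V" and y: "y \<in> fspan (basis V)"
  have "linf (\<lambda>a. linf (\<lambda>b. R (a, b)) y) x = 0"
  proof (rule null_deg_linf[OF x])
    fix x u v assume x: "x \<in> null V" "x \<in> fspan {b \<in> basis V. dl b = u \<and> dr b = v}"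
    have "linf (\<lambda>a. linf (\<lambda>b. R (a, b)) y) x
      = linf (\<lambda>a. beps H a * linf (\<lambda>b. linf (beps H) (la (\<sigma> u) b)) y) x"
      by (rule fspan_linf_cong[OF x(2)], subst linf_fun_mult_left[symmetric],
          rule fspan_linf_cong[OF y]) (auto simp: S)
    also have "\<dots> = 0" by (simp add: linf_fun_mult_right null_eps x)
    finally show "linf (\<lambda>a. linf (\<lambda>b. R (a, b)) y) x = 0" .
  qed
  thus "linf R (tensor x y) = 0" by (simp add: linf_tensor)
next
  fix x :: "'b \<Rightarrow>\<^sub>0 'k" and y assume x: "x \<in> fspan (basis V)" and y: "y \<in> null V"
  have "linf R (tensor x y) = linf (\<lambda>a. 0) x"
    unfolding linf_tensor
  proof (rule fspan_linf_cong[OF x])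
    fix a assume a: "a \<in> basis V"
    have "linf (\<lambda>b. R (a, b)) y = linf (\<lambda>b. beps H a * linf (beps H) (la (\<sigma> (dl a)) b)) y"
      by (rule fspan_linf_cong[OF null_in[OF y]]) (use a in \<open>auto simp: S\<close>)
    also have "\<dots> = beps H a * linf (beps H) (lin (la (\<sigma> (dl a))) y)"
      by (simp add: linf_fun_mult_left linf_lin)
    also have "\<dots> = 0" using a y by (simp add: null_eps null_la \<sigma>)
    finally show "linf (\<lambda>b. R (a, b)) y = 0" .
  qed
  thus "linf R (tensor x y) = 0" by simp
qed

text \<open>The factor \<open>beps H a1\<close> vanishes unless
  \<open>dl a1 = dr a1 = dl a2\<close>. Both forms then act by elements computed from the same
  degree, and \<open>eps_la_la\<close> multiplies these to \<open>\<one>\<close>.\<close>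

lemma canon_R_convolution:
  assumes ab: "a \<in> basis V" "b \<in> basis V"
    and R: "\<And>a b. a \<in> basis V \<Longrightarrow> b \<in> basis V \<Longrightarrow> R (a, b) = beps H a * linf (beps H) (la (\<sigma> (dl a)) b)"
    and R': "\<And>a b. a \<in> basis V \<Longrightarrow> b \<in> basis V \<Longrightarrow> R' (a, b) = beps H a * linf (beps H) (la (\<tau> (dl a)) b)"
    and \<sigma>: "\<And>g. g \<in> carrier G \<Longrightarrow> \<sigma> g \<in> carrier G \<and> \<tau> g \<in> carrier G \<and> \<tau> g \<otimes> \<sigma> g = \<one>"
  shows "linf (\<lambda>((a1, a2), (b1, b2)). R (a1, b1) * R' (a2, b2)) (tensor (bcop H a) (bcop H b))
    = beps H a * beps H b"
proof -
  have "linf (\<lambda>((a1, a2), (b1, b2)). R (a1, b1) * R' (a2, b2)) (tensor (bcop H a) (bcop H b))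
    = linf (\<lambda>(a1, a2). linf (\<lambda>(b1, b2). R (a1, b1) * R' (a2, b2)) (bcop H b)) (bcop H a)"
    by (simp add: linf_tensor case_prod_unfold)
  also have "\<dots> = linf (\<lambda>(a1, a2). beps H a1 * (beps H a2 * beps H b)) (bcop H a)"
  proof (rule cop_congf[OF ab(1)])
    fix a1 a2 assume a: "a1 \<in> basis V" "a2 \<in> basis V" "dr a1 = dl a2"
    show "linf (\<lambda>(b1, b2). R (a1, b1) * R' (a2, b2)) (bcop H b) = beps H a1 * (beps H a2 * beps H b)"
    proof (cases "beps H a1 = 0")
      case True
      have "linf (\<lambda>(b1, b2). R (a1, b1) * R' (a2, b2)) (bcop H b) = linf (\<lambda>(b1, b2). 0) (bcop H b)"
        by (rule cop_congf[OF ab(2)]) (use a True in \<open>simp add: R\<close>)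
      thus ?thesis using True by (simp add: case_prod_unfold)
    next
      case False
      hence d: "dl a2 = dl a1" using eps_deg a by simp
      let ?h = "dl a1"
      have h: "\<sigma> ?h \<in> carrier G" "\<tau> ?h \<in> carrier G" "\<tau> ?h \<otimes> \<sigma> ?h = \<one>"
        using a \<sigma> by auto
      have "linf (\<lambda>(b1, b2). R (a1, b1) * R' (a2, b2)) (bcop H b)
        = linf (\<lambda>(b1, b2). (beps H a1 * beps H a2) *
            (linf (beps H) (la (\<sigma> ?h) b1) * linf (beps H) (la (\<tau> ?h) b2))) (bcop H b)"
        by (rule cop_congf[OF ab(2)]) (use a d in \<open>simp add: R R'\<close>)
      also have "\<dots> = (beps H a1 * beps H a2) *
         linf (\<lambda>(b1, b2). linf (beps H) (la (\<sigma> ?h) b1) * linf (beps H) (la (\<tau> ?h) b2)) (bcop H b)"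
        by (simp add: case_prod_unfold linf_fun_mult_left)
      also have "\<dots> = (beps H a1 * beps H a2) * beps H b"
        using ab h by (simp add: eps_la_la la_one)
      finally show ?thesis by simp
    qed
  qed
  also have "\<dots> = beps H a * beps H b"
    using ab by (rule_tac contract_counitf)
  finally show ?thesis .
qed

lemma eps_la_mul:
  assumes "h \<in> carrier G" "a \<in> basis V" "b \<in> basis V"
  shows "linf (beps H) (lin (la h) (bmul H (a, b))) = linf (beps H) (la h a) * linf (beps H) (la h b)"
proof -
  have "linf (beps H) (lin (la h) (bmul H (a, b)))
    = linf (\<lambda>a'. linf (\<lambda>b'. beps H a' * beps H b') (la h b)) (la h a)"
    unfolding la_mul[OF assms] lin_tensor linf_lin
    by (intro fspan_linf_cong[OF la_in] assms) (auto simp: eps_mul)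
  thus ?thesis by (simp add: linf_fun_mult_left linf_fun_mult_right)
qed

end

text \<open>\<open>comm\<close> is quasi-commutativity with respect to \<open>canon_R\<close> after
  the counits have been contracted. Unlike the algebra laws it is imposed modulo
  \<open>null V\<close>, because for \<open>A(R)\<close> it is the defining relation.\<close>

locale crossed_coquasi = crossed_bialgebra +
  assumes comm: "a \<in> basis V \<Longrightarrow> b \<in> basis V \<Longrightarrow>
    lin (\<lambda>c. bmul H (a, c)) (la (inv (dl a)) b) - lin (\<lambda>c. bmul H (c, a)) (ra (dr a) b) \<in> null V"
begin

lemma coquasitriangular_canon_R:
  assumes R: "\<And>a b. a \<in> basis V \<Longrightarrow> b \<in> basis V \<Longrightarrow> R (a, b) = canon_R (a, b)"
  shows "coquasitriangular_bialgebra V H R"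
  unfolding coquasitriangular_bialgebra_def
proof (intro conjI ballI exI[of _ canon_R_inv])
  show "bialgebra_wrt flip V H" by (rule bialgebra_wrt_flip)
  show "linf R z = 0" if "z \<in> null (tens V V)" for z
    by (rule canon_R_null_tens[OF that, where \<sigma> = "\<lambda>g. inv g"]) (auto simp: R canon_R_def)
  show "linf canon_R_inv z = 0" if "z \<in> null (tens V V)" for z
    by (rule canon_R_null_tens[OF that, where \<sigma> = "\<lambda>g. g"]) (auto simp: canon_R_inv_def)
next
  fix a b assume ab: "a \<in> basis V" "b \<in> basis V"
  show "linf (\<lambda>((a1, a2), (b1, b2)). R (a1, b1) * canon_R_inv (a2, b2)) (tensor (bcop H a) (bcop H b))
    = beps H a * beps H b"
    by (rule canon_R_convolution[OF ab, where \<sigma> = "\<lambda>g. inv g" and \<tau> = "\<lambda>g. g"])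
      (auto simp: R canon_R_def canon_R_inv_def)
  show "linf (\<lambda>((a1, a2), (b1, b2)). canon_R_inv (a1, b1) * R (a2, b2)) (tensor (bcop H a) (bcop H b))
    = beps H a * beps H b"
    by (rule canon_R_convolution[OF ab, where \<sigma> = "\<lambda>g. g" and \<tau> = "\<lambda>g. inv g"])
      (auto simp: R canon_R_def canon_R_inv_def)
next
  fix a b c assume abc: "a \<in> basis V" "b \<in> basis V" "c \<in> basis V"
  have "linf R (tensor (bmul H (a, b)) (bvec c)) = linf (\<lambda>d. R (d, c)) (bmul H (a, b))"
    by (simp add: linf_tensor)
  also have "\<dots> = linf (\<lambda>d. beps H d * linf (beps H) (la (inv (dl a \<otimes> dl b)) c)) (bmul H (a, b))"
    by (rule fspan_linf_cong[OF mul_deg[OF abc(1,2)]]) (use abc in \<open>auto simp: R canon_R_def\<close>)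
  \<comment> \<open>Left degrees multiply, so their inverses appear in reversed order, exactly the
    order in which \<open>eps_la_la\<close> splits the counit over the coproduct of
    \<open>c\<close>.\<close>
  also have "\<dots> = beps H a * beps H b * linf (beps H) (la (inv (dl b) \<otimes> inv (dl a)) c)"
    using abc by (simp add: linf_fun_mult_right eps_mul inv_mult_group)
  also have "\<dots> = beps H a * beps H b *
      linf (\<lambda>(c1, c2). linf (beps H) (la (inv (dl a)) c1) * linf (beps H) (la (inv (dl b)) c2)) (bcop H c)"
    using abc by (simp add: eps_la_la)
  also have "\<dots> = linf (\<lambda>(c1, c2). R (a, c1) * R (b, c2)) (bcop H c)"
    unfolding linf_fun_mult_left[where x = "bcop H c", symmetric] case_prod_unfold
    by (rule fspan_linf_cong[OF cop_in[OF abc(3)]]) (use abc in \<open>auto simp: R canon_R_def\<close>)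
  finally show "linf R (tensor (bmul H (a, b)) (bvec c)) =
      linf (\<lambda>(c1, c2). R (a, c1) * R (b, c2)) (bcop H c)" .
  have "linf R (tensor (bvec a) (bmul H (b, c))) = linf (\<lambda>d. R (a, d)) (bmul H (b, c))"
    by (simp add: linf_tensor)
  also have "\<dots> = linf (\<lambda>d. beps H a * linf (beps H) (la (inv (dl a)) d)) (bmul H (b, c))"
    by (rule fspan_linf_cong[OF mul_in[OF abc(2,3)]]) (use abc in \<open>auto simp: R canon_R_def\<close>)
  also have "\<dots> = beps H a * (linf (beps H) (la (inv (dl a)) b) * linf (beps H) (la (inv (dl a)) c))"
    using abc by (simp add: linf_fun_mult_left eps_la_mul flip: linf_lin)
  also have "\<dots> = linf (\<lambda>(a1, a2). beps H a1 * (beps H a2 *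
      (linf (beps H) (la (inv (dl a2)) b) * linf (beps H) (la (inv (dl a2)) c)))) (bcop H a)"
    using abc by (simp add: contract_counitf)
  also have "\<dots> = linf (\<lambda>(a1, a2). R (a1, c) * R (a2, b)) (bcop H a)"
  proof (rule cop_congf[OF abc(1)])
    fix a1 a2 assume "a1 \<in> basis V" "a2 \<in> basis V" "dr a1 = dl a2"
    thus "beps H a1 * (beps H a2 *
      (linf (beps H) (la (inv (dl a2)) b) * linf (beps H) (la (inv (dl a2)) c))) = R (a1, c) * R (a2, b)"
      \<comment> \<open>A nonzero counit of \<open>a1\<close> forces
        \<open>dl a1 = dr a1 = dl a2\<close>, so both factors use the same group element.\<close>
      using eps_deg[of a1] abc by (cases "beps H a1 = 0") (auto simp: R canon_R_def)
  qed
  finally show "linf R (tensor (bvec a) (bmul H (b, c))) =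
      linf (\<lambda>(a1, a2). R (a1, c) * R (a2, b)) (bcop H a)" .
next
  fix a b assume ab: "a \<in> basis V" "b \<in> basis V"
  have "lin (\<lambda>((a1, a2), (b1, b2)). scale (R (a2, b2)) (bmul H (b1, a1))) (tensor (bcop H a) (bcop H b))
    = lin (\<lambda>(a1, a2). lin (\<lambda>(b1, b2). scale (R (a2, b2)) (bmul H (b1, a1))) (bcop H b)) (bcop H a)"
    by (simp add: lin_tensor case_prod_unfold)
  \<comment> \<open>Since \<open>dl a2 = dr a1\<close>, contracting the second leg of
    \<open>b\<close> against \<open>la (inv (dr a1))\<close> leaves \<open>ra (dr a1)\<close> on
    \<open>b\<close>.\<close>
  also have "\<dots> = lin (\<lambda>(a1, a2). scale (beps H a2) (lin (\<lambda>c. bmul H (c, a1)) (ra (dr a1) b))) (bcop H a)"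
  proof (rule cop_cong[OF ab(1)])
    fix a1 a2 assume a: "a1 \<in> basis V" "a2 \<in> basis V" "dr a1 = dl a2"
    have "lin (\<lambda>(b1, b2). scale (R (a2, b2)) (bmul H (b1, a1))) (bcop H b)
      = lin (\<lambda>(b1, b2). scale (beps H a2) (scale (linf (beps H) (la (inv (dr a1)) b2)) (bmul H (b1, a1)))) (bcop H b)"
      by (rule cop_cong[OF ab(2)]) (use a in \<open>auto simp: R canon_R_def\<close>)
    also have "\<dots> = scale (beps H a2)
        (lin (\<lambda>(b1, b2). scale (linf (beps H) (la (inv (dr a1)) b2)) (bmul H (b1, a1))) (bcop H b))"
      unfolding lin_fun_scale[symmetric] by (simp add: case_prod_unfold)
    also have "\<dots> = scale (beps H a2) (lin (\<lambda>c. bmul H (c, a1)) (ra (dr a1) b))"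
      using a ab by (simp add: contract_right)
    finally show "lin (\<lambda>(b1, b2). scale (R (a2, b2)) (bmul H (b1, a1))) (bcop H b) =
      scale (beps H a2) (lin (\<lambda>c. bmul H (c, a1)) (ra (dr a1) b))" .
  qed
  also have "\<dots> = lin (\<lambda>c. bmul H (c, a)) (ra (dr a) b)"
    using ab by (simp add: contract_right_counit)
  finally have 1: "lin (\<lambda>((a1, a2), (b1, b2)). scale (R (a2, b2)) (bmul H (b1, a1))) (tensor (bcop H a) (bcop H b))
    = lin (\<lambda>c. bmul H (c, a)) (ra (dr a) b)" .
  have "lin (\<lambda>((a1, a2), (b1, b2)). scale (R (a1, b1)) (bmul H (a2, b2))) (tensor (bcop H a) (bcop H b))
    = lin (\<lambda>(a1, a2). lin (\<lambda>(b1, b2). scale (R (a1, b1)) (bmul H (a2, b2))) (bcop H b)) (bcop H a)"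
    by (simp add: lin_tensor case_prod_unfold)
  also have "\<dots> = lin (\<lambda>(a1, a2). scale (beps H a1) (lin (\<lambda>c. bmul H (a2, c)) (la (inv (dl a2)) b))) (bcop H a)"
  proof (rule cop_cong[OF ab(1)])
    fix a1 a2 assume a: "a1 \<in> basis V" "a2 \<in> basis V" "dr a1 = dl a2"
    have "lin (\<lambda>(b1, b2). scale (R (a1, b1)) (bmul H (a2, b2))) (bcop H b)
      = lin (\<lambda>(b1, b2). scale (beps H a1) (scale (linf (beps H) (la (inv (dl a2)) b1)) (bmul H (a2, b2)))) (bcop H b)"
      by (rule cop_cong[OF ab(2)])
        (use a eps_deg[of a1] in \<open>cases "beps H a1 = 0", auto simp: R canon_R_def\<close>)
    also have "\<dots> = scale (beps H a1)
        (lin (\<lambda>(b1, b2). scale (linf (beps H) (la (inv (dl a2)) b1)) (bmul H (a2, b2))) (bcop H b))"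
      unfolding lin_fun_scale[symmetric] by (simp add: case_prod_unfold)
    also have "\<dots> = scale (beps H a1) (lin (\<lambda>c. bmul H (a2, c)) (la (inv (dl a2)) b))"
      using a ab by (simp add: contract_left)
    finally show "lin (\<lambda>(b1, b2). scale (R (a1, b1)) (bmul H (a2, b2))) (bcop H b) =
      scale (beps H a1) (lin (\<lambda>c. bmul H (a2, c)) (la (inv (dl a2)) b))" .
  qed
  also have "\<dots> = lin (\<lambda>c. bmul H (a, c)) (la (inv (dl a)) b)"
    using ab by (simp add: contract_left_counit)
  finally have 2: "lin (\<lambda>((a1, a2), (b1, b2)). scale (R (a1, b1)) (bmul H (a2, b2))) (tensor (bcop H a) (bcop H b))
    = lin (\<lambda>c. bmul H (a, c)) (la (inv (dl a)) b)" .
  show "eqv V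
        (lin (\<lambda>((a1, a2), (b1, b2)). scale (R (a2, b2)) (bmul H (b1, a1)))
             (tensor (bcop H a) (bcop H b)))
        (lin (\<lambda>((a1, a2), (b1, b2)). scale (R (a1, b1)) (bmul H (a2, b2)))
             (tensor (bcop H a) (bcop H b)))"
    \<comment> \<open>\<open>comm\<close> supplies the difference with the opposite sign.\<close>
    using comm[OF ab] fv.subspace_neg[OF null_subspace] unfolding 1 2 eqv_def by force
qed

end

section \<open>Transmutation\<close>

lemma xtens_sel [simp]: "basis (xtens G X Y) = basis X \<times> basis Y" "null (xtens G X Y) = null (tens X Y)"
  "act (xtens G X Y) h = tmap (act X h) (act Y h)" "deg (xtens G X Y) = (\<lambda>(b, c). deg X b \<otimes>\<^bsub>G\<^esub> deg Y c)"
  by (simp_all add: xtens_def)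

lemma xtriv_sel [simp]: "basis (xtriv G) = UNIV" "null (xtriv G) = {0}"
  "act (xtriv G) h = bvec" "deg (xtriv G) b = \<one>\<^bsub>G\<^esub>"
  by (auto simp add: xtriv_def)

section \<open>Cancellation and reindexing in the group\<close>

context group
begin

lemma inv_cancel_left [simp]: "x \<in> carrier G \<Longrightarrow> y \<in> carrier G \<Longrightarrow> inv x \<otimes> (x \<otimes> y) = y"
  by (simp flip: m_assoc)

lemma cancel_inv_left [simp]: "x \<in> carrier G \<Longrightarrow> y \<in> carrier G \<Longrightarrow> x \<otimes> (inv x \<otimes> y) = y"
  by (simp flip: m_assoc)

lemma sum_mult_left:
  "h \<in> carrier G \<Longrightarrow> (\<Sum>g\<in>carrier G. F (h \<otimes> g)) = (\<Sum>g\<in>carrier G. F g)"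
  by (rule sum.reindex_bij_witness[where i = "\<lambda>g. inv h \<otimes> g" and j = "\<lambda>g. h \<otimes> g"]) auto

lemma sum_mult_right:
  "h \<in> carrier G \<Longrightarrow> (\<Sum>g\<in>carrier G. F (g \<otimes> h)) = (\<Sum>g\<in>carrier G. F g)"
  by (rule sum.reindex_bij_witness[where i = "\<lambda>g. g \<otimes> inv h" and j = "\<lambda>g. g \<otimes> h"]) (auto simp: m_assoc)

lemma sum_inv: "(\<Sum>g\<in>carrier G. F (inv g)) = (\<Sum>g\<in>carrier G. F g)"
  by (rule sum.reindex_bij_witness[where i = "\<lambda>g. inv g" and j = "\<lambda>g. inv g"]) auto

lemma sum_conj:
  "h \<in> carrier G \<Longrightarrow> (\<Sum>g\<in>carrier G. F (h \<otimes> g \<otimes> inv h)) = (\<Sum>g\<in>carrier G. F g)"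
  by (rule sum.reindex_bij_witness[where i = "\<lambda>g. inv h \<otimes> g \<otimes> h" and j = "\<lambda>g. h \<otimes> g \<otimes> inv h"])
    (auto simp: m_assoc)

end

lemma tmap_tmap: "lin (tmap f g) (tmap f' g' p) = tmap (\<lambda>x. lin f (f' x)) (\<lambda>y. lin g (g' y)) p"
  by (cases p) (simp add: tmap_apply lin_tmap_tensor)

lemma lin_tmap_lin_tmap:
  "lin (tmap f g) (lin (tmap f' g') x) = lin (tmap (\<lambda>x. lin f (f' x)) (\<lambda>y. lin g (g' y))) x"
  by (simp add: lin_lin tmap_tmap)

section \<open>The transmuted product and the adjoint action\<close>

context crossed_bialgebra
begin

definition gdeg :: "'b \<Rightarrow> 'a" where
  "gdeg a = inv (dl a) \<otimes> dr a"

definition ad :: "'a \<Rightarrow> 'b \<Rightarrow> ('b \<Rightarrow>\<^sub>0 'k)" where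
  "ad h a = lin (ra h) (la h a)"

abbreviation mulv :: "('b \<Rightarrow>\<^sub>0 'k) \<Rightarrow> ('b \<Rightarrow>\<^sub>0 'k) \<Rightarrow> ('b \<Rightarrow>\<^sub>0 'k)" where
  "mulv x y \<equiv> lin (bmul H) (tensor x y)"

definition trmul :: "'b \<times> 'b \<Rightarrow> ('b \<Rightarrow>\<^sub>0 'k)" where
  "trmul = (\<lambda>(a, b). mulv (bvec a) (la (gdeg a) b))"

definition trX :: "('a, 'b, 'k) xmod" where
  "trX = \<lparr>basis = basis V, null = null V, act = ad, deg = gdeg\<rparr>"

definition trH :: "('b, 'k) bialg" where
  "trH = H\<lparr>bmul := trmul\<rparr>"

lemma trX_simps [simp]:
  "basis trX = basis V" "null trX = null V" "act trX = ad" "deg trX = gdeg"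
  by (simp_all add: trX_def)

lemma trH_simps [simp]:
  "bone trH = bone H" "bmul trH = trmul" "bcop trH = bcop H" "beps trH = beps H"
  by (simp_all add: trH_def)

lemma gdeg_in [simp]: "a \<in> basis V \<Longrightarrow> gdeg a \<in> carrier G"
  by (simp add: gdeg_def)

lemma ad_deg:
  assumes "h \<in> carrier G" "a \<in> basis V"
  shows "ad h a \<in> fspan {b \<in> basis V. dl b = h \<otimes> dl a \<otimes> inv h \<and> dr b = h \<otimes> dr a \<otimes> inv h}"
  unfolding ad_def
proof (rule lin_in_fspan[OF la_deg[OF assms]])
  fix b assume "b \<in> {b \<in> basis V. dl b = h \<otimes> dl a \<otimes> inv h \<and> dr b = dr a}"
  thus "ra h b \<in> fspan {b \<in> basis V. dl b = h \<otimes> dl a \<otimes> inv h \<and> dr b = h \<otimes> dr a \<otimes> inv h}"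
    using ra_deg[of h b] assms by auto
qed

lemma ad_in [simp]: "h \<in> carrier G \<Longrightarrow> a \<in> basis V \<Longrightarrow> ad h a \<in> fspan (basis V)"
  using ad_deg[of h a] by (auto simp: fspan_def)

lemma inv_conj: "h \<in> carrier G \<Longrightarrow> g \<in> carrier G \<Longrightarrow> inv (h \<otimes> g \<otimes> inv h) = h \<otimes> inv g \<otimes> inv h"
  by (simp add: inv_mult_group m_assoc)

lemma ad_gdeg:
  assumes "h \<in> carrier G" "a \<in> basis V"
  shows "ad h a \<in> fspan {b \<in> basis V. gdeg b = h \<otimes> gdeg a \<otimes> inv h}"
proof -
  have "{b \<in> basis V. dl b = h \<otimes> dl a \<otimes> inv h \<and> dr b = h \<otimes> dr a \<otimes> inv h}
    \<subseteq> {b \<in> basis V. gdeg b = h \<otimes> gdeg a \<otimes> inv h}"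
    using assms by (auto simp: gdeg_def inv_mult_group m_assoc)
  thus ?thesis using ad_deg[OF assms] fspan_mono by blast
qed

lemma lin_ad: "lin (ad h) x = lin (ra h) (lin (la h) x)"
  by (simp add: ad_def[abs_def] lin_lin)

lemma ad_one: "a \<in> basis V \<Longrightarrow> ad \<one> a = bvec a"
  by (simp add: ad_def la_one ra_one)

lemma ad_mult: "g \<in> carrier G \<Longrightarrow> h \<in> carrier G \<Longrightarrow> a \<in> basis V \<Longrightarrow> lin (ad g) (ad h a) = ad (g \<otimes> h) a"
proof -
  assume A: "g \<in> carrier G" "h \<in> carrier G" "a \<in> basis V"
  have "lin (ad g) (ad h a) = lin (ra g) (lin (la g) (lin (ra h) (la h a)))"
    by (simp add: lin_ad ad_def)
  also have "\<dots> = lin (ra g) (lin (ra h) (lin (la g) (la h a)))"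
    using A by (simp add: la_ra')
  also have "\<dots> = ad (g \<otimes> h) a"
    using A by (simp add: la_mult ra_mult' ad_def)
  finally show ?thesis .
qed

text \<open>\<open>ra h\<close> commutes with the left action, and \<open>la h\<close> past
  \<open>la g\<close> costs a conjugation of \<open>g\<close>. This is what makes the twisted
  product equivariant.\<close>

lemma ad_la:
  assumes "g \<in> carrier G" "h \<in> carrier G" "a \<in> basis V"
  shows "lin (ad h) (la g a) = lin (la (h \<otimes> g \<otimes> inv h)) (ad h a)"
proof -
  have "lin (ad h) (la g a) = lin (ra h) (lin (la h) (la g a))"
    by (simp add: lin_ad ad_def)
  also have "\<dots> = lin (ra h) (la (h \<otimes> g) a)" using assms by (simp add: la_mult)
  also have "\<dots> = lin (ra h) (lin (la (h \<otimes> g \<otimes> inv h)) (la h a))"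
    using assms by (simp add: la_mult m_assoc)
  also have "\<dots> = lin (la (h \<otimes> g \<otimes> inv h)) (ad h a)"
    using assms by (simp add: la_ra' ad_def)
  finally show ?thesis .
qed

lemma mulv_lin_left: "mulv (lin f x) y = lin (\<lambda>a. mulv (f a) y) x"
  by (simp add: tensor_lin_left lin_lin)

lemma mulv_lin_right: "mulv x (lin f y) = lin (\<lambda>a. mulv x (f a)) y"
  by (simp add: tensor_lin_right lin_lin)

lemma mulv_in [simp]: "x \<in> fspan (basis V) \<Longrightarrow> y \<in> fspan (basis V) \<Longrightarrow> mulv x y \<in> fspan (basis V)"
  by (rule lin_in_fspan[OF tensor_in_fspan]) auto

lemma bilin_ext:
  assumes "x \<in> fspan A" "y \<in> fspan B"
    and "\<And>a b. a \<in> A \<Longrightarrow> b \<in> B \<Longrightarrow> f (a, b) = g (a, b)"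
  shows "lin f (tensor x y) = lin g (tensor x y)"
  by (rule fspan_lin_cong[OF tensor_in_fspan[OF assms(1,2)]]) (use assms(3) in auto)

lemma mulv_assoc:
  assumes "x \<in> fspan (basis V)" "y \<in> fspan (basis V)" "z \<in> fspan (basis V)"
  shows "mulv (mulv x y) z = mulv x (mulv y z)"
proof -
  have r: "mulv u z = lin (\<lambda>c. mulv u (bvec c)) z" for u
    using mulv_lin_right[of u bvec z] by simp
  have l: "mulv x u = lin (\<lambda>a. mulv (bvec a) u) x" for u
    using mulv_lin_left[of bvec x u] by simp
  have "mulv (mulv x y) z = lin (\<lambda>a. lin (\<lambda>b. mulv (bmul H (a, b)) z) y) x"
    unfolding mulv_lin_left by (rule lin_tensor)
  also have "\<dots> = lin (\<lambda>a. lin (\<lambda>b. lin (\<lambda>c. mulv (bmul H (a, b)) (bvec c)) z) y) x"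
    by (simp only: r)
  also have "\<dots> = lin (\<lambda>a. lin (\<lambda>b. lin (\<lambda>c. mulv (bvec a) (bmul H (b, c))) z) y) x"
    using assms by (intro fspan_lin_cong[OF assms(1)] fspan_lin_cong[OF assms(2)] fspan_lin_cong[OF assms(3)])
      (auto simp: mul_assoc)
  also have "\<dots> = mulv x (mulv y z)"
    by (subst l) (simp only: lin_tensor[of "bmul H" y z] mulv_lin_right)
  finally show ?thesis .
qed

lemma la_mulv:
  assumes "h \<in> carrier G" "x \<in> fspan (basis V)" "y \<in> fspan (basis V)"
  shows "lin (la h) (mulv x y) = mulv (lin (la h) x) (lin (la h) y)"
proof -
  have "lin (la h) (mulv x y) = lin (\<lambda>(a, b). lin (bmul H) (tensor (la h a) (la h b))) (tensor x y)"
    unfolding lin_lin by (rule bilin_ext[OF assms(2,3)]) (use assms in \<open>auto simp: la_mul\<close>)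
  also have "\<dots> = mulv (lin (la h) x) (lin (la h) y)"
    by (simp add: lin_tensor lin_lin tensor_lin_left tensor_lin_right) (rule lin_swap)
  finally show ?thesis .
qed

lemma ra_mulv:
  assumes "h \<in> carrier G" "x \<in> fspan (basis V)" "y \<in> fspan (basis V)"
  shows "lin (ra h) (mulv x y) = mulv (lin (ra h) x) (lin (ra h) y)"
proof -
  have "lin (ra h) (mulv x y) = lin (\<lambda>(a, b). lin (bmul H) (tensor (ra h a) (ra h b))) (tensor x y)"
    unfolding lin_lin by (rule bilin_ext[OF assms(2,3)]) (use assms in \<open>auto simp: ra_mul\<close>)
  also have "\<dots> = mulv (lin (ra h) x) (lin (ra h) y)"
    by (simp add: lin_tensor lin_lin tensor_lin_left tensor_lin_right) (rule lin_swap)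
  finally show ?thesis .
qed

lemma ad_mulv:
  assumes "h \<in> carrier G" "x \<in> fspan (basis V)" "y \<in> fspan (basis V)"
  shows "lin (ad h) (mulv x y) = mulv (lin (ad h) x) (lin (ad h) y)"
  using assms by (simp add: lin_ad la_mulv ra_mulv)

lemma mulv_null_left: "x \<in> null V \<Longrightarrow> y \<in> fspan (basis V) \<Longrightarrow> mulv x y \<in> null V"
  using algebra_on_V unfolding algebra_on_def lmap_def by (blast intro: tensor_null_left)

lemma mulv_null_right: "x \<in> fspan (basis V) \<Longrightarrow> y \<in> null V \<Longrightarrow> mulv x y \<in> null V"
  using algebra_on_V unfolding algebra_on_def lmap_def by (blast intro: tensor_null_right)

lemma trmul_in [simp]: "a \<in> basis V \<Longrightarrow> b \<in> basis V \<Longrightarrow> trmul (a, b) \<in> fspan (basis V)"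
  by (simp add: trmul_def)

text \<open>The twist conjugates \<open>dl b\<close> by \<open>gdeg a\<close>; after inversion of
  the left degree this conjugation moves \<open>gdeg a\<close> to the front and leaves
  \<open>gdeg b\<close> behind it.\<close>

lemma trmul_gdeg:
  assumes "a \<in> basis V" "b \<in> basis V"
  shows "trmul (a, b) \<in> fspan {c \<in> basis V. gdeg c = gdeg a \<otimes> gdeg b}"
proof -
  have "trmul (a, b) = lin (\<lambda>c. bmul H (a, c)) (la (gdeg a) b)"
    by (simp add: trmul_def lin_tensor)
  also have "\<dots> \<in> fspan {c \<in> basis V. gdeg c = gdeg a \<otimes> gdeg b}"
  proof (rule lin_in_fspan[OF la_deg])
    fix c assume "c \<in> {c \<in> basis V. dl c = gdeg a \<otimes> dl b \<otimes> inv gdeg a \<and> dr c = dr b}"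
    hence c: "c \<in> basis V" "dl c = gdeg a \<otimes> dl b \<otimes> inv gdeg a" "dr c = dr b" by auto
    have "{d \<in> basis V. dl d = dl a \<otimes> dl c \<and> dr d = dr a \<otimes> dr c} \<subseteq> {c \<in> basis V. gdeg c = gdeg a \<otimes> gdeg b}"
      using c assms by (auto simp: gdeg_def inv_mult_group m_assoc)
    thus "bmul H (a, c) \<in> fspan {c \<in> basis V. gdeg c = gdeg a \<otimes> gdeg b}"
      using mul_deg[OF assms(1) c(1)] fspan_mono by blast
  qed (use assms in auto)
  finally show ?thesis .
qed

text \<open>The twist depends on the degree of the left factor, so a formula for vectors requires
  that factor to be homogeneous.\<close>

lemma lin_trmul_homog:
  assumes "x \<in> fspan {c \<in> basis V. gdeg c = g}"
  shows "lin trmul (tensor x y) = mulv x (lin (la g) y)"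
proof -
  have "lin trmul (tensor x y) = lin (\<lambda>a. mulv (bvec a) (lin (la (gdeg a)) y)) x"
    by (simp add: lin_tensor trmul_def mulv_lin_right lin_lin)
  also have "\<dots> = lin (\<lambda>a. mulv (bvec a) (lin (la g) y)) x"
    by (rule fspan_lin_cong[OF assms]) simp
  also have "\<dots> = mulv x (lin (la g) y)"
    by (simp flip: mulv_lin_left)
  finally show ?thesis .
qed

lemma lin_trmul_bvec: "lin trmul (tensor (bvec a) y) = mulv (bvec a) (lin (la (gdeg a)) y)"
  by (simp add: lin_tensor trmul_def lin_lin)

text \<open>With \<open>g\<close> and \<open>k\<close> the degrees of \<open>a\<close> and
  \<open>b\<close>, both sides equal the ordinary product of \<open>a\<close>, \<open>la g b\<close>
  and \<open>la (g \<otimes> k) c\<close>.\<close>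

lemma trmul_assoc:
  assumes "a \<in> basis V" "b \<in> basis V" "c \<in> basis V"
  shows "lin trmul (tensor (trmul (a, b)) (bvec c)) = lin trmul (tensor (bvec a) (trmul (b, c)))"
proof -
  have "lin trmul (tensor (trmul (a, b)) (bvec c)) = mulv (trmul (a, b)) (la (gdeg a \<otimes> gdeg b) c)"
    using assms by (simp add: lin_trmul_homog[OF trmul_gdeg])
  also have "\<dots> = mulv (bvec a) (mulv (la (gdeg a) b) (la (gdeg a \<otimes> gdeg b) c))"
    using assms by (simp add: trmul_def mulv_assoc)
  also have "\<dots> = mulv (bvec a) (lin (la (gdeg a)) (trmul (b, c)))"
    using assms by (simp add: trmul_def la_mulv la_mult)
  also have "\<dots> = lin trmul (tensor (bvec a) (trmul (b, c)))"
    by (simp add: lin_trmul_bvec)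
  finally show ?thesis .
qed

lemma one_gdeg: "bone H \<in> fspan {c \<in> basis V. gdeg c = \<one>}"
proof -
  have "{c \<in> basis V. dl c = \<one> \<and> dr c = \<one>} \<subseteq> {c \<in> basis V. gdeg c = \<one>}"
    by (auto simp: gdeg_def)
  thus ?thesis using one_deg fspan_mono by blast
qed

text \<open>\<open>ad h\<close> conjugates the degree of \<open>a\<close>, and \<open>ad_la\<close>
  conjugates the twist in the same way.\<close>

lemma ad_trmul:
  assumes "h \<in> carrier G" "a \<in> basis V" "b \<in> basis V"
  shows "lin (ad h) (trmul (a, b)) = lin trmul (tensor (ad h a) (ad h b))"
proof -
  have "lin (ad h) (trmul (a, b)) = mulv (ad h a) (lin (ad h) (la (gdeg a) b))"
    using assms by (simp add: trmul_def ad_mulv)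
  also have "\<dots> = mulv (ad h a) (lin (la (h \<otimes> gdeg a \<otimes> inv h)) (ad h b))"
    using assms by (simp add: ad_la)
  also have "\<dots> = lin trmul (tensor (ad h a) (ad h b))"
    using assms by (simp add: lin_trmul_homog[OF ad_gdeg])
  finally show ?thesis .
qed

lemma trmul_lmap: "lmap (tens trX trX) trX trmul"
  unfolding lmap_def
proof (intro conjI ballI)
  fix z assume "z \<in> null (tens trX trX)"
  thus "lin trmul z \<in> null trX"
  proof (rule null_tens_lin)
    fix x and y :: "'b \<Rightarrow>\<^sub>0 'k" assume x: "x \<in> null trX" and y: "y \<in> fspan (basis trX)"
    \<comment> \<open>The twist is constant only on a homogeneous left factor, so the null vector is
      first cut into its components.\<close>
    have "lin (\<lambda>a. lin trmul (tensor (bvec a) y)) x \<in> null V"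
    proof (rule null_deg_subspace)
      fix x u v assume x: "x \<in> null V" "x \<in> fspan {b \<in> basis V. dl b = u \<and> dr b = v}"
        and uv: "u \<in> carrier G" "v \<in> carrier G"
      have "x \<in> fspan {b \<in> basis V. gdeg b = inv u \<otimes> v}"
        using x(2) by (auto simp: fspan_def gdeg_def)
      from lin_trmul_homog[OF this] show "lin (\<lambda>a. lin trmul (tensor (bvec a) y)) x \<in> null V"
        using x uv y by (simp add: mulv_null_left flip: lin_lin tensor_lin_left)
    qed (use x in auto)
    thus "lin trmul (tensor x y) \<in> null trX"
      by (simp flip: lin_lin tensor_lin_left)
  next
    fix x :: "'b \<Rightarrow>\<^sub>0 'k" and y assume x: "x \<in> fspan (basis trX)" and y: "y \<in> null trX"
    have "lin trmul (tensor x y) = lin (\<lambda>a. lin trmul (tensor (bvec a) y)) x"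
      by (simp flip: lin_lin tensor_lin_left)
    also have "\<dots> \<in> null V"
      unfolding lin_trmul_bvec using x y
      by (auto intro!: lin_in_subspace mulv_null_right null_la dest: keysD)
    finally show "lin trmul (tensor x y) \<in> null trX" by simp
  qed simp
qed auto

lemma eqvI: "x = y \<Longrightarrow> eqv trX x y"
  by (simp add: eqv_def)

lemma algebra_on_trX: "algebra_on trX trH"
  unfolding algebra_on_def
proof (intro conjI ballI)
  show "lmap (tens trX trX) trX (bmul trH)" using trmul_lmap by simp
next
  fix a assume a: "a \<in> basis trX"
  show "eqv trX (lin (bmul trH) (tensor (bone trH) (bvec a))) (bvec a)"
    using a by (intro eqvI) (simp add: lin_trmul_homog[OF one_gdeg] la_one mul_one_left)
  show "eqv trX (lin (bmul trH) (tensor (bvec a) (bone trH))) (bvec a)"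
    using a by (intro eqvI) (simp add: lin_trmul_bvec la_unit mul_one_right)
qed (auto intro!: eqvI simp: trmul_assoc)

lemma tens_trX: "tens trX W = tens V W" "tens W trX = tens W V"
  by (simp_all add: tens_def)

lemma coalgebra_on_trX: "coalgebra_on trX trH"
  using coalgebra_on_V unfolding coalgebra_on_def by (simp add: tens_trX lmap_def eqv_def)

text \<open>In Sweedler notation with \<open>k = gdeg a2\<close>, the braided product of the two
  coproducts has legs \<open>a1 la(gdeg a1) ad(k) b1\<close> and \<open>a2 la(k) b2\<close>. Since
  \<open>gdeg a1 \<otimes> k = gdeg a\<close>, the first leg is
  \<open>a1 la(gdeg a) ra(k) b1\<close>. By \<open>cop_inv\<close> the pair \<open>ra(k)\<close>,
  \<open>la(k)\<close> on the legs of \<open>b\<close> disappears, which leaves the coproduct of the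
  transmuted product.\<close>

lemma cop_trmul:
  assumes ab: "a \<in> basis V" "b \<in> basis V"
  shows "lin (bcop H) (trmul (a, b)) = lin (tens_mul (xbraid trX) trmul) (tensor (bcop H a) (bcop H b))"
proof -
  let ?g = "gdeg a"
  have "lin (bcop H) (trmul (a, b)) = lin (\<lambda>c. lin (bcop H) (bmul H (a, c))) (la ?g b)"
    by (simp add: trmul_def lin_lin lin_tensor)
  also have "\<dots> = lin (\<lambda>c. lin (\<lambda>(a1, a2). lin (\<lambda>(b1, b2). tensor (bmul H (a1, b1)) (bmul H (a2, b2)))
      (bcop H c)) (bcop H a)) (la ?g b)"
    by (rule fspan_lin_cong[OF la_in]) (use ab in \<open>auto simp: cop_mul\<close>)
  also have "\<dots> = lin (\<lambda>(a1, a2). lin (\<lambda>(b1, b2). tensor (bmul H (a1, b1)) (bmul H (a2, b2)))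
      (lin (bcop H) (la ?g b))) (bcop H a)"
    unfolding lin_lin case_prod_unfold by (rule lin_swap)
  also have "\<dots> = lin (\<lambda>(a1, a2). lin (\<lambda>(b1, b2). tensor (mulv (bvec a1) (la ?g b1)) (bmul H (a2, b2)))
      (bcop H b)) (bcop H a)"
    using ab by (simp add: cop_la lin_lin tmap_def case_prod_unfold lin_tensor tensor_lin_left)
  also have "\<dots> = lin (\<lambda>(a1, a2). lin (\<lambda>(b1, b2). tens_mul (xbraid trX) trmul ((a1, a2), (b1, b2)))
      (bcop H b)) (bcop H a)"
  proof (rule cop_cong[OF ab(1)])
    fix a1 a2 assume a: "a1 \<in> basis V" "a2 \<in> basis V" "dl a1 = dl a" "dr a1 = dl a2" "dr a2 = dr a"
    let ?k = "gdeg a2"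
    \<comment> \<open>The inner degrees \<open>dr a1\<close> and \<open>dl a2\<close>
      cancel.\<close>
    have g: "gdeg a1 \<otimes> ?k = ?g"
      using a ab by (simp add: gdeg_def m_assoc)
    have "lin (\<lambda>(b1, b2). tens_mul (xbraid trX) trmul ((a1, a2), (b1, b2))) (bcop H b)
      = lin (\<lambda>(b1, b2). tensor (mulv (bvec a1) (lin (la (gdeg a1)) (ad ?k b1))) (mulv (bvec a2) (la ?k b2))) (bcop H b)"
      by (simp add: tens_mul_def xbraid_def lin_tensor tensor_lin_left lin_lin trmul_def)
    also have "\<dots> = lin (\<lambda>(b1, b2). tensor (mulv (bvec a1) (lin (la ?g) (ra ?k b1))) (mulv (bvec a2) (la ?k b2))) (bcop H b)"
    proof (rule cop_cong[OF ab(2)])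
      fix b1 b2 assume b: "b1 \<in> basis V"
      have "lin (la (gdeg a1)) (ad ?k b1) = lin (ra ?k) (lin (la (gdeg a1)) (la ?k b1))"
        using a b by (simp add: ad_def la_ra')
      also have "\<dots> = lin (ra ?k) (la ?g b1)"
        using a b by (simp add: la_mult g)
      also have "\<dots> = lin (la ?g) (ra ?k b1)"
        using a b ab by (simp add: la_ra)
      finally show "tensor (mulv (bvec a1) (lin (la (gdeg a1)) (ad ?k b1))) (mulv (bvec a2) (la ?k b2))
        = tensor (mulv (bvec a1) (lin (la ?g) (ra ?k b1))) (mulv (bvec a2) (la ?k b2))" by simp
    qed
    also have "\<dots> = lin (\<lambda>(b1, b2). tensor (mulv (bvec a1) (la ?g b1)) (bmul H (a2, b2)))
        (lin (tmap (ra ?k) (la ?k)) (bcop H b))"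
      unfolding lin_lin tmap_def case_prod_unfold
      by (simp add: lin_tensor) (simp add: tensor_lin_left tensor_lin_right lin_lin lin_tensor lin_swap[of _ "la (gdeg a2) _"])
    also have "\<dots> = lin (\<lambda>(b1, b2). tensor (mulv (bvec a1) (la ?g b1)) (bmul H (a2, b2))) (bcop H b)"
      \<comment> \<open>This is the point where the invariance of the coproduct absorbs the
        braiding.\<close>
      using a ab by (simp add: cop_inv)
    finally show "lin (\<lambda>(b1, b2). tensor (mulv (bvec a1) (la ?g b1)) (bmul H (a2, b2))) (bcop H b)
       = lin (\<lambda>(b1, b2). tens_mul (xbraid trX) trmul ((a1, a2), (b1, b2))) (bcop H b)" by simp
  qed
  also have "\<dots> = lin (tens_mul (xbraid trX) trmul) (tensor (bcop H a) (bcop H b))"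
    by (simp add: lin_tensor case_prod_unfold)
  finally show ?thesis .
qed

text \<open>If the counit of \<open>a\<close> is nonzero, its degree is \<open>\<one>\<close> and
  there is no twist.\<close>

lemma eps_trmul:
  assumes ab: "a \<in> basis V" "b \<in> basis V"
  shows "linf (beps H) (trmul (a, b)) = beps H a * beps H b"
proof -
  have "linf (beps H) (trmul (a, b)) = linf (\<lambda>c. linf (beps H) (bmul H (a, c))) (la (gdeg a) b)"
    by (simp add: trmul_def linf_lin lin_tensor)
  also have "\<dots> = linf (\<lambda>c. beps H a * beps H c) (la (gdeg a) b)"
    by (rule fspan_linf_cong[OF la_in]) (use ab in \<open>auto simp: eps_mul\<close>)
  also have "\<dots> = beps H a * linf (beps H) (la (gdeg a) b)"
    by (simp add: linf_fun_mult_left)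
  also have "\<dots> = beps H a * beps H b"
    using ab eps_deg[of a] by (cases "beps H a = 0") (auto simp: gdeg_def la_one)
  finally show ?thesis .
qed

lemma bialgebra_wrt_trX: "bialgebra_wrt (xbraid trX) trX trH"
  unfolding bialgebra_wrt_def
  using null_ok algebra_on_trX coalgebra_on_trX
  by (auto simp: pspace_ok_def cop_one eps_one eps_trmul cop_trmul)

lemma crossed_module_trX: "crossed_module G trX"
  unfolding crossed_module_def
proof (intro conjI ballI)
  show "pspace_ok trX" using null_ok by (simp add: pspace_ok_def)
next
  fix x g assume x: "x \<in> null trX" and g: "g \<in> carrier G"
  have "lin (\<lambda>b. if gdeg b = g then bvec b else 0) x \<in> null V"
  proof (rule null_deg_subspace)
    fix x u v assume x: "x \<in> null V" "x \<in> fspan {b \<in> basis V. dl b = u \<and> dr b = v}"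
    \<comment> \<open>On a component of fixed bidegree the projection is either the identity or
      zero.\<close>
    have "lin (\<lambda>b. if gdeg b = g then bvec b else 0) x = lin (\<lambda>b. if inv u \<otimes> v = g then bvec b else 0) x"
      by (rule fspan_lin_cong[OF x(2)]) (auto simp: gdeg_def)
    also have "\<dots> \<in> null V" using x(1) by (auto simp: lin_if_zero)
    finally show "lin (\<lambda>b. if gdeg b = g then bvec b else 0) x \<in> null V" .
  qed (use x in auto)
  thus "lin (\<lambda>b. if deg trX b = g then bvec b else 0) x \<in> null trX" by simp
next
  fix h assume h: "h \<in> carrier G"
  show "lmap trX trX (act trX h)"
    using h by (auto simp: lmap_def lin_ad null_la null_ra)
next
  fix h b assume h: "h \<in> carrier G" and b: "b \<in> basis trX"
  show "act trX h b \<in> homog trX (h \<otimes> deg trX b \<otimes> inv h)"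
    using h b ad_gdeg[of h b] by (auto simp: homog_def intro!: bexI[of _ "ad h b"] eqvI)
qed (auto intro!: eqvI simp: ad_one ad_mult)

lemma homog_trXI: "x \<in> fspan {b \<in> basis V. gdeg b = g} \<Longrightarrow> x \<in> homog trX g"
  by (auto simp: homog_def intro!: bexI[of _ x] eqvI)

text \<open>\<open>cop_la\<close> and \<open>cop_ra\<close> put \<open>la h\<close> on the first leg
  and \<open>ra h\<close> on the second. Inserting the invariance \<open>cop_inv\<close> supplies
  the missing \<open>ra h\<close> and \<open>la h\<close>.\<close>

lemma cop_ad:
  assumes "h \<in> carrier G" "a \<in> basis V"
  shows "lin (bcop H) (ad h a) = lin (tmap (ad h) (ad h)) (bcop H a)"
proof -
  have "lin (bcop H) (ad h a) = lin (\<lambda>b. lin (tmap bvec (ra h)) (bcop H b)) (la h a)"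
    unfolding ad_def lin_lin by (rule fspan_lin_cong[OF la_in]) (use assms in \<open>auto simp: cop_ra\<close>)
  also have "\<dots> = lin (tmap bvec (ra h)) (lin (tmap (la h) bvec) (bcop H a))"
    using assms by (simp add: cop_la flip: lin_lin)
  also have "\<dots> = lin (tmap (la h) (ra h)) (bcop H a)"
    by (simp add: lin_tmap_lin_tmap)
  also have "\<dots> = lin (tmap (la h) (ra h)) (lin (tmap (ra h) (la h)) (bcop H a))"
    using assms by (simp add: cop_inv)
  also have "\<dots> = lin (tmap (ad h) (ad h)) (bcop H a)"
    unfolding lin_tmap_lin_tmap
    by (rule fspan_lin_cong[OF cop_in]) (use assms in \<open>auto simp: tmap_def ad_def la_ra\<close>)
  finally show ?thesis .
qed

text \<open>The degrees telescope because \<open>dr b = dl c\<close>.\<close>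

lemma cop_gdeg: "a \<in> basis V \<Longrightarrow> bcop H a \<in> fspan {(b, c). b \<in> basis V \<and> c \<in> basis V \<and> gdeg b \<otimes> gdeg c = gdeg a}"
proof -
  assume a: "a \<in> basis V"
  have "{(b, c). b \<in> basis V \<and> c \<in> basis V \<and> dl b = dl a \<and> dr b = dl c \<and> dr c = dr a}
     \<subseteq> {(b, c). b \<in> basis V \<and> c \<in> basis V \<and> gdeg b \<otimes> gdeg c = gdeg a}"
    using a by (auto simp: gdeg_def m_assoc)
  thus ?thesis using cop_deg[OF a] fspan_mono by blast
qed

lemma eqv_xtens_refl [simp]: "eqv (xtens G X Y) x x" 
  by (simp add: eqv_def fv.subspace_0)

theorem braided_bialgebra_trX: "braided_bialgebra G trX trH"
  unfolding braided_bialgebra_def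
proof (intro conjI)
  show "crossed_module G trX" by (rule crossed_module_trX)
  show "bialgebra_wrt (xbraid trX) trX trH" by (rule bialgebra_wrt_trX)
  show "crossed_hom G (xtriv G) trX (\<lambda>_. bone trH)"
    using one_gdeg by (auto simp: crossed_hom_def lmap_def lin_ad la_unit ra_unit intro!: eqvI homog_trXI)
  show "crossed_hom G (xtens G trX trX) trX (bmul trH)"
    unfolding crossed_hom_def
  proof (intro conjI ballI)
    show "lmap (xtens G trX trX) trX (bmul trH)"
      using trmul_lmap by (simp add: lmap_def)
  next
    fix h b assume "h \<in> carrier G" "b \<in> basis (xtens G trX trX)"
    thus "eqv trX (lin (bmul trH) (act (xtens G trX trX) h b)) (lin (act trX h) (bmul trH b))"
      by (intro eqvI) (auto simp: tmap_apply ad_trmul)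
  next
    fix b assume "b \<in> basis (xtens G trX trX)"
    thus "bmul trH b \<in> homog trX (deg (xtens G trX trX) b)"
      by (intro homog_trXI) (use trmul_gdeg in auto)
  qed
  show "crossed_hom G trX (xtens G trX trX) (bcop trH)"
    unfolding crossed_hom_def
  proof (intro conjI ballI)
    show "lmap trX (xtens G trX trX) (bcop trH)"
      by (auto simp: lmap_def tens_trX null_cop)
  next
    fix h b assume "h \<in> carrier G" "b \<in> basis trX"
    thus "eqv (xtens G trX trX) (lin (bcop trH) (act trX h b)) (lin (act (xtens G trX trX) h) (bcop trH b))"
      by (simp add: cop_ad)
  next
    fix b assume "b \<in> basis trX"
    hence "bcop H b \<in> fspan {c \<in> basis (xtens G trX trX). deg (xtens G trX trX) c = gdeg b}"
      using cop_gdeg[of b] by (auto simp: fspan_def)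
    thus "bcop trH b \<in> homog (xtens G trX trX) (deg trX b)"
      unfolding homog_def by (auto intro!: bexI[of _ "bcop H b"])
  qed
  show "crossed_hom G trX (xtriv G) (\<lambda>b. Poly_Mapping.single () (beps trH b))"
    unfolding crossed_hom_def
  proof (intro conjI ballI)
    show "lmap trX (xtriv G) (\<lambda>b. Poly_Mapping.single () (beps trH b))"
      using coalgebra_on_trX by (auto simp: coalgebra_on_def lmap_def kspace_def)
  next
    fix h b assume "h \<in> carrier G" "b \<in> basis trX"
    thus "eqv (xtriv G) (lin (\<lambda>b. Poly_Mapping.single () (beps trH b)) (act trX h b))
      (lin (act (xtriv G) h) (Poly_Mapping.single () (beps trH b)))"
      by (simp add: eqv_def single_eq_scale_bvec lin_scale_fun_const ad_def eps_inv)
  next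
    fix b assume b: "b \<in> basis trX"
    show "Poly_Mapping.single () (beps trH b) \<in> homog (xtriv G) (deg trX b)"
      \<comment> \<open>A zero value is homogeneous of every degree; otherwise the degree of
        \<open>b\<close> is \<open>\<one>\<close>.\<close>
      using b eps_deg[of b]
      by (cases "beps H b = 0")
        (auto simp: homog_def eqv_def gdeg_def fspan_def intro!: bexI[of _ "Poly_Mapping.single () (beps H b)"] bexI[of _ 0])
  qed
qed

end

section \<open>The quantum double as an instance\<close>

definition D_la :: "('g, 'm) monoid_scheme \<Rightarrow> 'g \<Rightarrow> 'g \<times> 'g \<Rightarrow> ('g \<times> 'g \<Rightarrow>\<^sub>0 'k::field)" where
  "D_la G k = (\<lambda>(g, h). bvec (k \<otimes>\<^bsub>G\<^esub> g, h))"

text \<open>Right translation of the delta function; the conjugation of the second entry is what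
  keeps \<open>D_dl\<close> fixed.\<close>

definition D_ra :: "('g, 'm) monoid_scheme \<Rightarrow> 'g \<Rightarrow> 'g \<times> 'g \<Rightarrow> ('g \<times> 'g \<Rightarrow>\<^sub>0 'k::field)" where
  "D_ra G k = (\<lambda>(g, h). bvec (g \<otimes>\<^bsub>G\<^esub> inv\<^bsub>G\<^esub> k, k \<otimes>\<^bsub>G\<^esub> h \<otimes>\<^bsub>G\<^esub> inv\<^bsub>G\<^esub> k))"

text \<open>The group entry of the first leg of the coproduct in the summand
  \<open>f = \<one>\<close>.\<close>

definition D_dl :: "('g, 'm) monoid_scheme \<Rightarrow> 'g \<times> 'g \<Rightarrow> 'g" where
  "D_dl G = (\<lambda>(g, h). g \<otimes>\<^bsub>G\<^esub> h \<otimes>\<^bsub>G\<^esub> inv\<^bsub>G\<^esub> g)"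

lemma D_simps [simp]:
  "basis (D_space G) = carrier G \<times> carrier G" "null (D_space G) = {0}"
  by (simp_all add: D_space_def)

context group
begin

text \<open>The main identities are translations of the summation variable of the coproduct: by
  \<open>h\<close> on the left for \<open>cop_la\<close>, by \<open>inv h\<close> on the right for
  \<open>cop_inv\<close>, and by the outer variable for coassociativity.\<close>

lemma D_coalgebra:
  assumes fin: "finite (carrier G)"
  shows "crossed_coalgebra G (carrier G \<times> carrier G) (D_la G) (D_ra G) (D_dl G) snd
    (bcop (D_bialg G)) (beps (D_bialg G) :: _ \<Rightarrow> 'k::field)"
proof unfold_locales
  show "finite (carrier G)" by fact
next
  fix a h assume "a \<in> carrier G \<times> carrier G" "h \<in> carrier G"
  thus "lin (bcop (D_bialg G)) (D_la G h a :: _ \<Rightarrow>\<^sub>0 'k) = lin (tmap (D_la G h) bvec) (bcop (D_bialg G) a)"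
  proof (cases a)
    case (Pair g k)
    hence c: "g \<in> carrier G" "k \<in> carrier G" "h \<in> carrier G"
      using \<open>a \<in> carrier G \<times> carrier G\<close> \<open>h \<in> carrier G\<close> by auto
    \<comment> \<open>The summand is kept as an abstraction applied to \<open>f\<close>, the shape
      in which \<open>sum_mult_left\<close> can shift the variable.\<close>
    have "lin (bcop (D_bialg G)) (D_la G h a :: _ \<Rightarrow>\<^sub>0 'k) = (\<Sum>f\<in>carrier G. (\<lambda>f.
       bvec ((f, inv f \<otimes> (h \<otimes> g) \<otimes> k \<otimes> inv (h \<otimes> g) \<otimes> f), (inv f \<otimes> (h \<otimes> g), k))) f)"
      by (simp add: Pair D_la_def D_bialg_def)
    also have "\<dots> = (\<Sum>f\<in>carrier G. (\<lambda>f.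
       bvec ((f, inv f \<otimes> (h \<otimes> g) \<otimes> k \<otimes> inv (h \<otimes> g) \<otimes> f), (inv f \<otimes> (h \<otimes> g), k))) (h \<otimes> f))"
      using c by (subst sum_mult_left) auto
    also have "\<dots> = lin (tmap (D_la G h) bvec) (bcop (D_bialg G) a)"
      using c by (auto simp: Pair D_la_def D_bialg_def lin_sum tmap_def inv_mult_group m_assoc intro!: sum.cong)
    finally show ?thesis .
  qed
next
  fix a h assume "a \<in> carrier G \<times> carrier G" "h \<in> carrier G"
  thus "lin (bcop (D_bialg G)) (D_ra G h a :: _ \<Rightarrow>\<^sub>0 'k) = lin (tmap bvec (D_ra G h)) (bcop (D_bialg G) a)"
    by (auto simp: D_ra_def D_bialg_def lin_sum tmap_def inv_mult_group m_assoc intro!: sum.cong)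
next
  fix a h assume "a \<in> carrier G \<times> carrier G" "h \<in> carrier G"
  thus "lin (tmap (D_ra G h) (D_la G h)) (bcop (D_bialg G) a) = (bcop (D_bialg G) a :: _ \<Rightarrow>\<^sub>0 'k)"
  proof (cases a)
    case (Pair g k)
    hence c: "g \<in> carrier G" "k \<in> carrier G" "h \<in> carrier G"
      using \<open>a \<in> carrier G \<times> carrier G\<close> \<open>h \<in> carrier G\<close> by auto
    have "bcop (D_bialg G) a = (\<Sum>f\<in>carrier G. (\<lambda>f.
       bvec ((f, inv f \<otimes> g \<otimes> k \<otimes> inv g \<otimes> f), (inv f \<otimes> g, k))) f :: _ \<Rightarrow>\<^sub>0 'k)"
      by (simp add: Pair D_bialg_def)
    also have "\<dots> = (\<Sum>f\<in>carrier G. (\<lambda>f.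
       bvec ((f, inv f \<otimes> g \<otimes> k \<otimes> inv g \<otimes> f), (inv f \<otimes> g, k))) (f \<otimes> inv h))"
      using c by (subst sum_mult_right) auto
    also have "\<dots> = lin (tmap (D_ra G h) (D_la G h)) (bcop (D_bialg G) a)"
      using c by (auto simp: Pair D_la_def D_ra_def D_bialg_def lin_sum tmap_def inv_mult_group m_assoc intro!: sum.cong)
    finally show ?thesis by simp
  qed
next
  fix a assume "a \<in> carrier G \<times> carrier G"
  then obtain g h where a: "a = (g, h)" and c: "g \<in> carrier G" "h \<in> carrier G" by auto
  have "lin (tmap (bcop (D_bialg G)) bvec) (bcop (D_bialg G) a) = (\<Sum>f\<in>carrier G. \<Sum>k\<in>carrier G.
      bvec (((k, inv k \<otimes> g \<otimes> h \<otimes> inv g \<otimes> k), (inv k \<otimes> f, inv f \<otimes> g \<otimes> h \<otimes> inv g \<otimes> f)), (inv f \<otimes> g, h)) :: _ \<Rightarrow>\<^sub>0 'k)"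
    using c by (auto simp: a D_bialg_def lin_sum tmap_def tensor_sum_left inv_mult_group m_assoc intro!: sum.cong)
  also have "\<dots> = (\<Sum>k\<in>carrier G. \<Sum>f\<in>carrier G. (\<lambda>f.
      bvec (((k, inv k \<otimes> g \<otimes> h \<otimes> inv g \<otimes> k), (inv k \<otimes> f, inv f \<otimes> g \<otimes> h \<otimes> inv g \<otimes> f)), (inv f \<otimes> g, h))) f)"
    by (rule sum.swap)
  also have "\<dots> = (\<Sum>k\<in>carrier G. \<Sum>f\<in>carrier G. (\<lambda>f.
      bvec (((k, inv k \<otimes> g \<otimes> h \<otimes> inv g \<otimes> k), (inv k \<otimes> f, inv f \<otimes> g \<otimes> h \<otimes> inv g \<otimes> f)), (inv f \<otimes> g, h))) (k \<otimes> f))"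
    by (rule sum.cong[OF refl sum_mult_left[symmetric]])
  also have "\<dots> = lin (\<lambda>(x, (y, z)). bvec ((x, y), z)) (lin (tmap bvec (bcop (D_bialg G))) (bcop (D_bialg G) a))"
    using c by (auto simp: a D_bialg_def lin_sum tmap_def tensor_sum_right inv_mult_group m_assoc intro!: sum.cong)
  finally show "lin (tmap (bcop (D_bialg G)) bvec) (bcop (D_bialg G) a) =
    lin (\<lambda>(x, (y, z)). bvec ((x, y), z)) (lin (tmap bvec (bcop (D_bialg G))) (bcop (D_bialg G) a) :: _ \<Rightarrow>\<^sub>0 'k)" .
next
  fix a assume "a \<in> carrier G \<times> carrier G"
  then obtain g h where a: "a = (g, h)" and c: "g \<in> carrier G" "h \<in> carrier G" by auto
  have "lin (\<lambda>(x, y). scale (beps (D_bialg G) x) (bvec y)) (bcop (D_bialg G) a)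
    = (\<Sum>f\<in>carrier G. if \<one> = f then bvec (g, h) else 0 :: _ \<Rightarrow>\<^sub>0 'k)"
    using c by (auto simp: a D_bialg_def lin_sum intro!: sum.cong)
  thus "lin (\<lambda>(x, y). scale (beps (D_bialg G) x) (bvec y)) (bcop (D_bialg G) a) = (bvec a :: _ \<Rightarrow>\<^sub>0 'k)"
    using fin by (simp add: a)
  have "lin (\<lambda>(x, y). scale (beps (D_bialg G) y) (bvec x)) (bcop (D_bialg G) a)
    = (\<Sum>f\<in>carrier G. if g = f then bvec (g, h) else 0 :: _ \<Rightarrow>\<^sub>0 'k)"
    unfolding a D_bialg_def bialg.simps lin_sum prod.case
  proof (intro sum.cong refl)
    fix f assume f: "f \<in> carrier G"
    have "inv f \<otimes> g = \<one> \<longleftrightarrow> g = f"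
      using f c by (metis inv_equality inv_inv inv_closed l_inv)
    thus "lin (\<lambda>(x, y). scale (case y of (g, h) \<Rightarrow> if g = \<one> then 1 else 0) (bvec x))
       (bvec ((f, inv f \<otimes> g \<otimes> h \<otimes> inv g \<otimes> f), inv f \<otimes> g, h)) =
      (if g = f then bvec (g, h) else 0 :: _ \<Rightarrow>\<^sub>0 'k)"
      using f c by (auto simp: m_assoc)
  qed
  thus "lin (\<lambda>(x, y). scale (beps (D_bialg G) y) (bvec x)) (bcop (D_bialg G) a) = (bvec a :: _ \<Rightarrow>\<^sub>0 'k)"
    using fin c by (simp add: a)
next
  fix a assume "a \<in> carrier G \<times> carrier G"
  thus "bcop (D_bialg G) a \<in> (fspan {(b, c). b \<in> carrier G \<times> carrier G \<and> c \<in> carrier G \<times> carrier G \<and>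
     D_dl G b = D_dl G a \<and> snd b = D_dl G c \<and> snd c = snd a} :: (_ \<Rightarrow>\<^sub>0 'k) set)"
    by (auto simp: D_bialg_def D_dl_def inv_mult_group m_assoc intro!: sum_in_fspan)
next
  fix h a assume "h \<in> carrier G" "a \<in> carrier G \<times> carrier G"
  then obtain g k where a: "a = (g, k)" and c: "g \<in> carrier G" "k \<in> carrier G" "h \<in> carrier G" by auto
  have "h \<otimes> (g \<otimes> inv h) = \<one> \<longleftrightarrow> g = \<one>"
    using c by (metis cancel_inv_left inv_closed inv_equality inv_inv l_cancel_one' m_assoc m_closed r_inv r_one)
  thus "linf (beps (D_bialg G)) (lin (D_ra G h) (D_la G h a)) = (beps (D_bialg G) a :: 'k)"
    using c by (simp add: a D_bialg_def D_ra_def D_la_def m_assoc)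
qed (auto simp: D_la_def D_ra_def D_dl_def D_bialg_def inv_mult_group m_assoc split: if_splits)

lemma D_coquasi:
  assumes fin: "finite (carrier G)"
  shows "crossed_coquasi G (D_space G) (D_bialg G :: (_, 'k::field) bialg) (D_la G) (D_ra G) (D_dl G) snd"
proof -
  interpret crossed_coalgebra G "carrier G \<times> carrier G" "D_la G" "D_ra G" "D_dl G" snd
    "bcop (D_bialg G)" "beps (D_bialg G) :: _ \<Rightarrow> 'k"
    by (rule D_coalgebra[OF fin])
  interpret crossed_coalgebra G "basis (D_space G :: (_, 'k) pspace)" "D_la G" "D_ra G" "D_dl G" snd
    "bcop (D_bialg G)" "beps (D_bialg G) :: _ \<Rightarrow> 'k"
    using crossed_coalgebra_axioms by simp
  show ?thesis
  proof unfold_locales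
    fix a b assume "a \<in> basis (D_space G :: (_, 'k) pspace)" "b \<in> basis (D_space G :: (_, 'k) pspace)"
    then obtain g h u v where ab: "a = (g, h)" "b = (u, v)"
      and c: "g \<in> carrier G" "h \<in> carrier G" "u \<in> carrier G" "v \<in> carrier G" by auto
    have "lin (bcop (D_bialg G)) (bmul (D_bialg G) (a, b)) = (if g = u then
       \<Sum>f\<in>carrier G. bvec ((f, inv f \<otimes> g \<otimes> h \<otimes> v \<otimes> inv g \<otimes> f), (inv f \<otimes> g, h \<otimes> v)) else 0 :: _ \<Rightarrow>\<^sub>0 'k)"
      using c by (auto simp: ab D_bialg_def m_assoc)
    \<comment> \<open>The product of the two coproducts is a double sum in which the delta functions
      of the first legs force \<open>f = k\<close>.\<close>
    also have "\<dots> = (\<Sum>f\<in>carrier G. \<Sum>k\<in>carrier G. if f = k then if g = u then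
       bvec ((f, inv f \<otimes> g \<otimes> h \<otimes> v \<otimes> inv g \<otimes> f), (inv f \<otimes> g, h \<otimes> v)) else 0 else 0)"
      using fin by simp
    also have "\<dots> = lin (\<lambda>(a1, a2). lin (\<lambda>(b1, b2). tensor (bmul (D_bialg G) (a1, b1)) (bmul (D_bialg G) (a2, b2)))
      (bcop (D_bialg G) b)) (bcop (D_bialg G) a)"
      using c by (auto simp: ab D_bialg_def lin_sum lin_fun_sum m_assoc intro!: sum.cong)
    finally show "lin (bcop (D_bialg G)) (bmul (D_bialg G) (a, b)) = lin (\<lambda>(a1, a2). lin (\<lambda>(b1, b2).
       tensor (bmul (D_bialg G) (a1, b1)) (bmul (D_bialg G) (a2, b2)))
      (bcop (D_bialg G) b)) (bcop (D_bialg G) a :: _ \<Rightarrow>\<^sub>0 'k)" .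
    show "lin (\<lambda>c. bmul (D_bialg G) (a, c)) (D_la G (inv (D_dl G a)) b) -
       lin (\<lambda>c. bmul (D_bialg G) (c, a)) (D_ra G (snd a) b) \<in> null (D_space G :: (_, 'k) pspace)"
    \<comment> \<open>Both products are nonzero exactly for \<open>u = g \<otimes> h\<close>, and
      there they agree.\<close>
    proof (cases "u = g \<otimes> h")
      case True
      thus ?thesis using c by (simp add: ab D_bialg_def D_la_def D_ra_def D_dl_def inv_mult_group m_assoc)
    next
      case False
      have "g \<noteq> g \<otimes> (inv h \<otimes> (inv g \<otimes> u))"
      proof
        assume "g = g \<otimes> (inv h \<otimes> (inv g \<otimes> u))"
        hence "g \<otimes> h = g \<otimes> h \<otimes> (inv g \<otimes> (g \<otimes> (inv h \<otimes> (inv g \<otimes> u))))" using c by simp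
        thus False using False c by (simp add: m_assoc)
      qed
      moreover have "u \<otimes> inv h \<noteq> g"
        using False c by (auto simp: m_assoc)
      ultimately show ?thesis
        using c by (simp add: ab D_bialg_def D_la_def D_ra_def D_dl_def inv_mult_group m_assoc)
    qed
  next
    have "lin (bcop (D_bialg G)) (bone (D_bialg G)) = (\<Sum>g\<in>carrier G. \<Sum>f\<in>carrier G.
       bvec ((f, \<one>), (inv f \<otimes> g, \<one>)) :: _ \<Rightarrow>\<^sub>0 'k)"
      by (auto simp: D_bialg_def lin_sum m_assoc intro!: sum.cong)
    also have "\<dots> = (\<Sum>f\<in>carrier G. \<Sum>g\<in>carrier G. (\<lambda>g. bvec ((f, \<one>), (inv f \<otimes> g, \<one>))) g)"
      by (rule sum.swap)
    also have "\<dots> = (\<Sum>f\<in>carrier G. \<Sum>g\<in>carrier G. (\<lambda>g. bvec ((f, \<one>), (inv f \<otimes> g, \<one>))) (f \<otimes> g))"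
      by (rule sum.cong[OF refl sum_mult_left[symmetric]])
    also have "\<dots> = (\<Sum>f\<in>carrier G. \<Sum>g\<in>carrier G. bvec ((f, \<one>), (g, \<one>)))"
      by (intro sum.cong refl) simp
    also have "\<dots> = (\<Sum>g\<in>carrier G. \<Sum>f\<in>carrier G. bvec ((f, \<one>), (g, \<one>)))"
      by (rule sum.swap)
    also have "\<dots> = tensor (bone (D_bialg G)) (bone (D_bialg G))"
      by (simp add: D_bialg_def tensor_sum_left tensor_sum_right)
    finally show "lin (bcop (D_bialg G)) (bone (D_bialg G)) = (tensor (bone (D_bialg G)) (bone (D_bialg G)) :: _ \<Rightarrow>\<^sub>0 'k)" .
  next
    fix h assume h: "h \<in> carrier G"
    show "lin (D_la G h) (bone (D_bialg G)) = (bone (D_bialg G) :: _ \<Rightarrow>\<^sub>0 'k)"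
      using sum_mult_left[OF h, of "\<lambda>g. bvec (g, \<one>) :: _ \<Rightarrow>\<^sub>0 'k"] by (simp add: D_bialg_def lin_sum D_la_def)
    show "lin (D_ra G h) (bone (D_bialg G)) = (bone (D_bialg G) :: _ \<Rightarrow>\<^sub>0 'k)"
      using sum_mult_right[of "inv h", of "\<lambda>g. bvec (g, \<one>) :: _ \<Rightarrow>\<^sub>0 'k"] h by (simp add: D_bialg_def lin_sum D_ra_def)
  next
    fix h a b assume "h \<in> carrier G" "a \<in> basis (D_space G :: (_, 'k) pspace)" "b \<in> basis (D_space G :: (_, 'k) pspace)"
    thus "lin (D_ra G h) (bmul (D_bialg G) (a, b)) = (lin (bmul (D_bialg G)) (tensor (D_ra G h a) (D_ra G h b)) :: _ \<Rightarrow>\<^sub>0 'k)"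
      by (auto simp: D_ra_def D_bialg_def inv_mult_group m_assoc)
  next
    fix a assume "a \<in> basis (D_space G :: (_, 'k) pspace)"
    then obtain g h where a: "a = (g, h)" and c: "g \<in> carrier G" "h \<in> carrier G" by auto
    have "lin (bmul (D_bialg G)) (tensor (bone (D_bialg G)) (bvec a)) = (\<Sum>f\<in>carrier G. if f = g then bvec (g, h) else 0 :: _ \<Rightarrow>\<^sub>0 'k)"
      using c by (auto simp: a D_bialg_def tensor_sum_left lin_sum intro!: sum.cong)
    thus "lin (bmul (D_bialg G)) (tensor (bone (D_bialg G)) (bvec a)) = (bvec a :: _ \<Rightarrow>\<^sub>0 'k)"
      using c fin by (simp add: a)
    have "lin (bmul (D_bialg G)) (tensor (bvec a) (bone (D_bialg G))) = (\<Sum>f\<in>carrier G. if f = g then bvec (g, h) else 0 :: _ \<Rightarrow>\<^sub>0 'k)"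
      using c by (auto simp: a D_bialg_def tensor_sum_right lin_sum intro!: sum.cong)
    thus "lin (bmul (D_bialg G)) (tensor (bvec a) (bone (D_bialg G))) = (bvec a :: _ \<Rightarrow>\<^sub>0 'k)"
      using c fin by (simp add: a)
  next
    show "linf (beps (D_bialg G)) (bone (D_bialg G)) = (1 :: 'k)"
      using fin by (simp add: D_bialg_def linf_sum)
  qed (auto simp: D_la_def D_ra_def D_dl_def D_bialg_def m_assoc inv_mult_group pspace_ok_def
       fv.subspace_0 intro!: sum_in_fspan)
qed

end

section \<open>The canonical map to the quantum double\<close>

lemma BD_simps [simp]:
  "basis (BD_xmod G) = carrier G \<times> carrier G" "null (BD_xmod G) = {0}"
  "act (BD_xmod G) f (g, h) = bvec (f \<otimes>\<^bsub>G\<^esub> g \<otimes>\<^bsub>G\<^esub> inv\<^bsub>G\<^esub> f, f \<otimes>\<^bsub>G\<^esub> h \<otimes>\<^bsub>G\<^esub> inv\<^bsub>G\<^esub> f)"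
  "deg (BD_xmod G) (g, h) = g \<otimes>\<^bsub>G\<^esub> inv\<^bsub>G\<^esub> h \<otimes>\<^bsub>G\<^esub> inv\<^bsub>G\<^esub> g \<otimes>\<^bsub>G\<^esub> h"
  by (simp_all add: BD_xmod_def)

context crossed_bialgebra
begin

definition toD :: "'b \<Rightarrow> ('a \<times> 'a \<Rightarrow>\<^sub>0 'k)" where
  "toD a = (\<Sum>g\<in>carrier G. scale (linf (beps H) (la (inv g) a)) (bvec (g, dr a)))"

lemma lin_toD: "lin F (toD a) = (\<Sum>g\<in>carrier G. scale (linf (beps H) (la (inv g) a)) (F (g, dr a)))"
  by (simp add: toD_def lin_sum lin_scale)

lemma linf_toD: "linf F (toD a) = (\<Sum>g\<in>carrier G. linf (beps H) (la (inv g) a) * F (g, dr a))"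
  by (simp add: toD_def linf_sum linf_scale)

lemma toD_in [simp]: "a \<in> basis V \<Longrightarrow> toD a \<in> fspan (carrier G \<times> carrier G)"
  unfolding toD_def by (auto intro!: sum_in_fspan scale_in_fspan)

text \<open>The coefficient of \<open>\<delta>\<^sub>g \<otimes> h\<close> vanishes unless \<open>h = dr a\<close> equals \<open>g\<^sup>-\<^sup>1 (dl a) g\<close>.\<close>

lemma toD_coeff_cong:
  assumes "a \<in> basis V" "\<And>g. g \<in> carrier G \<Longrightarrow> inv g \<otimes> dl a \<otimes> g = dr a \<Longrightarrow> x g = y g"
  shows "(\<Sum>g\<in>carrier G. scale (linf (beps H) (la (inv g) a)) (x g))
    = (\<Sum>g\<in>carrier G. scale (linf (beps H) (la (inv g) a)) (y g))"
proof (rule sum.cong[OF refl])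
  fix g assume g: "g \<in> carrier G"
  show "scale (linf (beps H) (la (inv g) a)) (x g) = scale (linf (beps H) (la (inv g) a)) (y g)"
    using eps_la_deg[of "inv g" a] assms g by (cases "linf (beps H) (la (inv g) a) = 0") auto
qed

text \<open>With a common right degree the group entry is constant, and only the counit coefficients
  depend on \<open>x\<close>.\<close>

lemma toD_homog:
  assumes "x \<in> fspan {a \<in> basis V. dr a = v}"
  shows "lin toD x = (\<Sum>g\<in>carrier G. scale (linf (beps H) (lin (la (inv g)) x)) (bvec (g, v)))"
proof -
  have "lin toD x = lin (\<lambda>a. \<Sum>g\<in>carrier G. scale (linf (beps H) (la (inv g) a)) (bvec (g, v))) x"
    by (rule fspan_lin_cong[OF assms]) (auto simp: toD_def)
  thus ?thesis by (simp add: lin_fun_sum lin_scale_fun_const linf_lin)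
qed

lemma toD_null:
  assumes "x \<in> null V"
  shows "lin toD x = 0"
proof -
  have "lin toD x \<in> {0}"
  proof (rule null_deg_subspace[OF _ assms])
    fix x u v assume x: "x \<in> null V" "x \<in> fspan {b \<in> basis V. dl b = u \<and> dr b = v}"
    have "x \<in> fspan {a \<in> basis V. dr a = v}" using x(2) by (auto simp: fspan_def)
    thus "lin toD x \<in> {0}" using x(1) by (simp add: toD_homog null_la null_eps)
  qed simp
  thus ?thesis by simp
qed

text \<open>Each coefficient is multiplicative, since \<open>la\<close> acts by algebra maps and the
  counit is one; products in \<open>k(G)\<close> are pointwise.\<close>

lemma toD_mul:
  assumes ab: "a \<in> basis V" "b \<in> basis V"
  shows "lin toD (bmul H (a, b)) = lin (bmul (D_bialg G)) (tensor (toD a) (toD b))"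
proof -
  let ?c = "\<lambda>g x. linf (beps H) (la (inv g) x)"
  have "bmul H (a, b) \<in> fspan {c \<in> basis V. dr c = dr a \<otimes> dr b}"
    using mul_deg[OF ab] by (auto simp: fspan_def)
  hence "lin toD (bmul H (a, b)) = (\<Sum>g\<in>carrier G. scale (?c g a * ?c g b) (bvec (g, dr a \<otimes> dr b)))"
    using ab by (simp add: toD_homog eps_la_mul)
  also have "\<dots> = (\<Sum>g\<in>carrier G. \<Sum>u\<in>carrier G.
      if u = g then scale (?c g a * ?c u b) (bvec (g, dr a \<otimes> dr b)) else 0)"
    using fin by simp
  also have "\<dots> = lin (bmul (D_bialg G)) (tensor (toD a) (toD b))"
    by (auto simp: lin_tensor lin_toD D_bialg_def scale_sum_right intro!: sum.cong)
  finally show ?thesis .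
qed

lemma toD_one: "lin toD (bone H) = bone (D_bialg G)"
proof -
  have "bone H \<in> fspan {c \<in> basis V. dr c = \<one>}"
    using one_deg by (auto simp: fspan_def)
  thus ?thesis by (simp add: toD_homog la_unit eps_one D_bialg_def)
qed

lemma toD_eps:
  assumes "a \<in> basis V"
  shows "linf (beps (D_bialg G)) (toD a) = beps H a"
proof -
  have "linf (beps (D_bialg G)) (toD a) = (\<Sum>g\<in>carrier G. if g = \<one> then linf (beps H) (la (inv g) a) else 0)"
    by (auto simp: linf_toD D_bialg_def intro!: sum.cong)
  thus ?thesis using assms fin by (simp add: la_one)
qed

text \<open>On the support of the coefficient of \<open>c\<close>, the inner degree
  \<open>dr b = dl c\<close> is \<open>k \<otimes> dr a \<otimes> inv k\<close>. The two
  coefficients then merge by \<open>eps_la_la\<close>, and the substitution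
  \<open>u = f \<otimes> k\<close> gives the coproduct of the double.\<close>

lemma toD_cop:
  assumes a: "a \<in> basis V"
  shows "lin (tmap toD toD) (bcop H a) = lin (bcop (D_bialg G)) (toD a)"
proof -
  let ?c = "\<lambda>g x. linf (beps H) (la (inv g) x)"
  let ?B = "\<lambda>f k. bvec ((f, k \<otimes> dr a \<otimes> inv k), (k, dr a))"
  have "lin (tmap toD toD) (bcop H a) = lin (\<lambda>(b, c). \<Sum>f\<in>carrier G. scale (?c f b)
      (\<Sum>k\<in>carrier G. scale (?c k c) (bvec ((f, dr b), (k, dr c))))) (bcop H a)"
    by (simp add: tmap_def tensor_def lin_toD)
  also have "\<dots> = lin (\<lambda>(b, c). \<Sum>f\<in>carrier G. scale (?c f b) (\<Sum>k\<in>carrier G. scale (?c k c) (?B f k))) (bcop H a)"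
  proof (rule cop_cong[OF a])
    fix b c assume bc: "b \<in> basis V" "c \<in> basis V" "dr b = dl c" "dr c = dr a"
    have inner: "(\<Sum>k\<in>carrier G. scale (?c k c) (bvec ((f, dr b), (k, dr c)))) =
      (\<Sum>k\<in>carrier G. scale (?c k c) (?B f k))" for f
    proof (rule toD_coeff_cong[OF bc(2)])
      fix k assume k: "k \<in> carrier G" and e: "inv k \<otimes> dl c \<otimes> k = dr c"
      have "k \<otimes> dr c \<otimes> inv k = dl c"
        unfolding e[symmetric] using k bc(2) by (simp add: m_assoc)
      thus "bvec ((f, dr b), (k, dr c)) = ?B f k" using bc by simp
    qed
    show "(\<Sum>f\<in>carrier G. scale (?c f b) (\<Sum>k\<in>carrier G. scale (?c k c) (bvec ((f, dr b), (k, dr c))))) =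
      (\<Sum>f\<in>carrier G. scale (?c f b) (\<Sum>k\<in>carrier G. scale (?c k c) (?B f k)))"
      unfolding inner ..
  qed
  also have "\<dots> = (\<Sum>f\<in>carrier G. \<Sum>k\<in>carrier G. scale (linf (\<lambda>(b, c). ?c f b * ?c k c) (bcop H a)) (?B f k))"
    by (simp add: case_prod_unfold scale_sum_right lin_fun_sum lin_scale_fun_const)
  also have "\<dots> = (\<Sum>f\<in>carrier G. \<Sum>k\<in>carrier G. scale (linf (beps H) (la (inv k \<otimes> inv f) a)) (?B f k))"
    using a by (simp add: eps_la_la)
  also have "\<dots> = (\<Sum>f\<in>carrier G. \<Sum>k\<in>carrier G.
      (\<lambda>u. scale (?c u a) (bvec ((f, inv f \<otimes> u \<otimes> dr a \<otimes> inv u \<otimes> f), (inv f \<otimes> u, dr a)))) (f \<otimes> k))"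
    using a by (intro sum.cong refl) (simp add: inv_mult_group m_assoc)
  also have "\<dots> = (\<Sum>f\<in>carrier G. \<Sum>u\<in>carrier G.
      scale (?c u a) (bvec ((f, inv f \<otimes> u \<otimes> dr a \<otimes> inv u \<otimes> f), (inv f \<otimes> u, dr a))))"
    by (rule sum.cong[OF refl sum_mult_left])
  also have "\<dots> = (\<Sum>u\<in>carrier G. \<Sum>f\<in>carrier G.
      scale (?c u a) (bvec ((f, inv f \<otimes> u \<otimes> dr a \<otimes> inv u \<otimes> f), (inv f \<otimes> u, dr a))))"
    by (rule sum.swap)
  also have "\<dots> = lin (bcop (D_bialg G)) (toD a)"
    by (simp add: lin_toD D_bialg_def scale_sum_right)
  finally show ?thesis .
qed

text \<open>\<open>D_R\<close> selects \<open>g = \<one>\<close> and \<open>u = dr a\<close>. This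
  yields \<open>dr a\<close> where \<open>canon_R\<close> has \<open>dl a\<close>; the two agree
  when the counit of \<open>a\<close> is nonzero.\<close>

lemma toD_R:
  assumes ab: "a \<in> basis V" "b \<in> basis V"
  shows "linf (D_R G) (tensor (toD a) (toD b)) = canon_R (a, b)"
proof -
  let ?c = "\<lambda>g x. linf (beps H) (la (inv g) x)"
  have "linf (D_R G) (tensor (toD a) (toD b)) = (\<Sum>g\<in>carrier G. if g = \<one> then
      (\<Sum>u\<in>carrier G. if u = dr a then ?c g a * ?c u b else 0) else 0)"
    by (auto simp: linf_tensor linf_toD D_R_def sum_distrib_left intro!: sum.cong)
  also have "\<dots> = beps H a * ?c (dr a) b"
    using ab fin by (simp add: la_one)
  also have "\<dots> = canon_R (a, b)"
    using ab eps_deg[of a] by (cases "beps H a = 0") (auto simp: canon_R_def)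
  finally show ?thesis .
qed

lemma bialgebra_hom_toD: "bialgebra_hom V H (D_space G) (D_bialg G) toD"
  unfolding bialgebra_hom_def lmap_def
  by (auto simp: toD_null toD_one toD_mul toD_cop toD_eps eqv_def fv.subspace_0)

text \<open>The substitution of \<open>h \<otimes> g \<otimes> inv h\<close> for \<open>g\<close>
  lets \<open>ad h\<close> pass the left action by \<open>ad_la\<close>, after which
  \<open>eps_inv\<close> removes it.\<close>

lemma toD_ad:
  assumes h: "h \<in> carrier G" and a: "a \<in> basis V"
  shows "lin toD (ad h a) = lin (act (BD_xmod G) h) (toD a)"
proof -
  let ?c = "\<lambda>g x. linf (beps H) (la (inv g) x)"
  have "ad h a \<in> fspan {b \<in> basis V. dr b = h \<otimes> dr a \<otimes> inv h}"
    using ad_deg[OF h a] by (auto simp: fspan_def)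
  hence "lin toD (ad h a) = (\<Sum>g\<in>carrier G. scale (linf (beps H) (lin (la (inv g)) (ad h a))) (bvec (g, h \<otimes> dr a \<otimes> inv h)))"
    by (rule toD_homog)
  also have "\<dots> = (\<Sum>g\<in>carrier G. (\<lambda>g. scale (linf (beps H) (lin (la (inv g)) (ad h a))) (bvec (g, h \<otimes> dr a \<otimes> inv h))) (h \<otimes> g \<otimes> inv h))"
    by (rule sum_conj[OF h, symmetric])
  also have "\<dots> = (\<Sum>g\<in>carrier G. scale (?c g a) (bvec (h \<otimes> g \<otimes> inv h, h \<otimes> dr a \<otimes> inv h)))"
  proof (intro sum.cong refl)
    fix g assume g: "g \<in> carrier G"
    have "linf (beps H) (lin (la (inv (h \<otimes> g \<otimes> inv h))) (ad h a)) = linf (beps H) (lin (ad h) (la (inv g) a))"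
      using g h a by (simp add: ad_la inv_conj)
    also have "\<dots> = ?c g a"
      unfolding linf_lin[of _ "ad h"]
      by (rule fspan_linf_cong[OF la_in]) (use g h a in \<open>auto simp: ad_def eps_inv\<close>)
    finally show "(\<lambda>g. scale (linf (beps H) (lin (la (inv g)) (ad h a))) (bvec (g, h \<otimes> dr a \<otimes> inv h))) (h \<otimes> g \<otimes> inv h)
      = scale (?c g a) (bvec (h \<otimes> g \<otimes> inv h, h \<otimes> dr a \<otimes> inv h))" by simp
  qed
  also have "\<dots> = lin (act (BD_xmod G) h) (toD a)"
    by (simp add: lin_toD BD_xmod_def)
  finally show ?thesis .
qed

text \<open>On the support, \<open>dl a\<close> is \<open>dr a\<close> conjugated by
  \<open>g\<close>, which turns \<open>gdeg a\<close> into the degree of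
  \<open>BD(G)\<close>.\<close>

lemma toD_gdeg:
  assumes a: "a \<in> basis V"
  shows "toD a \<in> fspan {(g, h) \<in> carrier G \<times> carrier G. g \<otimes> inv h \<otimes> inv g \<otimes> h = gdeg a}"
proof -
  let ?P = "\<lambda>g. g \<otimes> inv (dr a) \<otimes> inv g \<otimes> dr a = gdeg a"
  have "toD a = (\<Sum>g\<in>carrier G. scale (linf (beps H) (la (inv g) a)) (if ?P g then bvec (g, dr a) else 0))"
    unfolding toD_def
  proof (rule toD_coeff_cong[OF a])
    fix g assume g: "g \<in> carrier G" and d: "inv g \<otimes> dl a \<otimes> g = dr a"
    have "?P g"
      using g a by (simp add: gdeg_def inv_mult_group m_assoc flip: d)
    thus "bvec (g, dr a) = (if ?P g then bvec (g, dr a) else 0)" by simp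
  qed
  also have "\<dots> \<in> fspan {(g, h) \<in> carrier G \<times> carrier G. g \<otimes> inv h \<otimes> inv g \<otimes> h = gdeg a}"
    using a by (auto intro!: sum_in_fspan scale_in_fspan)
  finally show ?thesis .
qed

text \<open>The twist replaces \<open>inv g\<close> by \<open>inv g \<otimes> gdeg a\<close> in the
  coefficient of \<open>b\<close>. On the support of \<open>a\<close> this is the inverse of
  \<open>inv (dr a) \<otimes> g \<otimes> dr a\<close>, and the resulting condition on
  \<open>u\<close> is that of the product of \<open>BD(G)\<close>.\<close>

lemma toD_trmul:
  assumes ab: "a \<in> basis V" "b \<in> basis V"
  shows "lin toD (trmul (a, b)) = lin (bmul (BD_bialg G)) (tensor (toD a) (toD b))"
proof -
  let ?c = "\<lambda>g x. linf (beps H) (la (inv g) x)"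
  have d: "bmul H (a, c) \<in> fspan {d \<in> basis V. dr d = dr a \<otimes> dr c}" if "c \<in> basis V" for c
    using mul_deg[OF ab(1) that] by (auto simp: fspan_def)
  have "lin toD (trmul (a, b)) = lin (\<lambda>c. lin toD (bmul H (a, c))) (la (gdeg a) b)"
    by (simp add: trmul_def lin_lin lin_tensor)
  also have "\<dots> = lin (\<lambda>c. \<Sum>g\<in>carrier G. scale (?c g c) (scale (?c g a) (bvec (g, dr a \<otimes> dr b)))) (la (gdeg a) b)"
    by (rule fspan_lin_cong[OF la_deg])
      (use ab in \<open>auto simp: toD_homog[OF d] eps_la_mul mult.commute intro!: sum.cong\<close>)
  also have "\<dots> = (\<Sum>g\<in>carrier G. scale (?c g a) (scale (linf (beps H) (la (inv g \<otimes> gdeg a) b)) (bvec (g, dr a \<otimes> dr b))))"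
    using ab by (simp add: lin_fun_sum lin_scale_fun_const la_mult mult.commute linf_fun_mult_right flip: linf_lin)
  also have "\<dots> = (\<Sum>g\<in>carrier G. scale (?c g a) (\<Sum>u\<in>carrier G. scale (?c u b)
      (if u = inv (dr a) \<otimes> g \<otimes> dr a then bvec (g, dr a \<otimes> dr b) else 0)))"
  proof (rule toD_coeff_cong[OF ab(1)])
    fix g assume g: "g \<in> carrier G" and e: "inv g \<otimes> dl a \<otimes> g = dr a"
    have "inv g \<otimes> gdeg a = inv (inv (dr a) \<otimes> g \<otimes> dr a)"
      using g ab by (simp add: gdeg_def inv_mult_group m_assoc flip: e)
    moreover have "(\<Sum>u\<in>carrier G. scale (?c u b) (if u = inv (dr a) \<otimes> g \<otimes> dr a then bvec (g, dr a \<otimes> dr b) else 0))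
      = (\<Sum>u\<in>carrier G. if u = inv (dr a) \<otimes> g \<otimes> dr a then scale (?c u b) (bvec (g, dr a \<otimes> dr b)) else 0)"
      by (rule sum.cong) auto
    ultimately show "scale (linf (beps H) (la (inv g \<otimes> gdeg a) b)) (bvec (g, dr a \<otimes> dr b)) =
      (\<Sum>u\<in>carrier G. scale (?c u b) (if u = inv (dr a) \<otimes> g \<otimes> dr a then bvec (g, dr a \<otimes> dr b) else 0))"
      using g ab fin by simp
  qed
  also have "\<dots> = lin (bmul (BD_bialg G)) (tensor (toD a) (toD b))"
  proof -
    have *: "u = inv (dr a) \<otimes> g \<otimes> dr a \<longleftrightarrow> g = dr a \<otimes> u \<otimes> inv (dr a)" if "g \<in> carrier G" "u \<in> carrier G" for g u
      using that ab by (auto simp: m_assoc)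
    show ?thesis
      unfolding lin_tensor lin_toD
      by (intro sum.cong refl arg_cong2[where f = scale]) (simp add: * BD_bialg_def D_bialg_def)
  qed
  finally show ?thesis .
qed

section \<open>The canonical map and the transmutation formulas\<close>

lemma crossed_hom_toD: "crossed_hom G trX (BD_xmod G) toD"
proof -
  have "toD a \<in> homog (BD_xmod G) (gdeg a)" if "a \<in> basis V" for a
  proof -
    have "{(g, h) \<in> carrier G \<times> carrier G. g \<otimes> inv h \<otimes> inv g \<otimes> h = gdeg a}
      = {b \<in> basis (BD_xmod G :: ('a, _, 'k) xmod). deg (BD_xmod G :: ('a, _, 'k) xmod) b = gdeg a}"
      by auto
    with toD_gdeg[OF that] show ?thesis
      unfolding homog_def by (auto simp: eqv_def intro!: bexI[of _ "toD a"])
  qed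
  thus ?thesis
    unfolding crossed_hom_def lmap_def by (auto simp: toD_null toD_ad eqv_def)
qed

text \<open>The antipode inverts the delta index of \<open>a\<close>, so the product forces
  \<open>u = inv g\<close>. The support condition turns
  \<open>g \<otimes> inv (dr a) \<otimes> inv g\<close> into \<open>inv (dl a)\<close>, which no
  longer depends on \<open>g\<close>.\<close>

lemma adj_part_toD:
  assumes U: "\<And>a. a \<in> basis V \<Longrightarrow> U a = toD a" and ab: "a \<in> basis V" "b \<in> basis V"
  shows "adj_part G U a b = (\<Sum>g\<in>carrier G.
    scale (linf (beps H) (la g a) * linf (beps H) (la (inv g) b)) (bvec (g, inv (dl a) \<otimes> dr b)))"
proof -
  let ?c = "\<lambda>g x. linf (beps H) (la (inv g) x)"
  have "adj_part G U a b = (\<Sum>g\<in>carrier G. scale (?c g a) (\<Sum>u\<in>carrier G. scale (?c u b)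
      (if u = inv g then bvec (inv g, g \<otimes> inv (dr a) \<otimes> inv g \<otimes> dr b) else 0)))"
    unfolding adj_part_def using ab
    by (auto simp: U lin_tensor lin_toD D_antipode_def D_bialg_def lin_sum lin_scale intro!: sum.cong)
  also have "\<dots> = (\<Sum>g\<in>carrier G. scale (?c g a) (scale (linf (beps H) (la g b))
      (bvec (inv g, g \<otimes> inv (dr a) \<otimes> inv g \<otimes> dr b))))"
  proof (intro sum.cong refl arg_cong2[where f = scale])
    fix g assume g: "g \<in> carrier G"
    have "(\<Sum>u\<in>carrier G. scale (?c u b) (if u = inv g then bvec (inv g, g \<otimes> inv (dr a) \<otimes> inv g \<otimes> dr b) else 0))
      = (\<Sum>u\<in>carrier G. if u = inv g then scale (?c u b) (bvec (inv g, g \<otimes> inv (dr a) \<otimes> inv g \<otimes> dr b)) else 0)"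
      by (rule sum.cong) auto
    thus "(\<Sum>u\<in>carrier G. scale (?c u b) (if u = inv g then bvec (inv g, g \<otimes> inv (dr a) \<otimes> inv g \<otimes> dr b) else 0)) =
      scale (linf (beps H) (la g b)) (bvec (inv g, g \<otimes> inv (dr a) \<otimes> inv g \<otimes> dr b))"
      using g fin by simp
  qed
  also have "\<dots> = (\<Sum>g\<in>carrier G. scale (?c g a) (scale (linf (beps H) (la g b))
      (bvec (inv g, inv (dl a) \<otimes> dr b))))"
  proof (rule toD_coeff_cong[OF ab(1)])
    fix g assume g: "g \<in> carrier G" and e: "inv g \<otimes> dl a \<otimes> g = dr a"
    have "g \<otimes> inv (dr a) \<otimes> inv g = inv (dl a)"
      using g ab by (simp add: inv_mult_group m_assoc flip: e)
    thus "scale (linf (beps H) (la g b)) (bvec (inv g, g \<otimes> inv (dr a) \<otimes> inv g \<otimes> dr b)) =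
      scale (linf (beps H) (la g b)) (bvec (inv g, inv (dl a) \<otimes> dr b))" by simp
  qed
  also have "\<dots> = (\<Sum>g\<in>carrier G. (\<lambda>g. scale (linf (beps H) (la g a)) (scale (?c g b)
      (bvec (g, inv (dl a) \<otimes> dr b)))) (inv g))"
    by (rule sum.cong) auto
  also have "\<dots> = (\<Sum>g\<in>carrier G. scale (linf (beps H) (la g a)) (scale (?c g b)
      (bvec (g, inv (dl a) \<otimes> dr b))))"
    by (rule sum_inv)
  finally show ?thesis by simp
qed

lemma lin_cop3: "lin (\<lambda>((a1, a2), a3). F a1 a2 a3) (cop3 H a) =
    lin (\<lambda>(x, a3). lin (\<lambda>(a1, a2). F a1 a2 a3) (bcop H x)) (bcop H a)"
  by (simp add: cop3_def lin_lin tmap_def case_prod_unfold lin_tensor)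

text \<open>Contracting \<open>a1\<close> leaves \<open>la g\<close> and contracting
  \<open>a3\<close> leaves \<open>ra g\<close> on the middle leg; together they are
  \<open>ad g\<close>. The outer degrees of \<open>a1\<close> and \<open>a3\<close> are those of
  \<open>a\<close> and combine to \<open>gdeg a\<close>.\<close>

lemma transmuted_coaction_toD:
  assumes U: "\<And>a. a \<in> basis V \<Longrightarrow> U a = toD a" and a: "a \<in> basis V"
  shows "transmuted_coaction G H U a = crossed_coaction G trX a"
proof -
  let ?c = "\<lambda>g x. linf (beps H) (la g x)"
  let ?T = "\<lambda>g c. bvec (c, (g, gdeg a))"
  have "transmuted_coaction G H U a = lin (\<lambda>(x, a3). lin (\<lambda>(a1, a2). tensor (bvec a2) (adj_part G U a1 a3))
      (bcop H x)) (bcop H a)"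
    by (simp add: transmuted_coaction_def lin_cop3)
  also have "\<dots> = lin (\<lambda>(x, a3). \<Sum>g\<in>carrier G. scale (?c (inv g) a3) (lin (\<lambda>c. ?T g c) (la g x))) (bcop H a)"
  proof (rule cop_cong[OF a])
    fix x a3 assume x: "x \<in> basis V" "a3 \<in> basis V" "dl x = dl a" "dr a3 = dr a"
    have "lin (\<lambda>(a1, a2). tensor (bvec a2) (adj_part G U a1 a3)) (bcop H x)
      = lin (\<lambda>(a1, a2). \<Sum>g\<in>carrier G. scale (?c (inv g) a3) (scale (?c g a1) (?T g a2))) (bcop H x)"
      by (rule cop_cong[OF x(1)])
        (use x in \<open>simp add: adj_part_toD[OF U] tensor_sum_right tensor_scale_right gdeg_def mult.commute\<close>)
    also have "\<dots> = (\<Sum>g\<in>carrier G. scale (?c (inv g) a3) (lin (\<lambda>(a1, a2). scale (?c g a1) (?T g a2)) (bcop H x)))"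
      by (simp add: case_prod_unfold lin_fun_sum lin_fun_scale[symmetric])
    also have "\<dots> = (\<Sum>g\<in>carrier G. scale (?c (inv g) a3) (lin (\<lambda>c. ?T g c) (la g x)))"
      by (intro sum.cong refl arg_cong2[where f = scale] contract_left x)
    finally show "lin (\<lambda>(a1, a2). tensor (bvec a2) (adj_part G U a1 a3)) (bcop H x) =
      (\<Sum>g\<in>carrier G. scale (?c (inv g) a3) (lin (\<lambda>c. ?T g c) (la g x)))" .
  qed
  also have "\<dots> = (\<Sum>g\<in>carrier G. lin (\<lambda>(x, a3). scale (?c (inv g) a3) (lin (\<lambda>c. ?T g c) (la g x))) (bcop H a))"
    by (simp add: case_prod_unfold lin_fun_sum)
  also have "\<dots> = (\<Sum>g\<in>carrier G. lin (\<lambda>x. lin (\<lambda>c. ?T g c) (la g x)) (ra g a))"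
  proof (intro sum.cong refl)
    fix g assume "g \<in> carrier G"
    thus "lin (\<lambda>(x, a3). scale (?c (inv g) a3) (lin (\<lambda>c. ?T g c) (la g x))) (bcop H a) =
        lin (\<lambda>x. lin (\<lambda>c. ?T g c) (la g x)) (ra g a)"
      using contract_right[of "inv g" a "\<lambda>x. lin (\<lambda>c. ?T g c) (la g x)"] a by simp
  qed
  also have "\<dots> = (\<Sum>g\<in>carrier G. lin (\<lambda>c. ?T g c) (ad g a))"
    using a by (intro sum.cong refl) (simp add: ad_def la_ra flip: lin_lin)
  also have "\<dots> = crossed_coaction G trX a"
    by (simp add: crossed_coaction_def tensor_bvec_right)
  finally show ?thesis .
qed

text \<open>Evaluation of \<open>D_R\<close> contracts both outer legs of \<open>a\<close> by the
  counit and turns the first leg of \<open>b\<close> into the twist by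
  \<open>gdeg a\<close>.\<close>

lemma transmuted_bmul_toD:
  assumes U: "\<And>a. a \<in> basis V \<Longrightarrow> U a = toD a" and ab: "a \<in> basis V" "b \<in> basis V"
  shows "bmul (transmuted_bialg G H U) (a, b) = trmul (a, b)"
proof -
  let ?Q = "\<lambda>a1 a3 b1. linf (D_R G) (tensor (adj_part G U a1 a3) (lin (D_antipode G) (U b1)))"
  \<comment> \<open>\<open>D_R\<close> keeps only \<open>g = \<one>\<close>, whence the two counits,
    and matches the group entry \<open>inv (dl a1) \<otimes> dr a3\<close> with the delta index that
    the antipode has inverted.\<close>
  have Q: "?Q a1 a3 b1 = beps H a1 * (beps H a3 * linf (beps H) (la (inv (dl a1) \<otimes> dr a3) b1))"
    if "a1 \<in> basis V" "a3 \<in> basis V" "b1 \<in> basis V" for a1 a3 b1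
  proof -
    have "?Q a1 a3 b1 = (\<Sum>g\<in>carrier G. if g = \<one> then linf (beps H) (la g a1) * linf (beps H) (la (inv g) a3) *
      (\<Sum>u\<in>carrier G. if u = inv (inv (dl a1) \<otimes> dr a3) then linf (beps H) (la (inv u) b1) else 0) else 0)"
    proof -
      have *: "inv (dl a1) \<otimes> dr a3 = inv u \<longleftrightarrow> u = inv (inv (dl a1) \<otimes> dr a3)" if "u \<in> carrier G" for u
        using that \<open>a1 \<in> basis V\<close> \<open>a3 \<in> basis V\<close> by (metis dl_in dr_in inv_closed inv_inv m_closed)
      show ?thesis
        using that
        by (auto simp: adj_part_toD[OF U] U linf_tensor linf_sum linf_scale linf_lin linf_toD D_antipode_def D_R_def *
           intro!: sum.cong)
    qed
    also have "\<dots> = beps H a1 * beps H a3 * linf (beps H) (la (inv (dl a1) \<otimes> dr a3) b1)"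
      using that fin by (simp add: la_one)
    finally show ?thesis by simp
  qed
  have "bmul (transmuted_bialg G H U) (a, b) =
    lin (\<lambda>((a1, a2), a3). lin (\<lambda>(b1, b2). scale (?Q a1 a3 b1) (bmul H (a2, b2))) (bcop H b)) (cop3 H a)"
    by (simp add: transmuted_bialg_def lin_tensor case_prod_unfold)
  also have "\<dots> = lin (\<lambda>(x, a3). lin (\<lambda>(a1, a2). lin (\<lambda>(b1, b2). scale (?Q a1 a3 b1) (bmul H (a2, b2))) (bcop H b))
     (bcop H x)) (bcop H a)"
    by (rule lin_cop3)
  also have "\<dots> = lin (\<lambda>(x, a3). scale (beps H a3) (mulv (bvec x) (la (gdeg a) b))) (bcop H a)"
  proof (rule cop_cong[OF ab(1)])
    fix x a3 assume x: "x \<in> basis V" "a3 \<in> basis V" "dl x = dl a" "dr a3 = dr a"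
    have "lin (\<lambda>(a1, a2). lin (\<lambda>(b1, b2). scale (?Q a1 a3 b1) (bmul H (a2, b2))) (bcop H b)) (bcop H x)
      = lin (\<lambda>(a1, a2). scale (beps H a1) (scale (beps H a3) (mulv (bvec a2) (la (gdeg a) b)))) (bcop H x)"
    proof (rule cop_cong[OF x(1)])
      fix a1 a2 assume a: "a1 \<in> basis V" "a2 \<in> basis V" "dl a1 = dl x"
      have "lin (\<lambda>(b1, b2). scale (?Q a1 a3 b1) (bmul H (a2, b2))) (bcop H b)
        = lin (\<lambda>(b1, b2). scale (beps H a1 * beps H a3)
             (scale (linf (beps H) (la (gdeg a) b1)) (bmul H (a2, b2)))) (bcop H b)"
        by (rule cop_cong[OF ab(2)]) (use a x in \<open>simp add: Q gdeg_def mult.assoc\<close>)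
      also have "\<dots> = scale (beps H a1 * beps H a3)
          (lin (\<lambda>(b1, b2). scale (linf (beps H) (la (gdeg a) b1)) (bmul H (a2, b2))) (bcop H b))"
        unfolding lin_fun_scale[symmetric] by (simp add: case_prod_unfold)
      also have "\<dots> = scale (beps H a1) (scale (beps H a3) (mulv (bvec a2) (la (gdeg a) b)))"
        using ab by (simp add: contract_left lin_tensor)
      finally show "lin (\<lambda>(b1, b2). scale (?Q a1 a3 b1) (bmul H (a2, b2))) (bcop H b) =
        scale (beps H a1) (scale (beps H a3) (mulv (bvec a2) (la (gdeg a) b)))" .
    qed
    also have "\<dots> = scale (beps H a3) (mulv (bvec x) (la (gdeg a) b))"
      by (rule contract_left_counit[OF x(1)])
    finally show "lin (\<lambda>(a1, a2). lin (\<lambda>(b1, b2). scale (?Q a1 a3 b1) (bmul H (a2, b2))) (bcop H b)) (bcop H x) =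
      scale (beps H a3) (mulv (bvec x) (la (gdeg a) b))" .
  qed
  also have "\<dots> = mulv (bvec a) (la (gdeg a) b)"
    by (rule contract_right_counit[OF ab(1)])
  finally show ?thesis by (simp add: trmul_def)
qed

lemma coquasitriangular_hom_toD:
  assumes "coquasitriangular_bialgebra V H R"
    and "coquasitriangular_bialgebra (D_space G) (D_bialg G) (D_R G :: _ \<Rightarrow> 'k)"
    and "\<And>a b. a \<in> basis V \<Longrightarrow> b \<in> basis V \<Longrightarrow> R (a, b) = canon_R (a, b)"
  shows "coquasitriangular_hom V H R (D_space G) (D_bialg G) (D_R G) toD"
  unfolding coquasitriangular_hom_def
  using assms bialgebra_hom_toD by (auto simp: toD_R)

end

text \<open>For the double, \<open>canon_R\<close> is \<open>D_R\<close>: the counit of the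
  translated second argument tests \<open>u = D_dl G a\<close>, and this is \<open>h\<close> when
  \<open>g = \<one>\<close>.\<close>

lemma (in group) D_coquasitriangular:
  assumes "finite (carrier G)"
  shows "coquasitriangular_bialgebra (D_space G) (D_bialg G) (D_R G :: _ \<Rightarrow> 'k::field)"
proof -
  interpret D: crossed_coquasi G "D_space G" "D_bialg G :: (_, 'k) bialg" "D_la G" "D_ra G" "D_dl G" snd
    by (rule D_coquasi[OF assms])
  show ?thesis
  proof (rule D.coquasitriangular_canon_R)
    fix a b assume "a \<in> basis (D_space G :: (_, 'k) pspace)" "b \<in> basis (D_space G :: (_, 'k) pspace)"
    then obtain g h u v where ab: "a = (g, h)" "b = (u, v)"
      and c: "g \<in> carrier G" "h \<in> carrier G" "u \<in> carrier G" "v \<in> carrier G" by auto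
    have *: "inv h \<otimes> u = \<one> \<longleftrightarrow> h = u"
      using c by (metis inv_equality inv_inv inv_closed l_inv)
    have "D.canon_R (a, b) = beps (D_bialg G) a * linf (beps (D_bialg G)) (D_la G (inv (D_dl G a)) b)"
      by (simp only: D.canon_R_def prod.case)
    with * show "(D_R G (a, b) :: 'k) = D.canon_R (a, b)"
      using c by (auto simp: ab D_R_def D_bialg_def D_la_def D_dl_def)
  qed
qed

section \<open>Transport along isomorphisms\<close>

lemma eqv_lin_cong:
  assumes "pspace_ok W" "x \<in> fspan B" "\<And>b. b \<in> B \<Longrightarrow> eqv W (f b) (g b)"
  shows "eqv W (lin f x) (lin g x)"
  unfolding eqv_def lin_fun_diff[symmetric]
  by (rule lin_in_subspace) (use assms keysD[OF assms(2)] in \<open>auto simp: eqv_def pspace_ok_def\<close>)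

lemma eqv_lmap: "lmap V W f \<Longrightarrow> eqv V x y \<Longrightarrow> eqv W (lin f x) (lin f y)"
  by (simp add: eqv_def lmap_def flip: lin_diff)

text \<open>The left inverse is exact on the free spaces, not only modulo null vectors. As
  \<open>f'\<close> also descends, null vectors and equalities are reflected from \<open>W\<close>
  to \<open>V\<close>.\<close>

definition lift_iso :: "('b, 'k::field, 'y) pspace_scheme \<Rightarrow> ('c, 'k, 'z) pspace_scheme \<Rightarrow>
    ('b \<Rightarrow> ('c \<Rightarrow>\<^sub>0 'k)) \<Rightarrow> ('c \<Rightarrow> ('b \<Rightarrow>\<^sub>0 'k)) \<Rightarrow> bool" where
  "lift_iso V W f f' \<longleftrightarrow> lmap V W f \<and> lmap W V f' \<and> (\<forall>b\<in>basis V. lin f' (f b) = bvec b)"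

lemma lift_iso_tens:
  assumes "lift_iso V W f f'" "lift_iso V' W' g g'"
  shows "lift_iso (tens V V') (tens W W') (tmap f g) (tmap f' g')"
  using assms unfolding lift_iso_def by (auto intro!: lmap_tmap simp: tmap_apply lin_tmap_tensor)

lemma lift_iso_inv:
  assumes "lift_iso V W f f'" "x \<in> fspan (basis V)"
  shows "lin f' (lin f x) = x"
proof -
  have "lin (\<lambda>b. lin f' (f b)) x = lin bvec x"
    by (rule fspan_lin_cong[OF assms(2)]) (use assms(1) in \<open>auto simp: lift_iso_def\<close>)
  thus ?thesis by (simp add: lin_lin)
qed

lemma lift_iso_null:
  assumes "lift_iso V W f f'" "x \<in> fspan (basis V)" "lin f x \<in> null W"
  shows "x \<in> null V"
proof -
  have "lin f' (lin f x) \<in> null V" using assms(1,3) by (simp add: lift_iso_def lmap_def)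
  thus ?thesis by (simp only: lift_iso_inv[OF assms(1,2)])
qed

lemma lift_iso_eqv:
  assumes "lift_iso V W f f'" "x \<in> fspan (basis V)" "y \<in> fspan (basis V)" "eqv W (lin f x) (lin f y)"
  shows "eqv V x y"
  using lift_iso_null[OF assms(1) diff_in_fspan[OF assms(2,3)]] assms(4) by (simp add: eqv_def lin_diff)

text \<open>The homogeneous vectors are the sum of the null space and the span of the basis elements
  of that degree.\<close>

lemma homog_subspace:
  assumes "pspace_ok X"
  shows "fv.subspace (homog X g :: (_ \<Rightarrow>\<^sub>0 'k::field) set)"
proof -
  have N: "fv.subspace (null X)" using assms by (simp add: pspace_ok_def)
  let ?F = "fspan {b \<in> basis X. deg X b = g} :: (_ \<Rightarrow>\<^sub>0 'k) set"
  have "homog X g = {x + y | x y. x \<in> null X \<and> y \<in> ?F}"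
  proof (intro equalityI subsetI)
    fix x assume "x \<in> homog X g"
    then obtain y where "y \<in> ?F" "x - y \<in> null X" by (auto simp: homog_def eqv_def)
    moreover have "x = (x - y) + y" by simp
    ultimately show "x \<in> {x + y | x y. x \<in> null X \<and> y \<in> ?F}" by blast
  next
    fix x assume "x \<in> {x + y | x y. x \<in> null X \<and> y \<in> ?F}"
    then obtain z y where "x = z + y" "z \<in> null X" "y \<in> ?F" by auto
    thus "x \<in> homog X g" unfolding homog_def eqv_def by (auto intro!: bexI[of _ y])
  qed
  thus ?thesis using fv.subspace_sums[OF N fspan_subspace] by simp
qed

lemma homog_lin:
  assumes "lmap Y X f" "\<And>c. c \<in> basis Y \<Longrightarrow> f c \<in> fspan {b \<in> basis X. deg X b = deg Y c}"
    and "y \<in> homog Y g"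
  shows "lin f y \<in> homog X g"
proof -
  from assms(3) obtain z where z: "z \<in> fspan {c \<in> basis Y. deg Y c = g}" "eqv Y y z"
    by (auto simp: homog_def)
  have "lin f z \<in> fspan {b \<in> basis X. deg X b = g}"
    by (rule lin_in_fspan[OF z(1)]) (use assms(2) in auto)
  thus ?thesis using eqv_lmap[OF assms(1) z(2)] by (auto simp: homog_def)
qed

text \<open>The coproduct is left to a second locale: for \<open>U(L)\<close> it is recursive in the
  braiding, and its compatibility with \<open>th\<close> is itself derived from
  \<open>tens_mul_th\<close>, a consequence of the algebra part.\<close>

locale crossed_algebra_transport =
  fixes G :: "('g, 'm) monoid_scheme"
    and X :: "('g, 'b, 'k::field) xmod" and H :: "('b, 'k) bialg"
    and Y :: "('g, 'c, 'k) xmod" and K :: "('c, 'k) bialg"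
    and th :: "'b \<Rightarrow> ('c \<Rightarrow>\<^sub>0 'k)" and th' :: "'c \<Rightarrow> ('b \<Rightarrow>\<^sub>0 'k)"
  assumes grp: "group G" and YK: "braided_bialgebra G Y K" and okX: "pspace_ok X"
    and iso: "lift_iso X Y th th'"
    and act_in: "h \<in> carrier G \<Longrightarrow> b \<in> basis X \<Longrightarrow> act X h b \<in> fspan (basis X)"
    and act_th: "h \<in> carrier G \<Longrightarrow> b \<in> basis X \<Longrightarrow> lin th (act X h b) = lin (act Y h) (th b)"
    and deg_in: "b \<in> basis X \<Longrightarrow> deg X b \<in> carrier G"
    and th_deg: "b \<in> basis X \<Longrightarrow> th b \<in> fspan {c \<in> basis Y. deg Y c = deg X b}"
    and th'_deg: "c \<in> basis Y \<Longrightarrow> th' c \<in> fspan {b \<in> basis X. deg X b = deg Y c}"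
    and one_in: "bone H \<in> fspan (basis X)" and one_th: "lin th (bone H) = bone K"
    and mul_in: "a \<in> basis X \<Longrightarrow> b \<in> basis X \<Longrightarrow> bmul H (a, b) \<in> fspan (basis X)"
    and mul_th: "a \<in> basis X \<Longrightarrow> b \<in> basis X \<Longrightarrow>
      lin th (bmul H (a, b)) = lin (bmul K) (tensor (th a) (th b))"
begin

lemma okY: "pspace_ok Y"
  using YK by (simp add: braided_bialgebra_def crossed_module_def)

lemma iso2: "lift_iso (tens X X) (tens Y Y) (tmap th th) (tmap th' th')"
  by (rule lift_iso_tens[OF iso iso])

lemma iso3: "lift_iso (tens (tens X X) X) (tens (tens Y Y) Y) (tmap (tmap th th) th) (tmap (tmap th' th') th')"
  by (rule lift_iso_tens[OF iso2 iso])

lemma ok2: "pspace_ok (tens Y Y)" and ok3: "pspace_ok (tens (tens Y Y) Y)"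
  by (auto intro!: pspace_ok_tens okY)

lemma th_in [simp]: "b \<in> basis X \<Longrightarrow> th b \<in> fspan (basis Y)"
  using iso by (simp add: lift_iso_def lmap_def)

lemma th_back: "x \<in> fspan (basis X) \<Longrightarrow> lin th' (lin th x) = x"
  by (rule lift_iso_inv[OF iso])

lemma lmap_th: "lmap X Y th" "lmap Y X th'"
  using iso by (auto simp: lift_iso_def)

lemma act_th': "h \<in> carrier G \<Longrightarrow> x \<in> fspan (basis X) \<Longrightarrow> lin th (lin (act X h) x) = lin (act Y h) (lin th x)"
  unfolding lin_lin by (rule fspan_lin_cong) (auto simp: act_th)

lemma mul_th': "z \<in> fspan (basis X \<times> basis X) \<Longrightarrow> lin th (lin (bmul H) z) = lin (bmul K) (lin (tmap th th) z)"
  unfolding lin_lin by (rule fspan_lin_cong) (auto simp: mul_th tmap_apply)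

lemma mul_th_tensor: "x \<in> fspan (basis X) \<Longrightarrow> y \<in> fspan (basis X) \<Longrightarrow>
    lin th (lin (bmul H) (tensor x y)) = lin (bmul K) (tensor (lin th x) (lin th y))"
  by (simp add: mul_th' tensor_in_fspan lin_tmap_tensor)

lemma mul_in': "z \<in> fspan (basis X \<times> basis X) \<Longrightarrow> lin (bmul H) z \<in> fspan (basis X)"
  by (rule lin_in_fspan) (auto simp: mul_in)

lemma mulv_in': "x \<in> fspan (basis X) \<Longrightarrow> y \<in> fspan (basis X) \<Longrightarrow> lin (bmul H) (tensor x y) \<in> fspan (basis X)"
  by (intro mul_in' tensor_in_fspan)

lemma act_in': "h \<in> carrier G \<Longrightarrow> x \<in> fspan (basis X) \<Longrightarrow> lin (act X h) x \<in> fspan (basis X)"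
  by (rule lin_in_fspan) (auto simp: act_in)

lemma homog_back:
  assumes "lin th x \<in> homog Y g" "x \<in> fspan (basis X)"
  shows "x \<in> homog X g"
  using homog_lin[OF lmap_th(2) th'_deg assms(1)] by (simp add: th_back assms(2))

lemmas eqv_back = lift_iso_eqv[OF iso]
lemmas eqv_back2 = lift_iso_eqv[OF iso2, simplified]

lemma module_Y: "crossed_module G Y" using YK by (simp add: braided_bialgebra_def)
lemma bialgebra_Y: "bialgebra_wrt (xbraid Y) Y K" using YK by (simp add: braided_bialgebra_def)
lemma algebra_Y: "algebra_on Y K" and coalgebra_Y: "coalgebra_on Y K"
  using bialgebra_Y by (auto simp: bialgebra_wrt_def)

lemma crossed_module_X: "crossed_module G X"
  unfolding crossed_module_def
proof (intro conjI ballI)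
  fix x g assume x: "x \<in> null X" and g: "g \<in> carrier G"
  have xs: "x \<in> fspan (basis X)" using x okX by (auto simp: pspace_ok_def)
  let ?p = "lin (\<lambda>b. if deg X b = g then bvec b else 0) x"
  \<comment> \<open>Degree projections commute with \<open>th\<close>, because \<open>th b\<close>
    is concentrated in the degree of \<open>b\<close>; the claim is then reflected from
    \<open>Y\<close>.\<close>
  have "lin th ?p = lin (\<lambda>b. lin (\<lambda>c. if deg Y c = g then bvec c else 0) (th b)) x"
    unfolding lin_lin
  proof (rule fspan_lin_cong[OF xs])
    fix b assume b: "b \<in> basis X"
    have "lin (\<lambda>c. if deg Y c = g then bvec c else 0) (th b) = lin (\<lambda>c. if deg X b = g then bvec c else 0) (th b)"
      by (rule fspan_lin_cong[OF th_deg[OF b]]) auto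
    thus "lin th (if deg X b = g then bvec b else 0) = lin (\<lambda>c. if deg Y c = g then bvec c else 0) (th b)"
      by (simp add: lin_if_zero)
  qed
  also have "\<dots> = lin (\<lambda>c. if deg Y c = g then bvec c else 0) (lin th x)"
    by (simp add: lin_lin)
  also have "\<dots> \<in> null Y"
    using module_Y g lmap_lin_null[OF lmap_th(1) x] by (simp add: crossed_module_def)
  finally show "?p \<in> null X"
    by (rule lift_iso_null[OF iso, rotated]) (rule lin_in_fspan[OF xs], auto)
next
  fix h assume h: "h \<in> carrier G"
  show "lmap X X (act X h)"
    unfolding lmap_def
  proof (intro conjI ballI)
    fix x assume x: "x \<in> null X"
    have xs: "x \<in> fspan (basis X)" using x okX by (auto simp: pspace_ok_def)
    have "lmap Y Y (act Y h)" using module_Y h by (simp add: crossed_module_def)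
    hence "lin th (lin (act X h) x) \<in> null Y"
      using h xs lmap_lin_null[OF lmap_th(1) x] by (simp add: act_th' lmap_lin_null)
    thus "lin (act X h) x \<in> null X"
      by (rule lift_iso_null[OF iso, rotated]) (use h xs in \<open>auto intro: act_in'\<close>)
  qed (use act_in h in auto)
next
  fix b assume b: "b \<in> basis X"
  have G1: "eqv Y (lin (act Y \<one>\<^bsub>G\<^esub>) (th b)) (lin bvec (th b))"
    by (rule eqv_lin_cong[OF okY th_in[OF b]]) (use module_Y in \<open>simp add: crossed_module_def\<close>)
  have one: "\<one>\<^bsub>G\<^esub> \<in> carrier G" by (rule monoid.one_closed[OF group.is_monoid[OF grp]])
  show "eqv X (act X \<one>\<^bsub>G\<^esub> b) (bvec b)"
    by (rule eqv_back) (use G1 one b in \<open>auto simp: act_in act_th\<close>)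
next
  fix g h b assume gh: "g \<in> carrier G" "h \<in> carrier G" and b: "b \<in> basis X"
  have m: "g \<otimes>\<^bsub>G\<^esub> h \<in> carrier G" using gh by (rule monoid.m_closed[OF group.is_monoid[OF grp]])
  have "eqv Y (lin (act Y (g \<otimes>\<^bsub>G\<^esub> h)) (th b)) (lin (\<lambda>c. lin (act Y g) (act Y h c)) (th b))"
    by (rule eqv_lin_cong[OF okY th_in[OF b]]) (use module_Y gh in \<open>simp add: crossed_module_def\<close>)
  hence "eqv Y (lin th (act X (g \<otimes>\<^bsub>G\<^esub> h) b)) (lin th (lin (act X g) (act X h b)))"
    using gh m b by (simp add: act_th act_th' act_in flip: lin_lin)
  thus "eqv X (act X (g \<otimes>\<^bsub>G\<^esub> h) b) (lin (act X g) (act X h b))"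
    by (rule eqv_back[rotated 2]) (use gh m b in \<open>auto simp: act_in act_in'\<close>)
next
  fix h b assume h: "h \<in> carrier G" and b: "b \<in> basis X"
  have "lin (act Y h) (th b) \<in> homog Y (h \<otimes>\<^bsub>G\<^esub> deg X b \<otimes>\<^bsub>G\<^esub> inv\<^bsub>G\<^esub> h)"
  proof (rule lin_in_subspace[OF homog_subspace[OF okY]])
    fix c assume "c \<in> Poly_Mapping.keys (th b)"
    hence c: "c \<in> basis Y" "deg Y c = deg X b" using keysD[OF th_deg[OF b]] by auto
    have "act Y h c \<in> homog Y (h \<otimes>\<^bsub>G\<^esub> deg Y c \<otimes>\<^bsub>G\<^esub> inv\<^bsub>G\<^esub> h)"
      using module_Y h c(1) unfolding crossed_module_def by blast
    thus "act Y h c \<in> homog Y (h \<otimes>\<^bsub>G\<^esub> deg X b \<otimes>\<^bsub>G\<^esub> inv\<^bsub>G\<^esub> h)"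
      by (simp only: c(2))
  qed
  thus "act X h b \<in> homog X (h \<otimes>\<^bsub>G\<^esub> deg X b \<otimes>\<^bsub>G\<^esub> inv\<^bsub>G\<^esub> h)"
    by (intro homog_back) (use h b in \<open>auto simp: act_th act_in\<close>)
qed (use okX deg_in in auto)


lemma mul_assoc_Y:
  assumes "x \<in> fspan (basis Y)" "y \<in> fspan (basis Y)" "z \<in> fspan (basis Y)"
  shows "eqv Y (lin (bmul K) (tensor (lin (bmul K) (tensor x y)) z))
    (lin (bmul K) (tensor x (lin (bmul K) (tensor y z))))"
proof -
  have "eqv Y (lin (\<lambda>((a, b), c). lin (bmul K) (tensor (bmul K (a, b)) (bvec c))) (tensor (tensor x y) z))
    (lin (\<lambda>((a, b), c). lin (bmul K) (tensor (bvec a) (bmul K (b, c)))) (tensor (tensor x y) z))"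
    by (rule eqv_lin_cong[OF okY tensor_in_fspan[OF tensor_in_fspan[OF assms(1,2)] assms(3)]])
      (use algebra_Y in \<open>auto simp: algebra_on_def\<close>)
  moreover have "lin (\<lambda>((a, b), c). lin (bmul K) (tensor (bmul K (a, b)) (bvec c))) (tensor (tensor x y) z)
    = lin (bmul K) (tensor (lin (bmul K) (tensor x y)) z)"
    by (simp add: lin_tensor lin_lin lin_swap[where x = z])
  moreover have "lin (\<lambda>((a, b), c). lin (bmul K) (tensor (bvec a) (bmul K (b, c)))) (tensor (tensor x y) z)
    = lin (bmul K) (tensor x (lin (bmul K) (tensor y z)))"
    by (simp add: lin_tensor lin_lin)
  ultimately show ?thesis by simp
qed

lemma algebra_on_X: "algebra_on X H"
  unfolding algebra_on_def
proof (intro conjI ballI)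
  show "bone H \<in> fspan (basis X)" by (rule one_in)
  show "lmap (tens X X) X (bmul H)"
    unfolding lmap_def
  proof (intro conjI ballI)
    fix z assume z: "z \<in> null (tens X X)"
    have zs: "z \<in> fspan (basis X \<times> basis X)"
      using z pspace_ok_tens[OF okX okX] by (auto simp: pspace_ok_def)
    have "lin (tmap th th) z \<in> null (tens Y Y)"
      using iso2 z by (simp add: lift_iso_def lmap_def)
    hence "lin th (lin (bmul H) z) \<in> null Y"
      using algebra_Y zs by (simp add: mul_th' algebra_on_def lmap_def)
    thus "lin (bmul H) z \<in> null X"
      by (rule lift_iso_null[OF iso mul_in'[OF zs]])
  qed (auto simp: mul_in)
next
  fix a b c assume abc: "a \<in> basis X" "b \<in> basis X" "c \<in> basis X"
  show "eqv X (lin (bmul H) (tensor (bmul H (a, b)) (bvec c))) (lin (bmul H) (tensor (bvec a) (bmul H (b, c))))"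
    by (rule eqv_back)
      (use abc in \<open>auto intro!: mulv_in' mul_in mul_assoc_Y simp: mul_th_tensor mul_in mul_th\<close>)
next
  fix a assume a: "a \<in> basis X"
  have "eqv Y (lin (\<lambda>b. lin (bmul K) (tensor (bone K) (bvec b))) (th a)) (lin bvec (th a))"
    by (rule eqv_lin_cong[OF okY th_in[OF a]]) (use algebra_Y in \<open>auto simp: algebra_on_def\<close>)
  hence 1: "eqv Y (lin (bmul K) (tensor (bone K) (th a))) (th a)"
    by (simp add: tensor_bvec_right lin_lin lin_tensor lin_swap[of _ "th a"])
  show "eqv X (lin (bmul H) (tensor (bone H) (bvec a))) (bvec a)"
    by (rule eqv_back) (use a 1 in \<open>auto intro!: mulv_in' one_in simp: mul_th_tensor one_in one_th\<close>)
  have "eqv Y (lin (\<lambda>b. lin (bmul K) (tensor (bvec b) (bone K))) (th a)) (lin bvec (th a))"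
    by (rule eqv_lin_cong[OF okY th_in[OF a]]) (use algebra_Y in \<open>auto simp: algebra_on_def\<close>)
  hence 2: "eqv Y (lin (bmul K) (tensor (th a) (bone K))) (th a)"
    by (simp add: lin_lin lin_tensor)
  show "eqv X (lin (bmul H) (tensor (bvec a) (bone H))) (bvec a)"
    by (rule eqv_back) (use a 2 in \<open>auto intro!: mulv_in' one_in simp: mul_th_tensor one_in one_th\<close>)
qed

lemma null_in_fspan: "x \<in> null X \<Longrightarrow> x \<in> fspan (basis X)"
  using okX by (auto simp: pspace_ok_def)

lemma tens_mul_in:
  assumes "p \<in> basis X \<times> basis X" "s \<in> basis X \<times> basis X"
  shows "tens_mul (xbraid X) (bmul H) (p, s) \<in> fspan (basis X \<times> basis X)"
proof -
  obtain a b c d where ps: "p = (a, b)" "s = (c, d)" by (cases p, cases s)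
  have "tensor (act X (deg X b) c) (bvec b) \<in> fspan (basis X \<times> basis X)"
    using assms by (auto simp: ps intro!: tensor_in_fspan act_in deg_in)
  thus ?thesis unfolding ps tens_mul_def xbraid_def prod.case
    by (rule lin_in_fspan) (use assms in \<open>auto simp: ps intro!: tensor_in_fspan mul_in\<close>)
qed

text \<open>An algebra map that is equivariant and preserves degrees is also one for the braided
  products on the tensor squares.\<close>

lemma tens_mul_th:
  assumes "p \<in> basis X \<times> basis X" "s \<in> basis X \<times> basis X"
  shows "lin (tmap th th) (tens_mul (xbraid X) (bmul H) (p, s)) =
    lin (tens_mul (xbraid Y) (bmul K)) (tensor (tmap th th p) (tmap th th s))"
proof -
  obtain a b c d where ps: "p = (a, b)" "s = (c, d)" by (cases p, cases s)
  have m: "a \<in> basis X" "b \<in> basis X" "c \<in> basis X" "d \<in> basis X" using assms by (auto simp: ps)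
  have "tens_mul (xbraid X) (bmul H) (p, s) =
     tensor (lin (bmul H) (tensor (bvec a) (act X (deg X b) c))) (bmul H (b, d))"
    by (simp add: ps tens_mul_def xbraid_def lin_tensor tensor_lin_left lin_lin)
  hence "lin (tmap th th) (tens_mul (xbraid X) (bmul H) (p, s)) =
     tensor (lin (bmul K) (tensor (th a) (lin (act Y (deg X b)) (th c)))) (lin (bmul K) (tensor (th b) (th d)))"
    using m by (simp add: lin_tmap_tensor mul_th_tensor act_in deg_in act_th mul_th)
  also have "\<dots> = lin (\<lambda>b'. tensor (lin (bmul K) (tensor (th a) (lin (act Y (deg X b)) (th c))))
      (lin (bmul K) (tensor (bvec b') (th d)))) (th b)"
    unfolding tensor_lin_right[symmetric] by (simp add: lin_lin lin_tensor)
  \<comment> \<open>The braiding in \<open>Y\<close> acts by the degree of each basis element of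
    \<open>th b\<close>, and these degrees all equal \<open>deg X b\<close>.\<close>
  also have "\<dots> = lin (\<lambda>b'. tensor (lin (bmul K) (tensor (th a) (lin (act Y (deg Y b')) (th c))))
      (lin (bmul K) (tensor (bvec b') (th d)))) (th b)"
    by (rule fspan_lin_cong[OF th_deg[OF m(2)]]) auto
  also have "\<dots> = lin (\<lambda>b'. lin (\<lambda>a'. lin (\<lambda>c'. lin (\<lambda>d'. tens_mul (xbraid Y) (bmul K) ((a', b'), (c', d')))
      (th d)) (th c)) (th a)) (th b)"
  proof -
    have 1: "lin (bmul K) (tensor x (lin A y)) = lin (\<lambda>a'. lin (\<lambda>c'. lin (bmul K) (tensor (bvec a') (A c'))) y) x"
      for x y A by (simp add: lin_tensor lin_lin)
    have 2: "lin (bmul K) (tensor (bvec b') (th d)) = lin (\<lambda>d'. bmul K (b', d')) (th d)" for b'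
      by (simp add: lin_tensor)
    have 3: "tens_mul (xbraid Y) (bmul K) ((a', b'), (c', d')) =
      tensor (lin (bmul K) (tensor (bvec a') (act Y (deg Y b') c'))) (bmul K (b', d'))" for a' b' c' d'
      by (simp add: tens_mul_def xbraid_def lin_tensor tensor_lin_left lin_lin)
    show ?thesis
      by (simp only: 1 2 3 tensor_lin_left) (simp only: tensor_lin_right lin_swap[where y = "th d"])
  qed
  also have "\<dots> = lin (tens_mul (xbraid Y) (bmul K)) (tensor (tmap th th p) (tmap th th s))"
    unfolding ps tmap_apply lin_tensor by (rule lin_swap)
  finally show ?thesis .
qed

end

locale crossed_transport = crossed_algebra_transport G X H Y K th th'
  for G :: "('g, 'm) monoid_scheme"
    and X :: "('g, 'b, 'k::field) xmod" and H :: "('b, 'k) bialg"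
    and Y :: "('g, 'c, 'k) xmod" and K :: "('c, 'k) bialg"
    and th :: "'b \<Rightarrow> ('c \<Rightarrow>\<^sub>0 'k)" and th' :: "'c \<Rightarrow> ('b \<Rightarrow>\<^sub>0 'k)" +
  assumes cop_in: "a \<in> basis X \<Longrightarrow> bcop H a \<in> fspan (basis X \<times> basis X)"
    and cop_th: "a \<in> basis X \<Longrightarrow> lin (tmap th th) (bcop H a) = lin (bcop K) (th a)"
    and eps_th: "a \<in> basis X \<Longrightarrow> linf (beps K) (th a) = beps H a"
begin

lemma cop_th': "x \<in> fspan (basis X) \<Longrightarrow> lin (tmap th th) (lin (bcop H) x) = lin (bcop K) (lin th x)"
  unfolding lin_lin by (rule fspan_lin_cong) (auto simp: cop_th)

lemma eps_th': "x \<in> fspan (basis X) \<Longrightarrow> linf (beps K) (lin th x) = linf (beps H) x"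
  unfolding linf_lin by (rule fspan_linf_cong) (auto simp: eps_th)

lemma cop_in': "x \<in> fspan (basis X) \<Longrightarrow> lin (bcop H) x \<in> fspan (basis X \<times> basis X)"
  by (rule lin_in_fspan) (auto simp: cop_in)

text \<open>Each law is pushed forward by a tensor power of \<open>th\<close>, holds there in
  \<open>Y\<close>, and is reflected by the isomorphism of that tensor power.\<close>

lemma coalgebra_on_X: "coalgebra_on X H"
  unfolding coalgebra_on_def
proof (intro conjI ballI)
  show "lmap X (tens X X) (bcop H)"
    unfolding lmap_def
  proof (intro conjI ballI)
    fix x assume x: "x \<in> null X"
    have "lin (tmap th th) (lin (bcop H) x) \<in> null (tens Y Y)"
      using coalgebra_Y lmap_lin_null[OF lmap_th(1) x]
      by (simp add: cop_th' null_in_fspan[OF x] coalgebra_on_def lmap_def)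
    thus "lin (bcop H) x \<in> null (tens X X)"
      by (rule lift_iso_null[OF iso2, rotated]) (simp add: cop_in' null_in_fspan[OF x])
  qed (auto simp: cop_in)
  have "linf (beps H) x = 0" if x: "x \<in> null X" for x
  proof -
    have "linf (beps K) (lin th x) = 0"
      using coalgebra_Y lmap_lin_null[OF lmap_th(1) x]
      by (auto simp: coalgebra_on_def lmap_def kspace_def linf_eq_lookup)
    thus ?thesis by (simp add: eps_th' null_in_fspan[OF x])
  qed
  thus "lmap X kspace (\<lambda>b. Poly_Mapping.single () (beps H b))"
    by (auto simp: lmap_def kspace_def fspan_def single_eq_scale_bvec lin_scale_fun_const)
next
  fix a assume a: "a \<in> basis X"
  let ?T = "tmap (tmap th th) th"
  let ?s = "\<lambda>(x, (y, z)). bvec ((x, y), z)"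
  have "lin ?T (lin (tmap (bcop H) bvec) (bcop H a)) = lin (tmap (bcop K) bvec) (lin (tmap th th) (bcop H a))"
    unfolding lin_tmap_lin_tmap
    by (rule fspan_lin_cong[OF cop_in[OF a]]) (auto simp: tmap_apply cop_th)
  hence 1: "lin ?T (lin (tmap (bcop H) bvec) (bcop H a)) = lin (\<lambda>c. lin (tmap (bcop K) bvec) (bcop K c)) (th a)"
    using a by (simp add: cop_th lin_lin)
  have r: "lin ?T (lin ?s z) = lin ?s (lin (tmap th (tmap th th)) z)" for z
    unfolding lin_lin
    by (rule lin_cong) (auto simp: tmap_apply lin_tensor tensor_def lin_lin)
  have 2: "lin (tmap th (tmap th th)) (lin (tmap bvec (bcop H)) (bcop H a)) = lin (tmap bvec (bcop K)) (lin (tmap th th) (bcop H a))"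
    unfolding lin_tmap_lin_tmap
    by (rule fspan_lin_cong[OF cop_in[OF a]]) (auto simp: tmap_apply cop_th)
  have 3: "lin ?T (lin ?s (lin (tmap bvec (bcop H)) (bcop H a)))
     = lin (\<lambda>c. lin ?s (lin (tmap bvec (bcop K)) (bcop K c))) (th a)"
    unfolding r 2 cop_th[OF a] by (simp only: lin_lin)
  have "eqv (tens (tens Y Y) Y) (lin (\<lambda>c. lin (tmap (bcop K) bvec) (bcop K c)) (th a))
     (lin (\<lambda>c. lin ?s (lin (tmap bvec (bcop K)) (bcop K c))) (th a))"
    by (rule eqv_lin_cong[OF ok3 th_in[OF a]]) (use coalgebra_Y in \<open>auto simp: coalgebra_on_def\<close>)
  thus "eqv (tens (tens X X) X) (lin (tmap (bcop H) bvec) (bcop H a)) (lin ?s (lin (tmap bvec (bcop H)) (bcop H a)))"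
    unfolding 1[symmetric] 3[symmetric]
  proof (rule lift_iso_eqv[OF iso3, rotated 2])
    show "lin (tmap (bcop H) bvec) (bcop H a) \<in> fspan (basis (tens (tens X X) X))"
      by (rule lin_in_fspan[OF cop_in[OF a]]) (auto simp: tmap_apply intro!: tensor_in_fspan cop_in)
    have "lin (tmap bvec (bcop H)) (bcop H a) \<in> fspan (basis X \<times> basis X \<times> basis X)"
      by (rule lin_in_fspan[OF cop_in[OF a]]) (auto simp: tmap_apply intro!: tensor_in_fspan cop_in)
    thus "lin ?s (lin (tmap bvec (bcop H)) (bcop H a)) \<in> fspan (basis (tens (tens X X) X))"
      by (rule lin_in_fspan) auto
  qed
next
  fix a assume a: "a \<in> basis X"
  have "lin th (lin (\<lambda>(x, y). scale (beps H x) (bvec y)) (bcop H a))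
     = lin (\<lambda>(x, y). scale (linf (beps K) (th x)) (th y)) (bcop H a)"
    unfolding lin_lin by (rule fspan_lin_cong[OF cop_in[OF a]]) (auto simp: lin_scale eps_th)
  also have "\<dots> = lin (\<lambda>(x, y). scale (beps K x) (bvec y)) (lin (tmap th th) (bcop H a))"
    unfolding lin_lin by (rule lin_cong) (auto simp: tmap_apply lin_tensor lin_scale_fun_const lin_fun_scale)
  finally have 1: "lin th (lin (\<lambda>(x, y). scale (beps H x) (bvec y)) (bcop H a))
      = lin (\<lambda>c. lin (\<lambda>(x, y). scale (beps K x) (bvec y)) (bcop K c)) (th a)"
    using a by (simp add: cop_th lin_lin)
  have "eqv Y (lin (\<lambda>c. lin (\<lambda>(x, y). scale (beps K x) (bvec y)) (bcop K c)) (th a)) (lin bvec (th a))"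
    by (rule eqv_lin_cong[OF okY th_in[OF a]]) (use coalgebra_Y in \<open>auto simp: coalgebra_on_def\<close>)
  thus "eqv X (lin (\<lambda>(x, y). scale (beps H x) (bvec y)) (bcop H a)) (bvec a)"
    unfolding 1[symmetric]
    by (intro eqv_back) (use a in \<open>auto intro!: lin_in_fspan[OF cop_in[OF a]] scale_in_fspan\<close>)
  have "lin th (lin (\<lambda>(x, y). scale (beps H y) (bvec x)) (bcop H a))
     = lin (\<lambda>(x, y). scale (linf (beps K) (th y)) (th x)) (bcop H a)"
    unfolding lin_lin by (rule fspan_lin_cong[OF cop_in[OF a]]) (auto simp: lin_scale eps_th)
  also have "\<dots> = lin (\<lambda>(x, y). scale (beps K y) (bvec x)) (lin (tmap th th) (bcop H a))"
    unfolding lin_lin by (rule lin_cong) (auto simp: tmap_apply lin_tensor lin_scale_fun_const lin_fun_scale)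
  finally have 2: "lin th (lin (\<lambda>(x, y). scale (beps H y) (bvec x)) (bcop H a))
      = lin (\<lambda>c. lin (\<lambda>(x, y). scale (beps K y) (bvec x)) (bcop K c)) (th a)"
    using a by (simp add: cop_th lin_lin)
  have "eqv Y (lin (\<lambda>c. lin (\<lambda>(x, y). scale (beps K y) (bvec x)) (bcop K c)) (th a)) (lin bvec (th a))"
    by (rule eqv_lin_cong[OF okY th_in[OF a]]) (use coalgebra_Y in \<open>auto simp: coalgebra_on_def\<close>)
  thus "eqv X (lin (\<lambda>(x, y). scale (beps H y) (bvec x)) (bcop H a)) (bvec a)"
    unfolding 2[symmetric]
    by (intro eqv_back) (use a in \<open>auto intro!: lin_in_fspan[OF cop_in[OF a]] scale_in_fspan\<close>)
qed

lemma bialgebra_wrt_X: "bialgebra_wrt (xbraid X) X H"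
  unfolding bialgebra_wrt_def
proof (intro conjI ballI)
  show "pspace_ok X" "algebra_on X H" "coalgebra_on X H"
    by (rule okX algebra_on_X coalgebra_on_X)+
  have "eqv (tens Y Y) (lin (bcop K) (bone K)) (tensor (bone K) (bone K))"
    using bialgebra_Y by (simp add: bialgebra_wrt_def)
  thus "eqv (tens X X) (lin (bcop H) (bone H)) (tensor (bone H) (bone H))"
    by (intro eqv_back2) (auto intro!: cop_in' tensor_in_fspan one_in simp: cop_th' one_in one_th lin_tmap_tensor)
  show "linf (beps H) (bone H) = 1"
    using bialgebra_Y by (simp add: bialgebra_wrt_def one_th one_in flip: eps_th')
next
  fix a b assume ab: "a \<in> basis X" "b \<in> basis X"
  have "lin (tmap th th) (lin (bcop H) (bmul H (a, b))) = lin (\<lambda>p. lin (bcop K) (bmul K p)) (tensor (th a) (th b))"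
    using ab by (simp add: cop_th' mul_in mul_th) (simp add: lin_lin)
  moreover have "lin (tmap th th) (lin (tens_mul (xbraid X) (bmul H)) (tensor (bcop H a) (bcop H b)))
     = lin (\<lambda>(a, b). lin (tens_mul (xbraid Y) (bmul K)) (tensor (bcop K a) (bcop K b))) (tensor (th a) (th b))"
  proof -
    have "lin (tmap th th) (lin (tens_mul (xbraid X) (bmul H)) (tensor (bcop H a) (bcop H b)))
      = lin (\<lambda>(p, s). lin (tens_mul (xbraid Y) (bmul K)) (tensor (tmap th th p) (tmap th th s))) (tensor (bcop H a) (bcop H b))"
      unfolding lin_lin
      by (rule fspan_lin_cong[OF tensor_in_fspan[OF cop_in[OF ab(1)] cop_in[OF ab(2)]]])
        (auto simp: tens_mul_th)
    also have "\<dots> = lin (tens_mul (xbraid Y) (bmul K)) (tensor (lin (tmap th th) (bcop H a)) (lin (tmap th th) (bcop H b)))"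
      by (simp add: lin_tensor lin_lin)
         (simp add: tensor_def lin_lin lin_swap[of _ "bcop H b"])
    also have "\<dots> = lin (\<lambda>(a, b). lin (tens_mul (xbraid Y) (bmul K)) (tensor (bcop K a) (bcop K b))) (tensor (th a) (th b))"
      using ab by (simp add: cop_th) (simp add: lin_tensor lin_lin lin_swap[of _ "th b"])
    finally show ?thesis .
  qed
  moreover have "eqv (tens Y Y) (lin (\<lambda>p. lin (bcop K) (bmul K p)) (tensor (th a) (th b)))
     (lin (\<lambda>(a, b). lin (tens_mul (xbraid Y) (bmul K)) (tensor (bcop K a) (bcop K b))) (tensor (th a) (th b)))"
    by (rule eqv_lin_cong[OF ok2 tensor_in_fspan[OF th_in[OF ab(1)] th_in[OF ab(2)]]])
      (use bialgebra_Y in \<open>auto simp: bialgebra_wrt_def\<close>)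
  ultimately show "eqv (tens X X) (lin (bcop H) (bmul H (a, b)))
      (lin (tens_mul (xbraid X) (bmul H)) (tensor (bcop H a) (bcop H b)))"
    using ab by (intro eqv_back2)
      (auto intro!: cop_in' mul_in lin_in_fspan[OF tensor_in_fspan[OF cop_in[OF ab(1)] cop_in[OF ab(2)]]] tens_mul_in)
  have "linf (beps H) (bmul H (a, b)) = linf (\<lambda>p. linf (beps K) (bmul K p)) (tensor (th a) (th b))"
    using ab by (simp add: mul_in mul_th linf_lin flip: eps_th')
  also have "\<dots> = linf (\<lambda>(a, b). beps K a * beps K b) (tensor (th a) (th b))"
    by (rule fspan_linf_cong[OF tensor_in_fspan[OF th_in[OF ab(1)] th_in[OF ab(2)]]])
      (use bialgebra_Y in \<open>auto simp: bialgebra_wrt_def\<close>)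
  also have "\<dots> = beps H a * beps H b"
    using ab by (simp add: linf_tensor linf_fun_mult_left linf_fun_mult_right eps_th)
  finally show "linf (beps H) (bmul H (a, b)) = beps H a * beps H b" .
qed

theorem braided_bialgebra_X: "braided_bialgebra G X H"
  unfolding braided_bialgebra_def
proof (intro conjI)
  have Yh: "crossed_hom G (xtriv G) Y (\<lambda>_. bone K)" "crossed_hom G (xtens G Y Y) Y (bmul K)"
    "crossed_hom G Y (xtens G Y Y) (bcop K)"
    "crossed_hom G Y (xtriv G) (\<lambda>b. Poly_Mapping.single () (beps K b))"
    using YK by (auto simp: braided_bialgebra_def)
  show "crossed_module G X" by (rule crossed_module_X)
  show "bialgebra_wrt (xbraid X) X H" by (rule bialgebra_wrt_X)
  show "crossed_hom G (xtriv G) X (\<lambda>_. bone H)"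
    unfolding crossed_hom_def
  proof (intro conjI ballI)
    show "lmap (xtriv G) X (\<lambda>_. bone H)"
      using one_in okX by (auto simp: lmap_def pspace_ok_def fv.subspace_0)
  next
    fix h b assume h: "h \<in> carrier G"
    have "eqv Y (bone K) (lin (act Y h) (bone K))"
      using Yh(1) h by (simp add: crossed_hom_def)
    thus "eqv X (lin (\<lambda>_. bone H) (act (xtriv G) h b)) (lin (act X h) (bone H))"
      using h by (intro eqv_back) (auto simp: one_in one_th act_th' act_in')
  next
    fix b
    have "bone K \<in> homog Y (deg (xtriv G) b)"
      using Yh(1) unfolding crossed_hom_def by fastforce
    thus "bone H \<in> homog X (deg (xtriv G) b)"
      by (intro homog_back) (auto simp: one_in one_th)
  qed
  show "crossed_hom G (xtens G X X) X (bmul H)"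
    unfolding crossed_hom_def
  proof (intro conjI ballI)
    show "lmap (xtens G X X) X (bmul H)"
      using algebra_on_X by (simp add: algebra_on_def lmap_def)
  next
    fix h p assume h: "h \<in> carrier G" and p: "p \<in> basis (xtens G X X)"
    obtain a b where ab: "p = (a, b)" "a \<in> basis X" "b \<in> basis X" using p by auto
    have "eqv Y (lin (\<lambda>p. lin (bmul K) (act (xtens G Y Y) h p)) (tensor (th a) (th b)))
       (lin (\<lambda>p. lin (act Y h) (bmul K p)) (tensor (th a) (th b)))"
      by (rule eqv_lin_cong[OF okY tensor_in_fspan[OF th_in[OF ab(2)] th_in[OF ab(3)]]])
        (use Yh(2) h in \<open>auto simp: crossed_hom_def\<close>)
    hence "eqv Y (lin (bmul K) (tensor (lin (act Y h) (th a)) (lin (act Y h) (th b))))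
       (lin (act Y h) (lin (bmul K) (tensor (th a) (th b))))"
      by (simp add: lin_tmap_tensor flip: lin_lin)
    thus "eqv X (lin (bmul H) (act (xtens G X X) h p)) (lin (act X h) (bmul H p))"
      using h ab by (intro eqv_back)
        (auto simp: tmap_apply mul_th_tensor act_in act_th act_th' mul_in mul_th intro!: mulv_in' act_in')
  next
    fix p assume p: "p \<in> basis (xtens G X X)"
    obtain a b where ab: "p = (a, b)" "a \<in> basis X" "b \<in> basis X" using p by auto
    have "lin (bmul K) (tensor (th a) (th b)) \<in> homog Y (deg X a \<otimes>\<^bsub>G\<^esub> deg X b)"
    proof (rule lin_in_subspace[OF homog_subspace[OF okY]])
      fix s assume "s \<in> Poly_Mapping.keys (tensor (th a) (th b))"
      hence s: "s \<in> {c \<in> basis Y. deg Y c = deg X a} \<times> {c \<in> basis Y. deg Y c = deg X b}"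
        by (rule keysD[OF tensor_in_fspan[OF th_deg[OF ab(2)] th_deg[OF ab(3)]]])
      hence "s \<in> basis (xtens G Y Y)" by auto
      hence "bmul K s \<in> homog Y (deg (xtens G Y Y) s)"
        using Yh(2) unfolding crossed_hom_def by blast
      thus "bmul K s \<in> homog Y (deg X a \<otimes>\<^bsub>G\<^esub> deg X b)" using s by auto
    qed
    thus "bmul H p \<in> homog X (deg (xtens G X X) p)"
      using ab by (intro homog_back) (auto simp: mul_th mul_in)
  qed
  show "crossed_hom G X (xtens G X X) (bcop H)"
    unfolding crossed_hom_def
  proof (intro conjI ballI)
    show "lmap X (xtens G X X) (bcop H)"
      using coalgebra_on_X by (simp add: coalgebra_on_def lmap_def)
  next
    fix h b assume h: "h \<in> carrier G" and b: "b \<in> basis X"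
    have "eqv (tens Y Y) (lin (\<lambda>c. lin (bcop K) (act Y h c)) (th b)) (lin (\<lambda>c. lin (tmap (act Y h) (act Y h)) (bcop K c)) (th b))"
      by (rule eqv_lin_cong[OF ok2 th_in[OF b]])
        (use Yh(3) h in \<open>auto simp: crossed_hom_def eqv_def\<close>)
    moreover have "lin (tmap th th) (lin (tmap (act X h) (act X h)) (bcop H b)) = lin (tmap (act Y h) (act Y h)) (lin (tmap th th) (bcop H b))"
      unfolding lin_tmap_lin_tmap
      by (rule fspan_lin_cong[OF cop_in[OF b]]) (use h in \<open>auto simp: tmap_apply act_th\<close>)
    ultimately have "eqv (tens X X) (lin (bcop H) (act X h b)) (lin (tmap (act X h) (act X h)) (bcop H b))"
      using h b by (intro eqv_back2)
        (auto simp: cop_th' act_in act_th cop_th cop_in' tmap_apply simp flip: lin_lin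
          intro!: lin_in_fspan[OF cop_in[OF b]] tensor_in_fspan)
    thus "eqv (xtens G X X) (lin (bcop H) (act X h b)) (lin (act (xtens G X X) h) (bcop H b))"
      by (simp add: eqv_def)
  next
    fix b assume b: "b \<in> basis X"
    have ok: "pspace_ok (xtens G Y Y)" using ok2 by (simp add: pspace_ok_def)
    have "lin (bcop K) (th b) \<in> homog (xtens G Y Y) (deg X b)"
    proof (rule lin_in_subspace[OF homog_subspace[OF ok]])
      fix c assume "c \<in> Poly_Mapping.keys (th b)"
      hence c: "c \<in> basis Y" "deg Y c = deg X b" using keysD[OF th_deg[OF b]] by auto
      have "bcop K c \<in> homog (xtens G Y Y) (deg Y c)"
        using Yh(3) c(1) unfolding crossed_hom_def by blast
      thus "bcop K c \<in> homog (xtens G Y Y) (deg X b)" by (simp only: c(2))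
    qed
    \<comment> \<open>Homogeneity is carried back by \<open>tmap th' th'\<close>, which preserves
      the total degree.\<close>
    moreover have "lmap (xtens G Y Y) (xtens G X X) (tmap th' th')"
      using iso2 by (simp add: lift_iso_def lmap_def)
    moreover have "tmap th' th' c \<in> fspan {b \<in> basis (xtens G X X). deg (xtens G X X) b = deg (xtens G Y Y) c}"
      if c: "c \<in> basis (xtens G Y Y)" for c
    proof -
      obtain c1 c2 where c12: "c = (c1, c2)" "c1 \<in> basis Y" "c2 \<in> basis Y" using c by auto
      show ?thesis
        using tensor_in_fspan[OF th'_deg[OF c12(2)] th'_deg[OF c12(3)]] c12
        by (auto simp: tmap_apply fspan_def)
    qed
    ultimately have "lin (tmap th' th') (lin (bcop K) (th b)) \<in> homog (xtens G X X) (deg X b)"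
      by (rule homog_lin[rotated 2])
    thus "bcop H b \<in> homog (xtens G X X) (deg X b)"
      using lift_iso_inv[OF iso2, of "bcop H b"] b by (simp add: cop_in cop_th)
  qed
  show "crossed_hom G X (xtriv G) (\<lambda>b. Poly_Mapping.single () (beps H b))"
    unfolding crossed_hom_def
  proof (intro conjI ballI)
    show "lmap X (xtriv G) (\<lambda>b. Poly_Mapping.single () (beps H b))"
      using coalgebra_on_X by (auto simp: coalgebra_on_def lmap_def kspace_def)
  next
    fix h b assume h: "h \<in> carrier G" and b: "b \<in> basis X"
    have "linf (beps H) (act X h b) = linf (\<lambda>c. linf (beps K) (act Y h c)) (th b)"
      using h b by (simp add: act_in act_th linf_lin flip: eps_th')
    also have "\<dots> = linf (beps K) (th b)"
    proof (rule fspan_linf_cong[OF th_in[OF b]])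
      fix c assume c: "c \<in> basis Y"
      have "eqv (xtriv G) (lin (\<lambda>b. Poly_Mapping.single () (beps K b)) (act Y h c))
         (lin (act (xtriv G) h) (Poly_Mapping.single () (beps K c)))"
        using Yh(4) h c unfolding crossed_hom_def by blast
      thus "linf (beps K) (act Y h c) = beps K c"
        by (auto simp: eqv_def linf_eq_lookup)
    qed
    finally show "eqv (xtriv G) (lin (\<lambda>b. Poly_Mapping.single () (beps H b)) (act X h b))
      (lin (act (xtriv G) h) (Poly_Mapping.single () (beps H b)))"
      using b by (simp add: eqv_def eps_th single_eq_scale_bvec lin_scale_fun_const)
  next
    fix b assume b: "b \<in> basis X"
    have ok: "pspace_ok (xtriv G :: (_, _, 'k) xmod)" by (simp add: pspace_ok_def fspan_def)
    have "lin (\<lambda>b. Poly_Mapping.single () (beps K b)) (th b) \<in> homog (xtriv G) (deg X b)"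
    proof (rule lin_in_subspace[OF homog_subspace[OF ok]])
      fix c assume "c \<in> Poly_Mapping.keys (th b)"
      hence c: "c \<in> basis Y" "deg Y c = deg X b" using keysD[OF th_deg[OF b]] by auto
      have "Poly_Mapping.single () (beps K c) \<in> homog (xtriv G) (deg Y c)"
        using Yh(4) c(1) unfolding crossed_hom_def by blast
      thus "Poly_Mapping.single () (beps K c) \<in> homog (xtriv G) (deg X b)" by (simp only: c(2))
    qed
    thus "Poly_Mapping.single () (beps H b) \<in> homog (xtriv G) (deg X b)"
      using b by (simp add: single_eq_scale_bvec lin_scale_fun_const eps_th)
  qed
qed

lemma bialgebra_hom_th: "bialgebra_hom X H Y K th"
  unfolding bialgebra_hom_def
  using lmap_th one_th mul_th cop_th eps_th okY null_tens_subspace[of Y Y]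
  by (auto simp: eqv_def pspace_ok_def fv.subspace_0)

end

section \<open>The braided group of the double\<close>

context crossed_bialgebra
begin

text \<open>The transmuted product is defined by its Sweedler formula and agrees with
  \<open>trmul\<close> on pairs of basis elements, which suffices since \<open>th\<close> takes
  values in their span.\<close>

lemma bialgebra_hom_transmuted:
  assumes U: "\<And>a. a \<in> basis V \<Longrightarrow> U a = toD a" and hom: "bialgebra_hom X K trX trH th"
  shows "bialgebra_hom X K V (transmuted_bialg G H U) th"
proof -
  have *: "lin (bmul (transmuted_bialg G H U)) (tensor (th a) (th b)) = lin trmul (tensor (th a) (th b))"
    if "a \<in> basis X" "b \<in> basis X" for a b
    using hom that
    by (intro fspan_lin_cong[OF tensor_in_fspan[of _ "basis V" _ "basis V"]])
      (auto simp: bialgebra_hom_def lmap_def transmuted_bmul_toD[OF U])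
  have "bone (transmuted_bialg G H U) = bone H" "bcop (transmuted_bialg G H U) = bcop H"
    "beps (transmuted_bialg G H U) = beps H"
    by (simp_all add: transmuted_bialg_def)
  with hom show ?thesis
    unfolding bialgebra_hom_def by (auto simp: * eqv_def lmap_def tens_trX)
qed

text \<open>\<open>lift_iso\<close> gives injectivity on the quotients and the assumption
  \<open>inv\<close> surjectivity. The coactions match because \<open>th\<close> intertwines the
  actions and preserves degrees.\<close>

lemma transmutation_isoI:
  assumes U: "\<And>a. a \<in> basis V \<Longrightarrow> U a = toD a"
    and T: "crossed_transport G X K trX trH th th'"
    and inv: "\<And>c. c \<in> basis V \<Longrightarrow> lin th (th' c) = bvec c"
  shows "transmutation_iso G X K V H U th"
proof -
  interpret T: crossed_transport G X K trX trH th th' by (rule T)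
  show ?thesis
    unfolding transmutation_iso_def
  proof (intro conjI ballI)
    show "bialgebra_hom X K V (transmuted_bialg G H U) th"
      by (rule bialgebra_hom_transmuted[OF U T.bialgebra_hom_th])
    show "quot_bij X V th"
      unfolding quot_bij_def
    proof (intro conjI ballI impI)
      fix x assume "x \<in> fspan (basis X)" "lin th x \<in> null V"
      thus "x \<in> null X" using lift_iso_null[OF T.iso, of x] by simp
    next
      fix y :: "'b \<Rightarrow>\<^sub>0 'k" assume y: "y \<in> fspan (basis V)"
      have "lin th (lin th' y) = lin bvec y"
        unfolding lin_lin by (rule fspan_lin_cong[OF y]) (simp add: inv)
      moreover have "lin th' y \<in> fspan (basis X)"
        using lmap_lin_fspan[OF T.lmap_th(2)] y by simp
      ultimately show "\<exists>x\<in>fspan (basis X). eqv V (lin th x) y" by (intro bexI[of _ "lin th' y"]) auto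
    qed
  next
    fix b assume b: "b \<in> basis X"
    have "lin (tmap th bvec) (crossed_coaction G X b) =
      (\<Sum>g\<in>carrier G. tensor (lin (ad g) (th b)) (bvec (g, deg X b)))"
      using b by (auto simp: crossed_coaction_def lin_sum lin_tmap_tensor T.act_th intro!: sum.cong)
    also have "\<dots> = lin (\<lambda>c. \<Sum>g\<in>carrier G. tensor (ad g c) (bvec (g, deg X b))) (th b)"
      by (simp add: lin_fun_sum tensor_lin_left)
    \<comment> \<open>\<open>th b\<close> is homogeneous, so \<open>deg X b\<close> is the degree of
      each of its basis elements \<open>c\<close>.\<close>
    also have "\<dots> = lin (\<lambda>c. transmuted_coaction G H U c) (th b)"
      by (rule fspan_lin_cong[OF T.th_deg[OF b]])
        (auto simp: transmuted_coaction_toD[OF U] crossed_coaction_def)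
    finally show "eqv (tens V (D_space G)) (lin (tmap th bvec) (crossed_coaction G X b))
        (lin (transmuted_coaction G H U) (th b))" by simp
  qed
qed

end

context group
begin

text \<open>\<open>BD(G)\<close> is \<open>trX\<close> for the double itself, with the identity as
  isomorphism, so its axioms follow from the general transmutation.\<close>

lemma BD_transmutation:
  assumes fin: "finite (carrier G)"
  shows "braided_bialgebra G (BD_xmod G) (BD_bialg G :: (_, 'k::field) bialg)"
    and "transmutation_iso G (BD_xmod G) (BD_bialg G) (D_space G) (D_bialg G :: (_, 'k) bialg) bvec bvec"
proof -
  interpret D: crossed_coquasi G "D_space G" "D_bialg G :: (_, 'k) bialg" "D_la G" "D_ra G" "D_dl G" snd
    by (rule D_coquasi[OF assms])
  have ad: "D.ad h (u, v) = bvec (h \<otimes> u \<otimes> inv h, h \<otimes> v \<otimes> inv h)" for h u v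
    by (simp add: D.ad_def D_la_def D_ra_def)
  have gdeg: "D.gdeg (u, v) = u \<otimes> inv v \<otimes> inv u \<otimes> v" if "u \<in> carrier G" "v \<in> carrier G" for u v
    using that unfolding D.gdeg_def by (simp add: D_dl_def inv_mult_group m_assoc)
  have mul: "bmul (BD_bialg G) (a, b) = D.trmul (a, b)"
    if ab: "a \<in> carrier G \<times> carrier G" "b \<in> carrier G \<times> carrier G" for a b
  proof -
    obtain g h u v where e: "a = (g, h)" "b = (u, v)"
      and c: "g \<in> carrier G" "h \<in> carrier G" "u \<in> carrier G" "v \<in> carrier G" using ab by auto
    \<comment> \<open>The left side is the condition on delta indices after \<open>u\<close> has
      been translated by the degree of \<open>(g, h)\<close>; the right side is the condition in
      \<open>BD_bialg\<close>.\<close>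
    have iff: "g = g \<otimes> (inv h \<otimes> (inv g \<otimes> (h \<otimes> u))) \<longleftrightarrow> g = h \<otimes> u \<otimes> inv h"
    proof
      assume a: "g = g \<otimes> (inv h \<otimes> (inv g \<otimes> (h \<otimes> u)))"
      have "g \<otimes> h = g \<otimes> (h \<otimes> (inv g \<otimes> g))" using c by simp
      also have "\<dots> = g \<otimes> (h \<otimes> (inv g \<otimes> (g \<otimes> (inv h \<otimes> (inv g \<otimes> (h \<otimes> u))))))"
        by (subst (3) a) simp
      also have "\<dots> = h \<otimes> u" using c by simp
      finally have "g \<otimes> h \<otimes> inv h = h \<otimes> u \<otimes> inv h" by simp
      thus "g = h \<otimes> u \<otimes> inv h" using c by (simp add: m_assoc)
    next
      assume "g = h \<otimes> u \<otimes> inv h"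
      hence a: "h \<otimes> u = g \<otimes> h" using c by (simp add: m_assoc)
      show "g = g \<otimes> (inv h \<otimes> (inv g \<otimes> (h \<otimes> u)))" unfolding a using c by simp
    qed
    have "D.trmul (a, b) = (if g = g \<otimes> (inv h \<otimes> (inv g \<otimes> (h \<otimes> u))) then bvec (g, h \<otimes> v) else 0)"
      using c by (simp add: e D.trmul_def gdeg D_la_def) (simp add: D_bialg_def m_assoc)
    moreover have "bmul (BD_bialg G) (a, b) = (if g = h \<otimes> u \<otimes> inv h then bvec (g, h \<otimes> v) else 0 :: _ \<Rightarrow>\<^sub>0 'k)"
      by (simp add: e BD_bialg_def)
    ultimately show ?thesis by (simp only: iff)
  qed
  have T: "crossed_transport G (BD_xmod G) (BD_bialg G :: (_, 'k) bialg) D.trX D.trH bvec bvec"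
  proof
    show "braided_bialgebra G D.trX D.trH" by (rule D.braided_bialgebra_trX)
    show "pspace_ok (BD_xmod G :: (_, _, 'k) xmod)" by (simp add: pspace_ok_def)
    show "lift_iso (BD_xmod G) (D.trX :: (_, _, 'k) xmod) bvec bvec" by (simp add: lift_iso_def lmap_def)
    show "bone (BD_bialg G) \<in> (fspan (basis (BD_xmod G :: (_, _, 'k) xmod)) :: (_ \<Rightarrow>\<^sub>0 'k) set)"
      using D.one_in by (simp add: BD_bialg_def)
    show "lin bvec (bone (BD_bialg G)) = (bone D.trH :: _ \<Rightarrow>\<^sub>0 'k)"
      by (simp add: BD_bialg_def)
  next
    fix h b assume "h \<in> carrier G" "b \<in> basis (BD_xmod G :: (_, _, 'k) xmod)"
    thus "act (BD_xmod G) h b \<in> fspan (basis (BD_xmod G :: (_, _, 'k) xmod))"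
      "lin bvec (act (BD_xmod G) h b) = lin (act D.trX h) (bvec b :: _ \<Rightarrow>\<^sub>0 'k)"
      by (auto simp: ad)
  next
    fix a b assume ab: "a \<in> basis (BD_xmod G :: (_, _, 'k) xmod)" "b \<in> basis (BD_xmod G :: (_, _, 'k) xmod)"
    thus "bmul (BD_bialg G) (a, b) \<in> (fspan (basis (BD_xmod G :: (_, _, 'k) xmod)) :: (_ \<Rightarrow>\<^sub>0 'k) set)"
      "lin bvec (bmul (BD_bialg G) (a, b)) = lin (bmul D.trH) (tensor (bvec a) (bvec b :: _ \<Rightarrow>\<^sub>0 'k))"
      using D.trmul_in[of a b] by (simp_all add: mul)
  next
    fix a assume a: "a \<in> basis (BD_xmod G :: (_, _, 'k) xmod)"
    thus "bcop (BD_bialg G) a \<in>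
      (fspan (basis (BD_xmod G :: (_, _, 'k) xmod) \<times> basis (BD_xmod G :: (_, _, 'k) xmod)) :: (_ \<Rightarrow>\<^sub>0 'k) set)"
      using D.cop_in[of a] by (simp add: BD_bialg_def)
  qed (auto simp: gdeg BD_bialg_def)
  show "braided_bialgebra G (BD_xmod G) (BD_bialg G :: (_, 'k) bialg)"
    by (rule crossed_transport.braided_bialgebra_X[OF T])
  \<comment> \<open>On the double the canonical map is the identity, since the counit of the
    translated element vanishes unless \<open>f = g\<close>.\<close>
  have toD: "bvec a = D.toD a" if D: "a \<in> basis (D_space G :: (_, 'k) pspace)" for a
  proof -
    obtain g h where a: "a = (g, h)" and c: "g \<in> carrier G" "h \<in> carrier G" using D by auto
    have "D.toD a = (\<Sum>f\<in>carrier G. if f = g then bvec (g, h) else 0 :: _ \<Rightarrow>\<^sub>0 'k)"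
      unfolding D.toD_def
    proof (intro sum.cong refl)
      fix f assume f: "f \<in> carrier G"
      have "inv f \<otimes> g = \<one> \<longleftrightarrow> f = g"
        using f c by (metis inv_equality inv_inv inv_closed l_inv)
      thus "scale (linf (beps (D_bialg G)) (D_la G (inv f) a)) (bvec (f, snd a)) = (if f = g then bvec (g, h) else 0 :: _ \<Rightarrow>\<^sub>0 'k)"
        using f c by (simp add: a D_la_def D_bialg_def)
    qed
    thus ?thesis using c fin by (simp add: a)
  qed
  show "transmutation_iso G (BD_xmod G) (BD_bialg G) (D_space G) (D_bialg G :: (_, 'k) bialg) bvec bvec"
    by (rule D.transmutation_isoI[OF toD T]) auto
qed

end

section \<open>Conjugacy classes, the cocycle \<open>zeta\<close> and the representation
  matrices\<close>

locale pair_data = group G for G (structure) +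
  fixes r :: "'a set \<Rightarrow> 'a" and q :: "'a set \<Rightarrow> 'a \<Rightarrow> 'a" and S :: "('a, 'k::field) cpair set"
  assumes finG: "finite (carrier G)" and choice: "class_choice G r q"
    and pairs: "P \<in> S \<Longrightarrow> nontrivial_pair G r P"
begin

text \<open>The matrix of \<open>h\<close> from the fibre over \<open>c\<close> to the fibre over
  \<open>h \<otimes> c \<otimes> inv h\<close> in the induced representation. The companion
  \<open>wt'\<close> is its inverse and acts on dual indices.\<close>

definition wt :: "('a, 'k) cpair \<Rightarrow> 'a \<Rightarrow> 'a \<Rightarrow> nat \<Rightarrow> nat \<Rightarrow> 'k" where
  "wt P c h i m = snd P (zeta G q (fst P) c h) $$ (i, m)"

definition wt' :: "('a, 'k) cpair \<Rightarrow> 'a \<Rightarrow> 'a \<Rightarrow> nat \<Rightarrow> nat \<Rightarrow> 'k" where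
  "wt' P c h i m = snd P (inv (zeta G q (fst P) c h)) $$ (i, m)"

lemma class_in: "P \<in> S \<Longrightarrow> fst P \<in> conj_classes G"
  using pairs by (simp add: nontrivial_pair_def)

lemma class_carrier [simp]: "P \<in> S \<Longrightarrow> c \<in> fst P \<Longrightarrow> c \<in> carrier G"
  using class_in[of P] by (auto simp: conj_classes_def)

lemma class_conj [simp]:
  assumes "P \<in> S" "c \<in> fst P" "h \<in> carrier G"
  shows "h \<otimes> c \<otimes> inv h \<in> fst P"
proof -
  obtain x where x: "x \<in> carrier G" "fst P = {g \<otimes> x \<otimes> inv g | g. g \<in> carrier G}"
    using class_in[OF assms(1)] by (auto simp: conj_classes_def)
  then obtain g where g: "g \<in> carrier G" "c = g \<otimes> x \<otimes> inv g" using assms(2) by auto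
  have "h \<otimes> c \<otimes> inv h = (h \<otimes> g) \<otimes> x \<otimes> inv (h \<otimes> g)"
    using x g assms(3) by (simp add: inv_mult_group m_assoc)
  moreover have "h \<otimes> g \<in> carrier G" using g assms by simp
  ultimately show ?thesis unfolding x(2) by blast
qed

lemma q_in [simp]: "P \<in> S \<Longrightarrow> c \<in> fst P \<Longrightarrow> q (fst P) c \<in> carrier G"
  and q_conj: "P \<in> S \<Longrightarrow> c \<in> fst P \<Longrightarrow> q (fst P) c \<otimes> r (fst P) \<otimes> inv (q (fst P) c) = c"
  and r_in_class: "P \<in> S \<Longrightarrow> r (fst P) \<in> fst P"
  using choice class_in by (auto simp: class_choice_def)

lemma r_in [simp]: "P \<in> S \<Longrightarrow> r (fst P) \<in> carrier G"
  using r_in_class class_carrier by blast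

lemma zeta_in [simp]: "P \<in> S \<Longrightarrow> c \<in> fst P \<Longrightarrow> h \<in> carrier G \<Longrightarrow> zeta G q (fst P) c h \<in> carrier G"
  by (simp add: zeta_def)

text \<open>The elements \<open>q\<close> conjugate the base point to \<open>a\<close> and to
  \<open>b\<close>, so \<open>g\<close> sends \<open>a\<close> to \<open>b\<close> by conjugation
  exactly when the displayed product fixes the base point.\<close>

lemma centralizer_iff:
  assumes P: "P \<in> S" and ab: "a \<in> fst P" "b \<in> fst P" and g: "g \<in> carrier G"
  shows "inv (q (fst P) b) \<otimes> g \<otimes> q (fst P) a \<in> centralizer G (r (fst P)) \<longleftrightarrow> g \<otimes> a \<otimes> inv g = b"
proof -
  let ?r = "r (fst P)" and ?a = "q (fst P) a" and ?b = "q (fst P) b"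
  have c: "?r \<in> carrier G" "?a \<in> carrier G" "?b \<in> carrier G" using assms by auto
  have a: "?a \<otimes> ?r \<otimes> inv ?a = a" and b: "?b \<otimes> ?r \<otimes> inv ?b = b"
    using q_conj assms by auto
  have "?a \<otimes> ?r = (?a \<otimes> ?r \<otimes> inv ?a) \<otimes> ?a" using c by (simp add: m_assoc)
  hence A: "?a \<otimes> ?r = a \<otimes> ?a" by (simp only: a)
  have "?r \<otimes> inv ?b = inv ?b \<otimes> (?b \<otimes> ?r \<otimes> inv ?b)" using c by (simp add: m_assoc)
  hence B: "?r \<otimes> inv ?b = inv ?b \<otimes> b" by (simp only: b)
  have ac: "a \<in> carrier G" "b \<in> carrier G" using assms by auto
  have "inv ?b \<otimes> g \<otimes> ?a \<otimes> ?r = ?r \<otimes> (inv ?b \<otimes> g \<otimes> ?a) \<longleftrightarrow>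
     inv ?b \<otimes> (g \<otimes> a) \<otimes> ?a = inv ?b \<otimes> (b \<otimes> g) \<otimes> ?a"
  proof -
    have "inv ?b \<otimes> g \<otimes> ?a \<otimes> ?r = inv ?b \<otimes> g \<otimes> (?a \<otimes> ?r)" using c g by (simp add: m_assoc)
    also have "\<dots> = inv ?b \<otimes> (g \<otimes> a) \<otimes> ?a" unfolding A using c g ac by (simp add: m_assoc)
    finally have 1: "inv ?b \<otimes> g \<otimes> ?a \<otimes> ?r = inv ?b \<otimes> (g \<otimes> a) \<otimes> ?a" .
    have "?r \<otimes> (inv ?b \<otimes> g \<otimes> ?a) = (?r \<otimes> inv ?b) \<otimes> g \<otimes> ?a" using c g by (simp add: m_assoc)
    also have "\<dots> = inv ?b \<otimes> (b \<otimes> g) \<otimes> ?a" unfolding B using c g ac by (simp add: m_assoc)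
    finally have 2: "?r \<otimes> (inv ?b \<otimes> g \<otimes> ?a) = inv ?b \<otimes> (b \<otimes> g) \<otimes> ?a" .
    show ?thesis unfolding 1 2 ..
  qed
  also have "\<dots> \<longleftrightarrow> g \<otimes> a = b \<otimes> g"
    using c g ac by simp
  also have "\<dots> \<longleftrightarrow> g \<otimes> a \<otimes> inv g = b"
  proof
    assume e: "g \<otimes> a = b \<otimes> g"
    show "g \<otimes> a \<otimes> inv g = b" unfolding e using g ac by (simp add: m_assoc)
  next
    assume e: "g \<otimes> a \<otimes> inv g = b"
    show "g \<otimes> a = b \<otimes> g" unfolding e[symmetric] using g ac by (simp add: m_assoc)
  qed
  finally show ?thesis using c g by (simp add: centralizer_def)
qed

lemma zeta_centralizer:
  assumes "P \<in> S" "c \<in> fst P" "h \<in> carrier G"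
  shows "zeta G q (fst P) c h \<in> centralizer G (r (fst P))"
  unfolding zeta_def using assms by (subst centralizer_iff) auto

lemma zeta_one: "P \<in> S \<Longrightarrow> c \<in> fst P \<Longrightarrow> zeta G q (fst P) c \<one> = \<one>"
  by (simp add: zeta_def)

text \<open>The cocycle identity: the section at the intermediate element
  \<open>h \<otimes> c \<otimes> inv h\<close> cancels.\<close>

lemma zeta_mult:
  assumes "P \<in> S" "c \<in> fst P" "g \<in> carrier G" "h \<in> carrier G"
  shows "zeta G q (fst P) c (g \<otimes> h) = zeta G q (fst P) (h \<otimes> c \<otimes> inv h) g \<otimes> zeta G q (fst P) c h"
proof -
  have e: "g \<otimes> h \<otimes> c \<otimes> inv (g \<otimes> h) = g \<otimes> (h \<otimes> c \<otimes> inv h) \<otimes> inv g"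
    using assms by (simp add: inv_mult_group m_assoc)
  have "q (fst P) (h \<otimes> c \<otimes> inv h) \<in> carrier G" "q (fst P) (g \<otimes> (h \<otimes> c \<otimes> inv h) \<otimes> inv g) \<in> carrier G"
    using assms by (auto simp del: m_assoc)
  thus ?thesis
    unfolding zeta_def e using assms by (simp add: m_assoc del: class_conj)
qed

lemma rep:
  assumes "P \<in> S"
  shows "n \<in> centralizer G (r (fst P)) \<Longrightarrow> snd P n \<in> carrier_mat (pdim G P) (pdim G P)"
    and "snd P \<one> = 1\<^sub>m (pdim G P)"
    and "m \<in> centralizer G (r (fst P)) \<Longrightarrow> n \<in> centralizer G (r (fst P)) \<Longrightarrow> snd P (m \<otimes> n) = snd P m * snd P n"
  using pairs[OF assms] by (auto simp: nontrivial_pair_def irreducible_rep_def matrix_rep_def)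

lemma rep_mult_entry:
  assumes "P \<in> S" "m \<in> centralizer G (r (fst P))" "n \<in> centralizer G (r (fst P))"
    and "i < pdim G P" "j < pdim G P"
  shows "snd P (m \<otimes> n) $$ (i, j) = (\<Sum>l<pdim G P. snd P m $$ (i, l) * snd P n $$ (l, j))"
proof -
  have "snd P m \<in> carrier_mat (pdim G P) (pdim G P)" "snd P n \<in> carrier_mat (pdim G P) (pdim G P)"
    using rep(1) assms by auto
  thus ?thesis
    using assms by (simp add: rep(3) scalar_prod_def atLeast0LessThan)
qed

lemma inv_centralizer: "P \<in> S \<Longrightarrow> n \<in> centralizer G (r (fst P)) \<Longrightarrow> inv n \<in> centralizer G (r (fst P))"
proof -
  assume P: "P \<in> S" and n: "n \<in> centralizer G (r (fst P))"
  let ?r = "r (fst P)"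
  have c: "n \<in> carrier G" "?r \<in> carrier G" "n \<otimes> ?r = ?r \<otimes> n" using n P by (auto simp: centralizer_def)
  have "inv n \<otimes> ?r = inv n \<otimes> (?r \<otimes> n) \<otimes> inv n" using c(1,2) by (simp add: m_assoc)
  also have "\<dots> = ?r \<otimes> inv n" unfolding c(3)[symmetric] using c(1,2) by (simp add: m_assoc)
  finally show ?thesis using c by (simp add: centralizer_def)
qed

lemma wt_one:
  "P \<in> S \<Longrightarrow> c \<in> fst P \<Longrightarrow> i < pdim G P \<Longrightarrow> m < pdim G P \<Longrightarrow> wt P c \<one> i m = (if i = m then 1 else 0)"
  "P \<in> S \<Longrightarrow> c \<in> fst P \<Longrightarrow> i < pdim G P \<Longrightarrow> m < pdim G P \<Longrightarrow> wt' P c \<one> i m = (if i = m then 1 else 0)"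
  by (simp_all add: wt_def wt'_def zeta_one rep(2))

lemma wt_mult:
  assumes "P \<in> S" "c \<in> fst P" "g \<in> carrier G" "h \<in> carrier G" "i < pdim G P" "m < pdim G P"
  shows "wt P c (g \<otimes> h) i m = (\<Sum>l<pdim G P. wt P (h \<otimes> c \<otimes> inv h) g i l * wt P c h l m)"
  using assms by (simp add: wt_def zeta_mult rep_mult_entry zeta_centralizer)

text \<open>Inversion reverses the cocycle identity, as it should for the dual action.\<close>

lemma wt'_mult:
  assumes "P \<in> S" "c \<in> fst P" "g \<in> carrier G" "h \<in> carrier G" "i < pdim G P" "m < pdim G P"
  shows "wt' P c (g \<otimes> h) i m = (\<Sum>l<pdim G P. wt' P c h i l * wt' P (h \<otimes> c \<otimes> inv h) g l m)"
  using assms by (simp add: wt'_def zeta_mult inv_mult_group rep_mult_entry zeta_centralizer inv_centralizer)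

lemma wt_wt':
  assumes "P \<in> S" "c \<in> fst P" "h \<in> carrier G" "i < pdim G P" "m < pdim G P"
  shows "(\<Sum>l<pdim G P. wt P c h i l * wt' P c h l m) = (if i = m then 1 else 0)"
    and "(\<Sum>l<pdim G P. wt' P c h i l * wt P c h l m) = (if i = m then 1 else 0)"
  using assms unfolding wt_def wt'_def
  by (simp_all add: rep(2) zeta_centralizer inv_centralizer flip: rep_mult_entry)

end

section \<open>The generators\<close>

lemma sum_scale_delta:
  assumes "finite A"
  shows "(\<Sum>x\<in>A. scale (if x = a then c else 0) (f x)) = (if a \<in> A then scale c (f a) else 0)"
    and "(\<Sum>x\<in>A. scale (if a = x then c else 0) (f x)) = (if a \<in> A then scale c (f a) else 0)"
proof -
  have "(\<Sum>x\<in>A. scale (if x = a then c else 0) (f x)) = (\<Sum>x\<in>A. if x = a then scale c (f x) else 0)"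
    by (rule sum.cong) auto
  thus 1: "(\<Sum>x\<in>A. scale (if x = a then c else 0) (f x)) = (if a \<in> A then scale c (f a) else 0)"
    using assms by simp
  have "(\<Sum>x\<in>A. scale (if a = x then c else 0) (f x)) = (\<Sum>x\<in>A. scale (if x = a then c else 0) (f x))"
    by (rule sum.cong) auto
  thus "(\<Sum>x\<in>A. scale (if a = x then c else 0) (f x)) = (if a \<in> A then scale c (f a) else 0)"
    using 1 by simp
qed

lemma sum_sum_scale_delta:
  assumes "finite A" "finite B" "a \<in> A" "b \<in> B"
  shows "(\<Sum>x\<in>A. \<Sum>y\<in>B. scale (if a = x \<and> b = y then 1 else 0) (f x y)) = f a b"
    and "(\<Sum>x\<in>A. \<Sum>y\<in>B. scale (if x = a \<and> y = b then 1 else 0) (f x y)) = f a b"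
proof -
  have "(\<Sum>y\<in>B. scale (if a = x \<and> b = y then 1 else 0) (f x y)) = (if x = a then f x b else 0)" for x
    using assms(2,4) by (cases "a = x") (simp_all add: sum_scale_delta)
  thus 1: "(\<Sum>x\<in>A. \<Sum>y\<in>B. scale (if a = x \<and> b = y then 1 else 0) (f x y)) = f a b"
    using assms(1,3) by simp
  show "(\<Sum>x\<in>A. \<Sum>y\<in>B. scale (if x = a \<and> y = b then 1 else 0) (f x y)) = f a b"
    unfolding 1[symmetric] by (simp only: eq_commute)
qed

context pair_data
begin

definition gla :: "'a \<Rightarrow> ('a, 'k) gen \<Rightarrow> (('a, 'k) gen \<Rightarrow>\<^sub>0 'k)" where
  "gla = left_act G q"

text \<open>The dual counterpart of \<open>left_act\<close>: only the upper index
  \<open>E^{bj}\<close> moves, by the inverse matrices.\<close>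

definition gra :: "'a \<Rightarrow> ('a, 'k) gen \<Rightarrow> (('a, 'k) gen \<Rightarrow>\<^sub>0 'k)" where
  "gra h = (\<lambda>(P, x, (b, j)). \<Sum>l<pdim G P. scale (wt' P b h j l) (bvec (P, x, (h \<otimes> b \<otimes> inv h, l))))"

definition gdl :: "('a, 'k) gen \<Rightarrow> 'a" where
  "gdl = (\<lambda>(P, (a, i), y). inv a)"

definition gdr :: "('a, 'k) gen \<Rightarrow> 'a" where
  "gdr = (\<lambda>(P, x, (b, j)). inv b)"

lemma gla_apply: "gla h (P, (a, i), y) =
    (\<Sum>m<pdim G P. scale (wt P a h m i) (bvec (P, (h \<otimes> a \<otimes> inv h, m), y)))"
  by (simp add: gla_def left_act_def wt_def)

lemma gra_apply: "gra h (P, x, (b, j)) =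
    (\<Sum>l<pdim G P. scale (wt' P b h j l) (bvec (P, x, (h \<otimes> b \<otimes> inv h, l))))"
  by (simp add: gra_def)

lemma gens_iff [simp]: "(P, (a, i), (b, j)) \<in> gens G S \<longleftrightarrow>
    P \<in> S \<and> a \<in> fst P \<and> i < pdim G P \<and> b \<in> fst P \<and> j < pdim G P"
  by (auto simp: gens_def pidx_def)

lemma gensE:
  assumes "t \<in> gens G S"
  obtains P a i b j where "t = (P, (a, i), (b, j))" "P \<in> S" "a \<in> fst P" "i < pdim G P" "b \<in> fst P" "j < pdim G P"
  using assms by (cases t) (auto simp: gens_def pidx_def)

lemma finite_class [simp]: "P \<in> S \<Longrightarrow> finite (fst P)"
  using finite_subset[OF subsetI finG, of "fst P"] class_carrier by blast

lemma mat_cop_apply: "mat_cop G (P, x, y) = (\<Sum>c\<in>fst P. \<Sum>m<pdim G P. bvec ((P, x, (c, m)), (P, (c, m), y)))"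
  by (simp add: mat_cop_def pidx_def sum.cartesian_product case_prod_unfold)

lemma conj_mult:
  "g \<in> carrier G \<Longrightarrow> h \<in> carrier G \<Longrightarrow> c \<in> carrier G \<Longrightarrow>
    g \<otimes> (h \<otimes> c \<otimes> inv h) \<otimes> inv g = (g \<otimes> h) \<otimes> c \<otimes> inv (g \<otimes> h)"
  by (simp add: inv_mult_group m_assoc)

lemma sum_class_conj:
  assumes "P \<in> S" "h \<in> carrier G"
  shows "(\<Sum>c\<in>fst P. F (h \<otimes> c \<otimes> inv h)) = (\<Sum>c\<in>fst P. F c)"
proof (rule sum.reindex_bij_witness[where i = "\<lambda>c. inv h \<otimes> c \<otimes> h" and j = "\<lambda>c. h \<otimes> c \<otimes> inv h"])
  fix c assume c: "c \<in> fst P"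
  show "inv h \<otimes> c \<otimes> h \<in> fst P"
    using class_conj[OF assms(1) c, of "inv h"] assms by simp
  show "h \<otimes> c \<otimes> inv h \<in> fst P" using assms c by simp
  show "inv h \<otimes> (h \<otimes> c \<otimes> inv h) \<otimes> h = c" "h \<otimes> (inv h \<otimes> c \<otimes> h) \<otimes> inv h = c"
    using assms c by (simp_all add: m_assoc)
qed simp

text \<open>The two invariance laws are those of the canonical element in the dual times the induced
  representation and of the evaluation pairing. Both reduce to \<open>wt\<close> and
  \<open>wt'\<close> being inverse matrices.\<close>

lemma gens_coalgebra: "crossed_coalgebra G (gens G S) gla gra gdl gdr (mat_cop G) mat_eps"
proof unfold_locales
  show "finite (carrier G)" by (rule finG)
next
  fix t assume "t \<in> gens G S"
  thus "gdl t \<in> carrier G" "gdr t \<in> carrier G"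
    by (auto elim!: gensE simp: gdl_def gdr_def)
next
  fix h t assume h: "h \<in> carrier G" and t: "t \<in> gens G S"
  from t obtain P a i b j where e: "t = (P, (a, i), (b, j))"
    and m: "P \<in> S" "a \<in> fst P" "i < pdim G P" "b \<in> fst P" "j < pdim G P" by (rule gensE)
  have inv: "inv (h \<otimes> c \<otimes> inv h) = h \<otimes> inv c \<otimes> inv h" if "c \<in> carrier G" for c
    using h that by (simp add: inv_mult_group m_assoc)
  show "gla h t \<in> fspan {b \<in> gens G S. gdl b = h \<otimes> gdl t \<otimes> inv h \<and> gdr b = gdr t}"
    using h m inv[of a] by (auto simp: e gla_apply gdl_def gdr_def intro!: sum_in_fspan scale_in_fspan)
  show "gra h t \<in> fspan {b \<in> gens G S. gdl b = gdl t \<and> gdr b = h \<otimes> gdr t \<otimes> inv h}"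
    using h m inv[of b] by (auto simp: e gra_apply gdl_def gdr_def intro!: sum_in_fspan scale_in_fspan)
  have "lin (mat_cop G) (gla h t) = (\<Sum>n<pdim G P. \<Sum>c\<in>fst P. \<Sum>k<pdim G P. scale (wt P a h n i)
     (bvec ((P, (h \<otimes> a \<otimes> inv h, n), (c, k)), (P, (c, k), (b, j)))))"
    by (simp add: e gla_apply lin_sum lin_scale mat_cop_apply scale_sum_right)
  also have "\<dots> = (\<Sum>c\<in>fst P. \<Sum>k<pdim G P. \<Sum>n<pdim G P. scale (wt P a h n i)
     (bvec ((P, (h \<otimes> a \<otimes> inv h, n), (c, k)), (P, (c, k), (b, j)))))"
    by (subst sum.swap) (intro sum.cong refl sum.swap)
  also have "\<dots> = lin (tmap (gla h) bvec) (mat_cop G t)"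
    by (simp add: e gla_apply mat_cop_apply lin_sum tmap_apply tensor_sum_left tensor_scale_left)
  finally show "lin (mat_cop G) (gla h t) = lin (tmap (gla h) bvec) (mat_cop G t)" .
  have "lin (mat_cop G) (gra h t) = (\<Sum>n<pdim G P. \<Sum>c\<in>fst P. \<Sum>k<pdim G P. scale (wt' P b h j n)
     (bvec ((P, (a, i), (c, k)), (P, (c, k), (h \<otimes> b \<otimes> inv h, n)))))"
    by (simp add: e gra_apply lin_sum lin_scale mat_cop_apply scale_sum_right)
  also have "\<dots> = (\<Sum>c\<in>fst P. \<Sum>k<pdim G P. \<Sum>n<pdim G P. scale (wt' P b h j n)
     (bvec ((P, (a, i), (c, k)), (P, (c, k), (h \<otimes> b \<otimes> inv h, n)))))"
    by (subst sum.swap) (intro sum.cong refl sum.swap)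
  also have "\<dots> = lin (tmap bvec (gra h)) (mat_cop G t)"
    by (simp add: e gra_apply mat_cop_apply lin_sum tmap_apply tensor_sum_right tensor_scale_right)
  finally show "lin (mat_cop G) (gra h t) = lin (tmap bvec (gra h)) (mat_cop G t)" .
  \<comment> \<open>For \<open>cop_inv\<close> the middle indices collapse by \<open>wt_wt'\<close>,
    and conjugation by \<open>h\<close> merely permutes the class in the sum over
    \<open>c\<close>.\<close>
  let ?B = "\<lambda>c l k. bvec ((P, (a, i), (c, l)), (P, (c, k), (b, j))) :: _ \<Rightarrow>\<^sub>0 'k"
  have "lin (tmap (gra h) (gla h)) (mat_cop G t) = (\<Sum>c\<in>fst P. \<Sum>n<pdim G P. \<Sum>k<pdim G P. \<Sum>l<pdim G P.
      scale (wt P c h k n * wt' P c h n l) (?B (h \<otimes> c \<otimes> inv h) l k))"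
    by (simp add: e gra_apply gla_apply mat_cop_apply lin_sum tmap_apply tensor_sum_right tensor_sum_left
       tensor_scale_right tensor_scale_left scale_sum_right mult.commute)
  also have "\<dots> = (\<Sum>c\<in>fst P. \<Sum>k<pdim G P. \<Sum>l<pdim G P. scale (\<Sum>n<pdim G P. wt P c h k n * wt' P c h n l)
      (?B (h \<otimes> c \<otimes> inv h) l k))"
  proof (rule sum.cong[OF refl])
    fix c assume "c \<in> fst P"
    have "(\<Sum>n<pdim G P. \<Sum>k<pdim G P. \<Sum>l<pdim G P. scale (wt P c h k n * wt' P c h n l) (?B (h \<otimes> c \<otimes> inv h) l k))
      = (\<Sum>k<pdim G P. \<Sum>n<pdim G P. \<Sum>l<pdim G P. scale (wt P c h k n * wt' P c h n l) (?B (h \<otimes> c \<otimes> inv h) l k))"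
      by (rule sum.swap)
    also have "\<dots> = (\<Sum>k<pdim G P. \<Sum>l<pdim G P. \<Sum>n<pdim G P. scale (wt P c h k n * wt' P c h n l) (?B (h \<otimes> c \<otimes> inv h) l k))"
      by (intro sum.cong refl sum.swap)
    finally show "(\<Sum>n<pdim G P. \<Sum>k<pdim G P. \<Sum>l<pdim G P. scale (wt P c h k n * wt' P c h n l) (?B (h \<otimes> c \<otimes> inv h) l k))
      = (\<Sum>k<pdim G P. \<Sum>l<pdim G P. scale (\<Sum>n<pdim G P. wt P c h k n * wt' P c h n l) (?B (h \<otimes> c \<otimes> inv h) l k))"
      by (simp add: scale_sum_left)
  qed
  also have "\<dots> = (\<Sum>c\<in>fst P. \<Sum>k<pdim G P. \<Sum>l<pdim G P. if l = k then ?B (h \<otimes> c \<otimes> inv h) l k else 0)"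
    using h m by (intro sum.cong refl) (simp add: wt_wt')
  also have "\<dots> = (\<Sum>c\<in>fst P. (\<lambda>c. \<Sum>k<pdim G P. ?B c k k) (h \<otimes> c \<otimes> inv h))"
    by simp
  also have "\<dots> = (\<Sum>c\<in>fst P. \<Sum>k<pdim G P. ?B c k k)"
    using m h by (subst sum_class_conj) auto
  also have "\<dots> = mat_cop G t"
    by (simp add: e mat_cop_apply)
  finally show "lin (tmap (gra h) (gla h)) (mat_cop G t) = mat_cop G t" .
  have delta: "(\<Sum>l<d. f l * (if n = l then 1 else 0)) = f n" if "n < d" for d n and f :: "nat \<Rightarrow> 'k"
  proof -
    have "(\<Sum>l<d. f l * (if n = l then 1 else 0)) = (\<Sum>l<d. if n = l then f l else 0)"
      by (rule sum.cong) auto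
    thus ?thesis using that by simp
  qed
  \<comment> \<open>Conjugation by \<open>h\<close> preserves whether \<open>a\<close> and
    \<open>b\<close> coincide; when they do, both weights belong to the same fibre.\<close>
  have "linf mat_eps (lin (gra h) (gla h t)) = (\<Sum>n<pdim G P. \<Sum>l<pdim G P.
     if n = l then (if a = b then wt P a h n i * wt' P b h j l else 0) else 0)"
    using h m by (auto simp: e gla_apply gra_apply lin_sum lin_scale linf_sum linf_scale mat_eps_def
       scale_sum_right delta intro!: sum.cong)
  also have "\<dots> = (if a = b then (\<Sum>n<pdim G P. wt' P a h j n * wt P a h n i) else 0)"
    by (simp add: mult.commute)
  also have "\<dots> = mat_eps t"
    using h m by (auto simp: wt_wt' e mat_eps_def)
  finally show "linf mat_eps (lin (gra h) (gla h t)) = (mat_eps t :: 'k)" .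
next
  fix t assume "t \<in> gens G S"
  then obtain P a i b j where e: "t = (P, (a, i), (b, j))"
    and m: "P \<in> S" "a \<in> fst P" "i < pdim G P" "b \<in> fst P" "j < pdim G P" by (rule gensE)
  show "gla \<one> t = bvec t" "gra \<one> t = bvec t"
    using m by (simp_all add: e gla_apply gra_apply wt_one sum_scale_delta)
  show "mat_cop G t \<in> fspan {(b, c). b \<in> gens G S \<and> c \<in> gens G S \<and> gdl b = gdl t \<and> gdr b = gdl c \<and> gdr c = gdr t}"
    using m by (auto simp: e mat_cop_apply gdl_def gdr_def intro!: sum_in_fspan)
  have "lin (tmap (mat_cop G) bvec) (mat_cop G t) = (\<Sum>c\<in>fst P. \<Sum>k<pdim G P. \<Sum>d\<in>fst P. \<Sum>l<pdim G P.
      bvec (((P, (a, i), (d, l)), (P, (d, l), (c, k))), (P, (c, k), (b, j))) :: _ \<Rightarrow>\<^sub>0 'k)"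
    by (simp add: e mat_cop_apply lin_sum tmap_apply tensor_sum_left)
  also have "\<dots> = (\<Sum>c\<in>fst P. \<Sum>d\<in>fst P. \<Sum>k<pdim G P. \<Sum>l<pdim G P.
      bvec (((P, (a, i), (d, l)), (P, (d, l), (c, k))), (P, (c, k), (b, j))))"
    by (intro sum.cong refl sum.swap)
  also have "\<dots> = (\<Sum>d\<in>fst P. \<Sum>c\<in>fst P. \<Sum>l<pdim G P. \<Sum>k<pdim G P.
      bvec (((P, (a, i), (d, l)), (P, (d, l), (c, k))), (P, (c, k), (b, j))))"
    by (subst sum.swap) (intro sum.cong refl sum.swap)
  also have "\<dots> = (\<Sum>d\<in>fst P. \<Sum>l<pdim G P. \<Sum>c\<in>fst P. \<Sum>k<pdim G P.
      bvec (((P, (a, i), (d, l)), (P, (d, l), (c, k))), (P, (c, k), (b, j))))"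
    by (intro sum.cong refl sum.swap)
  also have "\<dots> = lin (\<lambda>(x, (y, z)). bvec ((x, y), z)) (lin (tmap bvec (mat_cop G)) (mat_cop G t))"
    by (simp add: e mat_cop_apply lin_sum tmap_apply tensor_sum_right)
  finally show "lin (tmap (mat_cop G) bvec) (mat_cop G t) =
    lin (\<lambda>(x, (y, z)). bvec ((x, y), z)) (lin (tmap bvec (mat_cop G)) (mat_cop G t) :: _ \<Rightarrow>\<^sub>0 'k)" .
  show "lin (\<lambda>(x, y). scale (mat_eps x) (bvec y)) (mat_cop G t) = (bvec t :: _ \<Rightarrow>\<^sub>0 'k)"
    "lin (\<lambda>(x, y). scale (mat_eps y) (bvec x)) (mat_cop G t) = (bvec t :: _ \<Rightarrow>\<^sub>0 'k)"
    using m by (simp_all add: e mat_cop_apply lin_sum mat_eps_def sum_sum_scale_delta)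
  assume "mat_eps t \<noteq> (0 :: 'k)"
  thus "gdl t = gdr t" by (auto simp: e mat_eps_def gdl_def gdr_def split: if_splits)
next
  fix g h t assume gh: "g \<in> carrier G" "h \<in> carrier G" and t: "t \<in> gens G S"
  from t obtain P a i b j where e: "t = (P, (a, i), (b, j))"
    and m: "P \<in> S" "a \<in> fst P" "i < pdim G P" "b \<in> fst P" "j < pdim G P" by (rule gensE)
  let ?A = "g \<otimes> h \<otimes> a \<otimes> inv (g \<otimes> h)" and ?B = "g \<otimes> h \<otimes> b \<otimes> inv (g \<otimes> h)"
  have "lin (gla g) (gla h t) = (\<Sum>n<pdim G P. \<Sum>k<pdim G P.
     scale (wt P (h \<otimes> a \<otimes> inv h) g k n * wt P a h n i) (bvec (P, (?A, k), (b, j))))"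
    using gh m by (simp add: e gla_apply lin_sum lin_scale scale_sum_right conj_mult mult.commute)
  also have "\<dots> = (\<Sum>k<pdim G P. \<Sum>n<pdim G P.
     scale (wt P (h \<otimes> a \<otimes> inv h) g k n * wt P a h n i) (bvec (P, (?A, k), (b, j))))"
    by (rule sum.swap)
  also have "\<dots> = gla (g \<otimes> h) t"
    using gh m by (simp add: e gla_apply wt_mult scale_sum_left)
  finally show "lin (gla g) (gla h t) = gla (g \<otimes> h) t" .
  have "lin (gra g) (gra h t) = (\<Sum>n<pdim G P. \<Sum>k<pdim G P.
     scale (wt' P b h j n * wt' P (h \<otimes> b \<otimes> inv h) g n k) (bvec (P, (a, i), (?B, k))))"
    using gh m by (simp add: e gra_apply lin_sum lin_scale scale_sum_right conj_mult)
  also have "\<dots> = (\<Sum>k<pdim G P. \<Sum>n<pdim G P.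
     scale (wt' P b h j n * wt' P (h \<otimes> b \<otimes> inv h) g n k) (bvec (P, (a, i), (?B, k))))"
    by (rule sum.swap)
  also have "\<dots> = gra (g \<otimes> h) t"
    using gh m by (simp add: e gra_apply wt'_mult scale_sum_left)
  finally show "lin (gra g) (gra h t) = gra (g \<otimes> h) t" .
  have "lin (gla g) (gra h t) = (\<Sum>l<pdim G P. \<Sum>n<pdim G P. scale (wt' P b h j l * wt P a g n i)
     (bvec (P, (g \<otimes> a \<otimes> inv g, n), (h \<otimes> b \<otimes> inv h, l))))"
    by (simp add: e gla_apply gra_apply lin_sum lin_scale scale_sum_right)
  also have "\<dots> = (\<Sum>n<pdim G P. \<Sum>l<pdim G P. scale (wt' P b h j l * wt P a g n i)
     (bvec (P, (g \<otimes> a \<otimes> inv g, n), (h \<otimes> b \<otimes> inv h, l))))"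
    by (rule sum.swap)
  also have "\<dots> = lin (gra h) (gla g t)"
    by (simp add: e gla_apply gra_apply lin_sum lin_scale scale_sum_right mult.commute)
  finally show "lin (gla g) (gra h t) = lin (gra h) (gla g t)" .
qed

lemma L_act_eq:
  assumes "t \<in> gens G S" "h \<in> carrier G"
  shows "L_act G q h t = lin (gra h) (gla h t)"
  using assms(1)
  by (rule gensE) (simp add: L_act_def gla_apply gra_apply lin_sum lin_scale scale_sum_right wt_def wt'_def)

lemma L_deg_eq:
  assumes "t \<in> gens G S"
  shows "L_deg G t = inv (gdl t) \<otimes> gdr t"
  using assms by (rule gensE) (simp add: L_deg_def gdl_def gdr_def)

end

section \<open>Words in the generators\<close>

definition consv :: "('x \<Rightarrow>\<^sub>0 'k::field) \<Rightarrow> ('x list \<Rightarrow>\<^sub>0 'k) \<Rightarrow> ('x list \<Rightarrow>\<^sub>0 'k)" where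
  "consv x w = lin (\<lambda>(y, v). bvec (y # v)) (tensor x w)"

text \<open>For the flip this is multiplication by the coproduct of a letter in the ordinary tensor
  square.\<close>

definition consv2 :: "('x \<times> 'y \<Rightarrow>\<^sub>0 'k::field) \<Rightarrow> ('x list \<times> 'y list \<Rightarrow>\<^sub>0 'k) \<Rightarrow> ('x list \<times> 'y list \<Rightarrow>\<^sub>0 'k)" where
  "consv2 x w = lin (\<lambda>((y1, y2), (v1, v2)). bvec (y1 # v1, y2 # v2)) (tensor x w)"

definition appv :: "('x list \<Rightarrow>\<^sub>0 'k::field) \<Rightarrow> ('x list \<Rightarrow>\<^sub>0 'k) \<Rightarrow> ('x list \<Rightarrow>\<^sub>0 'k)" where
  "appv x y = lin word_mul (tensor x y)"

lemma lin_tensor_lin: "lin (\<lambda>(y, v). lin k (tensor (f y) (g v))) (tensor a b) = lin k (tensor (lin f a) (lin g b))"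
  by (simp add: lin_tmap_tensor[symmetric] lin_lin tmap_def case_prod_unfold)

lemma consv_bvec [simp]: "consv (bvec x) (bvec w) = bvec (x # w)"
  by (simp add: consv_def)

lemma consv_bvec_left: "consv (bvec x) w = lin (\<lambda>v. bvec (x # v)) w"
  by (simp add: consv_def tensor_bvec_left lin_lin)

lemma lin_consv: "lin f (consv x w) = lin (\<lambda>(y, v). f (y # v)) (tensor x w)"
  by (simp add: consv_def lin_lin case_prod_unfold)

lemma linf_consv: "linf f (consv x w) = linf (\<lambda>(y, v). f (y # v)) (tensor x w)"
  by (simp add: consv_def linf_lin case_prod_unfold)

lemma lin_consv2: "lin f (consv2 x w) = lin (\<lambda>((y1, y2), (v1, v2)). f (y1 # v1, y2 # v2)) (tensor x w)"
  by (simp add: consv2_def lin_lin case_prod_unfold)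

lemma word_act_Cons: "word_act f (x # w) = consv (f x) (word_act f w)"
  by (simp add: consv_def)

lemma lin_consv_consv:
  assumes "\<And>y v. f' (y # v) = consv (f y) (g v)"
  shows "lin f' (consv x w) = consv (lin f x) (lin g w)"
  unfolding lin_consv assms unfolding consv_def by (rule lin_tensor_lin)

lemma lin_word_act_consv: "lin (word_act f) (consv x w) = consv (lin f x) (lin (word_act f) w)"
  by (rule lin_consv_consv) (rule word_act_Cons)

lemma tens_mul_flip: "tens_mul flip word_mul ((a, b), z) = bvec (a @ fst z, b @ snd z)"
  by (cases z) (simp add: tens_mul_def flip_def word_mul_def)

lemma word_cop_flip_Cons: "word_cop flip D (x # w) = consv2 (D x) (word_cop flip D w)"
  by (simp add: consv2_def tensor_lin_left lin_lin lin_tensor case_prod_unfold)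
    (simp add: tens_mul_flip)

lemma lin_word_cop_consv: "lin (word_cop flip D) (consv x w) = consv2 (lin D x) (lin (word_cop flip D) w)"
  unfolding lin_consv word_cop_flip_Cons unfolding consv2_def by (rule lin_tensor_lin)

lemma tensor_consv: "tensor (consv x v) (consv y w) = lin (\<lambda>(p, s). bvec (fst p # fst s, snd p # snd s)) (tensor (tensor x y) (tensor v w))"
  by (simp add: consv_def tensor_def lin_lin lin_swap[where x = v and y = y])

lemma consv2_tensor: "consv2 (tensor x y) (tensor v w) = tensor (consv x v) (consv y w)"
  by (simp add: consv2_def tensor_consv case_prod_unfold)

text \<open>Legwise application of two letterwise maps splits into the first letter and the rest;
  this drives the inductions on words below.\<close>

lemma lin_tmap_consv2:
  assumes "\<And>y v. f' (y # v) = consv (f y) (f' v)" "\<And>y v. g' (y # v) = consv (g y) (g' v)"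
  shows "lin (tmap f' g') (consv2 p s) = consv2 (lin (tmap f g) p) (lin (tmap f' g') s)"
proof -
  have "lin (tmap f' g') (consv2 p s) = lin (\<lambda>(y, v). consv2 (tmap f g y) (tmap f' g' v)) (tensor p s)"
    unfolding lin_consv2
    by (rule lin_cong) (auto simp: tmap_apply assms consv2_tensor)
  also have "\<dots> = consv2 (lin (tmap f g) p) (lin (tmap f' g') s)"
    unfolding consv2_def by (rule lin_tensor_lin)
  finally show ?thesis .
qed

lemma appv_bvec [simp]: "appv (bvec u) (bvec v) = bvec (u @ v)"
  by (simp add: appv_def word_mul_def)

lemma appv_lin_left: "appv (lin f x) y = lin (\<lambda>a. appv (f a) y) x"
  by (simp add: appv_def tensor_lin_left lin_lin)

lemma appv_lin_right: "appv x (lin f y) = lin (\<lambda>a. appv x (f a)) y"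
  by (simp add: appv_def tensor_lin_right lin_lin)

lemma appv_consv: "appv (consv x u) v = consv x (appv u v)"
  by (simp add: appv_def consv_def word_mul_def tensor_def lin_lin)

lemma appv_Nil [simp]: "appv (bvec []) x = x" "appv x (bvec []) = x"
  by (simp_all add: appv_def tensor_bvec_left tensor_bvec_right lin_lin word_mul_def)

lemma appv_bvec_left: "appv (bvec u) x = lin (\<lambda>w. bvec (u @ w)) x"
  by (simp add: appv_def tensor_bvec_left lin_lin word_mul_def)

lemma appv_bvec_right: "appv x (bvec u) = lin (\<lambda>w. bvec (w @ u)) x"
  by (simp add: appv_def tensor_bvec_right lin_lin word_mul_def)

lemma appv_assoc: "appv (appv x y) z = appv x (appv y z)"
  by (simp add: appv_def word_mul_def tensor_def lin_lin)

lemma word_act_append: "word_act f (u @ v) = appv (word_act f u) (word_act f v)"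
  by (induction u) (simp_all add: word_act_Cons appv_consv del: word_act.simps(2))

lemma word_eps_append: "word_eps e (u @ v) = word_eps e u * word_eps e v"
  by (induction u) simp_all

lemma consv_in: "x \<in> fspan A \<Longrightarrow> w \<in> fspan B \<Longrightarrow> (\<And>a b. a \<in> A \<Longrightarrow> b \<in> B \<Longrightarrow> a # b \<in> C) \<Longrightarrow> consv x w \<in> fspan C"
  unfolding consv_def by (rule lin_in_fspan[OF tensor_in_fspan]) auto

lemma word_cop_flip_append: "word_cop flip D (u @ v) =
    lin (\<lambda>(a1, a2). lin (\<lambda>(b1, b2). bvec (a1 @ b1, a2 @ b2)) (word_cop flip D v)) (word_cop flip D u)"
proof (induction u)
  case Nil
  thus ?case by (simp add: case_prod_unfold)
next
  case (Cons x u)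
  show ?case
    by (simp add: word_cop_flip_Cons Cons del: word_cop.simps(2))
      (simp add: lin_consv2 consv2_def tensor_def lin_lin case_prod_unfold)
qed

section \<open>The coalgebra of words\<close>

context crossed_coalgebra
begin

lemma word_deg_in: "w \<in> lists B \<Longrightarrow> word_deg G dl w \<in> carrier G" "w \<in> lists B \<Longrightarrow> word_deg G dr w \<in> carrier G"
  by (induction w) auto

text \<open>Actions, coproduct and counit are multiplicative and the degrees multiply, so each law
  passes from letters to words by induction.\<close>

lemma words_coalgebra:
  "crossed_coalgebra G (lists B) (\<lambda>h. word_act (la h)) (\<lambda>h. word_act (ra h)) (word_deg G dl) (word_deg G dr)
     (word_cop flip cop) (word_eps eps)"
proof unfold_locales
  show "finite (carrier G)" by (rule fin)
next
  fix w assume w: "w \<in> lists B"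
  show "word_deg G dl w \<in> carrier G" "word_deg G dr w \<in> carrier G" using w by (rule word_deg_in)+
  show "word_act (la \<one>) w = bvec w" "word_act (ra \<one>) w = bvec w"
    using w by (induction w) (simp_all add: word_act_Cons la_one ra_one del: word_act.simps(2))
  show "word_cop flip cop w \<in> fspan {(b, c). b \<in> lists B \<and> c \<in> lists B \<and> word_deg G dl b = word_deg G dl w \<and>
     word_deg G dr b = word_deg G dl c \<and> word_deg G dr c = word_deg G dr w}"
    using w
  proof (induction w)
    case (Cons x w)
    show ?case
      unfolding word_cop_flip_Cons consv2_def
      by (rule lin_in_fspan[OF tensor_in_fspan[OF cop_deg[OF Cons.hyps(1)] Cons.IH]]) auto
  qed simp
  let ?s = "\<lambda>(x, (y, z)). bvec ((x, y), z)"
  show "lin (tmap (word_cop flip cop) bvec) (word_cop flip cop w) =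
       lin ?s (lin (tmap bvec (word_cop flip cop)) (word_cop flip cop w))"
    using w
  proof (induction w)
    case (Cons x w)
    \<comment> \<open>Prefixing a letter in all three legs, the operation through which both
      iterated coproducts factor.\<close>
    let ?c3 = "\<lambda>(((a, b), c), ((u, v), w)). bvec ((a # u, b # v), c # w)"
    have 1: "lin (tmap (word_cop flip cop) bvec) (consv2 p s) =
        lin ?c3 (tensor (lin (tmap cop bvec) p) (lin (tmap (word_cop flip cop) bvec) s))" for p s
    proof -
      have "lin (tmap (word_cop flip cop) bvec) (consv2 p s) = lin (\<lambda>(y, v). lin ?c3
         (tensor (tmap cop bvec y) (tmap (word_cop flip cop) bvec v))) (tensor p s)"
        unfolding lin_consv2
        by (rule lin_cong) (auto simp: tmap_apply word_cop_flip_Cons consv2_def tensor_def lin_lin case_prod_unfold simp del: word_cop.simps(2))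
      thus ?thesis unfolding lin_tensor_lin .
    qed
    have 2: "lin ?s (lin (tmap bvec (word_cop flip cop)) (consv2 p s)) =
        lin ?c3 (tensor (lin ?s (lin (tmap bvec cop) p)) (lin ?s (lin (tmap bvec (word_cop flip cop)) s)))" for p s
    proof -
      have "lin ?s (lin (tmap bvec (word_cop flip cop)) (consv2 p s)) = lin (\<lambda>(y, v). lin ?c3
         (tensor (lin ?s (tmap bvec cop y)) (lin ?s (tmap bvec (word_cop flip cop) v)))) (tensor p s)"
        unfolding lin_consv2 lin_lin[of ?s "tmap _ _"]
        unfolding lin_lin lin_consv2
        by (rule lin_cong) (auto simp: tmap_apply word_cop_flip_Cons consv2_def tensor_def lin_lin case_prod_unfold simp del: word_cop.simps(2))
      also have "\<dots> = lin ?c3 (tensor (lin (\<lambda>y. lin ?s (tmap bvec cop y)) p) (lin (\<lambda>v. lin ?s (tmap bvec (word_cop flip cop) v)) s))"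
        by (rule lin_tensor_lin)
      finally show ?thesis by (simp only: lin_lin)
    qed
    show ?case
      unfolding word_cop_flip_Cons 1 2 coassoc[OF Cons.hyps(1)] Cons.IH ..
  qed (simp add: tmap_apply)
  show "lin (\<lambda>(x, y). scale (word_eps eps x) (bvec y)) (word_cop flip cop w) = bvec w"
    using w
  proof (induction w)
    case (Cons x w)
    have step: "lin (\<lambda>(x, y). scale (word_eps eps x) (bvec y)) (consv2 p s) =
       consv (lin (\<lambda>(x, y). scale (eps x) (bvec y)) p) (lin (\<lambda>(x, y). scale (word_eps eps x) (bvec y)) s)" for p s
    proof -
      have "lin (\<lambda>(x, y). scale (word_eps eps x) (bvec y)) (consv2 p s) = lin (\<lambda>(z, v). consv
         (case z of (x, y) \<Rightarrow> scale (eps x) (bvec y)) (case v of (x, y) \<Rightarrow> scale (word_eps eps x) (bvec y))) (tensor p s)"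
        unfolding lin_consv2
        by (rule lin_cong) (auto simp: consv_def tensor_scale_left tensor_scale_right lin_scale mult.commute)
      thus ?thesis unfolding consv_def lin_tensor_lin .
    qed
    show ?case
      unfolding word_cop_flip_Cons by (simp only: step counit_left[OF Cons.hyps(1)] Cons.IH consv_bvec)
  qed simp
  show "lin (\<lambda>(x, y). scale (word_eps eps y) (bvec x)) (word_cop flip cop w) = bvec w"
    using w
  proof (induction w)
    case (Cons x w)
    have step: "lin (\<lambda>(x, y). scale (word_eps eps y) (bvec x)) (consv2 p s) =
       consv (lin (\<lambda>(x, y). scale (eps y) (bvec x)) p) (lin (\<lambda>(x, y). scale (word_eps eps y) (bvec x)) s)" for p s
    proof -
      have "lin (\<lambda>(x, y). scale (word_eps eps y) (bvec x)) (consv2 p s) = lin (\<lambda>(z, v). consv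
         (case z of (x, y) \<Rightarrow> scale (eps y) (bvec x)) (case v of (x, y) \<Rightarrow> scale (word_eps eps y) (bvec x))) (tensor p s)"
        unfolding lin_consv2
        by (rule lin_cong) (auto simp: consv_def tensor_scale_left tensor_scale_right lin_scale mult.commute)
      thus ?thesis unfolding consv_def lin_tensor_lin .
    qed
    show ?case
      unfolding word_cop_flip_Cons by (simp only: step counit_right[OF Cons.hyps(1)] Cons.IH consv_bvec)
  qed simp
  show "word_eps eps w \<noteq> 0 \<Longrightarrow> word_deg G dl w = word_deg G dr w"
    using w by (induction w) (auto simp: eps_deg)
next
  fix h w assume h: "h \<in> carrier G" and w: "w \<in> lists B"
  show "word_act (la h) w \<in> fspan {b \<in> lists B. word_deg G dl b = h \<otimes> word_deg G dl w \<otimes> inv h \<and>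
      word_deg G dr b = word_deg G dr w}"
    using w
  proof (induction w)
    case (Cons x w)
    show ?case
      unfolding word_act_Cons
      by (rule consv_in[OF la_deg[OF h Cons.hyps(1)] Cons.IH])
        (use h Cons.hyps word_deg_in in \<open>auto simp: m_assoc\<close>)
  qed (use h in simp)
  show "word_act (ra h) w \<in> fspan {b \<in> lists B. word_deg G dl b = word_deg G dl w \<and>
      word_deg G dr b = h \<otimes> word_deg G dr w \<otimes> inv h}"
    using w
  proof (induction w)
    case (Cons x w)
    show ?case
      unfolding word_act_Cons
      by (rule consv_in[OF ra_deg[OF h Cons.hyps(1)] Cons.IH])
        (use h Cons.hyps word_deg_in in \<open>auto simp: m_assoc\<close>)
  qed (use h in simp)
  show "lin (word_cop flip cop) (word_act (la h) w) = lin (tmap (word_act (la h)) bvec) (word_cop flip cop w)"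
    using w
  proof (induction w)
    case (Cons x w)
    show ?case
      unfolding word_act_Cons word_cop_flip_Cons lin_word_cop_consv cop_la[OF h Cons.hyps(1)] Cons.IH
      by (rule lin_tmap_consv2[symmetric]) (simp_all only: word_act_Cons consv_bvec)
  qed (simp add: tmap_apply)
  show "lin (word_cop flip cop) (word_act (ra h) w) = lin (tmap bvec (word_act (ra h))) (word_cop flip cop w)"
    using w
  proof (induction w)
    case (Cons x w)
    show ?case
      unfolding word_act_Cons word_cop_flip_Cons lin_word_cop_consv cop_ra[OF h Cons.hyps(1)] Cons.IH
      by (rule lin_tmap_consv2[symmetric]) (simp_all only: word_act_Cons consv_bvec)
  qed (simp add: tmap_apply)
  show "lin (tmap (word_act (ra h)) (word_act (la h))) (word_cop flip cop w) = word_cop flip cop w"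
    using w
  proof (induction w)
    case (Cons x w)
    have "lin (tmap (word_act (ra h)) (word_act (la h))) (word_cop flip cop (x # w)) =
      consv2 (lin (tmap (ra h) (la h)) (cop x)) (lin (tmap (word_act (ra h)) (word_act (la h))) (word_cop flip cop w))"
      unfolding word_cop_flip_Cons by (rule lin_tmap_consv2) (simp_all only: word_act_Cons)
    thus ?case using Cons h by (simp add: cop_inv word_cop_flip_Cons del: word_cop.simps(2))
  qed (simp add: tmap_apply)
  show "linf (word_eps eps) (lin (word_act (ra h)) (word_act (la h) w)) = word_eps eps w"
    using w
  proof (induction w)
    case (Cons x w)
    have "linf (word_eps eps) (consv x w) = linf eps x * linf (word_eps eps) w" for x w
      by (simp add: linf_consv linf_tensor linf_fun_mult_left linf_fun_mult_right)
    thus ?case using Cons h by (simp add: word_act_Cons lin_word_act_consv eps_inv del: word_act.simps(2))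
  qed simp
next
  fix g h w assume gh: "g \<in> carrier G" "h \<in> carrier G" and w: "w \<in> lists B"
  show "lin (word_act (la g)) (word_act (la h) w) = word_act (la (g \<otimes> h)) w"
    using w by (induction w) (use gh in \<open>simp_all add: word_act_Cons lin_word_act_consv la_mult del: word_act.simps(2)\<close>)
  show "lin (word_act (ra g)) (word_act (ra h) w) = word_act (ra (g \<otimes> h)) w"
    using w by (induction w) (use gh in \<open>simp_all add: word_act_Cons lin_word_act_consv ra_mult del: word_act.simps(2)\<close>)
  show "lin (word_act (la g)) (word_act (ra h) w) = lin (word_act (ra h)) (word_act (la g) w)"
    using w by (induction w) (use gh in \<open>simp_all add: word_act_Cons lin_word_act_consv la_ra del: word_act.simps(2)\<close>)
qed

end

section \<open>Ideals of relations\<close>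

lemma word_ideal_subspace [simp]: "fv.subspace (word_ideal B Q)"
  by (simp add: word_ideal_def)

lemma word_ideal_lin:
  assumes "y \<in> word_ideal B Q" "fv.subspace W"
    and "\<And>u v x. u \<in> lists B \<Longrightarrow> v \<in> lists B \<Longrightarrow> x \<in> Q \<Longrightarrow> lin f (lin (\<lambda>w. bvec (u @ w @ v)) x) \<in> W"
  shows "lin f y \<in> W"
  by (rule span_lin_closed[OF assms(1)[unfolded word_ideal_def] assms(2)]) (use assms(3) in auto)

lemma word_ideal_fspan:
  assumes "Q \<subseteq> fspan (lists B)"
  shows "word_ideal B Q \<subseteq> fspan (lists B)"
  unfolding word_ideal_def
  by (rule fv.span_minimal) (use assms in \<open>auto intro!: lin_in_fspan[of _ "lists B"]\<close>)

lemma word_ideal_gen: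
  "u \<in> lists B \<Longrightarrow> v \<in> lists B \<Longrightarrow> x \<in> Q \<Longrightarrow> lin (\<lambda>w. bvec (u @ w @ v)) x \<in> word_ideal B Q"
  unfolding word_ideal_def by (rule fv.span_base) auto

lemma word_ideal_base: "x \<in> Q \<Longrightarrow> x \<in> word_ideal B Q"
  using word_ideal_gen[of "[]" B "[]" x Q] by simp

lemma word_ideal_left:
  assumes "u \<in> lists B" "x \<in> word_ideal B Q"
  shows "appv (bvec u) x \<in> word_ideal B Q"
  unfolding appv_bvec_left
proof (rule word_ideal_lin[OF assms(2)])
  fix u' v x assume *: "u' \<in> lists B" "v \<in> lists B" "x \<in> Q"
  have "lin (\<lambda>w. bvec ((u @ u') @ w @ v)) x \<in> word_ideal B Q"
    by (rule word_ideal_gen) (use * assms in auto)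
  thus "lin (\<lambda>w. bvec (u @ w)) (lin (\<lambda>w. bvec (u' @ w @ v)) x) \<in> word_ideal B Q"
    by (simp add: lin_lin)
qed simp

lemma word_ideal_right:
  assumes "u \<in> lists B" "x \<in> word_ideal B Q"
  shows "appv x (bvec u) \<in> word_ideal B Q"
  unfolding appv_bvec_right
proof (rule word_ideal_lin[OF assms(2)])
  fix u' v x assume *: "u' \<in> lists B" "v \<in> lists B" "x \<in> Q"
  have "lin (\<lambda>w. bvec (u' @ w @ v @ u)) x \<in> word_ideal B Q"
    by (rule word_ideal_gen) (use * assms in auto)
  thus "lin (\<lambda>w. bvec (w @ u)) (lin (\<lambda>w. bvec (u' @ w @ v)) x) \<in> word_ideal B Q"
    by (simp add: lin_lin)
qed simp

lemma word_ideal_left':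
  assumes "y \<in> fspan (lists B)" "x \<in> word_ideal B Q"
  shows "appv y x \<in> word_ideal B Q"
proof -
  have "appv (lin bvec y) x \<in> word_ideal B Q"
    unfolding appv_lin_left
    by (rule lin_in_subspace) (use word_ideal_left[OF _ assms(2)] keysD[OF assms(1)] in auto)
  thus ?thesis by simp
qed

lemma word_ideal_right':
  assumes "y \<in> fspan (lists B)" "x \<in> word_ideal B Q"
  shows "appv x y \<in> word_ideal B Q"
proof -
  have "appv x (lin bvec y) \<in> word_ideal B Q"
    unfolding appv_lin_right
    by (rule lin_in_subspace) (use word_ideal_right[OF _ assms(2)] keysD[OF assms(1)] in auto)
  thus ?thesis by simp
qed

lemma appv_diff_left: "appv (x - y) z = appv x z - appv y z"
  by (simp add: appv_def tensor_diff_left lin_diff)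

lemma appv_diff_right: "appv z (x - y) = appv z x - appv z y"
  by (simp add: appv_def tensor_diff_right lin_diff)

section \<open>Bialgebras of words modulo relations\<close>

context crossed_coalgebra
begin

definition words :: "('b list \<Rightarrow>\<^sub>0 'k) set \<Rightarrow> ('b list, 'k) pspace" where
  "words Q = \<lparr>basis = lists B, null = word_ideal B Q\<rparr>"

lemma words_simps [simp]: "basis (words Q) = lists B" "null (words Q) = word_ideal B Q"
  by (simp_all add: words_def)

definition words_bialg :: "('b list, 'k) bialg" where
  "words_bialg = word_bialg flip cop eps"

lemma words_bialg_simps [simp]: "bone words_bialg = bvec []" "bmul words_bialg = word_mul"
  "bcop words_bialg = word_cop flip cop" "beps words_bialg = word_eps eps"
  by (simp_all add: words_bialg_def word_bialg_def)

lemma word_deg_append: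
  assumes "u \<in> lists B" "v \<in> lists B"
  shows "word_deg G dl (u @ v) = word_deg G dl u \<otimes> word_deg G dl v"
    and "word_deg G dr (u @ v) = word_deg G dr u \<otimes> word_deg G dr v"
  using assms word_deg_in[of v] by (induction u) (auto simp: m_assoc word_deg_in)

text \<open>All structure maps are multiplicative on the free algebra, so stability of the ideal
  needs to be checked on the relations only.\<close>

lemma words_bialgebra:
  assumes Q_in: "Q \<subseteq> fspan (lists B)"
    and Q_deg: "\<And>x. x \<in> Q \<Longrightarrow> \<exists>u v. x \<in> fspan {w \<in> lists B. word_deg G dl w = u \<and> word_deg G dr w = v}"
    and Q_la: "\<And>x h. x \<in> Q \<Longrightarrow> h \<in> carrier G \<Longrightarrow> lin (word_act (la h)) x \<in> word_ideal B Q"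
    and Q_ra: "\<And>x h. x \<in> Q \<Longrightarrow> h \<in> carrier G \<Longrightarrow> lin (word_act (ra h)) x \<in> word_ideal B Q"
    and Q_cop: "\<And>x. x \<in> Q \<Longrightarrow> lin (word_cop flip cop) x \<in> null (tens (words Q) (words Q))"
    and Q_eps: "\<And>x. x \<in> Q \<Longrightarrow> linf (word_eps eps) x = 0"
  shows "crossed_bialgebra G (words Q) words_bialg (\<lambda>h. word_act (la h)) (\<lambda>h. word_act (ra h))
    (word_deg G dl) (word_deg G dr)"
proof -
  let ?V = "words Q"
  interpret W: crossed_coalgebra G "lists B" "\<lambda>h. word_act (la h)" "\<lambda>h. word_act (ra h)"
    "word_deg G dl" "word_deg G dr" "word_cop flip cop" "word_eps eps"
    by (rule words_coalgebra)
  interpret C: crossed_coalgebra G "basis (words Q)" "\<lambda>h. word_act (la h)" "\<lambda>h. word_act (ra h)"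
    "word_deg G dl" "word_deg G dr" "bcop words_bialg" "beps words_bialg"
    using words_coalgebra by simp
  have ok: "pspace_ok ?V"
    using word_ideal_fspan[OF Q_in] by (simp add: pspace_ok_def)
  show ?thesis
  proof unfold_locales
    show "pspace_ok ?V" by (rule ok)
  next
    fix h y assume h: "h \<in> carrier G" and y: "y \<in> null ?V"
    show "lin (word_act (la h)) y \<in> null ?V"
    proof (rule word_ideal_lin[OF y[simplified]])
      fix u v x assume uv: "u \<in> lists B" "v \<in> lists B" and x: "x \<in> Q"
      have "lin (word_act (la h)) (lin (\<lambda>w. bvec (u @ w @ v)) x)
         = appv (word_act (la h) u) (appv (lin (word_act (la h)) x) (word_act (la h) v))"
        by (simp add: lin_lin word_act_append appv_lin_left appv_lin_right)
      also have "\<dots> \<in> word_ideal B Q"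
        using uv x h by (intro word_ideal_left' word_ideal_right' Q_la) auto
      finally show "lin (word_act (la h)) (lin (\<lambda>w. bvec (u @ w @ v)) x) \<in> null ?V" by simp
    qed simp
    show "lin (word_act (ra h)) y \<in> null ?V"
    proof (rule word_ideal_lin[OF y[simplified]])
      fix u v x assume uv: "u \<in> lists B" "v \<in> lists B" and x: "x \<in> Q"
      have "lin (word_act (ra h)) (lin (\<lambda>w. bvec (u @ w @ v)) x)
         = appv (word_act (ra h) u) (appv (lin (word_act (ra h)) x) (word_act (ra h) v))"
        by (simp add: lin_lin word_act_append appv_lin_left appv_lin_right)
      also have "\<dots> \<in> word_ideal B Q"
        using uv x h by (intro word_ideal_left' word_ideal_right' Q_ra) auto
      finally show "lin (word_act (ra h)) (lin (\<lambda>w. bvec (u @ w @ v)) x) \<in> null ?V" by simp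
    qed simp
  next
    fix s t y assume st: "s \<in> carrier G" "t \<in> carrier G" and y: "y \<in> null ?V"
    show "lin (\<lambda>b. if word_deg G dl b = s \<and> word_deg G dr b = t then bvec b else 0) y \<in> null ?V"
    proof (rule word_ideal_lin[OF y[simplified]])
      fix u v x assume uv: "u \<in> lists B" "v \<in> lists B" and x: "x \<in> Q"
      obtain m n where mn: "x \<in> fspan {w \<in> lists B. word_deg G dl w = m \<and> word_deg G dr w = n}"
        using Q_deg[OF x] by auto
      \<comment> \<open>A relation is bihomogeneous, so all words obtained by placing it between
        \<open>u\<close> and \<open>v\<close> share one bidegree, and the projection keeps all of
        them or none.\<close>
      define c where "c \<longleftrightarrow> word_deg G dl u \<otimes> (m \<otimes> word_deg G dl v) = s \<and> word_deg G dr u \<otimes> (n \<otimes> word_deg G dr v) = t"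
      have "lin (\<lambda>b. if word_deg G dl b = s \<and> word_deg G dr b = t then bvec b else 0) (lin (\<lambda>w. bvec (u @ w @ v)) x)
        = lin (\<lambda>w. if c then bvec (u @ w @ v) else 0) x"
        unfolding lin_lin
        by (rule fspan_lin_cong[OF mn]) (use uv in \<open>auto simp: c_def word_deg_append\<close>)
      also have "\<dots> \<in> word_ideal B Q"
        using word_ideal_gen[OF uv x] by (simp add: lin_if_zero fv.subspace_0)
      finally show "lin (\<lambda>b. if word_deg G dl b = s \<and> word_deg G dr b = t then bvec b else 0)
         (lin (\<lambda>w. bvec (u @ w @ v)) x) \<in> null ?V" by simp
    qed simp
  next
    fix x b assume x: "x \<in> null ?V" and b: "b \<in> basis ?V"
    show "lin (\<lambda>a. bmul words_bialg (a, b)) x \<in> null ?V"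
      using word_ideal_right[of b B x Q] x b by (simp add: appv_bvec_right word_mul_def)
    show "lin (\<lambda>a. bmul words_bialg (b, a)) x \<in> null ?V"
      using word_ideal_left[of b B x Q] x b by (simp add: appv_bvec_left word_mul_def)
  next
    fix y assume y: "y \<in> null ?V"
    show "lin (bcop words_bialg) y \<in> null (tens ?V ?V)"
    proof (rule word_ideal_lin[OF y[simplified]])
      fix u v x assume uv: "u \<in> lists B" "v \<in> lists B" and x: "x \<in> Q"
      let ?D = "word_cop flip cop"
      let ?m = "\<lambda>a b w. bvec (a @ w @ b)"
      have m: "lmap ?V ?V (?m a b)" if "a \<in> lists B" "b \<in> lists B" for a b
      proof -
        have "lin (?m a b) x \<in> word_ideal B Q" if "x \<in> word_ideal B Q" for x
        proof -
          have "appv (bvec a) (appv x (bvec b)) \<in> word_ideal B Q"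
            using that \<open>a \<in> lists B\<close> \<open>b \<in> lists B\<close> by (intro word_ideal_left word_ideal_right)
          thus ?thesis by (simp add: appv_bvec_left appv_bvec_right lin_lin)
        qed
        thus ?thesis using that by (auto simp: lmap_def)
      qed
      \<comment> \<open>Each leg of the coproduct of a sandwiched word is a leg of the middle part
        placed between legs of \<open>u\<close> and \<open>v\<close>.\<close>
      let ?g = "\<lambda>p s z. bvec (fst p @ fst z @ fst s, snd p @ snd z @ snd s)"
      have "lin ?D (lin (\<lambda>w. bvec (u @ w @ v)) x) =
         lin (\<lambda>w. lin (\<lambda>p. lin (\<lambda>z. lin (\<lambda>s. ?g p s z) (?D v)) (?D w)) (?D u)) x"
        by (simp add: lin_lin word_cop_flip_append case_prod_unfold)
      also have "\<dots> = lin (\<lambda>p. lin (\<lambda>w. lin (\<lambda>z. lin (\<lambda>s. ?g p s z) (?D v)) (?D w)) x) (?D u)"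
        by (rule lin_swap[where x = x and y = "?D u"])
      also have "\<dots> = lin (\<lambda>p. lin (\<lambda>z. lin (\<lambda>s. ?g p s z) (?D v)) (lin ?D x)) (?D u)"
        by (simp only: lin_lin)
      also have "\<dots> = lin (\<lambda>p. lin (\<lambda>s. lin (\<lambda>z. ?g p s z) (lin ?D x)) (?D v)) (?D u)"
        by (simp only: lin_swap[where x = "lin ?D x" and y = "?D v"])
      also have "\<dots> \<in> null (tens ?V ?V)"
      proof (rule lin_in_subspace)
        fix p assume "p \<in> Poly_Mapping.keys (?D u)"
        hence p: "p \<in> lists B \<times> lists B" using keysD[OF W.cop_in] uv by blast
        show "lin (\<lambda>s. lin (\<lambda>z. ?g p s z) (lin ?D x)) (?D v) \<in> null (tens ?V ?V)"
        proof (rule lin_in_subspace)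
          fix s assume "s \<in> Poly_Mapping.keys (?D v)"
          hence s: "s \<in> lists B \<times> lists B" using keysD[OF W.cop_in] uv by blast
          have "lin (tmap (?m (fst p) (fst s)) (?m (snd p) (snd s))) (lin ?D x) \<in> null (tens ?V ?V)"
            by (rule lmap_lin_null[OF lmap_tmap[OF m m] Q_cop[OF x]]) (use p s in auto)
          thus "lin (\<lambda>z. ?g p s z) (lin ?D x) \<in> null (tens ?V ?V)"
            by (simp add: tmap_def case_prod_unfold)
        qed simp
      qed simp
      finally show "lin (bcop words_bialg) (lin (\<lambda>w. bvec (u @ w @ v)) x) \<in> null (tens ?V ?V)" by simp
    qed simp
    have "lin (\<lambda>b. scale (word_eps eps b) (bvec ())) y \<in> {0}"
    proof (rule word_ideal_lin[OF y[simplified]])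
      fix u v x assume uv: "u \<in> lists B" "v \<in> lists B" and x: "x \<in> Q"
      have "linf (word_eps eps) (lin (\<lambda>w. bvec (u @ w @ v)) x) = 0"
        using Q_eps[OF x] by (simp add: linf_lin word_eps_append linf_fun_mult_left linf_fun_mult_right)
      thus "lin (\<lambda>b. scale (word_eps eps b) (bvec ())) (lin (\<lambda>w. bvec (u @ w @ v)) x) \<in> {0}"
        by (simp add: lin_scale_fun_const)
    qed simp
    hence "Poly_Mapping.lookup (lin (\<lambda>b. scale (word_eps eps b) (bvec ())) y) () = 0" by auto
    thus "linf (beps words_bialg) y = 0"
      by (simp add: linf_eq_lookup single_eq_scale_bvec)
  next
    fix a b assume "a \<in> basis ?V" "b \<in> basis ?V"
    thus "bmul words_bialg (a, b) \<in> fspan {c \<in> basis ?V. word_deg G dl c = word_deg G dl a \<otimes> word_deg G dl b \<and>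
        word_deg G dr c = word_deg G dr a \<otimes> word_deg G dr b}"
      by (simp add: word_mul_def word_deg_append)
  qed (simp_all add: word_mul_def word_act_append word_act.simps appv_def word_eps_append
      word_cop_flip_append case_prod_unfold lin_tensor tensor_bvec_left tensor_bvec_right lin_lin)
qed

text \<open>The relation moves one letter past one letter. Induction on \<open>b\<close> moves a
  letter past a word, and induction on \<open>a\<close> a word past a word.\<close>

lemma words_comm:
  assumes gen: "\<And>x y. x \<in> B \<Longrightarrow> y \<in> B \<Longrightarrow>
      lin (\<lambda>c. bvec [x, c]) (la (inv (dl x)) y) - lin (\<lambda>c. bvec [c, x]) (ra (dr x) y) \<in> word_ideal B Q"
    and a: "a \<in> lists B" and b: "b \<in> lists B"
  shows "lin (\<lambda>c. word_mul (a, c)) (word_act (la (inv (word_deg G dl a))) b) -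
      lin (\<lambda>c. word_mul (c, a)) (word_act (ra (word_deg G dr a)) b) \<in> word_ideal B Q"
proof -
  interpret W: crossed_coalgebra G "lists B" "\<lambda>h. word_act (la h)" "\<lambda>h. word_act (ra h)"
    "word_deg G dl" "word_deg G dr" "word_cop flip cop" "word_eps eps"
    by (rule words_coalgebra)
  define eqq where "eqq x y \<longleftrightarrow> x - y \<in> word_ideal B Q" for x y
  have eqq_trans: "eqq x z" if "eqq x y" "eqq y z" for x y z
    using fv.subspace_add[OF word_ideal_subspace that[unfolded eqq_def]] by (simp add: eqq_def)
  have eqq_left: "eqq (appv z x) (appv z y)" if "eqq x y" "z \<in> fspan (lists B)" for x y z
    using that by (simp add: eqq_def word_ideal_left' flip: appv_diff_right)
  have eqq_right: "eqq (appv x z) (appv y z)" if "eqq x y" "z \<in> fspan (lists B)" for x y z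
    using that by (simp add: eqq_def word_ideal_right' flip: appv_diff_left)
  have eqq_lin: "eqq (lin f z) (lin g z)" if "\<And>b. b \<in> lists B \<Longrightarrow> eqq (f b) (g b)" "z \<in> fspan (lists B)" for f g z
    unfolding eqq_def lin_fun_diff[symmetric]
    by (rule lin_in_subspace) (use that(1) keysD[OF that(2)] in \<open>auto simp: eqq_def\<close>)
  let ?L = "\<lambda>h. word_act (la h)" and ?R = "\<lambda>h. word_act (ra h)"
  let ?j = "\<lambda>z. lin (\<lambda>c. bvec [c]) z"
  have cj: "consv z w = appv (?j z) w" for z w
    by (simp add: consv_def appv_def word_mul_def tensor_def lin_lin)
  have one: "eqq (appv (bvec [x]) (?L (inv (dl x)) b)) (appv (?R (dr x) b) (bvec [x]))"
    if x: "x \<in> B" and b: "b \<in> lists B" for x b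
    using b
  proof (induction b)
    case Nil
    thus ?case by (simp add: eqq_def fv.subspace_0)
  next
    case (Cons y b)
    let ?l = "la (inv (dl x)) y" and ?r = "ra (dr x) y"
    have jr: "?j ?r \<in> fspan (lists B)"
      by (rule lin_in_fspan[OF ra_in]) (use x Cons in auto)
    have "eqq (appv (bvec [x]) (?j ?l)) (appv (?j ?r) (bvec [x]))"
      using gen[OF x Cons.hyps(1)] by (simp add: eqq_def appv_bvec_left appv_bvec_right lin_lin)
    hence "eqq (appv (appv (bvec [x]) (?j ?l)) (?L (inv (dl x)) b)) (appv (appv (?j ?r) (bvec [x])) (?L (inv (dl x)) b))"
      by (rule eqq_right) (use x Cons in auto)
    moreover have "eqq (appv (?j ?r) (appv (bvec [x]) (?L (inv (dl x)) b))) (appv (?j ?r) (appv (?R (dr x) b) (bvec [x])))"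
      by (rule eqq_left[OF Cons.IH jr])
    ultimately show ?case
      unfolding word_act_Cons cj appv_assoc by (rule eqq_trans)
  qed
  have one': "eqq (appv (bvec [x]) (lin (?L (inv (dl x))) z)) (appv (lin (?R (dr x)) z) (bvec [x]))"
    if "x \<in> B" "z \<in> fspan (lists B)" for x z
    unfolding appv_lin_left appv_lin_right by (rule eqq_lin) (use one that in auto)
  have "eqq (appv (bvec a) (?L (inv (word_deg G dl a)) b)) (appv (?R (word_deg G dr a) b) (bvec a))"
    using a b
  proof (induction a arbitrary: b)
    case Nil
    thus ?case by (simp add: eqq_def fv.subspace_0 W.la_one W.ra_one)
  next
    case (Cons x a)
    have x: "dl x \<in> carrier G" "dr x \<in> carrier G" using Cons by auto
    have a: "word_deg G dl a \<in> carrier G" "word_deg G dr a \<in> carrier G" using Cons by auto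
    let ?v = "?L (inv (dl x)) b" and ?w = "?R (word_deg G dr a) b"
    have v: "?v \<in> fspan (lists B)" and w: "?w \<in> fspan (lists B)" using x a Cons by auto
    have "eqq (appv (bvec a) (lin (?L (inv (word_deg G dl a))) ?v)) (appv (lin (?R (word_deg G dr a)) ?v) (bvec a))"
      unfolding appv_lin_left appv_lin_right by (rule eqq_lin[OF Cons.IH v])
    hence "eqq (appv (bvec [x]) (appv (bvec a) (lin (?L (inv (word_deg G dl a))) ?v)))
       (appv (bvec [x]) (appv (lin (?R (word_deg G dr a)) ?v) (bvec a)))"
      by (rule eqq_left) (use Cons in auto)
    moreover have "eqq (appv (appv (bvec [x]) (lin (?L (inv (dl x))) ?w)) (bvec a))
       (appv (appv (lin (?R (dr x)) ?w) (bvec [x])) (bvec a))"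
      by (rule eqq_right[OF one']) (use Cons w in auto)
    \<comment> \<open>Commutation of the two actions joins the relation for the tail to the one for
      the letter \<open>x\<close>.\<close>
    moreover have "lin (?R (word_deg G dr a)) ?v = lin (?L (inv (dl x))) ?w"
      using x a Cons by (simp add: W.la_ra)
    moreover have "lin (?L (inv (word_deg G dl a))) ?v = ?L (inv (word_deg G dl (x # a))) b"
      using x a Cons by (simp add: W.la_mult inv_mult_group)
    moreover have "lin (?R (dr x)) ?w = ?R (word_deg G dr (x # a)) b"
      using x a Cons by (simp add: W.ra_mult)
    ultimately have "eqq (appv (appv (bvec [x]) (bvec a)) (?L (inv (word_deg G dl (x # a))) b))
       (appv (?R (word_deg G dr (x # a)) b) (appv (bvec [x]) (bvec a)))"
      by (simp only: appv_assoc) (erule (1) eqq_trans)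
    thus ?case by simp
  qed
  thus ?thesis
    by (simp add: eqq_def appv_bvec_left appv_bvec_right word_mul_def)
qed

section \<open>Closed form of the recursively extended coquasitriangular structure\<close>

lemma linf_word_eps_Cons: "linf (word_eps eps) (word_act f (x # w)) = linf eps (f x) * linf (word_eps eps) (word_act f w)"
  by (simp add: word_act_Cons linf_consv linf_tensor linf_fun_mult_left linf_fun_mult_right del: word_act.simps(2))

text \<open>A nonzero counit of the first leg identifies the left degrees of both legs, so every
  letter of \<open>v\<close> is acted on by the same group element.\<close>

lemma gen_R_eq:
  assumes R: "\<And>x y. x \<in> B \<Longrightarrow> y \<in> B \<Longrightarrow> R (x, y) = eps x * linf eps (la (inv (dl x)) y)"
    and "v \<in> lists B" "x \<in> B"
  shows "gen_R cop eps R v x = eps x * linf (word_eps eps) (word_act (la (inv (dl x))) v)"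
  using assms(2,3)
proof (induction v arbitrary: x)
  case (Cons y v)
  have "gen_R cop eps R (y # v) x = linf (\<lambda>(x1, x2). eps x1 * (eps x2 *
     linf (word_eps eps) (word_act (la (inv (dl x2))) (y # v)))) (cop x)"
    unfolding gen_R.simps
  proof (rule cop_congf[OF Cons.prems])
    fix x1 x2 assume a: "x1 \<in> B" "x2 \<in> B" "dr x1 = dl x2"
    show "gen_R cop eps R v x1 * R (x2, y) = eps x1 * (eps x2 *
       linf (word_eps eps) (word_act (la (inv (dl x2))) (y # v)))"
      using a Cons.IH[OF a(1)] Cons.hyps(1) eps_deg[of x1] unfolding linf_word_eps_Cons
      by (cases "eps x1 = 0") (auto simp: R)
  qed
  also have "\<dots> = eps x * linf (word_eps eps) (word_act (la (inv (dl x))) (y # v))"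
    by (rule contract_counitf[OF Cons.prems])
  finally show ?case .
qed simp

text \<open>The recursion splits \<open>v\<close> by its coproduct, and \<open>eps_la_la\<close>
  merges the translations by the inverse degrees of \<open>x\<close> and of
  \<open>u\<close>.\<close>

lemma word_R_eq:
  assumes R: "\<And>x y. x \<in> B \<Longrightarrow> y \<in> B \<Longrightarrow> R (x, y) = eps x * linf eps (la (inv (dl x)) y)"
    and "u \<in> lists B" "v \<in> lists B"
  shows "word_R cop eps R u v = word_eps eps u * linf (word_eps eps) (word_act (la (inv (word_deg G dl u))) v)"
proof -
  interpret W: crossed_coalgebra G "lists B" "\<lambda>h. word_act (la h)" "\<lambda>h. word_act (ra h)"
    "word_deg G dl" "word_deg G dr" "word_cop flip cop" "word_eps eps"
    by (rule words_coalgebra)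
  show ?thesis
    using assms(2,3)
  proof (induction u arbitrary: v)
  case Nil
  thus ?case by (simp add: W.la_one)
next
  case (Cons x u)
  let ?E = "\<lambda>g v. linf (word_eps eps) (word_act (la (inv g)) v)"
  have x: "dl x \<in> carrier G" "word_deg G dl u \<in> carrier G" using Cons by auto
  have "word_R cop eps R (x # u) v = linf (\<lambda>(v1, v2). (eps x * word_eps eps u) * (?E (dl x) v1 * ?E (word_deg G dl u) v2))
     (word_cop flip cop v)"
    unfolding word_R.simps
    by (rule W.cop_congf[OF Cons.prems]) (use Cons in \<open>simp add: gen_R_eq[OF R]\<close>)
  also have "\<dots> = (eps x * word_eps eps u) * linf (\<lambda>(v1, v2). ?E (dl x) v1 * ?E (word_deg G dl u) v2) (word_cop flip cop v)"
    by (simp add: case_prod_unfold linf_fun_mult_left)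
  also have "\<dots> = word_eps eps (x # u) * ?E (word_deg G dl (x # u)) v"
    using x Cons by (simp add: W.eps_la_la inv_mult_group)
  finally show ?case .
  qed
qed

end

section \<open>The rearrangement of words\<close>

lemma word_act_cong: "(\<And>x. x \<in> set w \<Longrightarrow> f x = g x) \<Longrightarrow> word_act f w = word_act g w"
  by (induction w) simp_all

context crossed_coalgebra
begin

definition gd :: "'b \<Rightarrow> 'a" where
  "gd x = inv (dl x) \<otimes> dr x"

definition conj_act :: "'a \<Rightarrow> 'b \<Rightarrow> ('b \<Rightarrow>\<^sub>0 'k)" where
  "conj_act h x = lin (ra h) (la h x)"

text \<open>The relation \<open>\<R>(s\<^sub>1 \<otimes> t\<^sub>1) s\<^sub>2 t\<^sub>2 = t\<^sub>1 s\<^sub>1 \<R>(s\<^sub>2 \<otimes> t\<^sub>2)\<close> of \<open>A(\<R>)\<close>, with \<open>\<R>\<close> evaluated.\<close>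

definition arel :: "'b \<Rightarrow> 'b \<Rightarrow> ('b list \<Rightarrow>\<^sub>0 'k)" where
  "arel s t = lin (\<lambda>c. bvec [s, c]) (la (inv (dl s)) t) - lin (\<lambda>c. bvec [c, s]) (ra (dr s) t)"

definition arels :: "('b list \<Rightarrow>\<^sub>0 'k) set" where
  "arels = {arel s t | s t. s \<in> B \<and> t \<in> B}"

lemma gd_in [simp]: "x \<in> B \<Longrightarrow> gd x \<in> carrier G"
  by (simp add: gd_def)

lemma word_act_two: "word_act f [a, b] = lin (\<lambda>y. lin (\<lambda>z. bvec [y, z]) (f b)) (f a)"
  by (simp add: tensor_def lin_lin)

lemma arel_in_ideal: "s \<in> B \<Longrightarrow> t \<in> B \<Longrightarrow> arel s t \<in> word_ideal B arels"
  by (rule word_ideal_base) (auto simp: arels_def)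

lemma arel_homog:
  assumes "s \<in> B" "t \<in> B"
  shows "arel s t \<in> fspan {w \<in> lists B. word_deg G dl w = dl t \<otimes> dl s \<and> word_deg G dr w = dr s \<otimes> dr t}"
  unfolding arel_def
proof (rule diff_in_fspan)
  show "lin (\<lambda>c. bvec [s, c]) (la (inv (dl s)) t) \<in> fspan {w \<in> lists B. word_deg G dl w = dl t \<otimes> dl s \<and> word_deg G dr w = dr s \<otimes> dr t}"
    by (rule lin_in_fspan[OF la_deg]) (use assms in \<open>auto simp: m_assoc\<close>)
  show "lin (\<lambda>c. bvec [c, s]) (ra (dr s) t) \<in> fspan {w \<in> lists B. word_deg G dl w = dl t \<otimes> dl s \<and> word_deg G dr w = dr s \<otimes> dr t}"
    by (rule lin_in_fspan[OF ra_deg]) (use assms in \<open>auto simp: m_assoc\<close>)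
qed

text \<open>\<open>la h\<close> conjugates the left degree of \<open>s\<close>, and the conjugated
  twist agrees with moving \<open>la h\<close> past the old one. So the relations span an invariant
  space.\<close>

lemma la_arel:
  assumes h: "h \<in> carrier G" and st: "s \<in> B" "t \<in> B"
  shows "lin (word_act (la h)) (arel s t) = lin (\<lambda>s'. lin (\<lambda>t'. arel s' t') (la h t)) (la h s)"
proof -
  have "lin (word_act (la h)) (arel s t) =
      lin (\<lambda>c. lin (\<lambda>y. lin (\<lambda>z. bvec [y, z]) (la h c)) (la h s)) (la (inv (dl s)) t) -
      lin (\<lambda>c. lin (\<lambda>z. lin (\<lambda>y. bvec [z, y]) (la h s)) (la h c)) (ra (dr s) t)"
    by (simp add: arel_def lin_diff lin_lin word_act_two del: word_act.simps)
  also have "\<dots> = lin (\<lambda>y. lin (\<lambda>z. bvec [y, z]) (lin (la h) (la (inv (dl s)) t))) (la h s) -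
      lin (\<lambda>y. lin (\<lambda>z. bvec [z, y]) (lin (la h) (ra (dr s) t))) (la h s)"
    by (simp only: lin_swap[where y = "la h s"] lin_lin)
  also have "\<dots> = lin (\<lambda>y. lin (\<lambda>z. bvec [y, z]) (lin (la (inv (dl y))) (la h t)) -
      lin (\<lambda>z. bvec [z, y]) (lin (ra (dr y)) (la h t))) (la h s)"
    unfolding lin_fun_diff[symmetric]
    by (rule la_cong[OF h st(1)]) (use h st in \<open>simp add: la_mult la_ra inv_mult_group m_assoc\<close>)
  also have "\<dots> = lin (\<lambda>s'. lin (\<lambda>t'. arel s' t') (la h t)) (la h s)"
    by (simp add: arel_def lin_fun_diff lin_lin)
  finally show ?thesis .
qed

lemma ra_arel:
  assumes h: "h \<in> carrier G" and st: "s \<in> B" "t \<in> B"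
  shows "lin (word_act (ra h)) (arel s t) = lin (\<lambda>s'. lin (\<lambda>t'. arel s' t') (ra h t)) (ra h s)"
proof -
  have "lin (word_act (ra h)) (arel s t) =
      lin (\<lambda>c. lin (\<lambda>y. lin (\<lambda>z. bvec [y, z]) (ra h c)) (ra h s)) (la (inv (dl s)) t) -
      lin (\<lambda>c. lin (\<lambda>z. lin (\<lambda>y. bvec [z, y]) (ra h s)) (ra h c)) (ra (dr s) t)"
    by (simp add: arel_def lin_diff lin_lin word_act_two del: word_act.simps)
  also have "\<dots> = lin (\<lambda>y. lin (\<lambda>z. bvec [y, z]) (lin (ra h) (la (inv (dl s)) t))) (ra h s) -
      lin (\<lambda>y. lin (\<lambda>z. bvec [z, y]) (lin (ra h) (ra (dr s) t))) (ra h s)"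
    by (simp only: lin_swap[where y = "ra h s"] lin_lin)
  also have "\<dots> = lin (\<lambda>y. lin (\<lambda>z. bvec [y, z]) (lin (la (inv (dl y))) (ra h t)) -
      lin (\<lambda>z. bvec [z, y]) (lin (ra (dr y)) (ra h t))) (ra h s)"
    unfolding lin_fun_diff[symmetric]
    by (rule ra_cong[OF h st(1)]) (use h st in \<open>simp add: ra_mult la_ra inv_mult_group m_assoc\<close>)
  also have "\<dots> = lin (\<lambda>s'. lin (\<lambda>t'. arel s' t') (ra h t)) (ra h s)"
    by (simp add: arel_def lin_fun_diff lin_lin)
  finally show ?thesis .
qed

lemma lin_arel_in_ideal:
  assumes "x \<in> fspan B" "y \<in> fspan B"
  shows "lin (\<lambda>s. lin (\<lambda>t. arel s t) y) x \<in> word_ideal B arels"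
  by (intro lin_in_subspace word_ideal_subspace arel_in_ideal) (use keysD assms in fast)+

text \<open>The invariance of the coproduct, rewritten: a right action on the first leg equals the
  inverse left action on the second.\<close>

lemma cop_ra_la:
  assumes h: "h \<in> carrier G" and t: "t \<in> B"
  shows "lin (tmap (ra h) bvec) (cop t) = lin (tmap bvec (la (inv h))) (cop t)"
proof -
  have "lin (tmap bvec (la (inv h))) (cop t) = lin (tmap bvec (la (inv h))) (lin (tmap (ra h) (la h)) (cop t))"
    using h t by (simp add: cop_inv)
  also have "\<dots> = lin (tmap (ra h) bvec) (cop t)"
    unfolding lin_lin
    by (rule fspan_lin_cong[OF cop_in[OF t]])
      (use h in \<open>auto simp: tmap_apply lin_tmap_tensor la_mult la_one\<close>)
  finally show ?thesis by simp
qed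

lemma word_cop_two: "word_cop flip cop [a, b] =
    lin (\<lambda>(a1, a2). lin (\<lambda>(b1, b2). bvec ([a1, b1], [a2, b2])) (cop b)) (cop a)"
proof -
  have "consv2 (cop b) (bvec ([], [])) = lin (\<lambda>(b1, b2). bvec ([b1], [b2])) (cop b)"
    by (simp add: consv2_def tensor_bvec_right lin_lin case_prod_unfold)
  thus ?thesis
    unfolding word_cop_flip_Cons word_cop.simps(1)
    by (simp add: consv2_def tensor_def lin_lin case_prod_unfold)
qed

text \<open>A telescoping difference. The intermediate term \<open>ra(dr s1) t1\<close>,
  \<open>s1\<close> in the first leg and \<open>s2\<close>, \<open>t2\<close> in the second is
  rewritten by \<open>cop_ra_la\<close>; as \<open>dr s1 = dl s2\<close>, the twist becomes the one
  required for a relation in the second leg.\<close>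

lemma cop_arel:
  assumes st: "s \<in> B" "t \<in> B"
  shows "lin (word_cop flip cop) (arel s t) =
    lin (\<lambda>(s1, s2). lin (\<lambda>(t1, t2). tensor (arel s1 t1) (bvec [s2, t2]) + tensor (bvec [t1, s1]) (arel s2 t2)) (cop t)) (cop s)"
proof -
  have "lin (word_cop flip cop) (lin (\<lambda>c. bvec [s, c]) (la (inv (dl s)) t)) =
    lin (\<lambda>(s1, s2). lin (\<lambda>(b1, b2). bvec ([s1, b1], [s2, b2])) (lin cop (la (inv (dl s)) t))) (cop s)"
    by (simp add: lin_lin word_cop_two case_prod_unfold del: word_cop.simps) (rule lin_swap)
  also have "\<dots> = lin (\<lambda>(s1, s2). lin (\<lambda>(t1, t2). tensor (lin (\<lambda>c. bvec [s1, c]) (la (inv (dl s)) t1)) (bvec [s2, t2])) (cop t)) (cop s)"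
    using st by (simp add: cop_la lin_lin tmap_def case_prod_unfold tensor_def)
  also have "\<dots> = lin (\<lambda>(s1, s2). lin (\<lambda>(t1, t2). tensor (arel s1 t1) (bvec [s2, t2])) (cop t) +
      lin (\<lambda>(t1, t2). tensor (bvec [t1, s1]) (bvec [s2, t2])) (lin (tmap (ra (dr s1)) bvec) (cop t))) (cop s)"
  proof (rule cop_cong[OF st(1)])
    fix s1 s2 assume s: "dl s1 = dl s"
    have "lin (\<lambda>(t1, t2). tensor (lin (\<lambda>c. bvec [s1, c]) (la (inv (dl s)) t1)) (bvec [s2, t2])) (cop t)
      = lin (\<lambda>(t1, t2). tensor (arel s1 t1) (bvec [s2, t2]) + tensor (lin (\<lambda>c. bvec [c, s1]) (ra (dr s1) t1)) (bvec [s2, t2])) (cop t)"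
      by (simp add: arel_def s tensor_diff_left)
    also have "\<dots> = lin (\<lambda>(t1, t2). tensor (arel s1 t1) (bvec [s2, t2])) (cop t) +
      lin (\<lambda>(t1, t2). tensor (bvec [t1, s1]) (bvec [s2, t2])) (lin (tmap (ra (dr s1)) bvec) (cop t))"
      by (simp add: case_prod_unfold lin_fun_add lin_lin tmap_def tensor_def)
    finally show "lin (\<lambda>(t1, t2). tensor (lin (\<lambda>c. bvec [s1, c]) (la (inv (dl s)) t1)) (bvec [s2, t2])) (cop t)
      = lin (\<lambda>(t1, t2). tensor (arel s1 t1) (bvec [s2, t2])) (cop t) +
      lin (\<lambda>(t1, t2). tensor (bvec [t1, s1]) (bvec [s2, t2])) (lin (tmap (ra (dr s1)) bvec) (cop t))" .
  qed
  also have "\<dots> = lin (\<lambda>(s1, s2). lin (\<lambda>(t1, t2). tensor (arel s1 t1) (bvec [s2, t2])) (cop t) +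
      (lin (\<lambda>(t1, t2). tensor (bvec [t1, s1]) (arel s2 t2)) (cop t) +
       lin (\<lambda>(t1, t2). tensor (bvec [t1, s1]) (lin (\<lambda>c. bvec [c, s2]) (ra (dr s) t2))) (cop t))) (cop s)"
  proof (rule cop_cong[OF st(1)])
    fix s1 s2 assume s: "s1 \<in> B" "s2 \<in> B" "dr s1 = dl s2" "dr s2 = dr s"
    have "lin (\<lambda>(t1, t2). tensor (bvec [t1, s1]) (bvec [s2, t2])) (lin (tmap (ra (dr s1)) bvec) (cop t))
      = lin (\<lambda>(t1, t2). tensor (bvec [t1, s1]) (bvec [s2, t2])) (lin (tmap bvec (la (inv (dl s2)))) (cop t))"
      using s st by (simp add: cop_ra_la)
    also have "\<dots> = lin (\<lambda>(t1, t2). tensor (bvec [t1, s1]) (lin (\<lambda>c. bvec [s2, c]) (la (inv (dl s2)) t2))) (cop t)"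
      by (simp add: case_prod_unfold lin_lin tmap_def tensor_def)
    also have "\<dots> = lin (\<lambda>(t1, t2). tensor (bvec [t1, s1]) (arel s2 t2) +
        tensor (bvec [t1, s1]) (lin (\<lambda>c. bvec [c, s2]) (ra (dr s) t2))) (cop t)"
      by (simp add: arel_def s tensor_diff_right)
    also have "\<dots> = lin (\<lambda>(t1, t2). tensor (bvec [t1, s1]) (arel s2 t2)) (cop t) +
       lin (\<lambda>(t1, t2). tensor (bvec [t1, s1]) (lin (\<lambda>c. bvec [c, s2]) (ra (dr s) t2))) (cop t)"
      by (simp add: case_prod_unfold lin_fun_add)
    finally show "lin (\<lambda>(t1, t2). tensor (arel s1 t1) (bvec [s2, t2])) (cop t) +
      lin (\<lambda>(t1, t2). tensor (bvec [t1, s1]) (bvec [s2, t2])) (lin (tmap (ra (dr s1)) bvec) (cop t)) =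
      lin (\<lambda>(t1, t2). tensor (arel s1 t1) (bvec [s2, t2])) (cop t) +
      (lin (\<lambda>(t1, t2). tensor (bvec [t1, s1]) (arel s2 t2)) (cop t) +
       lin (\<lambda>(t1, t2). tensor (bvec [t1, s1]) (lin (\<lambda>c. bvec [c, s2]) (ra (dr s) t2))) (cop t))"
      by simp
  qed
  also have "\<dots> = lin (\<lambda>(s1, s2). lin (\<lambda>(t1, t2). tensor (arel s1 t1) (bvec [s2, t2]) + tensor (bvec [t1, s1]) (arel s2 t2)) (cop t)) (cop s)
     + lin (\<lambda>(s1, s2). lin (\<lambda>(t1, t2). tensor (bvec [t1, s1]) (lin (\<lambda>c. bvec [c, s2]) (ra (dr s) t2))) (cop t)) (cop s)"
    by (simp add: case_prod_unfold lin_fun_add)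
  finally have 1: "lin (word_cop flip cop) (lin (\<lambda>c. bvec [s, c]) (la (inv (dl s)) t)) = \<dots>" .
  have 2: "lin (word_cop flip cop) (lin (\<lambda>c. bvec [c, s]) (ra (dr s) t)) =
     lin (\<lambda>(s1, s2). lin (\<lambda>(t1, t2). tensor (bvec [t1, s1]) (lin (\<lambda>c. bvec [c, s2]) (ra (dr s) t2))) (cop t)) (cop s)"
  proof -
    have "lin (word_cop flip cop) (lin (\<lambda>c. bvec [c, s]) (ra (dr s) t)) =
      lin (\<lambda>(b1, b2). lin (\<lambda>(s1, s2). bvec ([b1, s1], [b2, s2])) (cop s)) (lin cop (ra (dr s) t))"
      by (simp add: lin_lin word_cop_two case_prod_unfold del: word_cop.simps)
    also have "\<dots> = lin (\<lambda>(s1, s2). lin (\<lambda>(b1, b2). bvec ([b1, s1], [b2, s2])) (lin cop (ra (dr s) t))) (cop s)"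
      unfolding case_prod_unfold by (rule lin_swap)
    also have "\<dots> = lin (\<lambda>(s1, s2). lin (\<lambda>(t1, t2). tensor (bvec [t1, s1]) (lin (\<lambda>c. bvec [c, s2]) (ra (dr s) t2))) (cop t)) (cop s)"
      using st by (simp add: cop_ra lin_lin tmap_def case_prod_unfold tensor_def)
    finally show ?thesis .
  qed
  show ?thesis unfolding arel_def[of s t] lin_diff 1 2 by simp
qed

theorem words_coquasi:
  "crossed_coquasi G (words arels) words_bialg (\<lambda>h. word_act (la h)) (\<lambda>h. word_act (ra h))
    (word_deg G dl) (word_deg G dr)"
proof -
  interpret W: crossed_bialgebra G "words arels" words_bialg "\<lambda>h. word_act (la h)" "\<lambda>h. word_act (ra h)"
    "word_deg G dl" "word_deg G dr"
  proof (rule words_bialgebra)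
    show "arels \<subseteq> fspan (lists B)"
      using arel_homog by (fastforce simp: arels_def fspan_def)
  next
    fix x assume "x \<in> arels"
    then obtain s t where x: "x = arel s t" and st: "s \<in> B" "t \<in> B" by (auto simp: arels_def)
    show "\<exists>u v. x \<in> fspan {w \<in> lists B. word_deg G dl w = u \<and> word_deg G dr w = v}"
      using arel_homog[OF st] unfolding x by blast
    show "lin (word_act (la h)) x \<in> word_ideal B arels" if "h \<in> carrier G" for h
      unfolding x la_arel[OF that st] by (rule lin_arel_in_ideal) (use that st in auto)
    show "lin (word_act (ra h)) x \<in> word_ideal B arels" if "h \<in> carrier G" for h
      unfolding x ra_arel[OF that st] by (rule lin_arel_in_ideal) (use that st in auto)
    show "lin (word_cop flip cop) x \<in> null (tens (words arels) (words arels))"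
      unfolding x cop_arel[OF st]
    proof (rule lin_in_subspace[OF null_tens_subspace])
      fix p assume "p \<in> Poly_Mapping.keys (cop s)"
      then obtain s1 s2 where p: "p = (s1, s2)" "s1 \<in> B" "s2 \<in> B"
        using keysD[OF cop_in[OF st(1)]] by (cases p) auto
      have "lin (\<lambda>(t1, t2). tensor (arel s1 t1) (bvec [s2, t2]) + tensor (bvec [t1, s1]) (arel s2 t2)) (cop t)
         \<in> null (tens (words arels) (words arels))"
      proof (rule lin_in_subspace[OF null_tens_subspace])
        fix z assume "z \<in> Poly_Mapping.keys (cop t)"
        then obtain t1 t2 where z: "z = (t1, t2)" "t1 \<in> B" "t2 \<in> B"
          using keysD[OF cop_in[OF st(2)]] by (cases z) auto
        have "tensor (arel s1 t1) (bvec [s2, t2]) \<in> null (tens (words arels) (words arels))"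
          by (rule tensor_null_left) (use p z in \<open>auto simp: arel_in_ideal\<close>)
        moreover have "tensor (bvec [t1, s1]) (arel s2 t2) \<in> null (tens (words arels) (words arels))"
          by (rule tensor_null_right) (use p z in \<open>auto simp: arel_in_ideal\<close>)
        ultimately show "(case z of (t1, t2) \<Rightarrow> tensor (arel s1 t1) (bvec [s2, t2]) + tensor (bvec [t1, s1]) (arel s2 t2))
          \<in> null (tens (words arels) (words arels))"
          using z by (auto intro: fv.subspace_add[OF null_tens_subspace])
      qed
      thus "(case p of (s1, s2) \<Rightarrow> lin (\<lambda>(t1, t2). tensor (arel s1 t1) (bvec [s2, t2]) + tensor (bvec [t1, s1]) (arel s2 t2)) (cop t))
         \<in> null (tens (words arels) (words arels))"
        by (simp add: p)
    qed
    show "linf (word_eps eps) x = 0"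
    proof -
      have "linf (word_eps eps) x = eps s * linf eps (la (inv (dl s)) t) - linf eps (ra (dr s) t) * eps s"
        by (simp add: x arel_def linf_diff linf_lin linf_fun_mult_left linf_fun_mult_right)
      \<comment> \<open>A nonzero counit of \<open>s\<close> gives \<open>dl s = dr s\<close>, and
        then \<open>eps_ra\<close> identifies the two counits of \<open>t\<close>.\<close>
      thus ?thesis using st eps_deg[of s] by (cases "eps s = 0") (auto simp: eps_ra)
    qed
  qed
  show ?thesis
  proof unfold_locales
    fix a b assume "a \<in> basis (words arels)" "b \<in> basis (words arels)"
    thus "lin (\<lambda>c. bmul words_bialg (a, c)) (word_act (la (inv (word_deg G dl a))) b) -
      lin (\<lambda>c. bmul words_bialg (c, a)) (word_act (ra (word_deg G dr a)) b) \<in> null (words arels)"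
      using words_comm[of arels a b] arel_in_ideal by (simp add: arel_def)
  qed
qed

text \<open>\<open>rearr \<one>\<close> is the algebra map from the words with concatenation to the words with the
  transmuted product that fixes the generators; the accumulated parameter \<open>g\<close> is the degree of the
  letters already read. \<open>unrearr \<one> \<one>\<close> is its inverse, with the left and right degrees accumulated
  separately.\<close>

primrec rearr :: "'b list \<Rightarrow> 'a \<Rightarrow> ('b list \<Rightarrow>\<^sub>0 'k)" where
  "rearr [] g = bvec []"
| "rearr (x # w) g = consv (la g x) (rearr w (g \<otimes> gd x))"

primrec unrearr :: "'b list \<Rightarrow> 'a \<Rightarrow> 'a \<Rightarrow> ('b list \<Rightarrow>\<^sub>0 'k)" where
  "unrearr [] d e = bvec []"
| "unrearr (y # w) d e = consv (la (inv e \<otimes> d) y) (unrearr w (d \<otimes> dl y) (e \<otimes> dr y))"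

lemma word_gd_in [simp]: "w \<in> lists B \<Longrightarrow> word_deg G gd w \<in> carrier G"
  by (induction w) auto

text \<open>The invariant carries the parameter \<open>g\<close> for the induction; at
  \<open>g = \<one>\<close> it says that the degree of the word is preserved.\<close>

lemma rearr_deg:
  assumes "w \<in> lists B" "g \<in> carrier G"
  shows "rearr w g \<in> fspan {v \<in> lists B. inv (word_deg G dl v) \<otimes> g \<otimes> word_deg G dr v = g \<otimes> word_deg G gd w}"
  using assms
proof (induction w arbitrary: g)
  case (Cons x w)
  have g': "g \<otimes> gd x \<in> carrier G" using Cons by auto
  show ?case
    unfolding rearr.simps
  proof (rule consv_in[OF la_deg[OF Cons.prems Cons.hyps(1)] Cons.IH[OF g']])
    fix y v assume y: "y \<in> {b \<in> B. dl b = g \<otimes> dl x \<otimes> inv g \<and> dr b = dr x}"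
      and v: "v \<in> {v \<in> lists B. inv (word_deg G dl v) \<otimes> (g \<otimes> gd x) \<otimes> word_deg G dr v = g \<otimes> gd x \<otimes> word_deg G gd w}"
    have c: "x \<in> B" "w \<in> lists B" "v \<in> lists B" "g \<in> carrier G" "word_deg G dl v \<in> carrier G" "word_deg G dr v \<in> carrier G"
      using v Cons.prems Cons.hyps word_deg_in by auto
    have e: "inv (word_deg G dl v) \<otimes> (g \<otimes> gd x) \<otimes> word_deg G dr v = g \<otimes> gd x \<otimes> word_deg G gd w"
      using v by simp
    have "inv (word_deg G dl (y # v)) \<otimes> g \<otimes> word_deg G dr (y # v) = inv (word_deg G dl v) \<otimes> (g \<otimes> gd x) \<otimes> word_deg G dr v"
      using y c by (simp add: gd_def inv_mult_group m_assoc)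
    also have "\<dots> = g \<otimes> word_deg G gd (x # w)"
      unfolding e using c by (simp add: m_assoc)
    finally show "y # v \<in> {v \<in> lists B. inv (word_deg G dl v) \<otimes> g \<otimes> word_deg G dr v = g \<otimes> word_deg G gd (x # w)}"
      using y c by simp
  qed
qed simp

lemma unrearr_deg:
  assumes "w \<in> lists B" "d \<in> carrier G" "e \<in> carrier G"
  shows "unrearr w d e \<in> fspan {v \<in> lists B. inv d \<otimes> e \<otimes> word_deg G gd v = inv (d \<otimes> word_deg G dl w) \<otimes> (e \<otimes> word_deg G dr w)}"
  using assms
proof (induction w arbitrary: d e)
  case (Cons y w)
  have c: "y \<in> B" "w \<in> lists B" "word_deg G dl w \<in> carrier G" "word_deg G dr w \<in> carrier G"
    using Cons.hyps word_deg_in by auto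
  have d': "d \<otimes> dl y \<in> carrier G" "e \<otimes> dr y \<in> carrier G" "inv e \<otimes> d \<in> carrier G" using Cons.prems c by auto
  show ?case
    unfolding unrearr.simps
  proof (rule consv_in[OF la_deg[OF d'(3) c(1)] Cons.IH[OF d'(1,2)]])
    fix x v assume x: "x \<in> {b \<in> B. dl b = inv e \<otimes> d \<otimes> dl y \<otimes> inv (inv e \<otimes> d) \<and> dr b = dr y}"
      and v: "v \<in> {v \<in> lists B. inv (d \<otimes> dl y) \<otimes> (e \<otimes> dr y) \<otimes> word_deg G gd v =
         inv (d \<otimes> dl y \<otimes> word_deg G dl w) \<otimes> (e \<otimes> dr y \<otimes> word_deg G dr w)}"
    have vl: "v \<in> lists B" using v by simp
    have e: "inv (d \<otimes> dl y) \<otimes> (e \<otimes> dr y) \<otimes> word_deg G gd v =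
         inv (d \<otimes> dl y \<otimes> word_deg G dl w) \<otimes> (e \<otimes> dr y \<otimes> word_deg G dr w)" using v by simp
    have "inv d \<otimes> e \<otimes> word_deg G gd (x # v) = inv (d \<otimes> dl y) \<otimes> (e \<otimes> dr y) \<otimes> word_deg G gd v"
      using x c vl Cons.prems by (simp add: gd_def[of x] inv_mult_group m_assoc)
    also have "\<dots> = inv (d \<otimes> word_deg G dl (y # w)) \<otimes> (e \<otimes> word_deg G dr (y # w))"
      unfolding e using c Cons.prems by (simp add: m_assoc)
    finally show "x # v \<in> {v \<in> lists B. inv d \<otimes> e \<otimes> word_deg G gd v =
        inv (d \<otimes> word_deg G dl (y # w)) \<otimes> (e \<otimes> word_deg G dr (y # w))}"
      using x vl by simp
  qed
qed simp

lemma rearr_in [simp]: "w \<in> lists B \<Longrightarrow> g \<in> carrier G \<Longrightarrow> rearr w g \<in> fspan (lists B)"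
  using rearr_deg[of w g] by (auto simp: fspan_def)

lemma unrearr_in [simp]: "w \<in> lists B \<Longrightarrow> d \<in> carrier G \<Longrightarrow> e \<in> carrier G \<Longrightarrow> unrearr w d e \<in> fspan (lists B)"
  using unrearr_deg[of w d e] by (auto simp: fspan_def)

text \<open>\<open>rearr\<close> records only a degree quotient, while \<open>unrearr\<close>
  records the left and right degrees. The parameter \<open>inv d \<otimes> e\<close> links them
  throughout the induction.\<close>

lemma unrearr_rearr:
  assumes "w \<in> lists B" "d \<in> carrier G" "e \<in> carrier G"
  shows "lin (\<lambda>v. unrearr v d e) (rearr w (inv d \<otimes> e)) = bvec w"
  using assms
proof (induction w arbitrary: d e)
  case (Cons x w)
  let ?g = "inv d \<otimes> e"
  have g: "?g \<in> carrier G" and x: "x \<in> B" using Cons by auto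
  have "lin (\<lambda>v. unrearr v d e) (rearr (x # w) ?g) =
      lin (\<lambda>y. consv (la (inv e \<otimes> d) y) (lin (\<lambda>v. unrearr v (d \<otimes> dl y) (e \<otimes> dr y)) (rearr w (?g \<otimes> gd x)))) (la ?g x)"
    by (simp add: lin_consv lin_tensor consv_def tensor_lin_right lin_lin)
  also have "\<dots> = lin (\<lambda>y. consv (la (inv e \<otimes> d) y) (bvec w)) (la ?g x)"
  proof (rule la_cong[OF g x])
    fix y assume y: "y \<in> B" "dl y = ?g \<otimes> dl x \<otimes> inv ?g" "dr y = dr x"
    \<comment> \<open>The left degree of \<open>y\<close> is that of \<open>x\<close> conjugated by
      \<open>?g\<close>, so the next parameter of \<open>rearr\<close> is again the quotient of the
      two accumulated degrees.\<close>
    have e: "?g \<otimes> gd x = inv (d \<otimes> dl y) \<otimes> (e \<otimes> dr y)"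
      using y x Cons.prems by (simp add: gd_def inv_mult_group m_assoc)
    have "lin (\<lambda>v. unrearr v (d \<otimes> dl y) (e \<otimes> dr y)) (rearr w (?g \<otimes> gd x)) = bvec w"
      unfolding e by (rule Cons.IH) (use y(1) Cons.prems in auto)
    thus "consv (la (inv e \<otimes> d) y) (lin (\<lambda>v. unrearr v (d \<otimes> dl y) (e \<otimes> dr y)) (rearr w (?g \<otimes> gd x))) =
        consv (la (inv e \<otimes> d) y) (bvec w)" by (simp only:)
  qed
  also have "\<dots> = consv (lin (la (inv e \<otimes> d)) (la ?g x)) (bvec w)"
    by (simp add: consv_def tensor_lin_left lin_lin)
  also have "\<dots> = bvec (x # w)"
    using g x Cons.prems by (simp add: la_mult la_one m_assoc)
  finally show ?case .
qed simp

lemma rearr_unrearr: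
  assumes "w \<in> lists B" "d \<in> carrier G" "e \<in> carrier G"
  shows "lin (\<lambda>v. rearr v (inv d \<otimes> e)) (unrearr w d e) = bvec w"
  using assms
proof (induction w arbitrary: d e)
  case (Cons y w)
  let ?g = "inv d \<otimes> e" and ?h = "inv e \<otimes> d"
  have g: "?g \<in> carrier G" "?h \<in> carrier G" and y: "y \<in> B" using Cons by auto
  have "lin (\<lambda>v. rearr v ?g) (unrearr (y # w) d e) =
      lin (\<lambda>x. consv (la ?g x) (lin (\<lambda>v. rearr v (?g \<otimes> gd x)) (unrearr w (d \<otimes> dl y) (e \<otimes> dr y)))) (la ?h y)"
    by (simp add: lin_consv lin_tensor consv_def tensor_lin_right lin_lin)
  also have "\<dots> = lin (\<lambda>x. consv (la ?g x) (bvec w)) (la ?h y)"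
  proof (rule la_cong[OF g(2) y])
    fix x assume x: "x \<in> B" "dl x = ?h \<otimes> dl y \<otimes> inv ?h" "dr x = dr y"
    have e: "?g \<otimes> gd x = inv (d \<otimes> dl y) \<otimes> (e \<otimes> dr y)"
      using y x Cons.prems by (simp add: gd_def inv_mult_group m_assoc)
    have "lin (\<lambda>v. rearr v (?g \<otimes> gd x)) (unrearr w (d \<otimes> dl y) (e \<otimes> dr y)) = bvec w"
      unfolding e by (rule Cons.IH) (use y Cons.prems in auto)
    thus "consv (la ?g x) (lin (\<lambda>v. rearr v (?g \<otimes> gd x)) (unrearr w (d \<otimes> dl y) (e \<otimes> dr y))) =
        consv (la ?g x) (bvec w)" by (simp only:)
  qed
  also have "\<dots> = consv (lin (la ?g) (la ?h y)) (bvec w)"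
    by (simp add: consv_def tensor_lin_left lin_lin)
  also have "\<dots> = bvec (y # w)"
    using g y Cons.prems by (simp add: la_mult la_one m_assoc)
  finally show ?case .
qed simp

lemma la_rearr:
  assumes "w \<in> lists B" "g \<in> carrier G" "k \<in> carrier G"
  shows "lin (word_act (la k)) (rearr w g) = rearr w (k \<otimes> g)"
  using assms
  by (induction w arbitrary: g) (auto simp: lin_word_act_consv la_mult m_assoc)

lemma rearr_append:
  assumes "u \<in> lists B" "v \<in> lists B" "g \<in> carrier G"
  shows "rearr (u @ v) g = appv (rearr u g) (rearr v (g \<otimes> word_deg G gd u))"
  using assms by (induction u arbitrary: g) (auto simp: appv_consv m_assoc)

lemma unrearr_append:
  assumes "u \<in> lists B" "v \<in> lists B" "d \<in> carrier G" "e \<in> carrier G"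
  shows "unrearr (u @ v) d e = appv (unrearr u d e) (unrearr v (d \<otimes> word_deg G dl u) (e \<otimes> word_deg G dr u))"
  using assms by (induction u arbitrary: d e) (auto simp: appv_consv m_assoc word_deg_in)

text \<open>Changing the parameter of \<open>rearr\<close> amounts to a left action by
  \<open>la_rearr\<close>; inverting this removes the parameters of \<open>unrearr\<close>.\<close>

lemma unrearr_shift:
  assumes "w \<in> lists B" "d \<in> carrier G" "e \<in> carrier G"
  shows "unrearr w d e = lin (\<lambda>v. unrearr v \<one> \<one>) (word_act (la (inv e \<otimes> d)) w)"
proof -
  let ?g = "inv d \<otimes> e" and ?h = "inv e \<otimes> d"
  have g: "?g \<in> carrier G" "?h \<in> carrier G" using assms by auto
  have "lin (\<lambda>v. rearr v \<one>) (unrearr w d e) = lin (\<lambda>v. lin (word_act (la ?h)) (rearr v ?g)) (unrearr w d e)"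
  proof (rule fspan_lin_cong[OF unrearr_in[OF assms]])
    fix v assume "v \<in> lists B"
    thus "rearr v \<one> = lin (word_act (la ?h)) (rearr v ?g)"
      using assms g by (simp add: la_rearr) (simp add: m_assoc)
  qed
  also have "\<dots> = lin (word_act (la ?h)) (lin (\<lambda>v. rearr v ?g) (unrearr w d e))"
    by (simp add: lin_lin)
  also have "\<dots> = word_act (la ?h) w" using rearr_unrearr[OF assms] by simp
  finally have "lin (\<lambda>v. unrearr v \<one> \<one>) (word_act (la ?h) w) = lin (\<lambda>v. unrearr v \<one> \<one>) (lin (\<lambda>v. rearr v \<one>) (unrearr w d e))" by simp
  also have "\<dots> = lin (\<lambda>v. lin (\<lambda>v. unrearr v \<one> \<one>) (rearr v \<one>)) (unrearr w d e)"
    by (simp add: lin_lin)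
  also have "\<dots> = lin bvec (unrearr w d e)"
    by (rule fspan_lin_cong[OF unrearr_in[OF assms]]) (use unrearr_rearr[of _ \<one> \<one>] in simp)
  finally show ?thesis by simp
qed

lemma conj_act_la:
  assumes "g \<in> carrier G" "h \<in> carrier G" "x \<in> B"
  shows "lin (conj_act h) (la g x) = lin (la (h \<otimes> g \<otimes> inv h)) (conj_act h x)"
proof -
  have "lin (conj_act h) (la g x) = lin (ra h) (lin (la h) (la g x))"
    by (simp add: conj_act_def[abs_def] lin_lin)
  also have "\<dots> = lin (ra h) (lin (la (h \<otimes> g \<otimes> inv h)) (la h x))"
    using assms by (simp add: la_mult m_assoc)
  also have "\<dots> = lin (la (h \<otimes> g \<otimes> inv h)) (conj_act h x)"
    using assms by (simp add: la_ra' conj_act_def)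
  finally show ?thesis .
qed

lemma conj_act_gd:
  assumes "h \<in> carrier G" "x \<in> B"
  shows "conj_act h x \<in> fspan {y \<in> B. gd y = h \<otimes> gd x \<otimes> inv h}"
  unfolding conj_act_def
proof (rule lin_in_fspan[OF la_deg[OF assms]])
  fix b assume b: "b \<in> {b \<in> B. dl b = h \<otimes> dl x \<otimes> inv h \<and> dr b = dr x}"
  have "{y \<in> B. dl y = dl b \<and> dr y = h \<otimes> dr b \<otimes> inv h} \<subseteq> {y \<in> B. gd y = h \<otimes> gd x \<otimes> inv h}"
    using assms b by (auto simp: gd_def inv_mult_group m_assoc)
  thus "ra h b \<in> fspan {y \<in> B. gd y = h \<otimes> gd x \<otimes> inv h}"
    using ra_deg[of h b] fspan_mono assms b by blast
qed

text \<open>Conjugation by \<open>h\<close> is applied to the letters and to the accumulated degree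
  alike, so the rearrangement is equivariant.\<close>

lemma conj_act_rearr:
  assumes "w \<in> lists B" "g \<in> carrier G" "h \<in> carrier G"
  shows "lin (word_act (conj_act h)) (rearr w g) = lin (\<lambda>v. rearr v (h \<otimes> g \<otimes> inv h)) (word_act (conj_act h) w)"
  using assms
proof (induction w arbitrary: g)
  case (Cons x w)
  have x: "x \<in> B" using Cons by simp
  let ?g = "h \<otimes> g \<otimes> inv h"
  have "lin (\<lambda>v. rearr v ?g) (word_act (conj_act h) (x # w)) =
     lin (\<lambda>y. consv (la ?g y) (lin (\<lambda>v. rearr v (?g \<otimes> gd y)) (word_act (conj_act h) w))) (conj_act h x)"
    by (simp add: word_act_Cons lin_consv lin_tensor consv_def tensor_lin_right lin_lin del: word_act.simps)
  also have "\<dots> = lin (\<lambda>y. consv (la ?g y) (lin (\<lambda>v. rearr v (h \<otimes> (g \<otimes> gd x) \<otimes> inv h)) (word_act (conj_act h) w))) (conj_act h x)"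
  proof (rule fspan_lin_cong[OF conj_act_gd[OF Cons.prems(2) x]])
    fix y assume "y \<in> {y \<in> B. gd y = h \<otimes> gd x \<otimes> inv h}"
    hence "?g \<otimes> gd y = h \<otimes> (g \<otimes> gd x) \<otimes> inv h"
      using Cons.prems x by (simp add: m_assoc)
    thus "consv (la ?g y) (lin (\<lambda>v. rearr v (?g \<otimes> gd y)) (word_act (conj_act h) w)) =
      consv (la ?g y) (lin (\<lambda>v. rearr v (h \<otimes> (g \<otimes> gd x) \<otimes> inv h)) (word_act (conj_act h) w))" by simp
  qed
  also have "\<dots> = consv (lin (la ?g) (conj_act h x)) (lin (\<lambda>v. rearr v (h \<otimes> (g \<otimes> gd x) \<otimes> inv h)) (word_act (conj_act h) w))"
    by (simp add: consv_def tensor_lin_left lin_lin)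
  also have "\<dots> = lin (word_act (conj_act h)) (rearr (x # w) g)"
    using Cons by (simp add: lin_word_act_consv conj_act_la)
  finally show ?case by simp
qed simp

text \<open>A letter with nonzero counit has degree \<open>\<one>\<close> and leaves the parameter
  unchanged.\<close>

lemma eps_rearr:
  assumes "w \<in> lists B"
  shows "linf (word_eps eps) (rearr w \<one>) = word_eps eps w"
  using assms
proof (induction w)
  case (Cons x w)
  have "linf (word_eps eps) (rearr (x # w) \<one>) = eps x * linf (word_eps eps) (rearr w (gd x))"
    using Cons by (simp add: linf_consv linf_tensor linf_fun_mult_left linf_fun_mult_right la_one)
  thus ?case using Cons eps_deg[of x] by (cases "eps x = 0") (auto simp: gd_def)
qed simp

text \<open>The relation \<open>xy = \<cdot>\<Psi>(x \<otimes> y)\<close> for the fundamental braiding.\<close>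

definition urel :: "'b \<Rightarrow> 'b \<Rightarrow> ('b list \<Rightarrow>\<^sub>0 'k)" where
  "urel s t = bvec [s, t] - lin (\<lambda>y. lin (\<lambda>x. bvec [y, x]) (la (inv (gd y)) s)) (conj_act (dr s) t)"

definition urels :: "('b list \<Rightarrow>\<^sub>0 'k) set" where
  "urels = {urel s t | s t. s \<in> B \<and> t \<in> B}"

lemma conj_act_in [simp]: "h \<in> carrier G \<Longrightarrow> x \<in> B \<Longrightarrow> conj_act h x \<in> fspan B"
  by (simp add: conj_act_def)

lemma urel_homog:
  assumes "s \<in> B" "t \<in> B"
  shows "urel s t \<in> fspan {w \<in> lists B. word_deg G gd w = gd s \<otimes> gd t}"
  unfolding urel_def
proof (rule diff_in_fspan)
  show "lin (\<lambda>y. lin (\<lambda>x. bvec [y, x]) (la (inv (gd y)) s)) (conj_act (dr s) t) \<in> fspan {w \<in> lists B. word_deg G gd w = gd s \<otimes> gd t}"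
  proof (rule lin_in_fspan[OF conj_act_gd])
    fix y assume y: "y \<in> {y \<in> B. gd y = dr s \<otimes> gd t \<otimes> inv (dr s)}"
    show "lin (\<lambda>x. bvec [y, x]) (la (inv (gd y)) s) \<in> fspan {w \<in> lists B. word_deg G gd w = gd s \<otimes> gd t}"
    proof (rule lin_in_fspan[OF la_deg])
      fix x assume x: "x \<in> {b \<in> B. dl b = inv (gd y) \<otimes> dl s \<otimes> inv (inv (gd y)) \<and> dr b = dr s}"
      have "gd y \<otimes> gd x = gd s \<otimes> gd t"
        using x y assms unfolding gd_def[of x] by (simp add: inv_mult_group m_assoc) (simp add: gd_def m_assoc)
      thus "bvec [y, x] \<in> fspan {w \<in> lists B. word_deg G gd w = gd s \<otimes> gd t}"
        using x y by simp
    qed (use y assms in auto)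
  qed (use assms in auto)
qed (use assms in simp)

text \<open>In the braided term the twist by \<open>gd y\<close> cancels the action by
  \<open>inv (gd y)\<close> on \<open>s\<close>, so \<open>y\<close> is followed by \<open>s\<close>
  itself. Writing \<open>la (gd s)\<close> as \<open>la (inv (dl s))\<close> after
  \<open>la (dr s)\<close> then exhibits relations of \<open>A(R)\<close> in
  \<open>la (dr s) t\<close>.\<close>

lemma rearr_urel:
  assumes st: "s \<in> B" "t \<in> B"
  shows "lin (\<lambda>w. rearr w \<one>) (urel s t) = lin (arel s) (la (dr s) t)"
proof -
  have j: "consv z (bvec []) = lin (\<lambda>c. bvec [c]) z" for z
    by (simp add: consv_def tensor_bvec_right lin_lin)
  have t2: "rearr [x, y] \<one> = lin (\<lambda>c. bvec [x, c]) (la (gd x) y)" if "x \<in> B" for x y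
    using that by (simp add: la_one j consv_bvec_left lin_lin)
  have "lin (\<lambda>w. rearr w \<one>) (urel s t) = lin (\<lambda>c. bvec [s, c]) (la (gd s) t) -
     lin (\<lambda>y. lin (\<lambda>x. rearr [y, x] \<one>) (la (inv (gd y)) s)) (conj_act (dr s) t)"
    using st by (simp add: urel_def lin_diff lin_lin t2 del: rearr.simps)
  also have "lin (\<lambda>y. lin (\<lambda>x. rearr [y, x] \<one>) (la (inv (gd y)) s)) (conj_act (dr s) t)
     = lin (\<lambda>y. bvec [y, s]) (conj_act (dr s) t)"
  proof (rule fspan_lin_cong[OF conj_act_in])
    fix y assume y: "y \<in> B"
    have "lin (\<lambda>x. rearr [y, x] \<one>) (la (inv (gd y)) s) = lin (\<lambda>c. bvec [y, c]) (lin (la (gd y)) (la (inv (gd y)) s))"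
      using y by (simp add: t2 lin_lin del: rearr.simps)
    thus "lin (\<lambda>x. rearr [y, x] \<one>) (la (inv (gd y)) s) = bvec [y, s]"
      using y st by (simp add: la_mult la_one)
  qed (use st in auto)
  also have "lin (\<lambda>c. bvec [s, c]) (la (gd s) t) = lin (\<lambda>c. bvec [s, c]) (lin (la (inv (dl s))) (la (dr s) t))"
    using st by (simp add: la_mult gd_def)
  also have "\<dots> - lin (\<lambda>y. bvec [y, s]) (conj_act (dr s) t) = lin (arel s) (la (dr s) t)"
    by (simp add: arel_def[abs_def] lin_fun_diff lin_lin conj_act_def)
  finally show ?thesis .
qed

lemma urel_in_ideal: "s \<in> B \<Longrightarrow> t \<in> B \<Longrightarrow> urel s t \<in> word_ideal B urels"
  by (rule word_ideal_base) (auto simp: urels_def)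

lemma urels_in: "urels \<subseteq> fspan (lists B)"
  using urel_homog by (fastforce simp: urels_def fspan_def)

text \<open>\<open>rearr_urel\<close> is solved for \<open>arel\<close> by acting with
  \<open>la (inv (dr s))\<close> on \<open>t\<close>.\<close>

lemma unrearr_arel:
  assumes st: "s \<in> B" "t \<in> B"
  shows "lin (\<lambda>w. unrearr w \<one> \<one>) (arel s t) \<in> word_ideal B urels"
proof -
  let ?u = "lin (urel s) (la (inv (dr s)) t)"
  have "lin (\<lambda>w. rearr w \<one>) ?u = lin (\<lambda>t'. lin (arel s) (la (dr s) t')) (la (inv (dr s)) t)"
    unfolding lin_lin by (rule fspan_lin_cong[OF la_in]) (use st in \<open>auto simp: rearr_urel\<close>)
  also have "\<dots> = arel s t"
    using st by (simp add: la_mult la_one flip: lin_lin)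
  finally have "lin (\<lambda>w. unrearr w \<one> \<one>) (arel s t) = lin (\<lambda>w. unrearr w \<one> \<one>) (lin (\<lambda>w. rearr w \<one>) ?u)" by simp
  also have "\<dots> = lin (\<lambda>w. lin (\<lambda>w. unrearr w \<one> \<one>) (rearr w \<one>)) ?u"
    by (simp only: lin_lin)
  also have "\<dots> = lin bvec ?u"
  proof (rule fspan_lin_cong)
    show "?u \<in> fspan (lists B)"
      by (rule lin_in_fspan[OF la_in]) (use st urels_in in \<open>auto simp: urels_def\<close>)
  qed (use unrearr_rearr[of _ \<one> \<one>] in simp)
  also have "\<dots> = ?u" by simp
  also have "\<dots> \<in> word_ideal B urels"
  proof (rule lin_in_subspace[OF word_ideal_subspace])
    fix t' assume t': "t' \<in> Poly_Mapping.keys (la (inv (dr s)) t)"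
    have "la (inv (dr s)) t \<in> fspan B" using st by simp
    from keysD[OF this t'] have "t' \<in> B" .
    thus "urel s t' \<in> word_ideal B urels" by (rule urel_in_ideal[OF st(1)])
  qed
  finally show ?thesis .
qed

text \<open>A prefix \<open>u\<close> changes the parameter at the relation to the degree of
  \<open>u\<close>. By \<open>la_rearr\<close> this is a left action, under which the ideal is
  stable.\<close>

lemma rearr_null:
  assumes "y \<in> word_ideal B urels"
  shows "lin (\<lambda>w. rearr w \<one>) y \<in> word_ideal B arels"
proof -
  interpret W: crossed_coquasi G "words arels" words_bialg "\<lambda>h. word_act (la h)" "\<lambda>h. word_act (ra h)"
    "word_deg G dl" "word_deg G dr"
    by (rule words_coquasi)
  show ?thesis
  proof (rule word_ideal_lin[OF assms])
    fix u v x assume uv: "u \<in> lists B" "v \<in> lists B" and "x \<in> urels"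
    then obtain s t where x: "x = urel s t" and st: "s \<in> B" "t \<in> B" by (auto simp: urels_def)
    let ?g = "word_deg G gd u" and ?k = "gd s \<otimes> gd t"
    have g: "?g \<in> carrier G" "?g \<otimes> ?k \<in> carrier G" using uv st by auto
    have x1: "lin (\<lambda>w. rearr w ?g) x \<in> word_ideal B arels"
    proof -
      have "lin (\<lambda>w. rearr w ?g) x = lin (\<lambda>w. lin (word_act (la ?g)) (rearr w \<one>)) x"
        by (rule fspan_lin_cong[OF urel_homog[OF st, folded x]]) (use g in \<open>auto simp: la_rearr\<close>)
      also have "\<dots> = lin (word_act (la ?g)) (lin (arel s) (la (dr s) t))"
        unfolding x by (simp add: rearr_urel[OF st] flip: lin_lin)
      also have "\<dots> \<in> word_ideal B arels"
      proof -
        have "lin (arel s) (la (dr s) t) \<in> word_ideal B arels"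
          using lin_arel_in_ideal[of "bvec s" "la (dr s) t"] st by simp
        thus ?thesis using W.null_la[OF g(1)] by simp
      qed
      finally show ?thesis .
    qed
    have "lin (\<lambda>w. rearr w \<one>) (lin (\<lambda>w. bvec (u @ w @ v)) x) = lin (\<lambda>w. appv (rearr u \<one>) (appv (rearr w ?g) (rearr v (?g \<otimes> ?k)))) x"
      unfolding lin_lin
      by (rule fspan_lin_cong[OF urel_homog[OF st, folded x]]) (use uv g in \<open>auto simp: rearr_append\<close>)
    also have "\<dots> = appv (rearr u \<one>) (appv (lin (\<lambda>w. rearr w ?g) x) (rearr v (?g \<otimes> ?k)))"
      by (simp add: appv_lin_left appv_lin_right)
    also have "\<dots> \<in> word_ideal B arels"
      by (intro word_ideal_left' word_ideal_right' x1) (use uv g in auto)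
    finally show "lin (\<lambda>w. rearr w \<one>) (lin (\<lambda>w. bvec (u @ w @ v)) x) \<in> word_ideal B arels" .
  qed simp
qed

text \<open>The accumulated degrees of the prefix are removed by \<open>unrearr_shift\<close>, and
  \<open>la_arel\<close> keeps the shifted relation within the span of relations.\<close>

lemma unrearr_null:
  assumes "y \<in> word_ideal B arels"
  shows "lin (\<lambda>w. unrearr w \<one> \<one>) y \<in> word_ideal B urels"
proof (rule word_ideal_lin[OF assms])
  fix u v x assume uv: "u \<in> lists B" "v \<in> lists B" and "x \<in> arels"
  then obtain s t where x: "x = arel s t" and st: "s \<in> B" "t \<in> B" by (auto simp: arels_def)
  let ?d = "word_deg G dl u" and ?e = "word_deg G dr u"
  let ?d' = "?d \<otimes> (dl t \<otimes> dl s)" and ?e' = "?e \<otimes> (dr s \<otimes> dr t)"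
  have g: "?d \<in> carrier G" "?e \<in> carrier G" "?d' \<in> carrier G" "?e' \<in> carrier G" using uv st word_deg_in by auto
  let ?h = "inv ?e \<otimes> ?d"
  have h: "?h \<in> carrier G" using g by simp
  have x1: "lin (\<lambda>w. unrearr w ?d ?e) x \<in> word_ideal B urels"
  proof -
    have "lin (\<lambda>w. unrearr w ?d ?e) x = lin (\<lambda>w. lin (\<lambda>v. unrearr v \<one> \<one>) (word_act (la ?h) w)) x"
      by (rule fspan_lin_cong[OF arel_homog[OF st, folded x]]) (use g in \<open>auto intro: unrearr_shift\<close>)
    also have "\<dots> = lin (\<lambda>v. unrearr v \<one> \<one>) (lin (word_act (la ?h)) (arel s t))"
      by (simp add: x lin_lin)
    also have "\<dots> = lin (\<lambda>s'. lin (\<lambda>t'. lin (\<lambda>v. unrearr v \<one> \<one>) (arel s' t')) (la ?h t)) (la ?h s)"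
      unfolding la_arel[OF h st] by (simp add: lin_lin)
    also have "\<dots> \<in> word_ideal B urels"
    proof (rule lin_in_subspace[OF word_ideal_subspace])
      fix s' assume "s' \<in> Poly_Mapping.keys (la ?h s)"
      hence s': "s' \<in> B" using keysD[OF la_in[OF h st(1)]] by blast
      show "lin (\<lambda>t'. lin (\<lambda>v. unrearr v \<one> \<one>) (arel s' t')) (la ?h t) \<in> word_ideal B urels"
      proof (rule lin_in_subspace[OF word_ideal_subspace])
        fix t' assume "t' \<in> Poly_Mapping.keys (la ?h t)"
        hence "t' \<in> B" using keysD[OF la_in[OF h st(2)]] by blast
        thus "lin (\<lambda>v. unrearr v \<one> \<one>) (arel s' t') \<in> word_ideal B urels" by (rule unrearr_arel[OF s'])
      qed
    qed
    finally show ?thesis .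
  qed
  have "lin (\<lambda>w. unrearr w \<one> \<one>) (lin (\<lambda>w. bvec (u @ w @ v)) x) = lin (\<lambda>w. appv (unrearr u \<one> \<one>) (appv (unrearr w ?d ?e) (unrearr v ?d' ?e'))) x"
    unfolding lin_lin
    by (rule fspan_lin_cong[OF arel_homog[OF st, folded x]]) (use uv g in \<open>auto simp: unrearr_append\<close>)
  also have "\<dots> = appv (unrearr u \<one> \<one>) (appv (lin (\<lambda>w. unrearr w ?d ?e) x) (unrearr v ?d' ?e'))"
    by (simp add: appv_lin_left appv_lin_right)
  also have "\<dots> \<in> word_ideal B urels"
    by (intro word_ideal_left' word_ideal_right' x1) (use uv g in auto)
  finally show "lin (\<lambda>w. unrearr w \<one> \<one>) (lin (\<lambda>w. bvec (u @ w @ v)) x) \<in> word_ideal B urels" .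
qed simp

end

section \<open>The braided enveloping algebra\<close>

lemma word_act_in:
  assumes "\<And>x. x \<in> B \<Longrightarrow> f x \<in> fspan B" "w \<in> lists B"
  shows "word_act f w \<in> fspan (lists B)"
  using assms(2)
proof (induction w)
  case (Cons x w)
  show ?case
    unfolding word_act_Cons by (rule consv_in[OF assms(1)[OF Cons.hyps(1)] Cons.IH]) auto
qed simp

lemma lin_word_act_word_act: "lin (word_act f) (word_act g w) = word_act (\<lambda>x. lin f (g x)) w"
  by (induction w) (simp_all add: word_act_Cons lin_word_act_consv del: word_act.simps(2))

lemma word_deg_cong: "(\<And>x. x \<in> set w \<Longrightarrow> d x = e x) \<Longrightarrow> word_deg G d w = word_deg G e w"
  by (induction w) simp_all

sublocale pair_data \<subseteq> C: crossed_coalgebra G "gens G S" gla gra gdl gdr "mat_cop G" mat_eps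
  by (rule gens_coalgebra)

section \<open>Identification of the relations of \<open>A(R)\<close> and
  \<open>U(L)\<close>\<close>

context pair_data
begin

lemma linf_mat_eps_gla:
  assumes "(P, (a, i), (b, j)) \<in> gens G S" "h \<in> carrier G"
  shows "linf mat_eps (gla h (P, (a, i), (b, j))) = (if h \<otimes> a \<otimes> inv h = b then wt P a h j i else 0)"
proof -
  have "linf mat_eps (gla h (P, (a, i), (b, j))) =
    (\<Sum>m<pdim G P. if m = j then (if h \<otimes> a \<otimes> inv h = b then wt P a h m i else 0) else 0)"
    unfolding gla_apply linf_sum linf_scale linf_bvec mat_eps_def by (rule sum.cong) auto
  thus ?thesis using assms by simp
qed

lemma sum_pidx: "(\<Sum>z\<in>pidx G P. f z) = (\<Sum>c\<in>fst P. \<Sum>m<pdim G P. f (c, m))"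
  by (simp add: pidx_def sum.cartesian_product case_prod_unfold)

text \<open>The entry of \<open>R\<close> is diagonal in the first pair of indices and is the matrix
  of \<open>a\<close> on the second, so the double sum collapses to the left action on the second
  letter.\<close>

lemma A_rel_left:
  assumes t: "(P, (a, i), y) \<in> gens G S" and t': "(P', (a', i'), y') \<in> gens G S"
  shows "(\<Sum>z\<in>pidx G P. \<Sum>w\<in>pidx G P'. scale (R_entry G q P P' z (a, i) w (a', i')) (bvec [(P, z, y), (P', w, y')]))
    = lin (\<lambda>c. bvec [(P, (a, i), y), c]) (gla a (P', (a', i'), y'))"
proof -
  have m: "P \<in> S" "a \<in> fst P" "i < pdim G P" "P' \<in> S" "a' \<in> fst P'" "i' < pdim G P'"
    using t t' by (auto simp: gens_def pidx_def)
  let ?b = "a \<otimes> a' \<otimes> inv a"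
  have b: "?b \<in> fst P'" using m by simp
  let ?W = "\<Sum>m<pdim G P'. scale (wt P' a' a m i') (bvec [(P, (a, i), y), (P', (?b, m), y')])"
  have inner: "(\<Sum>c'\<in>fst P'. \<Sum>m'<pdim G P'. scale (R_entry G q P P' (c, m) (a, i) (c', m') (a', i'))
       (bvec [(P, (c, m), y), (P', (c', m'), y')])) = (if c = a then if m = i then ?W else 0 else 0)"
    if c: "c \<in> fst P" for c m
  proof (cases "c = a \<and> m = i")
    case True
    have "(\<Sum>c'\<in>fst P'. \<Sum>m'<pdim G P'. scale (R_entry G q P P' (c, m) (a, i) (c', m') (a', i'))
       (bvec [(P, (c, m), y), (P', (c', m'), y')])) =
       (\<Sum>c'\<in>fst P'. if c' = ?b then ?W else 0)"
      by (intro sum.cong refl) (use True in \<open>auto simp: R_entry_def wt_def\<close>)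
    thus ?thesis using True b m by simp
  qed (auto simp: R_entry_def)
  have "(\<Sum>z\<in>pidx G P. \<Sum>w\<in>pidx G P'. scale (R_entry G q P P' z (a, i) w (a', i')) (bvec [(P, z, y), (P', w, y')]))
     = (\<Sum>c\<in>fst P. \<Sum>m<pdim G P. if c = a then if m = i then ?W else 0 else 0)"
    unfolding sum_pidx by (intro sum.cong refl inner)
  also have "\<dots> = (\<Sum>c\<in>fst P. if c = a then ?W else 0)"
    using m by (intro sum.cong refl) simp
  also have "\<dots> = ?W" using m by simp
  also have "\<dots> = lin (\<lambda>c. bvec [(P, (a, i), y), c]) (gla a (P', (a', i'), y'))"
    by (simp add: gla_apply lin_sum lin_scale)
  finally show ?thesis .
qed

text \<open>Here the matrix acts on the upper index from its other side, which is the dual action of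
  \<open>inv b\<close>.\<close>

lemma A_rel_right:
  assumes t: "(P, x, (b, j)) \<in> gens G S" and t': "(P', x', (b', j')) \<in> gens G S"
  shows "(\<Sum>w\<in>pidx G P'. \<Sum>z\<in>pidx G P. scale (R_entry G q P P' (b, j) z (b', j') w) (bvec [(P', x', w), (P, x, z)]))
    = lin (\<lambda>c. bvec [c, (P, x, (b, j))]) (gra (inv b) (P', x', (b', j')))"
proof -
  have m: "P \<in> S" "b \<in> fst P" "j < pdim G P" "P' \<in> S" "b' \<in> fst P'" "j' < pdim G P'"
    using t t' by (auto simp: gens_def pidx_def)
  have bc: "b \<in> carrier G" "b' \<in> carrier G" using m by auto
  let ?d = "inv b \<otimes> b' \<otimes> inv (inv b)"
  have d1: "?d \<in> fst P'" by (rule class_conj) (use m bc in auto)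
  have d: "?d \<in> fst P'" "?d \<in> carrier G" using d1 class_carrier[OF m(4) d1] by auto
  \<comment> \<open>The cocycle at \<open>inv b\<close> over \<open>b'\<close> is inverse to the
    cocycle at \<open>b\<close> over the conjugate of \<open>b'\<close>; this turns the entry of
    \<open>R\<close> into a dual weight.\<close>
  have "inv (zeta G q (fst P') b' (inv b)) = zeta G q (fst P') ?d b"
    using m bc d unfolding zeta_def by (simp add: inv_mult_group m_assoc del: class_conj)
  hence w: "wt' P' b' (inv b) j' l = wt P' ?d b j' l" for l
    by (simp add: wt_def wt'_def)
  have iff: "b' = b \<otimes> c \<otimes> inv b \<longleftrightarrow> c = ?d" if "c \<in> carrier G" for c
    using that bc by (auto simp: m_assoc)
  let ?W = "\<lambda>l. scale (wt' P' b' (inv b) j' l) (bvec [(P', x', (?d, l)), (P, x, (b, j))])"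
  have inner: "(\<Sum>c\<in>fst P. \<Sum>m<pdim G P. scale (R_entry G q P P' (b, j) (c, m) (b', j') (d, l))
      (bvec [(P', x', (d, l)), (P, x, (c, m))])) = (if d = ?d then ?W l else 0)" if dd: "d \<in> fst P'" for d l
  proof -
    have dc: "d \<in> carrier G" using m dd by auto
    have "(\<Sum>c\<in>fst P. \<Sum>m<pdim G P. scale (R_entry G q P P' (b, j) (c, m) (b', j') (d, l))
      (bvec [(P', x', (d, l)), (P, x, (c, m))])) =
      (\<Sum>c\<in>fst P. \<Sum>m<pdim G P. scale (if b = c \<and> j = m then 1 else 0)
        (if d = ?d then scale (wt' P' b' (inv b) j' l) (bvec [(P', x', (d, l)), (P, x, (c, m))]) else 0))"
      unfolding w by (intro sum.cong refl) (auto simp: R_entry_def iff[OF dc] wt_def)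
    also have "\<dots> = (if d = ?d then ?W l else 0)"
      using m by (subst sum_sum_scale_delta(1)) auto
    finally show ?thesis .
  qed
  have "(\<Sum>w\<in>pidx G P'. \<Sum>z\<in>pidx G P. scale (R_entry G q P P' (b, j) z (b', j') w) (bvec [(P', x', w), (P, x, z)]))
    = (\<Sum>d\<in>fst P'. \<Sum>l<pdim G P'. if d = ?d then ?W l else 0)"
    unfolding sum_pidx by (intro sum.cong refl inner)
  also have "\<dots> = (\<Sum>d\<in>fst P'. if d = ?d then (\<Sum>l<pdim G P'. ?W l) else 0)"
    by (intro sum.cong refl) auto
  also have "\<dots> = (\<Sum>l<pdim G P'. ?W l)"
    using m d by simp
  also have "\<dots> = lin (\<lambda>c. bvec [c, (P, x, (b, j))]) (gra (inv b) (P', x', (b', j')))"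
    by (simp add: gra_apply lin_sum lin_scale)
  finally show ?thesis .
qed

lemma A_rel_eq:
  assumes t: "(P, x, y) \<in> gens G S" and t': "(P', x', y') \<in> gens G S"
  shows "(\<Sum>z\<in>pidx G P. \<Sum>w\<in>pidx G P'. scale (R_entry G q P P' z x w x') (bvec [(P, z, y), (P', w, y')])) -
     (\<Sum>w\<in>pidx G P'. \<Sum>z\<in>pidx G P. scale (R_entry G q P P' y z y' w) (bvec [(P', x', w), (P, x, z)]))
    = C.arel (P, x, y) (P', x', y')"
proof -
  obtain a i b j a' i' b' j' where e: "x = (a, i)" "y = (b, j)" "x' = (a', i')" "y' = (b', j')"
    by (cases x, cases y, cases x', cases y')
  have "a \<in> carrier G" using t by (auto simp: e)
  thus ?thesis
    using A_rel_left[of P a i y P' a' i' y'] A_rel_right[of P x b j P' x' b' j'] t t'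
    unfolding e C.arel_def by (simp add: gdl_def gdr_def)
qed

lemma A_rels_eq: "A_rels G q S = C.arels"
proof (intro equalityI subsetI)
  fix v assume "v \<in> A_rels G q S"
  then obtain P x y P' x' y' where v: "v =
     (\<Sum>z\<in>pidx G P. \<Sum>w\<in>pidx G P'. scale (R_entry G q P P' z x w x') (bvec [(P, z, y), (P', w, y')])) -
     (\<Sum>w\<in>pidx G P'. \<Sum>z\<in>pidx G P. scale (R_entry G q P P' y z y' w) (bvec [(P', x', w), (P, x, z)]))"
    and g: "(P, x, y) \<in> gens G S" "(P', x', y') \<in> gens G S"
    unfolding A_rels_def by blast
  have "v = C.arel (P, x, y) (P', x', y')" unfolding v by (rule A_rel_eq[OF g])
  thus "v \<in> C.arels" unfolding C.arels_def using g by blast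
next
  fix v assume "v \<in> C.arels"
  then obtain s t where v: "v = C.arel s t" and st: "s \<in> gens G S" "t \<in> gens G S"
    unfolding C.arels_def by blast
  obtain P x y P' x' y' where e: "s = (P, x, y)" "t = (P', x', y')" by (cases s, cases t)
  have "v = (\<Sum>z\<in>pidx G P. \<Sum>w\<in>pidx G P'. scale (R_entry G q P P' z x w x') (bvec [(P, z, y), (P', w, y')])) -
     (\<Sum>w\<in>pidx G P'. \<Sum>z\<in>pidx G P. scale (R_entry G q P P' y z y' w) (bvec [(P', x', w), (P, x, z)]))"
    unfolding v e by (rule A_rel_eq[symmetric]) (use st e in auto)
  thus "v \<in> A_rels G q S" unfolding A_rels_def using st unfolding e by blast
qed

lemma A_space_eq: "A_space G q S = C.words C.arels"
  by (simp add: A_space_def C.words_def A_rels_eq)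

lemma A_bialg_eq: "A_bialg G = C.words_bialg"
  by (simp add: A_bialg_def C.words_bialg_def)

lemma L_deg_gd: "t \<in> gens G S \<Longrightarrow> L_deg G t = C.gd t"
  by (simp add: L_deg_eq C.gd_def)

lemma L_act_conj_act: "t \<in> gens G S \<Longrightarrow> h \<in> carrier G \<Longrightarrow> L_act G q h t = C.conj_act h t"
  by (simp add: L_act_eq C.conj_act_def)

text \<open>The element \<open>inv b\<close> by which the fundamental braiding acts is the right
  degree of the first letter.\<close>

lemma U_rel_eq:
  assumes s: "s \<in> gens G S" and t: "t \<in> gens G S"
  shows "bvec [s, t] - lin (\<lambda>(y', x'). bvec [y', x']) (fund_braiding G q (s, t)) = C.urel s t"
proof -
  obtain P x b j where e: "s = (P, x, (b, j))" by (cases s) auto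
  have b: "inv b \<in> carrier G" "gdr s = inv b" using s by (auto simp: e gdr_def elim: gensE)
  have "lin (\<lambda>(y', x'). bvec [y', x']) (fund_braiding G q (s, t)) =
    lin (\<lambda>y. lin (\<lambda>x. bvec [y, x]) (gla (inv (L_deg G y)) s)) (C.conj_act (gdr s) t)"
    using t b by (simp add: fund_braiding_def e lin_lin lin_tensor gla_def L_act_conj_act)
  also have "\<dots> = lin (\<lambda>y. lin (\<lambda>x. bvec [y, x]) (gla (inv (C.gd y)) s)) (C.conj_act (gdr s) t)"
    by (rule fspan_lin_cong[OF C.conj_act_in]) (use t b in \<open>auto simp: L_deg_gd\<close>)
  finally show ?thesis by (simp add: C.urel_def)
qed

lemma U_rels_eq: "U_rels G q S = C.urels"
proof (intro equalityI subsetI)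
  fix v assume "v \<in> U_rels G q S"
  thus "v \<in> C.urels"
    unfolding U_rels_def C.urels_def using U_rel_eq by blast
next
  fix v assume "v \<in> C.urels"
  then obtain s t where v: "v = C.urel s t" and st: "s \<in> gens G S" "t \<in> gens G S"
    unfolding C.urels_def by blast
  show "v \<in> U_rels G q S"
    unfolding v U_rel_eq[OF st, symmetric] U_rels_def using st by blast
qed

lemma U_xmod_simps [simp]: "basis (U_xmod G q S) = lists (gens G S)"
  "null (U_xmod G q S) = word_ideal (gens G S) C.urels"
  "act (U_xmod G q S) h = word_act (L_act G q h)" "deg (U_xmod G q S) = word_deg G (L_deg G)"
  by (simp_all add: U_xmod_def U_rels_eq)

lemma U_bialg_simps [simp]: "bone (U_bialg G q S) = bvec []" "bmul (U_bialg G q S) = word_mul"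
  "bcop (U_bialg G q S) = word_cop (xbraid (U_xmod G q S)) (mat_cop G)" "beps (U_bialg G q S) = word_eps mat_eps"
  by (simp_all add: U_bialg_def word_bialg_def)

lemma U_act_eq: "w \<in> lists (gens G S) \<Longrightarrow> h \<in> carrier G \<Longrightarrow> word_act (L_act G q h) w = word_act (C.conj_act h) w"
  by (rule word_act_cong) (auto simp: L_act_conj_act)

lemma U_deg_eq: "w \<in> lists (gens G S) \<Longrightarrow> word_deg G (L_deg G) w = word_deg G C.gd w"
  by (rule word_deg_cong) (auto simp: L_deg_gd)

definition theta :: "('a, 'k) gen list \<Rightarrow> (('a, 'k) gen list \<Rightarrow>\<^sub>0 'k)" where
  "theta w = C.rearr w \<one>"

definition theta' :: "('a, 'k) gen list \<Rightarrow> (('a, 'k) gen list \<Rightarrow>\<^sub>0 'k)" where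
  "theta' w = C.unrearr w \<one> \<one>"

end

sublocale pair_data \<subseteq> A: crossed_coquasi G "C.words C.arels" "C.words_bialg" "\<lambda>h. word_act (gla h)"
    "\<lambda>h. word_act (gra h)" "word_deg G gdl" "word_deg G gdr"
  by (rule C.words_coquasi)

section \<open>\<open>U(L)\<close> as the transmutation of \<open>A(R)\<close>, and the map to
  \<open>BD(G)\<close>\<close>

context pair_data
begin

lemma A_ad: "A.ad h w = word_act (C.conj_act h) w"
  unfolding A.ad_def lin_word_act_word_act by (simp add: C.conj_act_def[abs_def])

lemma theta_gdeg:
  assumes "w \<in> lists (gens G S)"
  shows "theta w \<in> fspan {v \<in> lists (gens G S). A.gdeg v = word_deg G C.gd w}"
proof -
  have "{v \<in> lists (gens G S). inv (word_deg G gdl v) \<otimes> \<one> \<otimes> word_deg G gdr v = \<one> \<otimes> word_deg G C.gd w}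
    \<subseteq> {v \<in> lists (gens G S). A.gdeg v = word_deg G C.gd w}"
    using assms by (intro subsetI, elim CollectE conjE) (simp add: A.gdeg_def C.word_deg_in del: in_lists_conv_set)
  thus ?thesis
    using C.rearr_deg[OF assms one_closed] fspan_mono unfolding theta_def by blast
qed

lemma theta'_gdeg:
  assumes "w \<in> lists (gens G S)"
  shows "theta' w \<in> fspan {v \<in> lists (gens G S). word_deg G C.gd v = A.gdeg w}"
proof -
  have "{v \<in> lists (gens G S). inv \<one> \<otimes> \<one> \<otimes> word_deg G C.gd v = inv (\<one> \<otimes> word_deg G gdl w) \<otimes> (\<one> \<otimes> word_deg G gdr w)}
    \<subseteq> {v \<in> lists (gens G S). word_deg G C.gd v = A.gdeg w}"
    using assms by (intro subsetI, elim CollectE conjE) (simp add: A.gdeg_def C.word_deg_in del: in_lists_conv_set)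
  thus ?thesis
    using C.unrearr_deg[OF assms one_closed one_closed] fspan_mono unfolding theta'_def by blast
qed

text \<open>Reading \<open>u\<close> first raises the parameter for \<open>v\<close> to the degree
  of \<open>u\<close>, which is precisely the twist of the transmuted product.\<close>

lemma theta_append:
  assumes "u \<in> lists (gens G S)" "v \<in> lists (gens G S)"
  shows "theta (u @ v) = lin A.trmul (tensor (theta u) (theta v))"
proof -
  have "theta (u @ v) = appv (theta u) (lin (word_act (gla (word_deg G C.gd u))) (theta v))"
    using assms by (simp add: theta_def C.rearr_append C.la_rearr)
  also have "\<dots> = lin A.trmul (tensor (theta u) (theta v))"
  proof -
    have "theta u \<in> fspan {c \<in> basis (C.words C.arels). A.gdeg c = word_deg G C.gd u}"
      using theta_gdeg[OF assms(1)] by simp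
    from A.lin_trmul_homog[OF this, of "theta v"] show ?thesis by (simp add: appv_def)
  qed
  finally show ?thesis .
qed

lemma U_algebra_transport:
  "crossed_algebra_transport G (U_xmod G q S) (U_bialg G q S) A.trX A.trH theta theta'"
proof
  show "braided_bialgebra G A.trX A.trH" by (rule A.braided_bialgebra_trX)
  show "pspace_ok (U_xmod G q S)"
    using word_ideal_fspan[OF C.urels_in] by (simp add: pspace_ok_def)
  show "lift_iso (U_xmod G q S) A.trX theta theta'"
    using C.unrearr_rearr[of _ \<one> \<one>]
    by (auto simp: lift_iso_def lmap_def theta_def[abs_def] theta'_def[abs_def] C.rearr_null C.unrearr_null)
next
  fix h w assume h: "h \<in> carrier G" and w: "w \<in> basis (U_xmod G q S)"
  show "act (U_xmod G q S) h w \<in> fspan (basis (U_xmod G q S))"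
    using h w by (auto simp: U_act_eq intro!: word_act_in)
  show "lin theta (act (U_xmod G q S) h w) = lin (act A.trX h) (theta w)"
    using C.conj_act_rearr[of w \<one> h] h w by (simp add: U_act_eq theta_def[abs_def] A_ad[abs_def])
next
  fix w assume w: "w \<in> basis (U_xmod G q S)"
  show "deg (U_xmod G q S) w \<in> carrier G"
    using w by (simp add: U_deg_eq)
  show "theta w \<in> fspan {c \<in> basis A.trX. deg A.trX c = deg (U_xmod G q S) w}"
    using theta_gdeg[of w] w by (simp add: U_deg_eq)
next
  fix w assume w: "w \<in> basis A.trX"
  have "{v \<in> lists (gens G S). word_deg G C.gd v = A.gdeg w} = {b \<in> lists (gens G S). word_deg G (L_deg G) b = A.gdeg w}"
    by (rule Collect_cong) (simp add: U_deg_eq del: in_lists_conv_set cong: conj_cong)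
  thus "theta' w \<in> fspan {b \<in> basis (U_xmod G q S). deg (U_xmod G q S) b = deg A.trX w}"
    using theta'_gdeg[of w] w by simp
next
  fix u v assume "u \<in> basis (U_xmod G q S)" "v \<in> basis (U_xmod G q S)"
  thus "bmul (U_bialg G q S) (u, v) \<in> fspan (basis (U_xmod G q S))"
    "lin theta (bmul (U_bialg G q S) (u, v)) = lin (bmul A.trH) (tensor (theta u) (theta v))"
    by (simp_all add: word_mul_def theta_append)
qed (simp_all add: theta_def)

lemma theta_single: "x \<in> gens G S \<Longrightarrow> theta [x] = bvec [x]"
  by (simp add: theta_def C.la_one)

text \<open>Both coproducts are multiplicative for their braided tensor squares, and they agree on
  letters, which \<open>theta\<close> fixes. Membership is proved in the same induction because
  \<open>tens_mul_th\<close> applies only to basis pairs.\<close>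

lemma U_cop:
  assumes "w \<in> lists (gens G S)"
  shows "bcop (U_bialg G q S) w \<in> fspan (lists (gens G S) \<times> lists (gens G S)) \<and>
    lin (tmap theta theta) (bcop (U_bialg G q S) w) = lin (bcop A.trH) (theta w)"
  using assms
proof (induction w)
  case Nil
  thus ?case by (simp add: theta_def tmap_apply)
next
  case (Cons x w)
  interpret U: crossed_algebra_transport G "U_xmod G q S" "U_bialg G q S" A.trX A.trH theta theta'
    by (rule U_algebra_transport)
  let ?B = "lists (gens G S)" and ?D = "word_cop flip (mat_cop G)"
  let ?M = "tens_mul (xbraid (U_xmod G q S)) word_mul" and ?N = "tens_mul (xbraid A.trX) A.trmul"
  let ?T = "tmap theta theta"
  let ?p = "lin (\<lambda>(y, z). bvec ([y], [z])) (mat_cop G x)" and ?s = "bcop (U_bialg G q S) w"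
  have x: "x \<in> gens G S" using Cons by simp
  have p: "?p \<in> fspan (?B \<times> ?B)"
    by (rule lin_in_fspan[OF C.cop_in[OF x]]) auto
  \<comment> \<open>The coproduct of a generator involves only words of length one.\<close>
  have Tp: "lin ?T ?p = ?p"
    unfolding lin_lin by (rule fspan_lin_cong[OF C.cop_in[OF x]]) (auto simp: tmap_apply theta_single)
  have Dx: "?D [x] = ?p"
    unfolding word_cop_flip_Cons word_cop.simps(1)
    by (simp add: consv2_def tensor_bvec_right lin_lin case_prod_unfold)
  have s: "?s \<in> fspan (?B \<times> ?B)" and IH: "lin ?T ?s = lin ?D (theta w)" using Cons by auto
  have c: "bcop (U_bialg G q S) (x # w) = lin ?M (tensor ?p ?s)" by simp
  have "lin ?M (tensor ?p ?s) \<in> fspan (?B \<times> ?B)"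
    by (rule lin_in_fspan[OF tensor_in_fspan[OF p s]]) (use U.tens_mul_in in auto)
  moreover have "lin ?T (lin ?M (tensor ?p ?s)) = lin ?D (theta (x # w))"
  proof -
    have "lin ?T (lin ?M (tensor ?p ?s)) = lin (\<lambda>(a, b). lin ?N (tensor (?T a) (?T b))) (tensor ?p ?s)"
      unfolding lin_lin
      by (rule fspan_lin_cong[OF tensor_in_fspan[OF p s]]) (use U.tens_mul_th in auto)
    also have "\<dots> = lin ?N (tensor (lin ?T ?p) (lin ?T ?s))"
      by (rule lin_tensor_lin)
    also have "\<dots> = lin ?N (tensor (?D [x]) (lin ?D (theta w)))"
      unfolding Tp IH Dx ..
    also have "\<dots> = lin (\<lambda>v. lin ?N (tensor (?D [x]) (?D v))) (theta w)"
      by (simp only: tensor_lin_right lin_lin)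
    also have "\<dots> = lin (\<lambda>v. lin ?D (A.trmul ([x], v))) (theta w)"
      by (rule fspan_lin_cong[OF theta_gdeg]) (use A.cop_trmul[of "[x]"] x Cons in auto)
    also have "\<dots> = lin ?D (lin A.trmul (tensor (bvec [x]) (theta w)))"
      by (simp add: tensor_bvec_left lin_lin)
    also have "\<dots> = lin ?D (theta (x # w))"
      using theta_append[of "[x]" w] x Cons by (simp add: theta_single)
    finally show ?thesis .
  qed
  ultimately show ?case unfolding c by simp
qed

lemma U_transport: "crossed_transport G (U_xmod G q S) (U_bialg G q S) A.trX A.trH theta theta'"
proof -
  interpret U: crossed_algebra_transport G "U_xmod G q S" "U_bialg G q S" A.trX A.trH theta theta'
    by (rule U_algebra_transport)
  show ?thesis
  proof unfold_locales
    fix w assume w: "w \<in> basis (U_xmod G q S)"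
    show "bcop (U_bialg G q S) w \<in> fspan (basis (U_xmod G q S) \<times> basis (U_xmod G q S))"
      "lin (tmap theta theta) (bcop (U_bialg G q S) w) = lin (bcop A.trH) (theta w)"
      using U_cop[of w] w by simp_all
    show "linf (beps A.trH) (theta w) = beps (U_bialg G q S) w"
      using C.eps_rearr[of w] w by (simp add: theta_def)
  qed
qed

text \<open>On letters the entry of \<open>R\<close> is the counit of \<open>s\<close> times the
  counit of \<open>t\<close> translated by \<open>inv (gdl s)\<close>; \<open>word_R_eq\<close>
  extends this to words.\<close>

lemma A_R_eq:
  assumes "u \<in> lists (gens G S)" "v \<in> lists (gens G S)"
  shows "A_R G q (u, v) = A.canon_R (u, v)"
proof -
  let ?R = "\<lambda>((P, x, y), (P', x', y')). R_entry G q P P' y x y' x'"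
  have eps: "mat_eps (P, x, y) = (if x = y then 1 else 0 :: 'k)" for P :: "('a, 'k) cpair" and x y
    by (simp add: mat_eps_def)
  have "?R (s, t) = mat_eps s * linf mat_eps (gla (inv (gdl s)) t)" if s: "s \<in> gens G S" and t: "t \<in> gens G S" for s t
  proof -
    obtain P a i b j where e: "s = (P, (a, i), (b, j))" by (cases s) auto
    obtain P' a' i' b' j' where e': "t = (P', (a', i'), (b', j'))" by (cases t) auto
    have a: "a \<in> carrier G" using s by (auto simp: e)
    show ?thesis
      using s t a unfolding e e' by (auto simp: gdl_def linf_mat_eps_gla R_entry_def eps wt_def)
  qed
  from C.word_R_eq[OF this assms] show ?thesis
    by (simp add: A_R_def A.canon_R_def)
qed

text \<open>The coefficient at \<open>g\<close> is a matrix entry of the cocycle at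
  \<open>inv g\<close>, supported where \<open>inv g\<close> conjugates \<open>a\<close> to
  \<open>b\<close>. The values of the cocycle there parametrize the centralizer.\<close>

lemma toD_single:
  assumes x: "x \<in> gens G S"
  shows "A.toD [x] = r_elem G r q x"
proof -
  obtain P a i b j where e: "x = (P, (a, i), (b, j))" by (cases x) auto
  have m: "P \<in> S" "a \<in> fst P" "i < pdim G P" "b \<in> fst P" "j < pdim G P" using x by (auto simp: e)
  let ?a = "q (fst P) a" and ?b = "q (fst P) b"
  have c: "a \<in> carrier G" "b \<in> carrier G" "?a \<in> carrier G" "?b \<in> carrier G" using m by auto
  let ?F = "\<lambda>g. scale (wt P a (inv g) j i) (bvec (g, inv b))"
  have "A.toD [x] = (\<Sum>g\<in>carrier G. if inv g \<otimes> a \<otimes> inv (inv g) = b then ?F g else 0)"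
    unfolding A.toD_def using x c
    by (intro sum.cong refl) (simp add: C.linf_word_eps_Cons e linf_mat_eps_gla gdr_def del: word_act.simps(2))
  also have "\<dots> = (\<Sum>g | g \<in> carrier G \<and> inv g \<otimes> a \<otimes> inv (inv g) = b. ?F g)"
    using finG by (simp add: sum.inter_filter)
  also have "\<dots> = (\<Sum>n\<in>centralizer G (r (fst P)). scale (snd P n $$ (j, i)) (bvec (?a \<otimes> inv n \<otimes> inv ?b, inv b)))"
  \<comment> \<open>The substitution is \<open>n = zeta G q (fst P) a (inv g)\<close>, solved for
    \<open>g\<close>.\<close>
  proof (rule sum.reindex_bij_witness[where i = "\<lambda>n. ?a \<otimes> inv n \<otimes> inv ?b" and j = "\<lambda>g. inv ?b \<otimes> inv g \<otimes> ?a"])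
    fix g assume g: "g \<in> {g \<in> carrier G. inv g \<otimes> a \<otimes> inv (inv g) = b}"
    show "inv ?b \<otimes> inv g \<otimes> ?a \<in> centralizer G (r (fst P))"
      using g m by (subst centralizer_iff) auto
    show "?a \<otimes> inv (inv ?b \<otimes> inv g \<otimes> ?a) \<otimes> inv ?b = g"
      using g c by (simp add: inv_mult_group m_assoc)
    have "zeta G q (fst P) a (inv g) = inv ?b \<otimes> inv g \<otimes> ?a"
      using g by (simp only: zeta_def mem_Collect_eq)
    thus "scale (snd P (inv ?b \<otimes> inv g \<otimes> ?a) $$ (j, i))
         (bvec (?a \<otimes> inv (inv ?b \<otimes> inv g \<otimes> ?a) \<otimes> inv ?b, inv b)) = ?F g"
      using g c by (simp add: wt_def inv_mult_group m_assoc)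
  next
    fix n assume n: "n \<in> centralizer G (r (fst P))"
    hence nc: "n \<in> carrier G" by (simp add: centralizer_def)
    let ?g = "?a \<otimes> inv n \<otimes> inv ?b"
    show e: "inv ?b \<otimes> inv ?g \<otimes> ?a = n"
      using nc c by (simp add: inv_mult_group m_assoc)
    have "inv ?b \<otimes> inv ?g \<otimes> ?a \<in> centralizer G (r (fst P))" unfolding e by (rule n)
    thus "?g \<in> {g \<in> carrier G. inv g \<otimes> a \<otimes> inv (inv g) = b}"
      using centralizer_iff[of P a b "inv ?g"] m c nc by simp
  qed
  also have "\<dots> = r_elem G r q x"
    by (simp add: r_elem_def e)
  finally show ?thesis .
qed

lemma braided_hom:
  "braided_bialgebra_hom G (U_xmod G q S) (U_bialg G q S) (BD_xmod G) (BD_bialg G) (\<lambda>w. lin A.toD (theta w))"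
proof -
  interpret U: crossed_transport G "U_xmod G q S" "U_bialg G q S" A.trX A.trH theta theta'
    by (rule U_transport)
  let ?phi = "\<lambda>w. lin A.toD (theta w)"
  have BD: "bone (BD_bialg G) = bone (D_bialg G)" "bcop (BD_bialg G) = bcop (D_bialg G)"
    "beps (BD_bialg G) = beps (D_bialg G)"
    by (simp_all add: BD_bialg_def)
  have okBD: "pspace_ok (BD_xmod G :: (_, _, 'k) xmod)" by (simp add: pspace_ok_def)
  have th_in: "theta w \<in> fspan (basis (C.words C.arels))" if "w \<in> lists (gens G S)" for w
    using that by (simp add: theta_def)
  have lphi: "lin ?phi x = lin A.toD (lin theta x)" for x by (simp add: lin_lin)
  have lm: "lmap (U_xmod G q S) (BD_xmod G) ?phi"
    unfolding lmap_def
  proof (intro conjI ballI)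
    fix w assume "w \<in> basis (U_xmod G q S)"
    thus "?phi w \<in> fspan (basis (BD_xmod G :: (_, _, 'k) xmod))"
      using th_in[of w] by (auto intro!: lin_in_fspan[OF th_in])
  next
    fix x assume "x \<in> null (U_xmod G q S)"
    thus "lin ?phi x \<in> null (BD_xmod G)"
      using lmap_lin_null[OF U.lmap_th(1), of x] by (simp add: lphi A.toD_null)
  qed
  have "crossed_hom G (U_xmod G q S) (BD_xmod G) ?phi"
    unfolding crossed_hom_def
  proof (intro conjI ballI)
    fix h w assume h: "h \<in> carrier G" and w: "w \<in> basis (U_xmod G q S)"
    have "lin ?phi (act (U_xmod G q S) h w) = lin (\<lambda>v. lin A.toD (A.ad h v)) (theta w)"
      unfolding lphi U.act_th[OF h w] by (simp add: lin_lin)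
    also have "\<dots> = lin (\<lambda>v. lin (act (BD_xmod G) h) (A.toD v)) (theta w)"
      by (rule fspan_lin_cong[OF th_in]) (use w h in \<open>auto simp: A.toD_ad\<close>)
    finally show "eqv (BD_xmod G) (lin ?phi (act (U_xmod G q S) h w)) (lin (act (BD_xmod G) h) (?phi w))"
      by (simp add: eqv_def lin_lin)
  next
    fix w assume w: "w \<in> basis (U_xmod G q S)"
    show "?phi w \<in> homog (BD_xmod G) (deg (U_xmod G q S) w)"
    proof (rule lin_in_subspace[OF homog_subspace[OF okBD]])
      fix c assume "c \<in> Poly_Mapping.keys (theta w)"
      hence c: "c \<in> basis A.trX" "deg A.trX c = deg (U_xmod G q S) w" using keysD[OF U.th_deg[OF w]] by auto
      have "A.toD c \<in> homog (BD_xmod G) (deg A.trX c)"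
        using A.crossed_hom_toD c(1) unfolding crossed_hom_def by blast
      thus "A.toD c \<in> homog (BD_xmod G) (deg (U_xmod G q S) w)" by (simp only: c(2))
    qed
  qed (rule lm)
  moreover have "bialgebra_hom (U_xmod G q S) (U_bialg G q S) (BD_xmod G) (BD_bialg G) ?phi"
    unfolding bialgebra_hom_def
  proof (intro conjI ballI)
    show "eqv (BD_xmod G) (lin ?phi (bone (U_bialg G q S))) (bone (BD_bialg G))"
      unfolding lphi U.one_th using A.toD_one by (simp add: eqv_def BD)
  next
    fix u v assume uv: "u \<in> basis (U_xmod G q S)" "v \<in> basis (U_xmod G q S)"
    have "lin ?phi (bmul (U_bialg G q S) (u, v)) = lin (\<lambda>p. lin A.toD (A.trmul p)) (tensor (theta u) (theta v))"
      unfolding lphi U.mul_th[OF uv] by (simp add: lin_lin)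
    also have "\<dots> = lin (\<lambda>(a, b). lin (bmul (BD_bialg G)) (tensor (A.toD a) (A.toD b))) (tensor (theta u) (theta v))"
      by (rule fspan_lin_cong[OF tensor_in_fspan[OF th_in th_in]]) (use uv A.toD_trmul in \<open>auto simp del: in_lists_conv_set\<close>)
    also have "\<dots> = lin (bmul (BD_bialg G)) (tensor (?phi u) (?phi v))"
      by (rule lin_tensor_lin)
    finally show "eqv (BD_xmod G) (lin ?phi (bmul (U_bialg G q S) (u, v))) (lin (bmul (BD_bialg G)) (tensor (?phi u) (?phi v)))"
      by (simp add: eqv_def)
  next
    fix w assume w: "w \<in> basis (U_xmod G q S)"
    have "lin (tmap ?phi ?phi) (bcop (U_bialg G q S) w) = lin (tmap A.toD A.toD) (lin (tmap theta theta) (bcop (U_bialg G q S) w))"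
      by (simp only: lin_tmap_lin_tmap)
    also have "\<dots> = lin (\<lambda>v. lin (tmap A.toD A.toD) (bcop A.trH v)) (theta w)"
      unfolding U.cop_th[OF w] by (simp only: lin_lin)
    also have "\<dots> = lin (\<lambda>v. lin (bcop (D_bialg G)) (A.toD v)) (theta w)"
      by (rule fspan_lin_cong[OF th_in]) (use w A.toD_cop in auto)
    finally show "eqv (tens (BD_xmod G) (BD_xmod G)) (lin (tmap ?phi ?phi) (bcop (U_bialg G q S) w)) (lin (bcop (BD_bialg G)) (?phi w))"
      by (simp add: eqv_def BD lin_lin fv.subspace_0)
    have "linf (beps (BD_bialg G)) (?phi w) = linf (\<lambda>v. beps A.trH v) (theta w)"
      unfolding linf_lin BD by (rule fspan_linf_cong[OF th_in]) (use w A.toD_eps in auto)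
    thus "linf (beps (BD_bialg G)) (?phi w) = beps (U_bialg G q S) w"
      using U.eps_th[OF w] by simp
  qed (rule lm)
  ultimately show ?thesis
    unfolding braided_bialgebra_hom_def
    using U.braided_bialgebra_X BD_transmutation(1)[OF finG] by blast
qed

end

theorem lemma5p12:
  fixes G :: "('g, 'm) monoid_scheme"
    and r :: "'g set \<Rightarrow> 'g" and q :: "'g set \<Rightarrow> 'g \<Rightarrow> 'g"
    and S :: "('g, 'k::field) cpair set"
  assumes "group G" and "finite (carrier G)"
    and "class_choice G r q"
    and "\<forall>P\<in>S. nontrivial_pair G r P"
  shows "\<exists>\<phi> \<Phi> \<theta>.
    braided_bialgebra_hom G (U_xmod G q S) (U_bialg G q S) (BD_xmod G) (BD_bialg G) \<phi> \<and>
    (\<forall>x\<in>gens G S. \<phi> [x] = r_elem G r q x) \<and>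
    (\<forall>v\<in>fspan (gens G S). lin \<phi> (lin L_incl v) = lin (r_elem G r q) v) \<and>
    coquasitriangular_hom (A_space G q S) (A_bialg G) (A_R G q)
      (D_space G) (D_bialg G) (D_R G) \<Phi> \<and>
    (\<forall>x\<in>gens G S. \<Phi> [x] = r_elem G r q x) \<and>
    transmutation_iso G (U_xmod G q S) (U_bialg G q S) (A_space G q S) (A_bialg G) \<Phi> \<theta> \<and>
    (\<forall>x\<in>gens G S. eqv (A_space G q S) (\<theta> [x]) (bvec [x])) \<and>
    transmutation_iso G (BD_xmod G) (BD_bialg G) (D_space G) (D_bialg G) bvec bvec \<and>
    (\<forall>w\<in>lists (gens G S). \<phi> w = lin \<Phi> (\<theta> w))"
proof -
  interpret group G by fact
  interpret pair_data G r q S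
    by unfold_locales (use assms in auto)
  have single: "lin A.toD (theta [x]) = r_elem G r q x" if "x \<in> gens G S" for x
    using that by (simp add: theta_single toD_single)
  have R: "A_R G q (u, v) = A.canon_R (u, v)"
    if "u \<in> basis (C.words C.arels)" "v \<in> basis (C.words C.arels)" for u v
    using A_R_eq that by simp
  \<comment> \<open>The witnesses are the canonical map after the rearrangement, the canonical map
    itself, and the rearrangement; the last conjunct then holds by definition.\<close>
  show ?thesis
  proof (rule exI[of _ "\<lambda>w. lin A.toD (theta w)"], rule exI[of _ A.toD], rule exI[of _ theta],
      intro conjI ballI)
    show "braided_bialgebra_hom G (U_xmod G q S) (U_bialg G q S) (BD_xmod G) (BD_bialg G) (\<lambda>w. lin A.toD (theta w))"
      by (rule braided_hom)
    show "lin (\<lambda>w. lin A.toD (theta w)) (lin L_incl v) = lin (r_elem G r q) v" if "v \<in> fspan (gens G S)" for v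
      unfolding lin_lin[of _ L_incl] by (rule fspan_lin_cong[OF that]) (simp add: L_incl_def single)
    show "coquasitriangular_hom (A_space G q S) (A_bialg G) (A_R G q) (D_space G) (D_bialg G) (D_R G) A.toD"
      unfolding A_space_eq A_bialg_eq
      by (rule A.coquasitriangular_hom_toD[OF A.coquasitriangular_canon_R[OF R] D_coquasitriangular[OF finG] R])
    show "transmutation_iso G (U_xmod G q S) (U_bialg G q S) (A_space G q S) (A_bialg G) A.toD theta"
      unfolding A_space_eq A_bialg_eq
      by (rule A.transmutation_isoI[OF refl U_transport])
        (use C.rearr_unrearr[of _ "\<one>\<^bsub>G\<^esub>" "\<one>\<^bsub>G\<^esub>"] in \<open>simp add: theta_def[abs_def] theta'_def\<close>)
  qed (auto simp: single toD_single theta_single A_space_eq BD_transmutation(2)[OF finG])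
qed

end
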